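(* Let $p\ge 11$ be a prime number with $p\equiv 2\pmod 3$ and let $n\ge 1$. Then \[ \mathrm{sf}_1(\mathbb{F}_p^n)=\frac{p-2}{3}\cdot p^{n-1}, \] and $\widetilde{\mathrm{SF}}_1(\mathbb{F}_p^n)$ is exactly the collection of all structured subsets of $\mathbb{F}_p^n$.
   Context: A subset $A$ of an abelian group $G$ is sum-free if there are no $x,y,z\in A$ with $x+y=z$. For a finite abelian group $G$ let $\mathrm{SF}_0(G)$ be the set of all sum-free subsets of $G$, $\mathrm{sf}_0(G)=\max\{|A|: A\in \mathrm{SF}_0(G)\}$ and $\widetilde{\mathrm{SF}}_0(G)=\{A\in\mathrm{SF}_0(G): |A|=\mathrm{sf}_0(G)\}$. Recursively for $k\ge1$: $\mathrm{SF}_k(G)$ is the set of all $A\in\mathrm{SF}_{k-1}(G)$ such that there is no $B\in\widetilde{\mathrm{SF}}_{k-1}(G)$ with $A\subseteq B$; $\mathrm{sf}_k(G)=\max\{|A|:A\in\mathrm{SF}_k(G)\}$; $\widetilde{\mathrm{SF}}_k(G)=\{A\in\mathrm{SF}_k(G): |A|=\mathrm{sf}_k(G)\}$. Two subsets of an abelian group $G$ are isomorphic if some group automorphism of $G$ maps one onto the other. Elements of $\mathbb{F}_p$ are identified with residues of integers mod $p$, and for integers $a\le b$, $[a,b]$ denotes $\{a,a+1,\dots,b\}$ reduced mod $p$; $\mathbb{F}_p^n$ is identified with $\mathbb{F}_p\times\mathbb{F}_p^{n-1}$ (with $\mathbb{F}_p^0=\{0\}$). Write $p=6m-1$. A set $A\subseteq\mathbb{F}_p^n$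 is very structured if there is a (possibly empty) set $P\subseteq\mathbb{F}_p^{n-1}$ with $0\notin P+P$ such that $A$ is isomorphic to \[ \{(2m-1,0)\}\cup \{2m\}\times(\mathbb{F}_p^{n-1}\setminus P)\cup[2m+1,4m-3]\times\mathbb{F}_p^{n-1}\cup\{4m-2\}\times(\mathbb{F}_p^{n-1}\setminus\{0\})\cup\{4m-1\}\times P \] (a disjoint union). A set $A\subseteq\mathbb{F}_p^n$ is structured if there exist $\ell\in\{1,\dots,n\}$ and a very structured set $B\subseteq\mathbb{F}_p^\ell$ such that $A$ is isomorphic to $B\times\mathbb{F}_p^{n-\ell}$. *)

theory Defs
  imports Complex_Main "HOL-Algebra.Product_Groups" "HOL-Computational_Algebra.Primes"
begin

text \<open>Abelian groups are HOL-Algebra groups and hence written multiplicatively: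
  \<open>x \<otimes>\<^bsub>G\<^esub> y\<close> plays the role of \<open>x + y\<close>.\<close>

definition sum_free :: "('a, 'b) monoid_scheme \<Rightarrow> 'a set \<Rightarrow> bool" where
  "sum_free G A \<longleftrightarrow>
     A \<subseteq> carrier G \<and> \<not> (\<exists>x\<in>A. \<exists>y\<in>A. \<exists>z\<in>A. x \<otimes>\<^bsub>G\<^esub> y = z)"

definition max_card :: "'a set set \<Rightarrow> nat" where
  "max_card F = Max (card ` F)"

primrec SF :: "nat \<Rightarrow> ('a, 'b) monoid_scheme \<Rightarrow> 'a set set" where
  "SF 0 G = {A. sum_free G A}"
| "SF (Suc k) G =
     {A \<in> SF k G. \<not> (\<exists>B \<in> {B \<in> SF k G. card B = max_card (SF k G)}. A \<subseteq> B)}"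

definition sf :: "nat \<Rightarrow> ('a, 'b) monoid_scheme \<Rightarrow> nat" where
  "sf k G = max_card (SF k G)"

definition SF_max :: "nat \<Rightarrow> ('a, 'b) monoid_scheme \<Rightarrow> 'a set set" where
  "SF_max k G = {A \<in> SF k G. card A = sf k G}"

lemma SF_Suc: "SF (Suc k) G = {A \<in> SF k G. \<not> (\<exists>B \<in> SF_max k G. A \<subseteq> B)}"
  by (simp add: SF_max_def sf_def)

definition isomorphic_subsets :: "('a, 'b) monoid_scheme \<Rightarrow> 'a set \<Rightarrow> 'a set \<Rightarrow> bool" where
  "isomorphic_subsets G A B \<longleftrightarrow>
     A \<subseteq> carrier G \<and> B \<subseteq> carrier G \<and> (\<exists>\<phi> \<in> iso G G. \<phi> ` A = B)"

text \<open>The additive group of \<open>\<bbbF>\<^sub>p\<^sup>n\<close>. Its elements are the functions on \<open>{..<n}\<close> (extended by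
  \<^const>\<open>undefined\<close>) with values in \<open>{0..<p}\<close>.\<close>

definition Fp :: "nat \<Rightarrow> nat \<Rightarrow> (nat \<Rightarrow> int) monoid" where
  "Fp p n = product_group {..<n} (\<lambda>_. integer_mod_group p)"

text \<open>For \<open>n \<ge> 1\<close>, \<open>\<bbbF>\<^sub>p\<^sup>n\<close> is identified with \<open>\<bbbF>\<^sub>p \<times> \<bbbF>\<^sub>p\<^sup>n\<^sup>-\<^sup>1\<close> via \<open>x \<mapsto> (x 0, vtail n x)\<close>;
  under this identification \<open>slab p n S T\<close> is the set \<open>S \<times> T\<close>.\<close>

definition vtail :: "nat \<Rightarrow> (nat \<Rightarrow> int) \<Rightarrow> nat \<Rightarrow> int" where
  "vtail n x = (\<lambda>i\<in>{..<n-1}. x (Suc i))"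

definition slab :: "nat \<Rightarrow> nat \<Rightarrow> int set \<Rightarrow> (nat \<Rightarrow> int) set \<Rightarrow> (nat \<Rightarrow> int) set" where
  "slab p n S T = {x \<in> carrier (Fp p n). x 0 \<in> S \<and> vtail n x \<in> T}"

text \<open>Here \<open>p = 6 m - 1\<close> with \<open>m \<ge> 1\<close>, so all first coordinates below are already reduced
  modulo \<open>p\<close>.\<close>

definition very_structured_model ::
    "nat \<Rightarrow> int \<Rightarrow> nat \<Rightarrow> (nat \<Rightarrow> int) set \<Rightarrow> (nat \<Rightarrow> int) set" where
  "very_structured_model p m n P =
     (let H = Fp p (n - 1); V = carrier H in
        slab p n {2*m - 1} {\<one>\<^bsub>H\<^esub>}
      \<union> slab p n {2*m} (V - P)
      \<union> slab p n {2*m + 1 .. 4*m - 3} V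
      \<union> slab p n {4*m - 2} (V - {\<one>\<^bsub>H\<^esub>})
      \<union> slab p n {4*m - 1} P)"

definition very_structured :: "nat \<Rightarrow> nat \<Rightarrow> (nat \<Rightarrow> int) set \<Rightarrow> bool" where
  "very_structured p n A \<longleftrightarrow>
     (\<exists>m P. int p = 6*m - 1 \<and> P \<subseteq> carrier (Fp p (n - 1)) \<and>
        \<one>\<^bsub>Fp p (n - 1)\<^esub> \<notin> P <#>\<^bsub>Fp p (n - 1)\<^esub> P \<and>
        isomorphic_subsets (Fp p n) A (very_structured_model p m n P))"

text \<open>For \<open>l \<le> n\<close> and \<open>B \<subseteq> \<bbbF>\<^sub>p\<^sup>l\<close>, the set \<open>cylinder p n l B\<close> is \<open>B \<times> \<bbbF>\<^sub>p\<^sup>n\<^sup>-\<^sup>l\<close>: the vectors whose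
  first \<open>l\<close> coordinates form an element of \<open>B\<close>.\<close>

definition cylinder ::
    "nat \<Rightarrow> nat \<Rightarrow> nat \<Rightarrow> (nat \<Rightarrow> int) set \<Rightarrow> (nat \<Rightarrow> int) set" where
  "cylinder p n l B = {x \<in> carrier (Fp p n). restrict x {..<l} \<in> B}"

definition structured :: "nat \<Rightarrow> nat \<Rightarrow> (nat \<Rightarrow> int) set \<Rightarrow> bool" where
  "structured p n A \<longleftrightarrow>
     (\<exists>l \<in> {1..n}. \<exists>B. very_structured p l B \<and>
        isomorphic_subsets (Fp p n) A (cylinder p n l B))"

end

theory Submission
  imports Defs "HOL-Library.Function_Algebras" "HOL-Number_Theory.Cong" "HOL-Combinatorics.Transposition"
begin

text \<open>
  Let \<open>A\<close> be sum-free with at least \<open>(2m - 1) p\<^sup>n\<^sup>-\<^sup>1\<close> elements, and let \<open>s i\<close> be the size of the slice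
  \<open>y = i\<close> of \<open>A\<close> for a nonzero linear functional \<open>y\<close>. If the slices with indices \<open>i\<close>, \<open>j\<close> and \<open>i + j\<close> are
  nonempty, then \<open>s i + s j + s (i + j) \<le> (p + 1) p\<^sup>n\<^sup>-\<^sup>2\<close> by a weak form of Kneser's theorem. Call \<open>y\<close>
  flat if this bound holds for all \<open>i\<close> and \<open>j\<close>, empty slices included. If \<open>y\<close> is not flat, then some
  slice is large, and Vosper's theorem applied to the level sets of \<open>s\<close> confines the support of \<open>s\<close>,
  after a dilation, to \<open>[2m - 1, 4m]\<close>.

  Functionals that are not flat exist. For \<open>p \<ge> 17\<close>, sum \<open>s i s j s (i + j)\<close> over all \<open>i\<close>, \<open>j\<close> and all
  functionals: since \<open>a + b = c\<close> has no solution in \<open>A\<close>, the result is smaller than flatness allows.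
  For \<open>p = 11\<close> this does not suffice. Instead, choose a direction \<open>v\<close> such that every line parallel to
  \<open>v\<close> meets \<open>A\<close> within four consecutive points. A finite check over the shapes of three such fibres
  shows that, over the functionals with value 1 on \<open>v\<close>, a suitably weighted mean of the real part of
  the first Fourier coefficient of \<open>s\<close> is more negative than flatness allows.

  So \<open>A\<close> may be assumed to lie over \<open>[2m - 1, 4m]\<close>. If both end sections are empty, then \<open>A\<close> is
  contained in the maximum sum-free set \<open>[2m, 4m - 1] \<times> \<bbbF>\<^sub>p\<^sup>n\<^sup>-\<^sup>1\<close>. Otherwise the bounds on the section
  sizes are attained, and \<open>A\<close> is very structured or invariant under a nonzero translation. The invariant case
  follows by induction on \<open>n\<close>.
\<close>

text \<open>Write q = p^(n-1), N = |A| and p = 6m - 1. Since N \<ge> (2m - 1) q, three average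
  slices have total size at least (6m - 3) q / p, which is within 3q / p of the Kneser bound 6m q /
  p. This narrow slack is what makes flatness restrictive. Flatness of all nonzero functionals gives
  4 N^2 \<le> 7 q (p q - N), which is impossible for all admissible N exactly if 16 m^2 - 44 m + 4 >
  0. This holds for m \<ge> 3 and fails for m = 2, hence the separate treatment of 11. The size of
  the largest sum-free sets is not taken from elsewhere. A sum-free set with at least (2m - 1) q
  elements either lies in an automorphic image of [2m, 4m - 1] x F_p^(n-1), of size 2m q, or is
  structured of size exactly (2m - 1) q. Together with the fact that no structured set lies in such
  an image, this one dichotomy determines both levels of the hierarchy.\<close>

section \<open>Finite quotients of abelian groups and a weak form of Kneser's theorem\<close>

definition sumset :: "'a::ab_group_add set \<Rightarrow> 'a set \<Rightarrow> 'a set" where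
  "sumset X Y = {x + y | x y. x \<in> X \<and> y \<in> Y}"

lemma sumsetI: "x \<in> X \<Longrightarrow> y \<in> Y \<Longrightarrow> x + y \<in> sumset X Y"
  by (auto simp: sumset_def)

text \<open>A finite abelian group is represented as an ambient group with a choice \<open>rep\<close> of coset
  representatives, and its subsets as the periodic subsets of the ambient group. This lets \<open>\<bbbF>\<^sub>p\<^sup>n\<close> be
  handled with plain integer vectors.\<close>

locale finite_quotient =
  fixes rep :: "'a::ab_group_add \<Rightarrow> 'a"
  assumes rep_add_left: "rep (rep x + y) = rep (x + y)"
    and finite_range_rep: "finite (range rep)"
begin

lemma rep_rep [simp]: "rep (rep x) = rep x"
  using rep_add_left[of x 0] by simp

lemma rep_add_right: "rep (x + rep y) = rep (x + y)"
  using rep_add_left[of y x] by (simp add: add.commute)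

lemma rep_uminus: "rep (- rep x) = rep (- x)"
proof -
  have "rep (rep x + (- x - rep x)) = rep (x + (- x - rep x))"
    by (rule rep_add_left)
  then show ?thesis by simp
qed

lemma rep_diff_left: "rep (rep x - y) = rep (x - y)"
  using rep_add_left[of x "- y"] by simp

definition periodic :: "'a set \<Rightarrow> bool" where
  "periodic X \<longleftrightarrow> (\<forall>x. rep x \<in> X \<longleftrightarrow> x \<in> X)"

definition size_of :: "'a set \<Rightarrow> nat" where
  "size_of X = card (X \<inter> range rep)"

abbreviation index :: nat where
  "index \<equiv> card (range rep)"

lemma periodicD: "periodic X \<Longrightarrow> rep x \<in> X \<longleftrightarrow> x \<in> X"
  by (simp add: periodic_def)

lemma periodic_cong: "periodic X \<Longrightarrow> rep x = rep y \<Longrightarrow> x \<in> X \<longleftrightarrow> y \<in> X"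
  by (metis periodic_def)

lemma periodic_UNIV [simp]: "periodic UNIV"
  and periodic_empty [simp]: "periodic {}"
  by (auto simp: periodic_def)

lemma periodic_Un: "periodic X \<Longrightarrow> periodic Y \<Longrightarrow> periodic (X \<union> Y)"
  and periodic_Int: "periodic X \<Longrightarrow> periodic Y \<Longrightarrow> periodic (X \<inter> Y)"
  and periodic_Diff: "periodic X \<Longrightarrow> periodic Y \<Longrightarrow> periodic (X - Y)"
  and periodic_Compl: "periodic X \<Longrightarrow> periodic (- X)"
  by (auto simp: periodic_def)

lemma periodic_translate: "periodic X \<Longrightarrow> periodic {x. x + c \<in> X}"
  unfolding periodic_def
  by (metis mem_Collect_eq rep_add_left)

lemma periodic_translate': "periodic X \<Longrightarrow> periodic {x. x - c \<in> X}"
  using periodic_translate[of X "- c"] by simp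

lemma periodic_uminus: "periodic X \<Longrightarrow> periodic {x. - x \<in> X}"
  unfolding periodic_def
  by (metis mem_Collect_eq rep_uminus)

text \<open>Replacing z = x + y by z' in the same class replaces x by z' - y, which is in the class
  of x, so the periodic summand absorbs the change.\<close>

lemma periodic_sumset:
  assumes "periodic X"
  shows "periodic (sumset X Y)"
proof -
  have *: "z' \<in> sumset X Y" if "z \<in> sumset X Y" "rep z = rep z'" for z z'
  proof -
    from that obtain x y where xy: "z = x + y" "x \<in> X" "y \<in> Y"
      by (auto simp: sumset_def)
    have "rep (z' - y) = rep (rep z' - y)"
      by (simp add: rep_diff_left)
    also have "\<dots> = rep (rep z - y)"
      using that by simp
    also have "\<dots> = rep x"
      using xy by (simp add: rep_diff_left)
    finally have "z' - y \<in> X"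
      using xy assms periodic_cong by blast
    then show ?thesis
      using sumsetI[OF _ xy(3), of "z' - y"] by simp
  qed
  show ?thesis
    unfolding periodic_def using *[of "rep _"] *[of _ "rep _"] by (metis rep_rep)
qed

lemma finite_Int_range [simp]: "finite (X \<inter> range rep)"
  using finite_range_rep by blast

lemma size_of_mono: "X \<subseteq> Y \<Longrightarrow> size_of X \<le> size_of Y"
  unfolding size_of_def by (intro card_mono) auto

lemma size_of_Un_disjoint:
  "X \<inter> Y = {} \<Longrightarrow> size_of (X \<union> Y) = size_of X + size_of Y"
  unfolding size_of_def by (subst card_Un_disjoint[symmetric]) (auto intro: arg_cong[where f = card])

lemma size_of_Un_Int:
  "size_of (X \<union> Y) + size_of (X \<inter> Y) = size_of X + size_of Y"
proof -
  have "card ((X \<inter> range rep) \<union> (Y \<inter> range rep)) + card ((X \<inter> range rep) \<inter> (Y \<inter> range rep))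
    = card (X \<inter> range rep) + card (Y \<inter> range rep)"
    by (subst card_Un_Int) auto
  moreover have "(X \<inter> range rep) \<union> (Y \<inter> range rep) = (X \<union> Y) \<inter> range rep"
    "(X \<inter> range rep) \<inter> (Y \<inter> range rep) = (X \<inter> Y) \<inter> range rep" by auto
  ultimately show ?thesis by (simp add: size_of_def)
qed

lemma size_of_UNIV: "size_of UNIV = index"
  by (simp add: size_of_def)

lemma size_of_empty [simp]: "size_of {} = 0"
  by (simp add: size_of_def)

lemma size_of_Compl: "size_of (- X) + size_of X = index"
  using size_of_Un_disjoint[of "- X" X] by (simp add: size_of_UNIV)

lemma size_of_le_order: "size_of X \<le> index"
  using size_of_Compl[of X] by simp

lemma size_of_disjoint_le: "X \<inter> Y = {} \<Longrightarrow> size_of X + size_of Y \<le> index"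
  by (metis size_of_Un_disjoint size_of_le_order)

lemma size_of_Diff: "Y \<subseteq> X \<Longrightarrow> size_of (X - Y) + size_of Y = size_of X"
  using size_of_Un_disjoint[of "X - Y" Y] by (metis Diff_disjoint Un_Diff_cancel2 inf_commute sup.absorb1)

lemma size_of_eq_0_iff: "periodic X \<Longrightarrow> size_of X = 0 \<longleftrightarrow> X = {}"
  unfolding size_of_def using periodicD by (fastforce simp: card_eq_0_iff)

lemma eq_if_subset_size:
  assumes "periodic X" "periodic Y" "X \<subseteq> Y" "size_of Y \<le> size_of X"
  shows "X = Y"
proof -
  have "size_of (Y - X) = 0"
    using size_of_Diff[OF assms(3)] assms(4) by simp
  then have "Y - X = {}"
    using assms periodic_Diff size_of_eq_0_iff by blast
  then show ?thesis using assms by blast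
qed

lemma psubset_size_of:
  assumes "periodic X" "periodic Y" "X \<subset> Y"
  shows "size_of X < size_of Y"
proof (rule ccontr)
  assume "\<not> size_of X < size_of Y"
  then have "X = Y" using eq_if_subset_size[OF assms(1,2)] assms(3) by auto
  then show False using assms(3) by auto
qed

lemma size_of_translate:
  assumes "periodic X"
  shows "size_of {x. x + c \<in> X} = size_of X"
  unfolding size_of_def
proof (rule bij_betw_same_card)
  show "bij_betw (\<lambda>x. rep (x + c)) ({x. x + c \<in> X} \<inter> range rep) (X \<inter> range rep)"
  proof (rule bij_betw_byWitness[where f' = "\<lambda>y. rep (y - c)"])
    show "\<forall>a\<in>{x. x + c \<in> X} \<inter> range rep. rep (rep (a + c) - c) = a"
      by (auto simp: rep_diff_left)
    show "\<forall>a'\<in>X \<inter> range rep. rep (rep (a' - c) + c) = a'"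
      by (auto simp: rep_add_left)
    show "(\<lambda>x. rep (x + c)) ` ({x. x + c \<in> X} \<inter> range rep) \<subseteq> X \<inter> range rep"
      using assms by (auto simp: periodicD)
    show "(\<lambda>y. rep (y - c)) ` (X \<inter> range rep) \<subseteq> {x. x + c \<in> X} \<inter> range rep"
    proof -
      have "rep (y - c) + c \<in> X" if "y \<in> X" for y
        using that periodic_cong[OF assms, of "rep (y - c) + c" y] by (simp add: rep_add_left)
      then show ?thesis by auto
    qed
  qed
qed

lemma size_of_translate': "periodic X \<Longrightarrow> size_of {x. x - c \<in> X} = size_of X"
  using size_of_translate[of X "- c"] by simp

lemma size_of_uminus:
  assumes "periodic X"
  shows "size_of {x. - x \<in> X} = size_of X"
  unfolding size_of_def
proof (rule bij_betw_same_card)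
  show "bij_betw (\<lambda>x. rep (- x)) ({x. - x \<in> X} \<inter> range rep) (X \<inter> range rep)"
  proof (rule bij_betw_byWitness[where f' = "\<lambda>x. rep (- x)"])
    show "\<forall>a\<in>{x. - x \<in> X} \<inter> range rep. rep (- rep (- a)) = a"
      and "\<forall>a'\<in>X \<inter> range rep. rep (- rep (- a')) = a'"
      by (auto simp: rep_uminus)
    show "(\<lambda>x. rep (- x)) ` ({x. - x \<in> X} \<inter> range rep) \<subseteq> X \<inter> range rep"
      using assms by (auto simp: periodicD)
    show "(\<lambda>x. rep (- x)) ` (X \<inter> range rep) \<subseteq> {x. - x \<in> X} \<inter> range rep"
      using assms by auto (metis assms add.inverse_inverse periodic_cong rep_uminus)
  qed
qed

lemma size_of_sumset_ge_left:
  assumes "periodic X" "Y \<noteq> {}"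
  shows "size_of X \<le> size_of (sumset X Y)"
proof -
  obtain y where "y \<in> Y" using assms by auto
  then have "{x. x + - y \<in> X} \<subseteq> sumset X Y"
    by (auto simp: sumset_def) (metis diff_add_cancel)
  then show ?thesis
    using size_of_mono size_of_translate[OF assms(1), of "- y"] by metis
qed

text \<open>Dyson's transform, iterated until it no longer changes the pair.\<close>

lemma dyson_transform:
  assumes "periodic X" "periodic Y" "X \<noteq> {}" "Y \<noteq> {}"
  obtains X' Y' where "periodic X'" "periodic Y'" "Y' \<noteq> {}" "X' \<noteq> {}"
    "sumset X' Y' \<subseteq> sumset X Y" "size_of X' + size_of Y' = size_of X + size_of Y"
    "\<And>x y y'. x \<in> X' \<Longrightarrow> y \<in> Y' \<Longrightarrow> y' \<in> Y' \<Longrightarrow> x + (y - y') \<in> X'"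
  using assms
proof (induction "size_of Y" arbitrary: X Y thesis rule: less_induct)
  case less
  show ?case
  proof (cases "\<forall>x\<in>X. \<forall>y\<in>Y. \<forall>y'\<in>Y. x + (y - y') \<in> X")
    case True
    then show ?thesis using less.prems by blast
  next
    case False
    then obtain x y y' where xy: "x \<in> X" "y \<in> Y" "y' \<in> Y" "x + (y - y') \<notin> X"
      by auto
    \<comment> \<open>With this shift y' + e = x lies in \<open>X\<close>, so y' survives in the
      second set, while y + e = x + (y - y') lies outside \<open>X\<close>, so y is dropped and the
      recursion terminates.\<close>
    define e where "e = x - y'"
    define X1 where "X1 = X \<union> {z. z - e \<in> Y}"
    define Y1 where "Y1 = Y \<inter> {z. z + e \<in> X}"
    have p: "periodic X1" "periodic Y1"
      unfolding X1_def Y1_def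
      by (intro periodic_Un periodic_Int periodic_translate periodic_translate' less.prems)+
    have y': "y' \<in> Y1" using xy by (auto simp: Y1_def e_def)
    have "y \<notin> Y1" using xy by (auto simp: Y1_def e_def algebra_simps)
    then have "Y1 \<subset> Y" using xy by (auto simp: Y1_def)
    then have lt: "size_of Y1 < size_of Y"
      using psubset_size_of p less.prems by blast
    have sub: "sumset X1 Y1 \<subseteq> sumset X Y"
    proof
      fix z assume "z \<in> sumset X1 Y1"
      then obtain a b where ab: "z = a + b" "a \<in> X1" "b \<in> Y1" by (auto simp: sumset_def)
      show "z \<in> sumset X Y"
      proof (cases "a \<in> X")
        case True
        then show ?thesis using ab by (auto simp: Y1_def sumset_def)
      next
        case False
        \<comment> \<open>A new element of \<open>X1\<close> comes from \<open>Y\<close>, and the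
          shift sends every element of \<open>Y1\<close> into \<open>X\<close>; exchanging the
          roles, a + b = (b + e) + (a - e).\<close>
        then have "a - e \<in> Y" "b + e \<in> X" using ab by (auto simp: X1_def Y1_def)
        then have "(b + e) + (a - e) \<in> sumset X Y" by (rule sumsetI[rotated])
        then show ?thesis using ab by (simp add: algebra_simps)
      qed
    qed
    have sz: "size_of X1 + size_of Y1 = size_of X + size_of Y"
    proof -
      \<comment> \<open>\<open>Y1\<close> shifted by e is the overlap of \<open>X\<close> with the
        shifted \<open>Y\<close>, so the total size is preserved by inclusion-exclusion.\<close>
      have "{z. z + e \<in> X \<inter> {z. z - e \<in> Y}} = Y1"
        by (auto simp: Y1_def)
      then have "size_of Y1 = size_of (X \<inter> {z. z - e \<in> Y})"
        using size_of_translate[of "X \<inter> {z. z - e \<in> Y}" e] less.prems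
        by (simp add: periodic_Int periodic_translate')
      then show ?thesis
        unfolding X1_def using size_of_Un_Int[of X "{z. z - e \<in> Y}"] size_of_translate'[OF less.prems(3), of e]
        by simp
    qed
    have ne: "X1 \<noteq> {}" "Y1 \<noteq> {}" using xy y' by (auto simp: X1_def)
    show ?thesis
    proof (rule less.hyps[OF lt _ p ne])
      fix X' Y'
      assume h: "periodic X'" "periodic Y'" "Y' \<noteq> {}" "X' \<noteq> {}" "sumset X' Y' \<subseteq> sumset X1 Y1"
        "size_of X' + size_of Y' = size_of X1 + size_of Y1"
        "\<And>x y y'. x \<in> X' \<Longrightarrow> y \<in> Y' \<Longrightarrow> y' \<in> Y' \<Longrightarrow> x + (y - y') \<in> X'"
      show thesis
        by (rule less.prems(1)[OF h(1-4)]) (use h sub sz in auto)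
    qed
  qed
qed

end

text \<open>The sum of p copies of x stands for the multiple p x; the second assumption says that
  the quotient is killed by p, that is, an elementary abelian p-group.\<close>

locale elementary_quotient = finite_quotient +
  fixes p :: nat
  assumes prime_p: "prime p"
    and rep_multiple: "rep (\<Sum>i<p. x) = rep 0"
begin

lemma rep_multiple_mult: "rep (\<Sum>i<p * k. x) = rep 0"
proof (induction k)
  case 0
  then show ?case by simp
next
  case (Suc k)
  have "(\<Sum>i<p * Suc k. x) = (\<Sum>i<p * k. x) + (\<Sum>i<p. x)"
  proof -
    have "(\<Sum>i<a + b. x) = (\<Sum>i<a. x) + (\<Sum>i<b. x)" for a b :: nat
      by (induction b) (simp_all add: algebra_simps)
    then show ?thesis by (simp add: add.commute)
  qed
  then show ?case
    using Suc rep_multiple by (metis add_0 rep_add_left rep_add_right)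
qed

text \<open>For v outside H the translates of H by 0, v, ..., (p - 1) v are pairwise disjoint: a
  multiple j v in H with 0 < j < p would, after multiplication by an inverse of j modulo p, put v
  itself into H. Negatives are available in H as - y = (p - 1) y.\<close>

lemma size_of_proper_subgroup:
  assumes H: "periodic H" "0 \<in> H" "\<And>x y. x \<in> H \<Longrightarrow> y \<in> H \<Longrightarrow> x + y \<in> H" and "H \<noteq> UNIV"
  shows "p * size_of H \<le> index"
proof -
  obtain v where v: "v \<notin> H" using assms by auto
  define s where "s j = (\<Sum>i<j. v)" for j :: nat
  have s_add: "s (a + b) = s a + s b" for a b
    by (induction b) (simp_all add: s_def algebra_simps)
  have mult: "(\<Sum>i<k. x) \<in> H" if "x \<in> H" for x and k :: nat
    by (induction k) (use H that in auto)
  have s_mult: "(\<Sum>i<k. s j) = s (j * k)" for j k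
    by (induction k) (simp_all add: s_add add.commute, simp add: s_def)
  have notin: "s j \<notin> H" if "0 < j" "j < p" for j
  proof
    assume "s j \<in> H"
    have "coprime j p"
      using that prime_p by (metis coprime_commute nat_dvd_not_less prime_imp_coprime)
    then obtain k where "[j * k = 1] (mod p)"
      using cong_solve_coprime_nat by auto
    moreover have "p > 1" using prime_p prime_gt_1_nat by blast
    ultimately have "j * k mod p = 1" by (simp add: cong_def)
    then obtain l where l: "j * k = p * l + 1"
      by (metis mult_div_mod_eq)
    have "s (j * k) \<in> H" using mult[OF \<open>s j \<in> H\<close>, of k] by (simp add: s_mult)
    moreover have "rep (s (j * k)) = rep v"
    proof -
      have "s (j * k) = s (p * l) + v" by (simp add: l s_add) (simp add: s_def)
      moreover have "rep (s (p * l)) = rep 0" unfolding s_def by (rule rep_multiple_mult)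
      ultimately show ?thesis by (metis add_0 rep_add_left)
    qed
    ultimately show False using v H(1) periodic_cong by blast
  qed
  define T where "T j = {x. x + s j \<in> H}" for j
  have disj: "T i \<inter> T j = {}" if "i < j" "j < p" for i j
  proof (rule ccontr)
    assume "T i \<inter> T j \<noteq> {}"
    then obtain x where x: "x + s i \<in> H" "x + s j \<in> H" by (auto simp: T_def)
    have neg: "- y \<in> H" if "y \<in> H" for y
    proof -
      have "p > 0" using prime_p prime_gt_0_nat by blast
      then have "(\<Sum>i<p - 1. y) + y = (\<Sum>i<p. y)"
        by (cases p) (simp_all add: algebra_simps)
      then have "rep (- y) = rep ((\<Sum>i<p - 1. y))"
        by (metis add_0 add_diff_cancel_right' diff_conv_add_uminus rep_add_left rep_multiple)
      then show ?thesis using mult[OF that] periodic_cong H(1) by metis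
    qed
    have "(x + s j) + - (x + s i) \<in> H" using x neg H by blast
    moreover have "(x + s j) + - (x + s i) = s (j - i)"
      using s_add[of i "j - i"] that by (simp add: algebra_simps)
    ultimately show False using notin[of "j - i"] that by simp
  qed
  have "size_of (\<Union>j<k. T j) = k * size_of H" if "k \<le> p" for k
    using that
  proof (induction k)
    case 0
    then show ?case by simp
  next
    case (Suc k)
    have "size_of ((\<Union>j<k. T j) \<union> T k) = size_of (\<Union>j<k. T j) + size_of (T k)"
      by (rule size_of_Un_disjoint) (use disj Suc.prems in \<open>force simp: disjoint_iff\<close>)
    moreover have "size_of (T k) = size_of H" unfolding T_def by (rule size_of_translate[OF H(1)])
    moreover have "(\<Union>j<Suc k. T j) = (\<Union>j<k. T j) \<union> T k" by (auto simp: less_Suc_eq)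
    ultimately show ?case using Suc by simp
  qed
  from this[of p] show ?thesis using size_of_le_order[of "\<Union>j<p. T j"] by simp
qed

text \<open>A substitute for Kneser's theorem: applied to a Dyson-stable pair, the stabiliser of the first
  component contains all differences of the second.\<close>

lemma size_of_sumset_disjoint:
  assumes "periodic X" "periodic Y" "periodic Z" "X \<noteq> {}" "Y \<noteq> {}" "Z \<noteq> {}"
    and "sumset X Y \<inter> Z = {}"
  shows "p * (size_of X + size_of Y + size_of Z) \<le> (p + 1) * index"
proof -
  obtain X' Y' where h: "periodic X'" "periodic Y'" "Y' \<noteq> {}" "X' \<noteq> {}"
    "sumset X' Y' \<subseteq> sumset X Y" "size_of X' + size_of Y' = size_of X + size_of Y"
    "\<And>x y y'. x \<in> X' \<Longrightarrow> y \<in> Y' \<Longrightarrow> y' \<in> Y' \<Longrightarrow> x + (y - y') \<in> X'"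
    using dyson_transform[OF assms(1,2,4,5)] by metis
  define H where "H = {h. \<forall>x\<in>X'. x + h \<in> X'}"
  have pH: "periodic H"
  proof -
    have "x + rep h \<in> X' \<longleftrightarrow> x + h \<in> X'" for x h
      by (rule periodic_cong[OF h(1)]) (rule rep_add_right)
    then show ?thesis by (simp add: H_def periodic_def)
  qed
  \<comment> \<open>If every translation stabilised X', the sumset would be the whole group and
    leave no room for the nonempty Z.\<close>
  have "H \<noteq> UNIV"
  proof
    assume "H = UNIV"
    moreover obtain x where x: "x \<in> X'" using h by auto
    ultimately have "x + (z - x) \<in> X'" for z
      unfolding H_def by blast
    then have "X' = UNIV" by auto
    moreover obtain y where "y \<in> Y'" using h by auto
    ultimately have "z \<in> sumset X' Y'" for z
      using sumsetI[of "z - y" X' y Y'] by simp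
    then show False using h assms by blast
  qed
  then have "p * size_of H \<le> index"
    by (intro size_of_proper_subgroup pH) (auto simp: H_def add.assoc[symmetric])
  moreover have "size_of Y' \<le> size_of H"
  proof -
    obtain y where "y \<in> Y'" using h by auto
    then have "Y' \<subseteq> {z. z + - y \<in> H}" using h(7) by (auto simp: H_def)
    then show ?thesis using size_of_mono size_of_translate[OF pH, of "- y"] by metis
  qed
  moreover have "size_of X' \<le> size_of (sumset X' Y')"
    using h size_of_sumset_ge_left by blast
  moreover have "size_of (sumset X' Y') \<le> size_of (sumset X Y)"
    using h size_of_mono by blast
  moreover have "size_of (sumset X Y) + size_of Z \<le> index"
    using assms size_of_disjoint_le by blast
  \<comment> \<open>|X| + |Y| = |X'| + |Y'| \<le> |X + Y| + |H|, and |X + Y| + |Z| is at most the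
    order of the group, of which H is at most a p-th part.\<close>
  ultimately have "p * (size_of X + size_of Y + size_of Z) \<le> p * (index + size_of H)"
    using h(6) by (intro mult_le_mono) auto
  also have "\<dots> \<le> (p + 1) * index"
    using \<open>p * size_of H \<le> index\<close> by (simp add: algebra_simps)
  finally show ?thesis .
qed

end

section \<open>Residues modulo p as periodic sets of integers\<close>

definition zrep :: "nat \<Rightarrow> int \<Rightarrow> int" where
  "zrep p x = x mod int p"

lemma range_zrep: "p > 0 \<Longrightarrow> range (zrep p) = {0..<int p}"
proof
  assume "p > 0"
  show "{0..<int p} \<subseteq> range (zrep p)"
  proof
    fix x assume "x \<in> {0..<int p}"
    then have "x = zrep p x" by (simp add: zrep_def)
    then show "x \<in> range (zrep p)" by blast
  qed
qed (auto simp: zrep_def)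

locale prime_modulus =
  fixes p :: nat
  assumes prime_p: "prime p"
begin

lemma p_pos: "p > 0" "int p > 0" and p_gt_1: "p > 1"
  using prime_p prime_gt_0_nat prime_gt_1_nat by auto

sublocale zp: elementary_quotient "zrep p" p
proof
  show "finite (range (zrep p))"
    using p_pos by (simp add: range_zrep)
qed (auto simp: zrep_def mod_add_left_eq prime_p)

abbreviation "per \<equiv> zp.periodic"
abbreviation "sz \<equiv> zp.size_of"

lemma index_eq: "card (range (zrep p)) = p"
  using p_pos by (simp add: range_zrep)

lemma sz_UNIV: "sz UNIV = p"
  by (simp add: zp.size_of_UNIV index_eq)

lemma sz_le: "sz X \<le> p"
  using zp.size_of_le_order[of X] by (simp add: index_eq)

lemma sz_Compl: "sz (- X) = p - sz X"
  using zp.size_of_Compl[of X] by (simp add: index_eq)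

lemma rep_eq_iff: "zrep p x = zrep p y \<longleftrightarrow> [x = y] (mod int p)"
  by (simp add: zrep_def cong_def)

lemma per_cong: "per X \<Longrightarrow> [x = y] (mod int p) \<Longrightarrow> x \<in> X \<longleftrightarrow> y \<in> X"
  using zp.periodic_cong rep_eq_iff by blast

lemma perI: "(\<And>x y. [x = y] (mod int p) \<Longrightarrow> x \<in> X \<Longrightarrow> y \<in> X) \<Longrightarrow> per X"
  unfolding zp.periodic_def by (metis cong_sym rep_eq_iff zp.rep_rep)

lemma sz_le_1_cong:
  assumes "per X" "sz X \<le> 1" "x \<in> X" "y \<in> X"
  shows "[x = y] (mod int p)"
proof (rule ccontr)
  assume "\<not> [x = y] (mod int p)"
  then have "zrep p x \<noteq> zrep p y" by (simp add: rep_eq_iff)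
  moreover have "{zrep p x, zrep p y} \<subseteq> X \<inter> range (zrep p)"
    using assms zp.periodicD by auto
  then have "card {zrep p x, zrep p y} \<le> sz X"
    unfolding zp.size_of_def by (intro card_mono) auto
  ultimately show False using assms(2) by simp
qed

lemma sz_class: "sz {x. [x = c] (mod int p)} = 1"
proof -
  have "{x. [x = c] (mod int p)} \<inter> range (zrep p) = {zrep p c}"
    by (auto simp: rep_eq_iff[symmetric])
  then show ?thesis by (simp add: zp.size_of_def)
qed

lemma per_class: "per {x. [x = c] (mod int p)}"
  by (auto intro!: perI simp: cong_def)

lemma obtain_inverse:
  assumes "\<not> int p dvd c"
  obtains d where "[c * d = 1] (mod int p)" "\<not> int p dvd d"
proof -
  have "coprime c (int p)"
    using assms prime_p by (metis coprime_commute prime_imp_coprime prime_nat_int_transfer)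
  then obtain d where d: "[c * d = 1] (mod int p)"
    using cong_solve_coprime_int by blast
  moreover have "\<not> int p dvd d"
  proof
    assume "int p dvd d"
    then have "[c * d = 0] (mod int p)" by (simp add: cong_0_iff)
    then have "[1 = 0] (mod int p)" using d cong_sym cong_trans by blast
    then show False using p_gt_1 by (simp add: cong_def)
  qed
  ultimately show ?thesis using that by blast
qed

lemma prime_dvd_mult: "int p dvd a * b \<longleftrightarrow> int p dvd a \<or> int p dvd b"
  using prime_p by (simp add: prime_dvd_mult_iff)

lemma per_dilate: "per X \<Longrightarrow> per {x. c * x \<in> X}"
  by (auto intro!: perI elim!: per_cong[THEN iffD1, rotated 2] intro: cong_scalar_left)

lemma sz_dilate:
  assumes "per X" "\<not> int p dvd c"
  shows "sz {x. c * x \<in> X} = sz X"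
proof -
  obtain d where d: "[c * d = 1] (mod int p)" using obtain_inverse[OF assms(2)] by blast
  have 1: "[d * (c * x) = x] (mod int p)" and 2: "[c * (d * x) = x] (mod int p)" for x
    using cong_scalar_right[OF d, of x] by (simp_all add: ac_simps)
  show ?thesis
    unfolding zp.size_of_def
  proof (rule bij_betw_same_card[of "\<lambda>a. zrep p (c * a)"],
      rule bij_betw_byWitness[where f' = "\<lambda>a. zrep p (d * a)"])
    show "\<forall>a\<in>{x. c * x \<in> X} \<inter> range (zrep p). zrep p (d * zrep p (c * a)) = a"
    proof
      fix a assume "a \<in> {x. c * x \<in> X} \<inter> range (zrep p)"
      then have "zrep p a = a" by auto
      moreover have "zrep p (d * zrep p (c * a)) = zrep p (d * (c * a))"
        by (simp add: zrep_def mod_mult_right_eq)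
      moreover have "zrep p (d * (c * a)) = zrep p a"
        using 1 by (simp add: rep_eq_iff)
      ultimately show "zrep p (d * zrep p (c * a)) = a" by simp
    qed
    show "\<forall>a\<in>X \<inter> range (zrep p). zrep p (c * zrep p (d * a)) = a"
    proof
      fix a assume "a \<in> X \<inter> range (zrep p)"
      then have "zrep p a = a" by auto
      moreover have "zrep p (c * zrep p (d * a)) = zrep p (c * (d * a))"
        by (simp add: zrep_def mod_mult_right_eq)
      moreover have "zrep p (c * (d * a)) = zrep p a"
        using 2 by (simp add: rep_eq_iff)
      ultimately show "zrep p (c * zrep p (d * a)) = a" by simp
    qed
    show "(\<lambda>a. zrep p (c * a)) ` ({x. c * x \<in> X} \<inter> range (zrep p)) \<subseteq> X \<inter> range (zrep p)"
      using assms by (auto simp: zp.periodicD)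
    show "(\<lambda>a. zrep p (d * a)) ` (X \<inter> range (zrep p)) \<subseteq> {x. c * x \<in> X} \<inter> range (zrep p)"
    proof -
      have "c * zrep p (d * x) \<in> X" if "x \<in> X" for x
      proof -
        have "[c * zrep p (d * x) = x] (mod int p)"
          using 2[of x] by (simp add: zrep_def cong_def mod_mult_right_eq)
        then show ?thesis using per_cong[OF assms(1)] that by blast
      qed
      then show ?thesis by auto
    qed
  qed
qed

text \<open>The weak Kneser bound with the complement of the sumset as third set; in a group of
  order p a p-th part is a single element, which is the loss of 1.\<close>

lemma cauchy_davenport:
  assumes "per X" "per Y" "X \<noteq> {}" "Y \<noteq> {}" "sumset X Y \<noteq> UNIV"
  shows "sz X + sz Y \<le> sz (sumset X Y) + 1"
proof -
  have "p * (sz X + sz Y + sz (- sumset X Y)) \<le> (p + 1) * p"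
    using zp.size_of_sumset_disjoint[OF assms(1,2) zp.periodic_Compl[OF zp.periodic_sumset[OF assms(1)]] assms(3,4)] assms(5)
    unfolding index_eq by blast
  then have "sz X + sz Y + sz (- sumset X Y) \<le> p + 1"
    using p_pos by (metis mult.commute mult_le_cancel1)
  then show ?thesis using sz_le[of "sumset X Y"] by (simp add: sz_Compl)
qed

subsection \<open>Arcs and Vosper's theorem\<close>

text \<open>A block of n consecutive residues from a onwards, wrapping around at p; for n \<ge> p it
  is everything.\<close>

definition arc :: "int \<Rightarrow> nat \<Rightarrow> int set" where
  "arc a n = {x. (x - a) mod int p < int n}"

lemma mem_arc_iff: "x \<in> arc a n \<longleftrightarrow> (\<exists>k<n. [x = a + int k] (mod int p))"
proof
  assume "x \<in> arc a n"
  then have "nat ((x - a) mod int p) < n" "[x = a + int (nat ((x - a) mod int p))] (mod int p)"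
    using p_pos by (auto simp: arc_def cong_def mod_add_right_eq nat_less_iff)
  then show "\<exists>k<n. [x = a + int k] (mod int p)" by blast
next
  assume "\<exists>k<n. [x = a + int k] (mod int p)"
  then obtain k where k: "k < n" "[x = a + int k] (mod int p)" by auto
  then have "[x - a = int k] (mod int p)" by (simp add: cong_iff_dvd_diff algebra_simps)
  then have "(x - a) mod int p = int k mod int p" by (simp add: cong_def)
  also have "\<dots> \<le> int k" using p_pos by (simp add: zmod_le_nonneg_dividend)
  finally show "x \<in> arc a n" using k by (simp add: arc_def)
qed

lemma per_arc: "per (arc a n)"
  by (rule perI) (metis mem_arc_iff cong_sym cong_trans)

lemma sz_arc: "n \<le> p \<Longrightarrow> sz (arc a n) = n"
proof -
  assume n: "n \<le> p"
  have "sz (arc a n) = sz {x. x - a \<in> {x. x mod int p < int n}}"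
    by (simp add: arc_def)
  also have "\<dots> = sz {x. x mod int p < int n}"
    by (rule zp.size_of_translate') (rule perI, simp add: cong_def)
  also have "{x. x mod int p < int n} \<inter> range (zrep p) = {0..<int n}"
    using n p_pos by (auto simp: range_zrep)
  then have "sz {x. x mod int p < int n} = n"
    by (simp add: zp.size_of_def)
  finally show ?thesis .
qed

lemma sumset_arc:
  assumes "n > 0" "k > 0"
  shows "sumset (arc a n) (arc b k) = arc (a + b) (n + k - 1)"
proof (intro equalityI subsetI)
  fix z assume "z \<in> sumset (arc a n) (arc b k)"
  then obtain x y where xy: "z = x + y" "x \<in> arc a n" "y \<in> arc b k" by (auto simp: sumset_def)
  then obtain i j where ij: "i < n" "j < k" "[x = a + int i] (mod int p)" "[y = b + int j] (mod int p)"
    by (auto simp: mem_arc_iff)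
  then have "[z = (a + int i) + (b + int j)] (mod int p)" using xy cong_add by blast
  then have "[z = (a + b) + int (i + j)] (mod int p)" by (simp add: algebra_simps)
  moreover have "i + j < n + k - 1" using ij by simp
  ultimately show "z \<in> arc (a + b) (n + k - 1)" by (auto simp: mem_arc_iff)
next
  fix z assume "z \<in> arc (a + b) (n + k - 1)"
  then obtain l where l: "l < n + k - 1" "[z = (a + b) + int l] (mod int p)"
    by (auto simp: mem_arc_iff)
  \<comment> \<open>The offset l is split greedily: the first arc takes as much of it as possible,
    and the rest is below k.\<close>
  define i where "i = min l (n - 1)"
  have "i < n" "l - i < k" "i \<le> l" using l assms by (auto simp: i_def)
  moreover have "[z - (a + int i) = b + int (l - i)] (mod int p)"
    using l \<open>i \<le> l\<close> by (simp add: cong_iff_dvd_diff algebra_simps)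
  ultimately have "a + int i \<in> arc a n" "z - (a + int i) \<in> arc b k"
    by (auto simp: mem_arc_iff)
  then have "(a + int i) + (z - (a + int i)) \<in> sumset (arc a n) (arc b k)" by (rule sumsetI)
  then show "z \<in> sumset (arc a n) (arc b k)" by simp
qed

lemma Compl_arc:
  assumes "n \<le> p"
  shows "- arc a n = arc (a + int n) (p - n)"
proof -
  have "(z - a) mod int p \<ge> int n \<longleftrightarrow> (z - (a + int n)) mod int p < int (p - n)" for z
  proof -
    define t where "t = (z - a) mod int p"
    have t: "0 \<le> t" "t < int p" using p_pos by (auto simp: t_def)
    have eq: "(z - (a + int n)) mod int p = (t - int n) mod int p"
      by (simp add: t_def mod_diff_left_eq algebra_simps)
    show ?thesis
    proof (cases "t \<ge> int n")
      case True
      then have "(t - int n) mod int p = t - int n" using t by simp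
      then show ?thesis using eq True t assms by (simp add: t_def[symmetric])
    next
      case False
      then have "(t - int n) mod int p = t - int n + int p"
      proof -
        have "(t - int n) mod int p = (t - int n + int p) mod int p" by simp
        also have "\<dots> = t - int n + int p"
          using t assms False by (intro mod_pos_pos_trivial) auto
        finally show ?thesis .
      qed
      then show ?thesis using eq False t assms by (simp add: t_def[symmetric])
    qed
  qed
  note key = this
  show ?thesis
  proof (intro Set.set_eqI)
    fix z show "z \<in> - arc a n \<longleftrightarrow> z \<in> arc (a + int n) (p - n)"
      using key[of z] unfolding arc_def Compl_iff mem_Collect_eq by linarith
  qed
qed

text \<open>Negation reverses the order, so the new first element is the negative of the old last
  element a + n - 1.\<close>

lemma uminus_arc:
  assumes "n \<le> p"
  shows "{x. - x \<in> arc a n} = arc (1 - a - int n) n"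
proof (intro equalityI subsetI)
  fix x assume "x \<in> {x. - x \<in> arc a n}"
  then obtain k where k: "k < n" "[- x = a + int k] (mod int p)" by (auto simp: mem_arc_iff)
  then have "[x = (1 - a - int n) + int (n - 1 - k)] (mod int p)"
    using cong_minus_minus_iff[of "- x" "a + int k" "int p"] by (simp add: algebra_simps of_nat_diff)
  then show "x \<in> arc (1 - a - int n) n" using k by (auto simp: mem_arc_iff intro!: exI[of _ "n - 1 - k"])
next
  fix x assume "x \<in> arc (1 - a - int n) n"
  then obtain k where k: "k < n" "[x = (1 - a - int n) + int k] (mod int p)" by (auto simp: mem_arc_iff)
  then have "[- x = a + int (n - 1 - k)] (mod int p)"
    using cong_minus_minus_iff[of x "(1 - a - int n) + int k" "int p"] by (simp add: algebra_simps of_nat_diff)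
  then show "x \<in> {x. - x \<in> arc a n}" using k by (auto simp: mem_arc_iff intro!: exI[of _ "n - 1 - k"])
qed

text \<open>Only the class of e may be left by a step of 1, so B is a single run that ends in e. Its
  length N is found by walking back from e to the first gap, which exists because B is not
  everything.\<close>

lemma arc_characterization:
  assumes B: "per B" "B \<noteq> UNIV" and e: "e \<in> B"
    and step: "\<And>x. x \<in> B \<Longrightarrow> x + 1 \<notin> B \<Longrightarrow> [x = e] (mod int p)"
  shows "\<exists>a. B = arc a (sz B)"
proof -
  have ex: "\<exists>k<p. e - int k \<notin> B"
  proof (rule ccontr)
    assume "\<not> (\<exists>k<p. e - int k \<notin> B)"
    then have *: "e - int k \<in> B" if "k < p" for k using that by auto
    have "x \<in> B" for x
    proof -
      define k where "k = nat ((e - x) mod int p)"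
      have "k < p" "[e - int k = x] (mod int p)"
        using p_pos by (auto simp: k_def cong_def nat_less_iff mod_diff_right_eq)
      then show ?thesis using * per_cong[OF B(1)] by blast
    qed
    then show False using B by auto
  qed
  define N where "N = (LEAST k. e - int k \<notin> B)"
  have N: "e - int N \<notin> B" "N < p" "\<And>j. j < N \<Longrightarrow> e - int j \<in> B"
    using LeastI_ex[of "\<lambda>k. e - int k \<notin> B"] ex Least_le[of "\<lambda>k. e - int k \<notin> B"]
      not_less_Least[of _ "\<lambda>k. e - int k \<notin> B"]
    unfolding N_def by (auto intro: le_less_trans)
  have "N > 0" using N(1) e by (cases N) auto
  define a where "a = e - int N + 1"
  have "B = arc a N"
  proof (intro equalityI subsetI)
    fix x assume "x \<in> arc a N"
    then obtain k where k: "k < N" "[x = a + int k] (mod int p)" by (auto simp: mem_arc_iff)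
    have "a + int k = e - int (N - 1 - k)" using k by (simp add: a_def of_nat_diff algebra_simps)
    moreover have "e - int (N - 1 - k) \<in> B" using k by (intro N(3)) simp
    ultimately show "x \<in> B" using k per_cong[OF B(1)] by metis
  next
    fix x assume x: "x \<in> B"
    define t where "t = nat ((e - x) mod int p)"
    have t: "t < p" "[e - x = int t] (mod int p)"
      using p_pos by (auto simp: t_def cong_def nat_less_iff)
    have walk: "x + int j \<in> B" if "j \<le> t" for j
      using that
    proof (induction j)
      case 0
      then show ?case using x by simp
    next
      case (Suc j)
      have "\<not> [x + int j = e] (mod int p)"
      proof
        assume "[x + int j = e] (mod int p)"
        then have "[int j = int t] (mod int p)"
        proof -
          have "[(x + int j) + (e - x) = e + int t] (mod int p)"
            using \<open>[x + int j = e] (mod int p)\<close> t(2) by (rule cong_add)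
          then show ?thesis by (simp add: cong_iff_dvd_diff algebra_simps)
        qed
        then have "j = t" using Suc.prems t by (simp add: cong_def)
        then show False using Suc.prems by simp
      qed
      then have "x + int j + 1 \<in> B" using step Suc by fastforce
      then show ?case by (simp add: algebra_simps)
    qed
    \<comment> \<open>Otherwise the walk from x to e, which stays in B, would pass through the gap
      at e - N.\<close>
    have "t < N"
    proof (rule ccontr)
      assume "\<not> t < N"
      then have "x + int (t - N) \<in> B" by (intro walk) simp
      moreover have "[x + int (t - N) = e - int N] (mod int p)"
      proof -
        have "(x + int (t - N)) - (e - int N) = - ((e - x) - int t)"
          using \<open>\<not> t < N\<close> by (simp add: of_nat_diff)
        then show ?thesis using t(2) unfolding cong_iff_dvd_diff by (metis dvd_minus_iff)
      qed
      ultimately show False using N(1) per_cong[OF B(1)] by blast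
    qed
    moreover have "[x = a + int (N - 1 - t)] (mod int p)"
    proof -
      have "x - (a + int (N - 1 - t)) = - ((e - x) - int t)"
        using \<open>t < N\<close> by (simp add: a_def of_nat_diff)
      then show ?thesis using t(2) unfolding cong_iff_dvd_diff by (metis dvd_minus_iff)
    qed
    ultimately show "x \<in> arc a N" by (unfold mem_arc_iff, intro exI[of _ "N - 1 - t"]) (use \<open>t < N\<close> in auto)
  qed
  moreover have "sz (arc a N) = N" using N by (intro sz_arc) simp
  ultimately show ?thesis by auto
qed

text \<open>\<open>progression c X\<close>: the set \<open>X\<close> is an arithmetic progression whose difference is an
  inverse of \<open>c\<close> modulo \<open>p\<close>.\<close>

definition progression :: "int \<Rightarrow> int set \<Rightarrow> bool" where
  "progression c X \<longleftrightarrow> (\<exists>a. X = {x. c * x \<in> arc a (sz X)})"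

lemma progression_dilate:
  assumes "per X" "\<not> int p dvd c" "[c * d = 1] (mod int p)" "\<exists>a. {x. d * x \<in> X} = arc a (sz X)"
  shows "progression c X"
proof -
  obtain a where a: "{x. d * x \<in> X} = arc a (sz X)" using assms by auto
  have "x \<in> X \<longleftrightarrow> c * x \<in> arc a (sz X)" for x
  proof -
    have "[d * (c * x) = x] (mod int p)"
      using cong_scalar_right[OF assms(3), of x] by (simp add: ac_simps)
    then have "x \<in> X \<longleftrightarrow> d * (c * x) \<in> X" using per_cong[OF assms(1)] by blast
    then show ?thesis using a by blast
  qed
  then show ?thesis unfolding progression_def by blast
qed

text \<open>The elements of (B + d) - B mark the ends of the maximal runs of B with step d, so B is
  a single run. Passing to \<open>B'\<close> turns the step d into the step 1, where
  \<open>arc_characterization\<close> applies.\<close>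

lemma progression_step:
  assumes B: "per B" "B \<noteq> {}" "B \<noteq> UNIV" and d: "\<not> int p dvd c" "[c * d = 1] (mod int p)"
    and sz: "sz {x. x - d \<in> B \<and> x \<notin> B} \<le> 1"
  shows "progression c B"
proof -
  have pd: "\<not> int p dvd d"
  proof
    assume "int p dvd d"
    then have "int p dvd c * d" by simp
    then have "int p dvd 1" using d(2) cong_dvd_iff by blast
    then show False using p_gt_1 by simp
  qed
  define B' where "B' = {x. d * x \<in> B}"
  have per: "per B'" "per {x. x - d \<in> B \<and> x \<notin> B}"
  proof -
    show "per B'" unfolding B'_def using per_dilate B by blast
    have "{x. x - d \<in> B \<and> x \<notin> B} = {x. x - d \<in> B} \<inter> - B" by auto
    then show "per {x. x - d \<in> B \<and> x \<notin> B}"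
      using B zp.periodic_Int zp.periodic_translate' zp.periodic_Compl by metis
  qed
  have inv: "[d * (c * x) = x] (mod int p)" for x
    using cong_scalar_right[OF d(2), of x] by (simp add: ac_simps)
  have mem: "c * x \<in> B' \<longleftrightarrow> x \<in> B" for x
    unfolding B'_def using inv per_cong[OF B(1)] by blast
  have ne: "B' \<noteq> UNIV" using mem B by blast
  have conv: "x + 1 \<in> B' \<longleftrightarrow> d * x + d \<in> B" for x
    unfolding B'_def by (simp add: algebra_simps)
  have "\<exists>e. e \<in> B' \<and> (\<forall>x. x \<in> B' \<longrightarrow> x + 1 \<notin> B' \<longrightarrow> [x = e] (mod int p))"
  proof (cases "\<exists>e. e \<in> B' \<and> e + 1 \<notin> B'")
    case True
    then obtain e where e: "e \<in> B'" "e + 1 \<notin> B'" by auto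
    have "[x = e] (mod int p)" if "x \<in> B'" "x + 1 \<notin> B'" for x
    proof -
      have "d * x + d \<in> {x. x - d \<in> B \<and> x \<notin> B}" "d * e + d \<in> {x. x - d \<in> B \<and> x \<notin> B}"
        using that e conv by (auto simp: B'_def)
      then have "[d * x + d = d * e + d] (mod int p)"
        using sz_le_1_cong[OF per(2) sz] by blast
      then have "int p dvd d * (x - e)" by (simp add: cong_iff_dvd_diff algebra_simps)
      then show ?thesis using pd by (simp add: prime_dvd_mult cong_iff_dvd_diff)
    qed
    then show ?thesis using e by blast
  next
    case False
    obtain b where "b \<in> B" using B by auto
    then have "c * b \<in> B'" using mem by blast
    then show ?thesis using False by blast
  qed
  then have "\<exists>a. B' = arc a (sz B')"
    using arc_characterization[OF per(1) ne] by blast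
  moreover have "sz B' = sz B" unfolding B'_def using sz_dilate[OF B(1) pd] .
  ultimately show ?thesis using progression_dilate[OF B(1) d] by (simp add: B'_def)
qed

end

context prime_modulus
begin

lemma not_dvd_inverse:
  assumes "[c * d = 1] (mod int p)"
  shows "\<not> int p dvd c" "\<not> int p dvd d"
proof -
  have "\<not> int p dvd c * d"
    using assms cong_dvd_iff p_gt_1 by force
  then show "\<not> int p dvd c" "\<not> int p dvd d" by auto
qed

lemma cong_cancel_inverse:
  assumes "[c * d = 1] (mod int p)"
  shows "[c * (d * x) = x] (mod int p)" "[d * (c * x) = x] (mod int p)"
  using cong_scalar_right[OF assms, of x] by (simp_all add: ac_simps)

lemma arc_add_1:
  assumes "x \<in> arc a n"
  shows "x + 1 \<in> arc a (n + 1)"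
proof -
  obtain k where k: "k < n" "[x = a + int k] (mod int p)"
    using assms by (auto simp: mem_arc_iff)
  have "[x + 1 = a + int k + 1] (mod int p)"
    using k(2) cong_add_rcancel by blast
  then have "[x + 1 = a + int (k + 1)] (mod int p)" by (simp add: algebra_simps)
  then show ?thesis using k(1) unfolding mem_arc_iff by (intro exI[of _ "k + 1"]) simp
qed

lemma arc_mono: "k \<le> n \<Longrightarrow> arc a k \<subseteq> arc a n"
  by (auto simp: arc_def)

text \<open>A progression of at least two elements contains I + {0, d} with I one element shorter,
  so A + B contains I + (B \<union> (B + d)). Cauchy-Davenport for the latter pair shows that B + d
  adds at most one element to B, which is the hypothesis of \<open>progression_step\<close>.\<close>

lemma progression_if_small_sumset:
  assumes A: "per A" "progression c A" "sz A \<ge> 2" and c: "\<not> int p dvd c"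
    and B: "per B" "B \<noteq> {}"
    and AB: "sumset A B \<noteq> UNIV" "sz (sumset A B) + 1 \<le> sz A + sz B"
  shows "progression c B"
proof -
  obtain d where d: "[c * d = 1] (mod int p)" using obtain_inverse[OF c] by blast
  define n where "n = sz A - 1"
  have n: "n > 0" "sz A = n + 1" "n < p" using A(3) sz_le[of A] by (auto simp: n_def)
  obtain a where a: "A = {x. c * x \<in> arc a (n + 1)}"
    using A(2) unfolding progression_def n(2) by blast
  define I where "I = {x. c * x \<in> arc a n}"
  have perI: "per I" unfolding I_def by (rule per_dilate[OF per_arc])
  have szI: "sz I = n"
    unfolding I_def using sz_dilate[OF per_arc c] sz_arc n by simp
  have "I \<noteq> {}" using szI n by force
  have I_A: "x \<in> A" "x + d \<in> A" if "x \<in> I" for x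
  proof -
    have x: "c * x \<in> arc a n" using that by (simp add: I_def)
    then show "x \<in> A" using arc_mono[of n "n + 1" a] by (auto simp: a)
    have "[c * x + 1 = c * (x + d)] (mod int p)"
      using cong_add_lcancel[of "c * x" 1 "c * d"] d cong_sym by (simp add: algebra_simps) blast
    then show "x + d \<in> A"
      using arc_add_1[OF x] per_cong[OF per_arc] unfolding a by blast
  qed
  define B2 where "B2 = B \<union> {x. x - d \<in> B}"
  have perB2: "per B2" unfolding B2_def
    by (intro zp.periodic_Un zp.periodic_translate' B)
  have sub: "sumset I B2 \<subseteq> sumset A B"
  proof
    fix z assume "z \<in> sumset I B2"
    then obtain x y where xy: "z = x + y" "x \<in> I" "y \<in> B \<or> y - d \<in> B"
      by (auto simp: sumset_def B2_def)
    from xy(3) show "z \<in> sumset A B"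
    proof
      assume "y \<in> B"
      then show ?thesis using sumsetI[OF I_A(1)[OF xy(2)], of y B] xy by simp
    next
      assume "y - d \<in> B"
      then show ?thesis using sumsetI[OF I_A(2)[OF xy(2)], of "y - d" B] xy by simp
    qed
  qed
  have "sumset I B2 \<noteq> UNIV" using sub AB by auto
  moreover have "B2 \<noteq> {}" using B by (auto simp: B2_def)
  ultimately have "sz I + sz B2 \<le> sz (sumset I B2) + 1"
    using cauchy_davenport[OF perI perB2 \<open>I \<noteq> {}\<close>] by blast
  also have "\<dots> \<le> sz (sumset A B) + 1" using zp.size_of_mono[OF sub] by simp
  also have "\<dots> \<le> sz I + 1 + sz B" using AB szI n by simp
  finally have "sz B2 \<le> sz B + 1" by simp
  moreover have "{x. x - d \<in> B \<and> x \<notin> B} = B2 - B" by (auto simp: B2_def)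
  moreover have "sz (B2 - B) + sz B = sz B2"
    by (rule zp.size_of_Diff) (auto simp: B2_def)
  ultimately have "sz {x. x - d \<in> B \<and> x \<notin> B} \<le> 1" by simp
  moreover have "B \<noteq> UNIV"
  proof
    assume "B = UNIV"
    obtain x where "x \<in> I" using \<open>I \<noteq> {}\<close> by blast
    then have "x + (z - x) \<in> sumset A B" for z
      using I_A \<open>B = UNIV\<close> by (intro sumsetI) auto
    then show False using AB by auto
  qed
  ultimately show ?thesis using progression_step[OF B(1,2) _ c d] by blast
qed

lemma progression_Compl:
  assumes "progression c X"
  shows "progression c (- X)"
proof -
  obtain a where a: "X = {x. c * x \<in> arc a (sz X)}"
    using assms unfolding progression_def by blast
  have "- X = {x. c * x \<in> - arc a (sz X)}" by (subst a) auto
  also have "\<dots> = {x. c * x \<in> arc (a + int (sz X)) (sz (- X))}"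
    unfolding Compl_arc[OF sz_le] sz_Compl ..
  finally show ?thesis unfolding progression_def by blast
qed

lemma progression_uminus:
  assumes "progression c X" "per X"
  shows "progression c {x. - x \<in> X}"
proof -
  obtain a where a: "X = {x. c * x \<in> arc a (sz X)}"
    using assms unfolding progression_def by blast
  have "{x. - x \<in> X} = {x. c * x \<in> {x. - x \<in> arc a (sz X)}}" by (subst a) auto
  also have "\<dots> = {x. c * x \<in> arc (1 - a - int (sz X)) (sz {x. - x \<in> X})}"
    unfolding uminus_arc[OF sz_le] zp.size_of_uminus[OF assms(2)] ..
  finally show ?thesis unfolding progression_def by blast
qed

lemma progression_sumset:
  assumes "progression c X" "progression c Y" "per X" "per Y" "\<not> int p dvd c"
    "X \<noteq> {}" "Y \<noteq> {}" "sz X + sz Y \<le> p + 1"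
  shows "progression c (sumset X Y)" "sz (sumset X Y) = sz X + sz Y - 1"
proof -
  obtain a b where a: "X = {x. c * x \<in> arc a (sz X)}" and b: "Y = {x. c * x \<in> arc b (sz Y)}"
    using assms unfolding progression_def by blast
  obtain d where d: "[c * d = 1] (mod int p)" using obtain_inverse[OF assms(5)] by blast
  have pos: "sz X > 0" "sz Y > 0" using assms zp.size_of_eq_0_iff by auto
  have eq: "sumset X Y = {z. c * z \<in> arc (a + b) (sz X + sz Y - 1)}"
  proof (intro equalityI subsetI)
    fix z assume "z \<in> sumset X Y"
    then obtain x y where xy: "z = x + y" "x \<in> X" "y \<in> Y" by (auto simp: sumset_def)
    then have "c * x + c * y \<in> sumset (arc a (sz X)) (arc b (sz Y))"
      using a b by (intro sumsetI) blast+
    then show "z \<in> {z. c * z \<in> arc (a + b) (sz X + sz Y - 1)}"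
      unfolding sumset_arc[OF pos] xy(1) by (simp add: algebra_simps)
  next
    fix z assume "z \<in> {z. c * z \<in> arc (a + b) (sz X + sz Y - 1)}"
    then have "c * z \<in> sumset (arc a (sz X)) (arc b (sz Y))"
      by (simp add: sumset_arc[OF pos])
    then obtain u v where uv: "c * z = u + v" "u \<in> arc a (sz X)" "v \<in> arc b (sz Y)"
      by (auto simp: sumset_def)
    have "c * (d * u) \<in> arc a (sz X)"
      using uv(2) per_cong[OF per_arc cong_cancel_inverse(1)[OF d]] by blast
    then have u: "d * u \<in> X" by (subst a) simp
    have "c * z - c * (d * u) = v + (u - c * (d * u))" using uv by simp
    moreover have "int p dvd (u - c * (d * u))"
      using cong_cancel_inverse(1)[OF d, of u] by (simp add: cong_iff_dvd_diff dvd_diff_commute)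
    ultimately have "[c * (z - d * u) = v] (mod int p)"
      by (simp add: cong_iff_dvd_diff algebra_simps)
    then have "c * (z - d * u) \<in> arc b (sz Y)"
      using uv(3) per_cong[OF per_arc] by blast
    then have "z - d * u \<in> Y" by (subst b) simp
    then show "z \<in> sumset X Y" using sumsetI[OF u, of "z - d * u" Y] by simp
  qed
  then show "sz (sumset X Y) = sz X + sz Y - 1"
    using sz_dilate[OF per_arc assms(5)] sz_arc assms(8) by simp
  then show "progression c (sumset X Y)"
    using eq unfolding progression_def by auto
qed

lemma sumset_commute: "sumset X Y = sumset Y X"
  by (auto simp: sumset_def) (metis add.commute)+

text \<open>Induction on |B| by Dyson's transform. A transform that shrinks B but keeps at least two
  of its elements gives a pair with the same sumset, by equality in Cauchy-Davenport; hence A + B is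
  a progression. This passes back by duality: with C the complement of A + B, the set C - B avoids
  A, so C and - B again have a small sumset. This makes B a progression, and then A.\<close>

lemma vosper:
  assumes "per A" "per B" "2 \<le> sz A" "2 \<le> sz B"
    and "sz (sumset A B) + 1 \<le> sz A + sz B" "sz (sumset A B) + 2 \<le> p"
  shows "\<exists>c. \<not> int p dvd c \<and> progression c A \<and> progression c B"
  using assms
proof (induction "sz B" arbitrary: A B rule: less_induct)
  case less
  note A = less.prems(1) and B = less.prems(2) and szA = less.prems(3) and szB = less.prems(4)
    and small = less.prems(5,6)
  have ne: "A \<noteq> {}" "B \<noteq> {}" using szA szB by auto
  have neU: "sumset A B \<noteq> UNIV" using small(2) sz_UNIV by auto
  obtain y0 where y0: "y0 \<in> B" using ne by auto
  have trans: "sz {z. z - y0 \<in> A} = sz A" "per {z. z - y0 \<in> A}"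
    using zp.size_of_translate'[OF A] zp.periodic_translate'[OF A] by auto
  have trans_sub: "{z. z - y0 \<in> A} \<subseteq> sumset A B"
    using y0 sumsetI[of "_ - y0" A y0 B] by auto
  define K where "K = {x. [x = y0] (mod int p)}"
  have K: "per K" "sz K = 1" "y0 \<in> K" using per_class sz_class by (auto simp: K_def)
  have "K \<subseteq> B" unfolding K_def using y0 per_cong[OF B] by blast
  have pBK: "per (B - K)" using B K zp.periodic_Diff by blast
  have szBK: "sz (B - K) + 1 = sz B" using zp.size_of_Diff[OF \<open>K \<subseteq> B\<close>] K by simp
  have "B - K \<noteq> {}" using szBK szB by force
  show ?case
  \<comment> \<open>For two classes y0 and y0 + d the sumset consists of two translates of A, so A +
    d has at most one element outside A.\<close>
  proof (cases "sz B = 2")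
    case True
    then have s1: "sz (B - K) = 1" using szBK by simp
    obtain y1 where y1: "y1 \<in> B" "y1 \<notin> K" using \<open>B - K \<noteq> {}\<close> by auto
    define d where "d = y1 - y0"
    have "\<not> int p dvd d" using y1 by (simp add: K_def d_def cong_iff_dvd_diff)
    then obtain c where c: "[d * c = 1] (mod int p)" using obtain_inverse by blast
    then have c': "[c * d = 1] (mod int p)" by (simp add: mult.commute)
    note nc = not_dvd_inverse[OF c']
    let ?E = "{x. x - d \<in> A \<and> x \<notin> A}"
    have "per ?E"
    proof -
      have "?E = {x. x - d \<in> A} - A" by auto
      then show ?thesis using zp.periodic_Diff[OF zp.periodic_translate'[OF A] A] by simp
    qed
    then have "sz {z. z - y0 \<in> ?E} = sz ?E" by (rule zp.size_of_translate')
    moreover have "sz {z. z - y0 \<in> A} + sz {z. z - y0 \<in> ?E} \<le> sz (sumset A B)"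
    proof -
      have "z \<in> sumset A B" if "z - y0 \<in> ?E" for z
        using that y1(1) sumsetI[of "z - y0 - d" A y1 B] by (simp add: d_def)
      then have "{z. z - y0 \<in> A} \<union> {z. z - y0 \<in> ?E} \<subseteq> sumset A B"
        using trans_sub by blast
      from zp.size_of_mono[OF this] show ?thesis
        by (subst zp.size_of_Un_disjoint[symmetric]) auto
    qed
    ultimately have "sz ?E \<le> 1" using small(1) True trans by simp
    moreover have "A \<noteq> UNIV" using zp.size_of_mono[OF trans_sub] small(2) trans sz_UNIV by auto
    ultimately have pA: "progression c A" using progression_step[OF A ne(1) _ nc(1) c'] by blast
    have "progression c B"
      using progression_if_small_sumset[OF A pA szA nc(1) B ne(2) neU small(1)] .
    then show ?thesis using pA nc by blast
  next
    case False
    then have szB3: "sz B \<ge> 3" using szB by simp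
    \<comment> \<open>If no such e existed, each x in A would admit as translations inside A either
      all of B - y0 (the set X below) or only the class of 0 (the set Y). Then Y + (B - K) is
      disjoint from A + y0 within A + B, so |Y| \<le> 1, and X + B lies in A + y0, so |X| + |B|
      \<le> |A| + 1. Together |B| \<le> 2, a contradiction.\<close>
    have "\<exists>e. e + y0 \<in> A \<and> 2 \<le> sz (B \<inter> {y. y + e \<in> A}) \<and> sz (B \<inter> {y. y + e \<in> A}) < sz B"
    proof (rule ccontr)
      assume none: "\<not> ?thesis"
      define X where "X = A \<inter> {x. \<forall>y\<in>B. x + (y - y0) \<in> A}"
      have pX: "per X"
      proof -
        have "per {x. \<forall>y\<in>B. x + (y - y0) \<in> A}"
        proof (rule perI)
          fix x x' assume "[x = x'] (mod int p)" "x \<in> {x. \<forall>y\<in>B. x + (y - y0) \<in> A}"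
          then show "x' \<in> {x. \<forall>y\<in>B. x + (y - y0) \<in> A}"
            using per_cong[OF A] cong_add_rcancel by blast
        qed
        then show ?thesis unfolding X_def using A zp.periodic_Int by blast
      qed
      define Y where "Y = A - X"
      have pY: "per Y" unfolding Y_def using A pX zp.periodic_Diff by blast
      have szXY: "sz Y + sz X = sz A" unfolding Y_def by (rule zp.size_of_Diff) (auto simp: X_def)
      have Yprop: "x + (y - y0) \<notin> A" if "x \<in> Y" "y \<in> B - K" for x y
      proof
        assume xy: "x + (y - y0) \<in> A"
        let ?C = "B \<inter> {y. y + (x - y0) \<in> A}"
        have pC: "per ?C" by (intro zp.periodic_Int B zp.periodic_translate A)
        have "x \<in> A" using that by (auto simp: Y_def)
        then have "y0 \<in> ?C" "y \<in> ?C" using y0 that xy by (auto simp: algebra_simps)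
        moreover have "\<not> [y = y0] (mod int p)" using that by (auto simp: K_def)
        ultimately have "\<not> sz ?C \<le> 1" using sz_le_1_cong[OF pC] by blast
        then have "\<not> sz ?C < sz B" using none \<open>x \<in> A\<close> by (metis diff_add_cancel not_less_eq_eq numeral_2_eq_2 One_nat_def)
        then have "?C = B" using zp.eq_if_subset_size[OF pC B] by auto
        then have "x \<in> X" unfolding X_def using \<open>x \<in> A\<close> by (auto simp: algebra_simps)
        then show False using that by (auto simp: Y_def)
      qed
      have "sz Y \<le> 1"
      proof (cases "Y = {}")
        case False
        define Z where "Z = sumset Y (B - K)"
        have pZ: "per Z" unfolding Z_def by (rule zp.periodic_sumset[OF pY])
        have disj: "{z. z - y0 \<in> A} \<inter> Z = {}"
          using Yprop unfolding Z_def sumset_def by (auto simp: algebra_simps)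
        have "Z \<subseteq> sumset A B" unfolding Z_def sumset_def Y_def by auto
        then have "sz ({z. z - y0 \<in> A} \<union> Z) \<le> sz (sumset A B)"
          using trans_sub by (intro zp.size_of_mono) auto
        then have "sz A + sz Z \<le> sz (sumset A B)"
          using zp.size_of_Un_disjoint[OF disj] trans by simp
        moreover have "Z \<noteq> UNIV" using \<open>Z \<subseteq> sumset A B\<close> neU by auto
        then have "sz Y + sz (B - K) \<le> sz Z + 1"
          using cauchy_davenport[OF pY pBK False \<open>B - K \<noteq> {}\<close>] by (simp add: Z_def)
        ultimately show ?thesis using small(1) szBK by simp
      qed simp
      then have "X \<noteq> {}" using szXY szA by force
      have sub: "sumset X B \<subseteq> {z. z - y0 \<in> A}"
        unfolding sumset_def X_def by (auto simp: algebra_simps)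
      then have "sumset X B \<noteq> UNIV" using trans_sub neU by auto
      then have "sz X + sz B \<le> sz (sumset X B) + 1"
        using cauchy_davenport[OF pX B \<open>X \<noteq> {}\<close> ne(2)] by blast
      then have "sz X + sz B \<le> sz A + 1" using zp.size_of_mono[OF sub] trans by simp
      then show False using szXY \<open>sz Y \<le> 1\<close> szB3 by simp
    qed
    then obtain e where e: "e + y0 \<in> A" "2 \<le> sz (B \<inter> {y. y + e \<in> A})"
      "sz (B \<inter> {y. y + e \<in> A}) < sz B" by blast
    define B1 where "B1 = B \<inter> {y. y + e \<in> A}"
    define A1 where "A1 = A \<union> {x. x - e \<in> B}"
    have pB1: "per B1" unfolding B1_def by (intro zp.periodic_Int B zp.periodic_translate A)
    have pA1: "per A1" unfolding A1_def by (intro zp.periodic_Un A zp.periodic_translate' B)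
    have B1: "2 \<le> sz B1" "sz B1 < sz B" using e by (auto simp: B1_def)
    have sum_eq: "sz A1 + sz B1 = sz A + sz B"
    proof -
      have "sz B1 = sz {x. x - e \<in> B1}" using zp.size_of_translate'[OF pB1] by simp
      also have "{x. x - e \<in> B1} = A \<inter> {x. x - e \<in> B}" by (auto simp: B1_def)
      finally show ?thesis unfolding A1_def
        using zp.size_of_Un_Int[of A "{x. x - e \<in> B}"] zp.size_of_translate'[OF B] by simp
    qed
    have sub: "sumset A1 B1 \<subseteq> sumset A B"
    proof
      fix z assume "z \<in> sumset A1 B1"
      then obtain x y where xy: "z = x + y" "x \<in> A \<or> x - e \<in> B" "y \<in> B" "y + e \<in> A"
        by (auto simp: sumset_def A1_def B1_def)
      from xy(2) show "z \<in> sumset A B"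
      proof
        assume "x \<in> A" then show ?thesis using xy sumsetI by blast
      next
        assume "x - e \<in> B" then show ?thesis using xy(1,4) sumsetI[of "y + e" A "x - e" B] by (simp add: add.commute)
      qed
    qed
    have szA1: "2 \<le> sz A1" using szA zp.size_of_mono[of A A1] by (auto simp: A1_def)
    have "sumset A1 B1 \<noteq> UNIV" using sub neU by auto
    moreover have ne1: "A1 \<noteq> {}" "B1 \<noteq> {}" using szA1 B1 by auto
    ultimately have "sz A1 + sz B1 \<le> sz (sumset A1 B1) + 1"
      using cauchy_davenport[OF pA1 pB1] by blast
    then have ge: "sz (sumset A B) \<le> sz (sumset A1 B1)" using small sum_eq by simp
    have eq: "sumset A1 B1 = sumset A B"
      using zp.eq_if_subset_size[OF zp.periodic_sumset[OF pA1] zp.periodic_sumset[OF A] sub ge] .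
    have "sz (sumset A1 B1) + 1 \<le> sz A1 + sz B1" "sz (sumset A1 B1) + 2 \<le> p"
      using small sum_eq eq by auto
    then obtain c where c: "\<not> int p dvd c" "progression c A1" "progression c B1"
      using less.hyps[OF B1(2) pA1 pB1 szA1 B1(1)] by blast
    have "sz A1 + sz B1 \<le> p + 1" using ge small \<open>sz A1 + sz B1 \<le> sz (sumset A1 B1) + 1\<close> eq by simp
    then have pAB: "progression c (sumset A B)"
      using progression_sumset(1)[OF c(2,3) pA1 pB1 c(1) ne1] eq by simp
    define C where "C = - sumset A B"
    have C: "per C" "progression c C" "sz C \<ge> 2"
      unfolding C_def using zp.periodic_Compl[OF zp.periodic_sumset[OF A]] progression_Compl[OF pAB] small(2)
      by (simp_all add: sz_Compl)
    define B' where "B' = {x. - x \<in> B}"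
    have B': "per B'" "B' \<noteq> {}" "sz B' = sz B"
    proof -
      show "per B'" "sz B' = sz B" unfolding B'_def
        using zp.periodic_uminus[OF B] zp.size_of_uminus[OF B] by auto
      then show "B' \<noteq> {}" using szB by auto
    qed
    have sub': "sumset C B' \<subseteq> - A"
    proof
      fix z assume "z \<in> sumset C B'"
      then obtain x y where xy: "z = x + y" "x \<notin> sumset A B" "- y \<in> B"
        by (auto simp: sumset_def C_def B'_def)
      show "z \<in> - A"
      proof
        assume "z \<in> A"
        then have "z + - y \<in> sumset A B" using xy(3) by (rule sumsetI)
        then show False using xy by simp
      qed
    qed
    have "sumset C B' \<noteq> UNIV" using sub' ne by auto
    moreover have "sz (sumset C B') + 1 \<le> sz C + sz B'"
    proof -
      have "sz (sumset C B') \<le> p - sz A" using zp.size_of_mono[OF sub'] by (simp add: sz_Compl)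
      moreover have "sz C = p - sz (sumset A B)" by (simp add: C_def sz_Compl)
      ultimately show ?thesis using small B'(3) sz_le[of A] by linarith
    qed
    ultimately have "progression c B'"
      using progression_if_small_sumset[OF C c(1) B'(1,2)] by blast
    then have "progression c {x. - x \<in> B'}" using progression_uminus B'(1) by blast
    then have pB: "progression c B" by (simp add: B'_def)
    moreover have "progression c A"
      using progression_if_small_sumset[OF B pB szB c(1) A ne(1)] neU small(1)
      by (simp add: sumset_commute[of B A] add.commute)
    ultimately show ?thesis using c by blast
  qed
qed

end

section \<open>Pairs of level sets and the middle interval\<close>

context prime_modulus
begin

text \<open>Pairing x with p - x; for odd p no class other than that of 0 is its own
  negative.\<close>

lemma even_sz_symmetric:
  assumes X: "per X" and sym: "\<And>x. x \<in> X \<Longrightarrow> - x \<in> X" and "0 \<notin> X" and "odd p"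
  shows "even (sz X)"
proof -
  define h where "h = int p div 2"
  have ph: "int p = 2 * h + 1" using assms(4) by (simp add: h_def)
  let ?L = "X \<inter> {1..h}" and ?U = "X \<inter> {h+1..<int p}"
  have refl: "int p - x \<in> X" if "x \<in> X" for x
  proof -
    have "[- x = int p - x] (mod int p)" by (simp add: cong_iff_dvd_diff)
    then show ?thesis using per_cong[OF X] sym[OF that] by blast
  qed
  have "bij_betw (\<lambda>x. int p - x) ?L ?U"
    by (rule bij_betw_byWitness[where f' = "\<lambda>x. int p - x"]) (use ph refl in auto)
  then have "card ?L = card ?U" by (rule bij_betw_same_card)
  moreover have "X \<inter> range (zrep p) = ?L \<union> ?U"
  proof -
    have "x \<noteq> 0" if "x \<in> X" for x using that assms(3) by auto
    moreover have "h \<ge> 0" using ph by simp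
    ultimately have "{0..<int p} - {0} = {1..h} \<union> {h+1..<int p}" using ph by auto
    then show ?thesis using assms(3) unfolding range_zrep[OF p_pos(1)] by blast
  qed
  moreover have "card (?L \<union> ?U) = card ?L + card ?U"
    by (rule card_Un_disjoint) auto
  ultimately have "sz X = 2 * card ?L" by (simp add: zp.size_of_def)
  then show ?thesis by simp
qed

lemma cong_dilate_cancel:
  assumes "\<not> int p dvd c" "[c * x = c * y] (mod int p)"
  shows "[x = y] (mod int p)"
proof -
  have "int p dvd c * (x - y)" using assms(2) by (simp add: cong_iff_dvd_diff algebra_simps)
  then show ?thesis using assms(1) by (simp add: prime_dvd_mult cong_iff_dvd_diff)
qed

text \<open>In terms of positions along Y let u and v be the first and the last position of X, so
  that |X| \<le> v + 1 - u. If k \<le> v, the element of Y that is k steps before position v will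
  do; otherwise u + k is still a position of Y, by the hypothesis on the sizes.\<close>

lemma progression_difference:
  assumes Y: "per Y" "progression c Y" and c: "\<not> int p dvd c"
    and X: "per X" "X \<subseteq> Y" "X \<noteq> {}" and k: "2 * k + 2 \<le> sz X + sz Y"
  obtains x y where "x \<in> X" "y \<in> Y" "[c * (x - y) = int k] (mod int p) \<or> [c * (y - x) = int k] (mod int p)"
proof -
  define n where "n = sz Y"
  obtain b where b: "Y = {x. c * x \<in> arc b n}"
    using Y(2) unfolding progression_def n_def by blast
  obtain d where d: "[c * d = 1] (mod int p)" using obtain_inverse[OF c] by blast
  have inY: "\<exists>y\<in>Y. [c * y = b + int j] (mod int p)" if "j < n" for j
  proof (rule bexI)
    show 1: "[c * (d * (b + int j)) = b + int j] (mod int p)"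
      using cong_cancel_inverse(1)[OF d] .
    show "d * (b + int j) \<in> Y" unfolding b mem_arc_iff using that 1 by blast
  qed
  define J where "J = {j. j < n \<and> (\<exists>x\<in>X. [c * x = b + int j] (mod int p))}"
  have "finite J" by (simp add: J_def)
  have "J \<noteq> {}"
  proof -
    obtain x where "x \<in> X" using X by auto
    then have "\<exists>j<n. [c * x = b + int j] (mod int p)" using X(2) unfolding b mem_arc_iff by blast
    then show ?thesis using \<open>x \<in> X\<close> unfolding J_def by blast
  qed
  define u v where "u = Min J" and "v = Max J"
  have uv: "u \<in> J" "v \<in> J" "\<And>j. j \<in> J \<Longrightarrow> u \<le> j \<and> j \<le> v"
    using \<open>finite J\<close> \<open>J \<noteq> {}\<close> by (auto simp: u_def v_def)
  have "u \<le> v" using uv by blast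
  have "X \<subseteq> {x. c * x \<in> arc (b + int u) (v + 1 - u)}"
  proof
    fix x assume x: "x \<in> X"
    then obtain j where j: "j < n" "[c * x = b + int j] (mod int p)"
      using X(2) unfolding b mem_arc_iff by auto
    then have "j \<in> J" using x by (auto simp: J_def)
    then have "u \<le> j" "j \<le> v" using uv by auto
    then have less: "j - u < v + 1 - u" and eq: "b + int j = b + int u + int (j - u)" by auto
    show "x \<in> {x. c * x \<in> arc (b + int u) (v + 1 - u)}"
      unfolding mem_arc_iff mem_Collect_eq using less j(2)[unfolded eq] by blast
  qed
  then have "sz X \<le> sz {x. c * x \<in> arc (b + int u) (v + 1 - u)}"
    by (rule zp.size_of_mono)
  also have "\<dots> = v + 1 - u"
  proof -
    have "v < n" using uv by (simp add: J_def)
    then have "v + 1 - u \<le> p" using sz_le[of Y] by (simp add: n_def)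
    then show ?thesis using sz_dilate[OF per_arc c] sz_arc by simp
  qed
  finally have szX: "sz X + u \<le> v + 1" using \<open>u \<le> v\<close> by simp
  show ?thesis
  proof (cases "k \<le> v")
    case True
    obtain x where x: "x \<in> X" "[c * x = b + int v] (mod int p)" and "v < n"
      using uv(2) by (auto simp: J_def)
    obtain y where y: "y \<in> Y" "[c * y = b + int (v - k)] (mod int p)"
      using inY[OF le_less_trans[OF diff_le_self \<open>v < n\<close>]] by blast
    have "[c * x - c * y = (b + int v) - (b + int (v - k))] (mod int p)"
      using x(2) y(2) by (rule cong_diff)
    then show ?thesis using that[OF x(1) y(1)] True by (simp add: algebra_simps of_nat_diff)
  next
    case False
    obtain x where x: "x \<in> X" "[c * x = b + int u] (mod int p)"
      using uv(1) by (auto simp: J_def)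
    have "u + k < n" using False szX k unfolding n_def by linarith
    then obtain y where y: "y \<in> Y" "[c * y = b + int (u + k)] (mod int p)"
      using inY by blast
    have "[c * y - c * x = (b + int (u + k)) - (b + int u)] (mod int p)"
      using y(2) x(2) by (rule cong_diff)
    then show ?thesis using that[OF x(1) y(1)] by (simp add: algebra_simps)
  qed
qed

text \<open>The pairs of positions (0, k) and (1, k + 1) have no position in common unless k = 1, so
  the class of b spoils at most one of them. If k = 1 and b sits at position 1, the pair (2, 3) is
  used, which is why four elements are required.\<close>

lemma symmetric_sum_free_difference:
  assumes Z: "per Z" "progression c Z" and c: "\<not> int p dvd c"
    and k: "k + 2 \<le> sz Z" "sz Z \<ge> 4"
  obtains x y where "x \<in> Z" "y \<in> Z" "[c * (x - y) = int k] (mod int p)"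
    "\<not> [x = b] (mod int p)" "\<not> [y = b] (mod int p)"
proof -
  define n where "n = sz Z"
  have n: "n \<le> p" unfolding n_def by (rule sz_le)
  obtain w where w: "Z = {x. c * x \<in> arc w n}"
    using Z(2) unfolding progression_def n_def by blast
  obtain d where d: "[c * d = 1] (mod int p)" using obtain_inverse[OF c] by blast
  define z where "z j = d * (w + int j)" for j :: nat
  have z: "[c * z j = w + int j] (mod int p)" for j
    unfolding z_def using cong_cancel_inverse(1)[OF d] .
  have zZ: "z j \<in> Z" if "j < n" for j
    unfolding w mem_arc_iff using that z by blast
  have inj: "i = j" if "[z i = z j] (mod int p)" "i < n" "j < n" for i j
  proof -
    have "[c * z i = c * z j] (mod int p)" using that(1) by (rule cong_scalar_left)
    then have "[w + int i = w + int j] (mod int p)" using z unfolding cong_def by metis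
    then have "[int i = int j] (mod int p)" using cong_add_lcancel by blast
    then show ?thesis using that n by (simp add: cong_def)
  qed
  have bad: "i = j" if "[z i = b] (mod int p)" "[z j = b] (mod int p)" "i < n" "j < n" for i j
    using inj that unfolding cong_def by metis
  note result = that
  have pair: thesis if "i + k < n" "\<not> [z i = b] (mod int p)" "\<not> [z (i + k) = b] (mod int p)" for i
  proof (rule result[of "z (i + k)" "z i"])
    show "z (i + k) \<in> Z" "z i \<in> Z" using that(1) zZ by auto
    have "[c * z (i + k) - c * z i = (w + int (i + k)) - (w + int i)] (mod int p)"
      using z z by (rule cong_diff)
    then show "[c * (z (i + k) - z i) = int k] (mod int p)" by (simp add: algebra_simps)
  qed (use that in auto)
  have kn: "k + 2 \<le> n" "n \<ge> 4" using k by (auto simp: n_def)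
  show thesis
  proof (cases "[z 0 = b] (mod int p) \<or> [z k = b] (mod int p)")
    case False then show ?thesis using pair[of 0] kn by simp
  next
    case True
    then obtain j where j: "j = 0 \<or> j = k" "[z j = b] (mod int p)" by auto
    then have "j < n" using kn by auto
    have other: "\<not> [z i = b] (mod int p)" if "i < n" "i \<noteq> j" for i
      using bad[OF _ j(2) that(1) \<open>j < n\<close>] that(2) by blast
    show ?thesis
    proof (cases "j = 1")
      case False
      then show ?thesis
        using pair[OF _ other[of 1] other[of "1 + k"]] kn j(1) by force
    next
      case True
      then show ?thesis
        using pair[OF _ other[of 2] other[of "2 + k"]] kn j(1) by force
    qed
  qed
qed

text \<open>The hypothesis keeps c s away from all residues k and - k with k \<le> 2m - 2. What is
  left is [2m - 1, p - (2m - 1)], and p - (2m - 1) = 4m.\<close>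

lemma dilate_into_middle:
  assumes S: "per S" and c: "\<not> int p dvd c" and p: "int p = 6 * m - 1" "m \<ge> 2"
    and avoid: "\<And>k. int k \<le> 2 * m - 2 \<Longrightarrow>
      \<exists>x. [c * x = int k] (mod int p) \<and> x \<notin> S \<and> - x \<notin> S"
    and s: "s \<in> S"
  shows "(c * s) mod int p \<in> {2 * m - 1..4 * m}"
proof (rule ccontr)
  define r where "r = (c * s) mod int p"
  have r: "0 \<le> r" "r < int p" using p_pos by (auto simp: r_def)
  have cr: "[c * s = r] (mod int p)" by (simp add: r_def cong_def)
  assume "\<not> ?thesis"
  then have "r \<le> 2 * m - 2 \<or> int p - r \<le> 2 * m - 2" using p(1) unfolding r_def[symmetric] atLeastAtMost_iff by linarith
  then show False
  proof
    assume le: "r \<le> 2 * m - 2"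
    then obtain x where x: "[c * x = r] (mod int p)" "x \<notin> S"
      using avoid[of "nat r"] r by auto
    have "[x = s] (mod int p)"
      using cong_dilate_cancel[OF c] x(1) cr unfolding cong_def by metis
    then show False using x s per_cong[OF S] by blast
  next
    assume le: "int p - r \<le> 2 * m - 2"
    then obtain x where x: "[c * x = int p - r] (mod int p)" "- x \<notin> S"
      using avoid[of "nat (int p - r)"] r by auto
    have "[c * x + c * s = int p - r + r] (mod int p)"
      using x(1) cr by (rule cong_add)
    then have "[c * x + c * s = 0] (mod int p)"
      by (simp add: cong_def)
    then have "[c * s = c * (- x)] (mod int p)"
      by (simp add: cong_iff_dvd_diff algebra_simps)
    then have "[s = - x] (mod int p)" using cong_dilate_cancel[OF c] by blast
    then show False using x s per_cong[OF S] by blast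
  qed
qed

end

context prime_modulus
begin

text \<open>Vosper's theorem needs a pair with a small sumset. The symmetric set U = X \<union> - X
  has even size and avoids Y - Y. If |Y - Y| < 2 |Y|, then Y is a progression and the differences
  between X and Y exclude all small residues from the dilated S. Otherwise counting leaves only |X|
  = |Y| = 2m - 1 or |X| = 2m - 2, |Y| = 2m. Then a symmetric part X' of X of size 2m - 2, completed
  by two classes a and - a, is a sum-free set Z of size 2m, and Vosper's theorem applies to Z +
  Z.\<close>

lemma support_in_middle:
  assumes p: "int p = 6 * m - 1" "m \<ge> 2"
    and per: "per X" "per Y" "per S" and XY: "X \<subseteq> Y" "X \<noteq> {}"
    and sz: "int (sz X) + int (sz Y) \<ge> 4 * m - 2"
    and d1: "sumset X Y \<inter> Y = {}" and d2: "sumset Y Y \<inter> X = {}"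
    and d3: "\<And>x y. x \<in> X \<Longrightarrow> y \<in> Y \<Longrightarrow> x - y \<notin> S \<and> y - x \<notin> S"
  shows "\<exists>c. \<not> int p dvd c \<and> (\<forall>s\<in>S. (c * s) mod int p \<in> {2 * m - 1..4 * m})"
proof -
  have odd: "odd p"
  proof
    assume "even p"
    then have "even (int p)" by simp
    then show False using p by simp
  qed
  have "Y \<noteq> {}" using XY by auto
  have "0 \<notin> X"
  proof
    assume "0 \<in> X"
    moreover obtain y where "y \<in> Y" using \<open>Y \<noteq> {}\<close> by auto
    ultimately have "0 + y \<in> sumset X Y" using sumsetI by blast
    then show False using d1 \<open>y \<in> Y\<close> by auto
  qed
  define N where "N T = {x. - x \<in> T}" for T :: "int set"
  have N: "per (N T)" "sz (N T) = sz T" if "per T" for T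
    using that unfolding N_def using zp.periodic_uminus zp.size_of_uminus by auto
  have x2y: "int (sz X) + 2 * int (sz Y) \<le> 6 * m"
  proof -
    have "sumset X Y \<noteq> UNIV" using d1 \<open>Y \<noteq> {}\<close> by auto
    then have "sz X + sz Y \<le> sz (sumset X Y) + 1"
      using cauchy_davenport[OF per(1,2) XY(2) \<open>Y \<noteq> {}\<close>] by simp
    moreover have "sz (sumset X Y) + sz Y \<le> p"
      using zp.size_of_disjoint_le[OF d1] by (simp add: index_eq)
    ultimately show ?thesis using p by linarith
  qed
  have szXY: "sz X \<le> sz Y" using zp.size_of_mono[OF XY(1)] .
  define U where "U = X \<union> N X"
  have pU: "per U" unfolding U_def using per N zp.periodic_Un by blast
  have evenU: "even (sz U)"
    by (rule even_sz_symmetric[OF pU]) (use \<open>0 \<notin> X\<close> odd in \<open>auto simp: U_def N_def\<close>)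
  have szU: "sz X \<le> sz U" by (rule zp.size_of_mono) (auto simp: U_def)
  define D where "D = sumset Y (N Y)"
  have pD: "per D" unfolding D_def using zp.periodic_sumset per by blast
  have DU: "D \<inter> U = {}"
  proof (rule ccontr)
    assume "D \<inter> U \<noteq> {}"
    then obtain y y' where y: "y \<in> Y" "- y' \<in> Y" "y + y' \<in> X \<or> - (y + y') \<in> X"
      unfolding D_def U_def sumset_def N_def by blast
    from y(3) show False
    proof
      assume "y + y' \<in> X"
      from sumsetI[OF this y(2)] show False using d1 y by auto
    next
      assume "- (y + y') \<in> X"
      from sumsetI[OF this y(1)] show False using d1 y by auto
    qed
  qed
  have szD: "sz D + sz U \<le> p" using zp.size_of_disjoint_le[OF DU] by (simp add: index_eq)
  show ?thesis
  proof (cases "sz D + 1 \<le> 2 * sz Y")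
    case True
    have "2 \<le> sz Y" "sz D + 2 \<le> p"
    proof -
      show "2 \<le> sz Y" using sz szXY p by linarith
      show "sz D + 2 \<le> p"
      proof -
        have "sz X \<ge> 1" using XY(2) per(1) zp.size_of_eq_0_iff[of X] by (cases "sz X") auto
        then have "sz U \<ge> 2" using szU evenU by (cases "sz U = 1") auto
        then show ?thesis using szD by simp
      qed
    qed
    then obtain c where c: "\<not> int p dvd c" "progression c Y"
      using vosper[OF per(2) N(1)[OF per(2)]] True N(2)[OF per(2)] unfolding D_def by auto
    have "(c * s) mod int p \<in> {2 * m - 1..4 * m}" if "s \<in> S" for s
    proof (rule dilate_into_middle[OF per(3) c(1) p _ that])
      fix k assume k: "int k \<le> 2 * m - 2"
      then have "2 * k + 2 \<le> sz X + sz Y" using sz by linarith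
      then obtain x y where xy: "x \<in> X" "y \<in> Y"
        "[c * (x - y) = int k] (mod int p) \<or> [c * (y - x) = int k] (mod int p)"
        using progression_difference[OF per(2) c(2,1) per(1) XY] by blast
      then show "\<exists>x. [c * x = int k] (mod int p) \<and> x \<notin> S \<and> - x \<notin> S"
        using d3[OF xy(1,2)] by (metis minus_diff_eq)
    qed
    then show ?thesis using c(1) by blast
  next
    case False
    \<comment> \<open>The element a is taken from Y, because only differences between X and Y are
      known to avoid S.\<close>
    have "\<exists>X' a. per X' \<and> N X' = X' \<and> X' \<subseteq> X \<and> a \<in> Y \<and> a \<notin> X' \<and> int (sz X') = 2 * m - 2"
    proof (cases "int (sz Y) = 2 * m - 1")
      case True
      then have szX: "int (sz X) = 2 * m - 1" using sz szXY by linarith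
      then have "X = Y" using True zp.eq_if_subset_size[OF per(1,2) XY(1)] by simp
      have "int (sz U) = 2 * m"
      proof -
        have "int (sz U) \<le> 2 * m + 1" using szD False True p by linarith
        moreover obtain j where j: "sz U = 2 * j" using evenU by auto
        ultimately have "2 * int j \<le> 2 * m + 1" "2 * m - 1 \<le> 2 * int j"
          using szU szX by linarith+
        then have "int j = m" by linarith
        then show ?thesis using j by simp
      qed
      moreover have "sz U + sz (X \<inter> N X) = sz X + sz (N X)"
        unfolding U_def by (rule zp.size_of_Un_Int)
      ultimately have s: "int (sz (X \<inter> N X)) = 2 * m - 2" using szX N(2)[OF per(1)] by linarith
      then have "\<not> X \<subseteq> X \<inter> N X" using szX zp.size_of_mono[of X "X \<inter> N X"] by linarith
      then obtain a where "a \<in> X" "a \<notin> X \<inter> N X" by blast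
      moreover have "N (X \<inter> N X) = X \<inter> N X" by (auto simp: N_def)
      moreover have "per (X \<inter> N X)" using per N zp.periodic_Int by blast
      ultimately show ?thesis using s \<open>X = Y\<close> by blast
    next
      case neq: False
      obtain j where j: "sz U = 2 * j" using evenU by auto
      have "int (sz Y) \<ge> 2 * m - 1" using sz szXY by linarith
      then have ge: "int (sz Y) \<ge> 2 * m" using neq by linarith
      have "2 * int j + 2 * int (sz Y) \<le> 6 * m - 1" using False szD p(1) j by linarith
      then have "int j + int (sz Y) \<le> 3 * m - 1" by linarith
      moreover have "int (sz X) \<le> 2 * int j" using szU j by linarith
      ultimately have s: "int (sz Y) = 2 * m" "int (sz X) = 2 * m - 2" "sz U = sz X"
        using sz ge j by linarith+
      have "X = U"
        by (rule zp.eq_if_subset_size[OF per(1) pU]) (use s in \<open>auto simp: U_def\<close>)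
      then have NX: "N X \<subseteq> X" unfolding U_def by blast
      have "X \<subseteq> N X"
      proof
        fix x assume "x \<in> X"
        then have "- x \<in> N X" unfolding N_def by simp
        then have "- x \<in> X" using NX by blast
        then show "x \<in> N X" unfolding N_def by simp
      qed
      then have "N X = X" using NX by blast
      moreover have "\<not> Y \<subseteq> X" using zp.size_of_mono[of Y X] s by auto
      ultimately show ?thesis using s per by blast
    qed
    then obtain X' a where X': "per X'" "N X' = X'" "X' \<subseteq> X" "int (sz X') = 2 * m - 2"
      and a: "a \<in> Y" "a \<notin> X'" by blast
    have symX: "x \<in> X' \<longleftrightarrow> - x \<in> X'" for x using X'(2) unfolding N_def by blast
    have X'Y: "X' \<subseteq> Y" using X'(3) XY by blast
    have e1: "x + y \<notin> Y" if "x \<in> X'" "y \<in> Y" for x y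
      using that X'(3) d1 sumsetI[of x X y Y] by blast
    have e2: "y + y' \<notin> X'" if "y \<in> Y" "y' \<in> Y" for y y'
      using that X'(3) d2 sumsetI[of y Y y' Y] by blast
    define K where "K b = {x. [x = b] (mod int p)}" for b
    have K: "per (K b)" "sz (K b) = 1" for b unfolding K_def by (rule per_class, rule sz_class)
    have p_small: "p > 3" using p by linarith
    have coprime_small: "\<not> int p dvd 2" "\<not> int p dvd 3"
      using p zdvd_imp_le[of "int p" 2] zdvd_imp_le[of "int p" 3] by auto
    have "\<not> int p dvd a"
    proof
      assume "int p dvd a"
      then have "[a = 0] (mod int p)" by (simp add: cong_0_iff)
      then have "0 \<in> Y" using a per_cong[OF per(2)] by blast
      moreover obtain x where "x \<in> X'" using X'(4) p by fastforce
      ultimately show False using e1[of x 0] X'Y by auto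
    qed
    then have na: "\<not> int p dvd 2 * a" "\<not> int p dvd 3 * a"
      using coprime_small by (simp_all add: prime_dvd_mult)
    define Z where "Z = X' \<union> (K a \<union> K (- a))"
    have pZ: "per Z" unfolding Z_def using X'(1) K zp.periodic_Un by blast
    have "K a \<inter> K (- a) = {}"
    proof (rule ccontr)
      assume "\<not> ?thesis"
      then obtain x where "[x = a] (mod int p)" "[x = - a] (mod int p)" by (auto simp: K_def)
      then have "[a = - a] (mod int p)" unfolding cong_def by metis
      then show False using na by (simp add: cong_iff_dvd_diff)
    qed
    moreover have "X' \<inter> (K a \<union> K (- a)) = {}"
    proof -
      have "a \<notin> X'" "- a \<notin> X'" using a symX by auto
      then show ?thesis unfolding K_def using per_cong[OF X'(1)] by blast
    qed
    ultimately have szZ: "int (sz Z) = 2 * m"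
      unfolding Z_def using X'(4) K by (simp add: zp.size_of_Un_disjoint)
    have rep: "\<exists>x'. [x = x'] (mod int p) \<and> (x' \<in> X' \<or> x' = a \<or> x' = - a)" if "x \<in> Z" for x
      using that unfolding Z_def K_def by (auto intro: cong_refl)
    \<comment> \<open>Up to congruence each of x, y and x + y is in X' or is a or - a. Relations
      that involve X' contradict the disjointness conditions, since X' is symmetric and a lies in Y;
      relations among a and - a alone would make p divide a or 3 a.\<close>
    have "sumset Z Z \<inter> Z = {}"
    proof (rule ccontr)
      assume "\<not> ?thesis"
      then obtain x y where xyZ: "x \<in> Z" "y \<in> Z" "x + y \<in> Z" by (auto simp: sumset_def)
      obtain x' where x': "[x = x'] (mod int p)" "x' \<in> X' \<or> x' = a \<or> x' = - a"
        using rep[OF xyZ(1)] by blast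
      obtain y' where y': "[y = y'] (mod int p)" "y' \<in> X' \<or> y' = a \<or> y' = - a"
        using rep[OF xyZ(2)] by blast
      obtain z' where z': "[x + y = z'] (mod int p)" "z' \<in> X' \<or> z' = a \<or> z' = - a"
        using rep[OF xyZ(3)] by blast
      have "[x' + y' = z'] (mod int p)"
        using cong_add[OF x'(1) y'(1)] z'(1) unfolding cong_def by metis
      note eq = this
      then have eqX: "x' + y' \<in> X' \<longleftrightarrow> z' \<in> X'" and eqY: "x' + y' \<in> Y \<longleftrightarrow> z' \<in> Y"
        using per_cong[OF X'(1)] per_cong[OF per(2)] by blast+
      have eq': "[z' - y' = x'] (mod int p)" "[z' - x' = y'] (mod int p)"
        "[x' + y' - z' = 0] (mod int p)"
        using eq cong_sym[OF eq] by (auto simp: cong_iff_dvd_diff algebra_simps)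
      have eqX': "- y' - x' \<in> X' \<longleftrightarrow> - z' \<in> X'" and eqY': "- y' - x' \<in> Y \<longleftrightarrow> - z' \<in> Y"
      proof -
        have "[- y' - x' = - z'] (mod int p)" using eq cong_sym[OF eq] by (auto simp: cong_iff_dvd_diff algebra_simps)
        then show "- y' - x' \<in> X' \<longleftrightarrow> - z' \<in> X'" "- y' - x' \<in> Y \<longleftrightarrow> - z' \<in> Y"
          using per_cong[OF X'(1)] per_cong[OF per(2)] by blast+
      qed
      have X'Yd: "x - y \<notin> Y" if "x \<in> X'" "y \<in> Y" for x y
        using that e2[of "x - y" y] X'Y by force
      have X'Ys: "y + x \<notin> Y" if "x \<in> X'" "y \<in> Y" for x y
        using e1[OF that] by (simp add: add.commute)
      have X'Yd2: "y - x \<notin> Y" if "x \<in> X'" "y \<in> Y" for x y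
        using e1[of "- x" y] that symX[of x] by auto
      note facts = e1 X'Ys e2 X'Yd X'Yd2
      show False
        using x'(2) y'(2) z'(2)
      proof (elim disjE)
        show False if "x' \<in> X'" "y' \<in> X'" "z' \<in> X'" using that e1 X'Y eqX by blast
        show False if "x' \<in> X'" "y' \<in> X'" "z' = a" using that e1 X'Y eqY a by blast
        show False if "x' \<in> X'" "y' \<in> X'" "z' = - a"
        proof -
          have "- x' \<in> X'" "- y' \<in> X'" using that symX by blast+
          then have "- y' + - x' \<notin> Y" using e1 X'Y by blast
          then show False using that(3) eqY' a by simp
        qed
        show False if "x' \<in> X'" "y' = a" "z' \<in> X'" using that e1 a eqY X'Y by blast
        show False if "x' = a" "y' \<in> X'" "z' \<in> X'" using that X'Ys a eqY X'Y by blast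
        show False if "x' \<in> X'" "y' = a" "z' = a" using that e1 a eqY by blast
        show False if "x' = a" "y' \<in> X'" "z' = a" using that X'Ys a eqY by blast
        show False if h: "x' \<in> X'" "y' = a" "z' = - a"
        proof -
          have "[a + a = - x'] (mod int p)" using eq h by (auto simp: cong_iff_dvd_diff algebra_simps)
          then show False using e2[OF a(1) a(1)] h(1) symX per_cong[OF X'(1)] by blast
        qed
        show False if h: "x' = a" "y' \<in> X'" "z' = - a"
        proof -
          have "[a + a = - y'] (mod int p)" using eq h by (auto simp: cong_iff_dvd_diff algebra_simps)
          then show False using e2[OF a(1) a(1)] h(2) symX per_cong[OF X'(1)] by blast
        qed
        show False if h: "x' \<in> X'" "y' = - a" "z' \<in> X'"
          using eqY X'Yd[OF h(1) a(1)] h X'Y by auto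
        show False if h: "x' = - a" "y' \<in> X'" "z' \<in> X'"
          using eqY X'Yd[OF h(2) a(1)] h X'Y by auto
        show False if h: "x' \<in> X'" "y' = - a" "z' = a"
        proof -
          have "[a + a = x'] (mod int p)" using cong_sym[OF eq] h by (auto simp: cong_iff_dvd_diff algebra_simps)
          then show False using e2[OF a(1) a(1)] h(1) per_cong[OF X'(1)] by blast
        qed
        show False if h: "x' = - a" "y' \<in> X'" "z' = a"
        proof -
          have "[a + a = y'] (mod int p)" using cong_sym[OF eq] h by (auto simp: cong_iff_dvd_diff algebra_simps)
          then show False using e2[OF a(1) a(1)] h(2) per_cong[OF X'(1)] by blast
        qed
        show False if h: "x' \<in> X'" "y' = - a" "z' = - a"
          using eqY' X'Yd2[OF h(1) a(1)] h a by auto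
        show False if h: "x' = - a" "y' \<in> X'" "z' = - a"
          using eqY' X'Yd2[OF h(2) a(1)] h a by (auto simp: add.commute)
        show False if "x' = a" "y' = a" "z' \<in> X'" using that e2 a eqX by blast
        show False if "x' = - a" "y' = - a" "z' \<in> X'" using that e2[OF a(1) a(1)] eqX' symX by auto
        show False if "x' = a" "y' = - a" "z' \<in> X'"
          using that eqX e2[of "z'" "- z'"] symX X'Y by auto
        show False if "x' = - a" "y' = a" "z' \<in> X'"
          using that eqX e2[of "z'" "- z'"] symX X'Y by auto
        show False if h: "x' = a" "y' = a" "z' = a"
          using eq h \<open>\<not> int p dvd a\<close> by (simp add: cong_iff_dvd_diff)
        show False if h: "x' = - a" "y' = - a" "z' = - a"
          using eq h \<open>\<not> int p dvd a\<close> by (simp add: cong_iff_dvd_diff)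
        show False if h: "x' = a" "y' = a" "z' = - a"
          using eq h na by (simp add: cong_iff_dvd_diff)
        show False if h: "x' = - a" "y' = - a" "z' = a"
        proof -
          have "int p dvd - (3 * a)" using eq h by (simp add: cong_iff_dvd_diff)
          then show False using na by simp
        qed
        show False if h: "x' = a" "y' = - a" "z' = a"
          using eq h \<open>\<not> int p dvd a\<close> by (simp add: cong_iff_dvd_diff)
        show False if h: "x' = - a" "y' = a" "z' = a"
          using eq h \<open>\<not> int p dvd a\<close> by (simp add: cong_iff_dvd_diff)
        show False if h: "x' = a" "y' = - a" "z' = - a"
          using eq h \<open>\<not> int p dvd a\<close> by (simp add: cong_iff_dvd_diff)
        show False if h: "x' = - a" "y' = a" "z' = - a"
          using eq h \<open>\<not> int p dvd a\<close> by (simp add: cong_iff_dvd_diff)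
      qed
    qed
    then have "sz (sumset Z Z) + sz Z \<le> p"
      using zp.size_of_disjoint_le by (simp add: index_eq)
    \<comment> \<open>|Z + Z| \<le> 4m - 1 = 2 |Z| - 1, the extremal case of
      Cauchy-Davenport.\<close>
    then have "sz (sumset Z Z) + 1 \<le> sz Z + sz Z" "sz (sumset Z Z) + 2 \<le> p" "2 \<le> sz Z" "4 \<le> sz Z"
      using szZ p by linarith+
    then obtain c where c: "\<not> int p dvd c" "progression c Z"
      using vosper[OF pZ pZ] by blast
    have "(c * s) mod int p \<in> {2 * m - 1..4 * m}" if "s \<in> S" for s
    proof (rule dilate_into_middle[OF per(3) c(1) p _ that])
      fix k assume k: "int k \<le> 2 * m - 2"
      then have k': "k + 2 \<le> sz Z" using szZ by linarith
      \<comment> \<open>Avoiding the class of - a leaves X' and the class of a, both inside Y. For k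
        \<noteq> 0 the two elements are not both in the class of a, so one of them is in X and their
        difference is not in S.\<close>
      obtain x y where xy: "x \<in> Z" "y \<in> Z" "[c * (x - y) = int k] (mod int p)"
        "\<not> [x = - a] (mod int p)" "\<not> [y = - a] (mod int p)"
        using symmetric_sum_free_difference[OF pZ c(2,1) k' \<open>4 \<le> sz Z\<close>, of "- a"] by blast
      show "\<exists>x. [c * x = int k] (mod int p) \<and> x \<notin> S \<and> - x \<notin> S"
      proof (cases "k = 0")
        case True
        obtain x where "x \<in> X'" using X'(4) p by fastforce
        then have "x - x \<notin> S" using d3 X'(3) XY by blast
        then show ?thesis using True by (intro exI[of _ 0]) simp
      next
        case False
        have KY: "K a \<subseteq> Y" unfolding K_def using a(1) per_cong[OF per(2)] by blast
        have "x \<in> X' \<or> x \<in> K a" "y \<in> X' \<or> y \<in> K a"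
          using xy unfolding Z_def K_def by auto
        moreover have "\<not> (x \<in> K a \<and> y \<in> K a)"
        proof
          assume "x \<in> K a \<and> y \<in> K a"
          then have "[x = y] (mod int p)" unfolding K_def cong_def by (metis mem_Collect_eq)
          then have "[c * (x - y) = c * 0] (mod int p)"
            by (intro cong_scalar_left) (simp add: cong_iff_dvd_diff)
          then have "[int k = 0] (mod int p)" using xy(3) unfolding cong_def mult_zero_right by metis
          then have "k mod p = 0" by (simp add: cong_def flip: of_nat_mod)
          moreover have "k < p" using k p by linarith
          ultimately show False using False by simp
        qed
        ultimately have "(x \<in> X \<and> y \<in> Y) \<or> (y \<in> X \<and> x \<in> Y)"
          using X'(3) X'Y KY by blast
        then have "x - y \<notin> S" "y - x \<notin> S" using d3 by blast+
        then show ?thesis using xy(3) by (intro exI[of _ "x - y"]) simp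
      qed
    qed
    then show ?thesis using c(1) by blast
  qed
qed

end

section \<open>From one large slice to the support of all slices\<close>

context finite_quotient
begin

lemma sum_translate:
  assumes "\<And>x. g (rep x) = g x"
  shows "(\<Sum>x\<in>range rep. g (x + c)) = (\<Sum>x\<in>range rep. g x)"
proof (rule sum.reindex_bij_witness[where i = "\<lambda>x. rep (x - c)" and j = "\<lambda>x. rep (x + c)"])
  fix a assume a: "a \<in> range rep"
  show "rep (rep (a + c) - c) = a" "rep (rep (a - c) + c) = a"
    using a by (auto simp: rep_add_left rep_diff_left)
  show "g (rep (a + c)) = g (a + c)" by (rule assms)
qed auto

end

text \<open>The involution t -> 2h + 1 - t matches each level above h with one below it. Two points
  from matched level sets have values adding up to more than 2h.\<close>

lemma sum_pair_levels:
  fixes F :: "int \<Rightarrow> int"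
  assumes "h < a"
  shows "(\<Sum>t\<in>{2 * h - a + 1..a}. F t) = (\<Sum>t\<in>{h + 1..a}. F t + F (2 * h + 1 - t))"
proof -
  have "(\<Sum>t\<in>{2 * h - a + 1..a}. F t) = (\<Sum>t\<in>{2 * h - a + 1..h}. F t) + (\<Sum>t\<in>{h + 1..a}. F t)"
    using assms by (subst sum.union_disjoint[symmetric]) (auto intro!: sum.cong)
  also have "(\<Sum>t\<in>{2 * h - a + 1..h}. F t) = (\<Sum>t\<in>{h + 1..a}. F (2 * h + 1 - t))"
    by (rule sum.reindex_bij_witness[where i = "\<lambda>t. 2 * h + 1 - t" and j = "\<lambda>t. 2 * h + 1 - t"]) auto
  finally show ?thesis by (simp add: sum.distrib)
qed

context prime_modulus
begin

text \<open>Here f stands for p times the slice size, 6m q = 2h, and a > h is the maximum, attained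
  at \<open>i0\<close>. Truncated at 2h - a, the function f has mean at most (2h - a) / 2, by the
  triple bound with \<open>i0\<close>. The remaining layers are paired as t and 2h + 1 - t; by the
  lower bound on the total, some pair of level sets has at least 4m - 2 elements altogether. Two
  points taken from them already exceed the triple bound, so the third value vanishes. This yields
  the hypotheses of \<open>support_in_middle\<close>.\<close>

lemma support_in_middle_if_peak:
  fixes f :: "int \<Rightarrow> int"
  assumes p: "int p = 6 * m - 1" "m \<ge> 2" and "q > 0"
    and per_f: "\<And>x. f (zrep p x) = f x" and f: "\<And>x. 0 \<le> f x" "\<And>x. f x \<le> int p * q"
    and triple: "\<And>i j. f i > 0 \<Longrightarrow> f j > 0 \<Longrightarrow> f (i + j) > 0 \<Longrightarrow> f i + f j + f (i + j) \<le> 6 * m * q"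
    and total: "(2 * m - 1) * int p * q \<le> (\<Sum>i\<in>range (zrep p). f i)"
    and peak: "f i1 > 3 * m * q"
  shows "\<exists>c. \<not> int p dvd c \<and> (\<forall>i. f i > 0 \<longrightarrow> (c * i) mod int p \<in> {2 * m - 1..4 * m})"
proof -
  let ?R = "range (zrep p)"
  have fin: "finite ?R" by (rule zp.finite_range_rep)
  define a where "a = Max (f ` ?R)"
  have a_max: "f x \<le> a" for x
    unfolding a_def using fin per_f[of x] by (metis Max_ge finite_imageI imageI rangeI)
  obtain i0 where i0: "f i0 = a"
  proof -
    have "Max (f ` ?R) \<in> f ` ?R" using fin by (intro Max_in) auto
    then show thesis using that unfolding a_def by (metis imageE)
  qed
  define h where "h = 3 * m * q"
  have ha: "h < a" using peak a_max[of i1] by (simp add: h_def)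
  have a_le: "a \<le> int p * q" using f i0 by metis
  have h2: "6 * m * q = 2 * h" by (simp add: h_def)
  have "int p * q < 2 * h" using p \<open>q > 0\<close> by (simp add: h_def algebra_simps)
  then have "a < 2 * h" using a_le by simp
  define g where "g i = min (f i) (2 * h - a)" for i
  have per_g: "g (zrep p x) = g x" for x by (simp add: g_def per_f)
  have g2: "g i + g (i + i0) \<le> 2 * h - a" for i
  proof (cases "f i > 0 \<and> f (i + i0) > 0")
    case True
    then have "f i + f i0 + f (i + i0) \<le> 2 * h"
      using triple[of i i0] i0 ha h2 \<open>a < 2 * h\<close> by linarith
    then show ?thesis by (simp add: g_def i0)
  next
    case False
    then have "f i = 0 \<or> f (i + i0) = 0" using f(1)[of i] f(1)[of "i + i0"] by linarith
    then show ?thesis using \<open>a < 2 * h\<close> by (auto simp: g_def min_def)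
  qed
  have "2 * (\<Sum>i\<in>?R. g i) = (\<Sum>i\<in>?R. g i + g (i + i0))"
    using zp.sum_translate[of g i0] per_g by (simp add: sum.distrib)
  also have "\<dots> \<le> (\<Sum>i\<in>?R. 2 * h - a)" by (intro sum_mono g2)
  also have "\<dots> = int p * (2 * h - a)" by (simp add: index_eq)
  finally have G: "2 * (\<Sum>i\<in>?R. g i) \<le> int p * (2 * h - a)" .
  define T where "T t = {i. f i \<ge> t}" for t
  have perT: "per (T t)" for t unfolding T_def zp.periodic_def by (simp add: per_f)
  have layer: "f i = g i + (\<Sum>t\<in>{2 * h - a + 1..a}. of_bool (t \<le> f i))" for i
  proof -
    have "(\<Sum>t\<in>{2 * h - a + 1..a}. of_bool (t \<le> f i)) = (\<Sum>t\<in>{2 * h - a + 1..f i}. (1::int))"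
      using a_max[of i] by (intro sum.mono_neutral_cong_right) auto
    then show ?thesis by (simp add: g_def)
  qed
  have "(\<Sum>i\<in>?R. f i) = (\<Sum>i\<in>?R. g i) + (\<Sum>i\<in>?R. \<Sum>t\<in>{2 * h - a + 1..a}. of_bool (t \<le> f i))"
    by (subst sum.distrib[symmetric]) (intro sum.cong refl layer)
  also have "(\<Sum>i\<in>?R. \<Sum>t\<in>{2 * h - a + 1..a}. of_bool (t \<le> f i)) =
      (\<Sum>t\<in>{2 * h - a + 1..a}. \<Sum>i\<in>?R. of_bool (t \<le> f i))" by (rule sum.swap)
  also have "\<dots> = (\<Sum>t\<in>{2 * h - a + 1..a}. int (sz (T t)))"
  proof (rule sum.cong[OF refl])
    fix t
    have "(\<Sum>i\<in>?R. of_bool (t \<le> f i)) = (\<Sum>i\<in>T t \<inter> ?R. (1::int))"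
      using fin by (intro sum.mono_neutral_cong_right) (auto simp: T_def)
    then show "(\<Sum>i\<in>?R. of_bool (t \<le> f i)) = int (sz (T t))" by (simp add: zp.size_of_def)
  qed
  also have "\<dots> = (\<Sum>t\<in>{h + 1..a}. int (sz (T t)) + int (sz (T (2 * h + 1 - t))))"
    by (rule sum_pair_levels[OF ha])
  finally have sum_f: "(\<Sum>i\<in>?R. f i) = (\<Sum>i\<in>?R. g i) + \<dots>" .
  have "\<exists>t\<in>{h + 1..a}. int (sz (T t)) + int (sz (T (2 * h + 1 - t))) \<ge> 4 * m - 2"
  proof (rule ccontr)
    assume "\<not> ?thesis"
    then have "(\<Sum>t\<in>{h + 1..a}. int (sz (T t)) + int (sz (T (2 * h + 1 - t)))) \<le> (\<Sum>t\<in>{h + 1..a}. 4 * m - 3)"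
      by (intro sum_mono) force
    also have "\<dots> = (a - h) * (4 * m - 3)" using ha by simp
    finally have "2 * ((2 * m - 1) * int p * q) \<le> int p * (2 * h - a) + 2 * ((a - h) * (4 * m - 3))"
      using sum_f total G by linarith
    note bound = this
    \<comment> \<open>In terms of the height of the peak above h, the total forces p q (m - 2) \<le>
      \<delta> (2m - 5), whereas \<delta> \<le> (3m - 1) q because f is at most p q. For m = 2 the
      right-hand side of the former is negative.\<close>
    define \<delta> where "\<delta> = a - h"
    then have "a = h + \<delta>" by simp
    with bound have "2 * ((2 * m - 1) * int p * q) \<le> int p * (h - \<delta>) + 2 * (\<delta> * (4 * m - 3))"
      by (simp add: algebra_simps)
    then have key: "(int p * q) * (m - 2) \<le> \<delta> * (2 * m - 5)"
      unfolding h_def p(1) by (simp add: algebra_simps)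
    have \<delta>: "0 < \<delta>" "\<delta> \<le> (3 * m - 1) * q"
      using ha a_le unfolding \<delta>_def h_def p(1) by (simp_all add: algebra_simps)
    show False
    proof (cases "m = 2")
      case True
      then show False using key \<delta> by simp
    next
      case False
      then have "m \<ge> 3" using p by simp
      then have "\<delta> * (2 * m - 5) \<le> (3 * m - 1) * q * (2 * m - 5)"
        using \<delta> by (intro mult_right_mono) auto
      then have "((6 * m - 1) * q) * (m - 2) \<le> (3 * m - 1) * q * (2 * m - 5)"
        using key unfolding p(1) by linarith
      then have "q * (4 * m - 3) \<le> 0" by (simp add: algebra_simps)
      then show False using \<open>q > 0\<close> \<open>m \<ge> 3\<close> by (simp add: mult_le_0_iff)
    qed
  qed
  then obtain t where t: "h + 1 \<le> t" "t \<le> a"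
    and big: "int (sz (T t)) + int (sz (T (2 * h + 1 - t))) \<ge> 4 * m - 2"
    unfolding Bex_def atLeastAtMost_iff by blast
  let ?X = "T t" and ?Y = "T (2 * h + 1 - t)"
  have pos: "f x > 0" if "x \<in> ?X" for x using that t ha \<open>a < 2 * h\<close> by (simp add: T_def)
  have posY: "f y > 0" if "y \<in> ?Y" for y using that t \<open>a < 2 * h\<close> by (simp add: T_def)
  have no: "\<not> (f u > 0 \<and> f v > 0 \<and> f (u + v) > 0 \<and> f u + f v + f (u + v) > 2 * h)" for u v
    using triple[of u v] h2 by auto
  have "\<exists>c. \<not> int p dvd c \<and> (\<forall>s\<in>{i. f i > 0}. (c * s) mod int p \<in> {2 * m - 1..4 * m})"
  proof (rule support_in_middle[OF p perT perT _ _ _ big])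
    show "per {i. 0 < f i}" unfolding zp.periodic_def by (simp add: per_f)
    show "?X \<subseteq> ?Y" using t by (auto simp: T_def)
    show "?X \<noteq> {}" using i0 t by (auto simp: T_def)
    show "sumset ?X ?Y \<inter> ?Y = {}"
    proof (rule ccontr)
      assume "\<not> ?thesis"
      then obtain x y where xy: "x \<in> ?X" "y \<in> ?Y" "x + y \<in> ?Y" by (auto simp: sumset_def)
      then have "f x + f y \<ge> 2 * h + 1" by (simp add: T_def)
      then show False using no[of x y] pos[OF xy(1)] posY[OF xy(2)] posY[OF xy(3)] by linarith
    qed
    show "sumset ?Y ?Y \<inter> ?X = {}"
    proof (rule ccontr)
      assume "\<not> ?thesis"
      then obtain x y where xy: "x \<in> ?Y" "y \<in> ?Y" "x + y \<in> ?X" by (auto simp: sumset_def)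
      then have "f (x + y) + f y \<ge> 2 * h + 1" by (simp add: T_def)
      then show False using no[of x y] pos[OF xy(3)] posY[OF xy(2)] posY[OF xy(1)] by linarith
    qed
    fix x y assume xy: "x \<in> ?X" "y \<in> ?Y"
    then have "f x + f y \<ge> 2 * h + 1" by (simp add: T_def)
    then show "x - y \<notin> {i. 0 < f i} \<and> y - x \<notin> {i. 0 < f i}"
      using no[of "x - y" y] no[of "y - x" x] pos[OF xy(1)] posY[OF xy(2)] by auto
  qed
  then show ?thesis by simp
qed

end

section \<open>A cubic inequality for flat functions\<close>

context prime_modulus
begin

definition Zsum :: "(int \<Rightarrow> 'b::comm_monoid_add) \<Rightarrow> 'b" where
  "Zsum g = (\<Sum>x\<in>range (zrep p). g x)"

definition per_fun :: "(int \<Rightarrow> 'b) \<Rightarrow> bool" where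
  "per_fun g \<longleftrightarrow> (\<forall>x. g (zrep p x) = g x)"

lemma per_funD: "per_fun g \<Longrightarrow> g (zrep p x) = g x"
  by (simp add: per_fun_def)

lemma per_fun_cong: "per_fun g \<Longrightarrow> [x = y] (mod int p) \<Longrightarrow> g x = g y"
  by (metis per_fun_def rep_eq_iff)

lemma per_funI: "(\<And>x y. [x = y] (mod int p) \<Longrightarrow> g x = g y) \<Longrightarrow> per_fun g"
  unfolding per_fun_def using rep_eq_iff zp.rep_rep by blast

lemma Zsum_add: "Zsum (\<lambda>x. f x + g x) = Zsum f + Zsum g"
  by (simp add: Zsum_def sum.distrib)

lemma Zsum_diff: "Zsum (\<lambda>x. f x - g x :: 'b::ab_group_add) = Zsum f - Zsum g"
  by (simp add: Zsum_def sum_subtractf)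

lemma Zsum_cmult: "Zsum (\<lambda>x. c * f x :: 'b::comm_ring_1) = c * Zsum f"
  by (simp add: Zsum_def sum_distrib_left)

lemma Zsum_const: "Zsum (\<lambda>x. c :: 'b::comm_ring_1) = of_nat p * c"
  by (simp add: Zsum_def index_eq)

lemma Zsum_swap: "Zsum (\<lambda>x. Zsum (\<lambda>y. f x y)) = Zsum (\<lambda>y. Zsum (\<lambda>x. f x y))"
  unfolding Zsum_def by (rule sum.swap)

lemma Zsum_translate: "per_fun g \<Longrightarrow> Zsum (\<lambda>x. g (x + c)) = Zsum g"
  unfolding Zsum_def by (rule zp.sum_translate) (rule per_funD)

lemma Zsum_dilate:
  assumes g: "per_fun g" and c: "\<not> int p dvd c"
  shows "Zsum (\<lambda>x. g (c * x)) = Zsum g"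
proof -
  obtain d where d: "[c * d = 1] (mod int p)" using obtain_inverse[OF c] by blast
  have inv: "zrep p (d * zrep p (c * x)) = zrep p x" "zrep p (c * zrep p (d * x)) = zrep p x" for x
    using cong_cancel_inverse[OF d, of x] by (simp_all add: zrep_def mod_mult_right_eq cong_def)
  have fix_rep: "zrep p a = a" if "a \<in> range (zrep p)" for a using that by auto
  show ?thesis unfolding Zsum_def
  proof (rule sum.reindex_bij_witness[where i = "\<lambda>x. zrep p (d * x)" and j = "\<lambda>x. zrep p (c * x)"])
    fix a assume a: "a \<in> range (zrep p)"
    show "zrep p (d * zrep p (c * a)) = a" "zrep p (c * zrep p (d * a)) = a"
      using inv fix_rep[OF a] by simp_all
    show "g (zrep p (c * a)) = g (c * a)" by (rule per_funD[OF g])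
  qed auto
qed

lemma Zsum_affine:
  assumes "per_fun g" "\<not> int p dvd c"
  shows "Zsum (\<lambda>x. g (c * x + a)) = Zsum g"
proof -
  have "per_fun (\<lambda>x. g (x + a))"
    using per_fun_cong[OF assms(1)] cong_add_rcancel by (intro per_funI) blast
  from Zsum_dilate[OF this assms(2)] show ?thesis using Zsum_translate[OF assms(1)] by simp
qed

lemma Zsum_indicator:
  fixes g :: "int \<Rightarrow> 'b::comm_ring_1"
  assumes "per_fun g"
  shows "Zsum (\<lambda>x. of_bool [u = x] (mod int p) * g x) = g u"
proof -
  have eq: "[u = x] (mod int p) \<longleftrightarrow> x = zrep p u" if "x \<in> range (zrep p)" for x
    using that rep_eq_iff[of u x] zp.rep_rep by auto
  have "Zsum (\<lambda>x. of_bool [u = x] (mod int p) * g x) = (\<Sum>x\<in>range (zrep p). if x = zrep p u then g x else 0)"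
    unfolding Zsum_def by (rule sum.cong) (auto simp: eq)
  also have "\<dots> = g (zrep p u)"
    using zp.finite_range_rep by (subst sum.delta) auto
  finally show ?thesis by (simp add: per_funD[OF assms])
qed

text \<open>The slacks 3Q - k i - k j - k (i + j) are nonnegative and are summed with the weights
  \<open>\<Omega> i j\<close>. Each weight is a sum over x of squares of 2 k(x) - k(x + i) - k(x +
  j) - k(x - i - j); the shifts i, j, - i - j add up to 0, so the three terms of the slack
  contribute equally. With c in place of the coefficient 2 the ratio between the quadratic and the
  cubic term would be (c^2 + 3) / (2c), smallest when c is the square root of 3; the value 2 gives
  the ratio 7/4 of the bound.\<close>

lemma flat_cubic_bound:
  fixes k :: "int \<Rightarrow> int"
  assumes k: "per_fun k" "Zsum k = 0" and "odd p"
    and flat: "\<And>i j. k i + k j + k (i + j) \<le> 3 * Q"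
  shows "0 \<le> 4 * Zsum (\<lambda>i. Zsum (\<lambda>j. k i * k j * k (i + j))) + 7 * int p * Q * Zsum (\<lambda>i. (k i)\<^sup>2)"
proof -
  define V where "V = Zsum (\<lambda>i. (k i)\<^sup>2)"
  define r where "r d = Zsum (\<lambda>x. k x * k (x + d))" for d
  define T where "T = Zsum (\<lambda>i. k i * r i)"
  define \<Omega> where "\<Omega> i j = 7 * V - 4 * (r i + r j + r (i + j))
      + 2 * (r (j - i) + r (2 * i + j) + r (i + 2 * j))" for i j
  have kc: "k x = k y" if "[x = y] (mod int p)" for x y using per_fun_cong[OF k(1) that] .
  have per_r: "per_fun r"
  proof (rule per_funI)
    fix x y assume "[x = y] (mod int p)"
    then have "k (z + x) = k (z + y)" for z by (intro kc) (simp add: cong_add_lcancel)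
    then show "r x = r y" by (simp add: r_def)
  qed
  have per2: "per_fun (\<lambda>x. k (x + a) * k (x + b))" for a b
  proof (rule per_funI)
    fix x y assume "[x = y] (mod int p)"
    then have "k (x + z) = k (y + z)" for z by (intro kc) (simp add: cong_add_rcancel)
    then show "k (x + a) * k (x + b) = k (y + a) * k (y + b)" by simp
  qed
  have corr: "Zsum (\<lambda>x. k (x + a) * k (x + b)) = r (b - a)" for a b
    using Zsum_translate[OF per2[of a b], of "- a"] by (simp add: r_def algebra_simps)
  have r_even: "r (- d) = r d" for d
    using corr[of d 0] corr[of 0 d] by (simp add: mult.commute)
  have r0: "r 0 = V" by (simp add: r_def V_def power2_eq_square)
  have odd2: "\<not> int p dvd 2"
  proof
    assume "int p dvd 2"
    then have "p dvd 2" by presburger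
    then have "p \<le> 2" by (rule dvd_imp_le) simp
    then have "p = 2" using p_gt_1 by simp
    then show False using assms(3) by simp
  qed
  have sum_r: "Zsum r = 0"
  proof -
    have "Zsum r = Zsum (\<lambda>x. Zsum (\<lambda>d. k x * k (x + d)))"
      unfolding r_def by (rule Zsum_swap)
    also have "\<dots> = Zsum (\<lambda>x. k x * Zsum (\<lambda>d. k (d + x)))"
      by (simp add: Zsum_cmult add.commute)
    also have "\<dots> = 0" using Zsum_translate[OF k(1)] k(2) by (simp add: Zsum_def)
    finally show ?thesis .
  qed
  have r_tr: "Zsum (\<lambda>x. r (x + a)) = 0" "Zsum (\<lambda>x. r (a + x)) = 0" for a
    using Zsum_translate[OF per_r, of a] sum_r by (simp_all add: add.commute)
  have r_neg: "Zsum (\<lambda>x. r (a - x)) = 0" for a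
  proof -
    have "r (a - x) = r (x + - a)" for x using r_even[of "x + - a"] by simp
    then show ?thesis using r_tr(1)[of "- a"] by simp
  qed
  \<comment> \<open>The factor 2 is invertible modulo the odd p, so the argument still runs through
    all residues.\<close>
  have r_dil: "Zsum (\<lambda>x. r (2 * x + a)) = 0" for a
    using Zsum_affine[OF per_r odd2, of a] sum_r by simp
  have square: "\<Omega> i j = Zsum (\<lambda>x. (2 * k x - k (x + i) - k (x + j) - k (x - i - j))\<^sup>2)" for i j
  proof -
    let ?c = "\<lambda>a b. Zsum (\<lambda>x. k (x + a) * k (x + b))"
    let ?e = "- i - j"
    have "(\<lambda>x. (2 * k x - k (x + i) - k (x + j) - k (x - i - j))\<^sup>2) = (\<lambda>x.
        4 * (k (x + 0) * k (x + 0)) + k (x + i) * k (x + i) + k (x + j) * k (x + j) + k (x + ?e) * k (x + ?e)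
        + 2 * (k (x + i) * k (x + j)) + 2 * (k (x + i) * k (x + ?e)) + 2 * (k (x + j) * k (x + ?e))
        - 4 * (k (x + 0) * k (x + i)) - 4 * (k (x + 0) * k (x + j)) - 4 * (k (x + 0) * k (x + ?e)))"
      by (rule ext) (simp add: power2_eq_square algebra_simps)
    then have "Zsum (\<lambda>x. (2 * k x - k (x + i) - k (x + j) - k (x - i - j))\<^sup>2) =
        4 * ?c 0 0 + ?c i i + ?c j j + ?c ?e ?e + 2 * ?c i j + 2 * ?c i ?e + 2 * ?c j ?e
        - 4 * ?c 0 i - 4 * ?c 0 j - 4 * ?c 0 ?e"
      by (simp only: Zsum_add Zsum_diff Zsum_cmult)
    also have "\<dots> = 7 * V - 4 * (r i + r j + r (- (i + j))) + 2 * (r (j - i) + r (- (2 * i + j)) + r (- (i + 2 * j)))"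
      unfolding corr using r0 by (simp add: algebra_simps)
    finally show ?thesis unfolding r_even by (simp add: \<Omega>_def)
  qed
  have \<Omega>_pos: "\<Omega> i j \<ge> 0" for i j
    unfolding square Zsum_def by (intro sum_nonneg) simp
  have \<Omega>_sym: "\<Omega> i j = \<Omega> j i" for i j
    using r_even[of "j - i"] by (simp add: \<Omega>_def algebra_simps)
  have row: "Zsum (\<lambda>j. \<Omega> i j) = int p * (7 * V - 4 * r i)" for i
  proof -
    have "(\<lambda>j. \<Omega> i j) = (\<lambda>j. (7 * V - 4 * r i) - 4 * r j - 4 * r (i + j)
        + 2 * r (j + - i) + 2 * r (2 * i + j) + 2 * r (2 * j + i))"
      by (rule ext) (simp add: \<Omega>_def algebra_simps)
    then show ?thesis
      by (simp only: Zsum_add Zsum_diff Zsum_cmult Zsum_const r_tr r_dil sum_r) (simp add: algebra_simps)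
  qed
  have diag: "Zsum (\<lambda>i. \<Omega> i (u - i)) = int p * (7 * V - 4 * r u)" for u
  proof -
    have "(\<lambda>i. \<Omega> i (u - i)) = (\<lambda>i. (7 * V - 4 * r u) - 4 * r i - 4 * r (u - i)
        + 2 * r (- (2 * i + - u)) + 2 * r (i + u) + 2 * r (2 * u - i))"
      by (rule ext) (simp add: \<Omega>_def algebra_simps)
    then show ?thesis
      by (simp only: Zsum_add Zsum_diff Zsum_cmult Zsum_const r_tr r_dil sum_r r_neg r_even) (simp add: algebra_simps)
  qed
  have weighted: "Zsum (\<lambda>i. k i * (int p * (7 * V - 4 * r i))) = - 4 * int p * T"
  proof -
    have "(\<lambda>i. k i * (int p * (7 * V - 4 * r i))) = (\<lambda>i. (7 * int p * V) * k i - (4 * int p) * (k i * r i))"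
      by (rule ext) (simp add: algebra_simps)
    then show ?thesis by (simp only: Zsum_diff Zsum_cmult k(2) T_def mult_zero_right)
  qed
  have D0: "Zsum (\<lambda>i. Zsum (\<lambda>j. \<Omega> i j)) = 7 * (int p)\<^sup>2 * V"
  proof -
    have "Zsum (\<lambda>i. Zsum (\<lambda>j. \<Omega> i j)) = int p * (Zsum (\<lambda>i. 7 * V) - 4 * Zsum r)"
      by (simp only: row Zsum_cmult Zsum_diff)
    then show ?thesis by (simp add: sum_r Zsum_const power2_eq_square)
  qed
  have D1: "Zsum (\<lambda>i. Zsum (\<lambda>j. k i * \<Omega> i j)) = - 4 * int p * T"
    by (simp only: Zsum_cmult row weighted)
  have D2: "Zsum (\<lambda>i. Zsum (\<lambda>j. k j * \<Omega> i j)) = - 4 * int p * T"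
    by (subst Zsum_swap) (use D1 \<Omega>_sym in simp)
  \<comment> \<open>The substitution u = i + j turns the third sum into one over the antidiagonals,
    which \<open>diag\<close> evaluates.\<close>
  have D3: "Zsum (\<lambda>i. Zsum (\<lambda>j. k (i + j) * \<Omega> i j)) = - 4 * int p * T"
  proof -
    have per_u: "per_fun (\<lambda>u. k u * \<Omega> i (u - i))" for i
    proof (rule per_funI)
      fix x y assume xy: "[x = y] (mod int p)"
      then have "k x = k y" by (rule kc)
      moreover have r_lin: "r (a + b * x) = r (a + b * y)" for a b
        using xy by (intro per_fun_cong[OF per_r]) (simp add: cong_add_lcancel cong_scalar_left)
      have "\<Omega> i (x - i) = \<Omega> i (y - i)"
        using r_lin[of "- i" 1] r_lin[of 0 1] r_lin[of "- 2 * i" 1] r_lin[of i 1] r_lin[of "- i" 2]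
        by (simp add: \<Omega>_def algebra_simps)
      ultimately show "k x * \<Omega> i (x - i) = k y * \<Omega> i (y - i)" by simp
    qed
    have "Zsum (\<lambda>j. k (i + j) * \<Omega> i j) = Zsum (\<lambda>u. k u * \<Omega> i (u - i))" for i
      using Zsum_translate[OF per_u[of i], of i] by (simp add: add.commute)
    then have "Zsum (\<lambda>i. Zsum (\<lambda>j. k (i + j) * \<Omega> i j)) = Zsum (\<lambda>i. Zsum (\<lambda>u. k u * \<Omega> i (u - i)))"
      by simp
    also have "\<dots> = Zsum (\<lambda>u. Zsum (\<lambda>i. k u * \<Omega> i (u - i)))" by (rule Zsum_swap)
    finally have "Zsum (\<lambda>i. Zsum (\<lambda>j. k (i + j) * \<Omega> i j)) = \<dots>" .
    then show ?thesis by (simp only: Zsum_cmult diag weighted)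
  qed
  have "0 \<le> Zsum (\<lambda>i. Zsum (\<lambda>j. (3 * Q - k i - k j - k (i + j)) * \<Omega> i j))"
    unfolding Zsum_def using flat \<Omega>_pos by (intro sum_nonneg mult_nonneg_nonneg) (auto simp: algebra_simps)
  also have "\<dots> = 3 * Q * (7 * (int p)\<^sup>2 * V) + 12 * int p * T"
  proof -
    have eq: "(3 * Q - k i - k j - k (i + j)) * \<Omega> i j =
        (3 * Q) * \<Omega> i j - k i * \<Omega> i j - k j * \<Omega> i j - k (i + j) * \<Omega> i j" for i j
      by (simp add: algebra_simps)
    have "Zsum (\<lambda>i. Zsum (\<lambda>j. (3 * Q - k i - k j - k (i + j)) * \<Omega> i j)) =
      Zsum (\<lambda>i. Zsum (\<lambda>j. (3 * Q) * \<Omega> i j)) - Zsum (\<lambda>i. Zsum (\<lambda>j. k i * \<Omega> i j))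
      - Zsum (\<lambda>i. Zsum (\<lambda>j. k j * \<Omega> i j)) - Zsum (\<lambda>i. Zsum (\<lambda>j. k (i + j) * \<Omega> i j))"
      by (simp only: Zsum_diff eq)
    also have "Zsum (\<lambda>i. Zsum (\<lambda>j. (3 * Q) * \<Omega> i j)) = (3 * Q) * (7 * (int p)\<^sup>2 * V)"
      by (simp only: Zsum_cmult D0)
    finally show ?thesis unfolding D1 D2 D3 by simp
  qed
  finally have "0 \<le> 3 * int p * (4 * T + 7 * int p * Q * V)"
    by (simp add: algebra_simps power2_eq_square)
  then have "0 \<le> 4 * T + 7 * int p * Q * V"
    using p_pos by (simp add: zero_le_mult_iff)
  moreover have "Zsum (\<lambda>i. Zsum (\<lambda>j. k i * k j * k (i + j))) = T"
  proof -
    have "Zsum (\<lambda>j. k i * k j * k (i + j)) = k i * r i" for i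
      unfolding r_def by (subst Zsum_cmult[symmetric]) (simp add: ac_simps)
    then show ?thesis by (simp add: T_def)
  qed
  ultimately show ?thesis by (simp add: V_def)
qed

end

subsection \<open>Slices along linear functionals\<close>

text \<open>Vectors are total functions on the natural numbers. Entries outside I are erased, so
  spaces with different index sets share one type, and a vector of a larger space is also read as
  one of a smaller space.\<close>

definition vrep :: "nat \<Rightarrow> nat set \<Rightarrow> (nat \<Rightarrow> int) \<Rightarrow> nat \<Rightarrow> int" where
  "vrep p I x = (\<lambda>i. if i \<in> I then x i mod int p else 0)"

definition dot :: "nat set \<Rightarrow> (nat \<Rightarrow> int) \<Rightarrow> (nat \<Rightarrow> int) \<Rightarrow> int" where
  "dot I y x = (\<Sum>i\<in>I. y i * x i)"

lemma dot_add_right: "dot I y (x + x') = dot I y x + dot I y x'"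
  by (simp add: dot_def algebra_simps sum.distrib)

lemma dot_add_left: "dot I (y + y') x = dot I y x + dot I y' x"
  by (simp add: dot_def algebra_simps sum.distrib)

lemma dot_diff_right: "dot I y (x - x') = dot I y x - dot I y x'"
  by (simp add: dot_def algebra_simps sum_subtractf)

lemma plus_sum_apply: "(\<Sum>i<(k::nat). (x :: nat \<Rightarrow> int)) j = int k * x j"
  by (induction k) (simp_all add: algebra_simps)

lemma sum_swap_2:
  "(\<Sum>y\<in>Y. \<Sum>a\<in>F. \<Sum>b\<in>G. g y a b) = (\<Sum>a\<in>F. \<Sum>b\<in>G. \<Sum>y\<in>Y. g y a b)"
  by (rule trans[OF sum.swap]) (rule sum.cong[OF refl], rule sum.swap)

lemma sum_swap_3:
  "(\<Sum>y\<in>Y. \<Sum>a\<in>F. \<Sum>b\<in>G. \<Sum>c\<in>H. g y a b c) = (\<Sum>a\<in>F. \<Sum>b\<in>G. \<Sum>c\<in>H. \<Sum>y\<in>Y. g y a b c)"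
  by (rule trans[OF sum.swap]) (rule sum.cong[OF refl], rule sum_swap_2)

locale coordinate_space = prime_modulus +
  fixes I :: "nat set"
  assumes finite_I: "finite I"
begin

lemma vrep_eq_iff: "vrep p I x = vrep p I y \<longleftrightarrow> (\<forall>i\<in>I. [x i = y i] (mod int p))"
  by (auto simp: vrep_def fun_eq_iff cong_def)

lemma range_vrep: "range (vrep p I) = {x. \<forall>i. if i \<in> I then 0 \<le> x i \<and> x i < int p else x i = 0}"
proof (intro equalityI subsetI)
  fix x assume "x \<in> {x. \<forall>i. if i \<in> I then 0 \<le> x i \<and> x i < int p else x i = 0}"
  then have "x i = vrep p I x i" for i
    by (cases "i \<in> I") (auto simp: vrep_def dest: spec[of _ i])
  then have "x = vrep p I x" by blast
  then show "x \<in> range (vrep p I)" by blast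
qed (use p_pos in \<open>auto simp: vrep_def\<close>)

lemma bij_vrep: "bij_betw (\<lambda>x. restrict x I) (range (vrep p I)) (PiE I (\<lambda>_. {0..<int p}))"
proof (rule bij_betw_byWitness[where f' = "\<lambda>x i. if i \<in> I then x i else 0"])
  show "\<forall>a\<in>range (vrep p I). (\<lambda>i. if i \<in> I then restrict a I i else 0) = a"
    by (auto simp: range_vrep fun_eq_iff)
  show "\<forall>a'\<in>PiE I (\<lambda>_. {0..<int p}). restrict (\<lambda>i. if i \<in> I then a' i else 0) I = a'"
    by (auto simp: fun_eq_iff PiE_def extensional_def)
  show "(\<lambda>x. restrict x I) ` range (vrep p I) \<subseteq> (PiE I (\<lambda>_. {0..<int p}))"
  proof
    fix f assume "f \<in> (\<lambda>x. restrict x I) ` range (vrep p I)"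
    then obtain x where x: "f = restrict x I" "\<forall>i. if i \<in> I then 0 \<le> x i \<and> x i < int p else x i = 0"
      unfolding range_vrep by blast
    have "x i \<in> {0..<int p}" if "i \<in> I" for i
      using x(2)[rule_format, of i] that by simp
    then show "f \<in> PiE I (\<lambda>_. {0..<int p})" unfolding x(1) by auto
  qed
  show "(\<lambda>x i. if i \<in> I then x i else 0) ` (PiE I (\<lambda>_. {0..<int p})) \<subseteq> range (vrep p I)"
    unfolding range_vrep by (auto simp: PiE_def Pi_def)
qed

lemma card_range_vrep: "card (range (vrep p I)) = p ^ card I"
  using bij_betw_same_card[OF bij_vrep] finite_I by (simp add: card_PiE)

lemma finite_range_vrep: "finite (range (vrep p I))"
  using bij_betw_finite[OF bij_vrep] finite_I by (simp add: finite_PiE)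

sublocale vs: elementary_quotient "vrep p I" p
proof
  show "finite (range (vrep p I))" by (rule finite_range_vrep)
  show "vrep p I (vrep p I x + y) = vrep p I (x + y)" for x y
    by (auto simp: vrep_def fun_eq_iff mod_add_left_eq)
  show "vrep p I (\<Sum>i<p. x) = vrep p I 0" for x
    by (auto simp: vrep_def fun_eq_iff plus_sum_apply)
qed (rule prime_p)

abbreviation "vper \<equiv> vs.periodic"
abbreviation "vsz \<equiv> vs.size_of"

lemma vper_cong: "vper X \<Longrightarrow> (\<And>i. i \<in> I \<Longrightarrow> [x i = y i] (mod int p)) \<Longrightarrow> x \<in> X \<longleftrightarrow> y \<in> X"
  using vs.periodic_cong vrep_eq_iff by blast

lemma vperI: "(\<And>x y. \<forall>i\<in>I. [x i = y i] (mod int p) \<Longrightarrow> x \<in> X \<Longrightarrow> y \<in> X) \<Longrightarrow> vper X"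
  unfolding vs.periodic_def by (metis vrep_eq_iff vs.rep_rep)

lemma dot_cong:
  assumes "\<And>i. i \<in> I \<Longrightarrow> [y i = y' i] (mod int p)" "\<And>i. i \<in> I \<Longrightarrow> [x i = x' i] (mod int p)"
  shows "[dot I y x = dot I y' x'] (mod int p)"
  unfolding dot_def by (intro cong_sum cong_mult assms)

text \<open>Translation by multiples of a vector whose product with z is 1 carries any level set of
  the product to any other, so the p level sets have equal size.\<close>

lemma size_hyperplane:
  assumes z: "j \<in> I" "\<not> int p dvd z j"
  shows "vsz {y. [dot I y z = r] (mod int p)} * p = p ^ card I"
proof -
  define D where "D r = {y. [dot I y z = r] (mod int p)}" for r
  have perD: "vper (D r)" for r
  proof (rule vperI)
    fix x y assume "\<forall>i\<in>I. [x i = y i] (mod int p)" "x \<in> D r"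
    then have "[dot I x z = dot I y z] (mod int p)" "[dot I x z = r] (mod int p)"
      by (auto simp: D_def intro!: dot_cong)
    then show "y \<in> D r" unfolding D_def cong_def by simp
  qed
  obtain d where d: "[z j * d = 1] (mod int p)" using obtain_inverse[OF z(2)] by blast
  define e where "e = (\<lambda>i. if i = j then d else 0)"
  have de: "[dot I e z = 1] (mod int p)"
  proof -
    have "dot I e z = (\<Sum>i\<in>I. if i = j then d * z j else 0)"
      unfolding dot_def e_def by (rule sum.cong) auto
    then have "dot I e z = d * z j" using z finite_I by simp
    then show ?thesis using d by (simp add: mult.commute)
  qed
  have eq: "vsz (D r) = vsz (D s)" for r s
  proof -
    define c where "c = (\<lambda>i. (s - r) * e i)"
    have "dot I c z = (s - r) * dot I e z"
      by (simp add: dot_def c_def sum_distrib_left mult.assoc)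
    then have c: "[dot I c z = s - r] (mod int p)"
      using cong_scalar_left[OF de, of "s - r"] by simp
    have "{x. x + c \<in> D s} = D r"
    proof (intro Set.set_eqI)
      fix x
      have "[dot I (x + c) z = dot I x z + (s - r)] (mod int p)"
        using c by (simp add: dot_add_left cong_add_lcancel)
      then have "[dot I (x + c) z = s] (mod int p) \<longleftrightarrow> [dot I x z + (s - r) = r + (s - r)] (mod int p)"
        unfolding cong_def by simp
      then show "x \<in> {x. x + c \<in> D s} \<longleftrightarrow> x \<in> D r"
        using cong_add_rcancel[of "dot I x z" "s - r" r "int p"] by (simp add: D_def)
    qed
    then show ?thesis using vs.size_of_translate[OF perD[of s], of c] by simp
  qed
  have "p ^ card I = (\<Sum>x\<in>range (vrep p I). 1)" by (simp add: card_range_vrep)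
  also have "\<dots> = (\<Sum>x\<in>range (vrep p I). nat (Zsum (\<lambda>t. of_bool [dot I x z = t] (mod int p) * 1)))"
    by (subst Zsum_indicator) (auto simp: per_fun_def)
  also have "int \<dots> = (\<Sum>x\<in>range (vrep p I). \<Sum>t\<in>range (zrep p). of_bool [dot I x z = t] (mod int p))"
    unfolding of_nat_sum by (rule sum.cong[OF refl]) (simp add: Zsum_def sum_nonneg)
  also have "\<dots> = (\<Sum>t\<in>range (zrep p). \<Sum>x\<in>range (vrep p I). of_bool [dot I x z = t] (mod int p))"
    by (rule sum.swap)
  also have "\<dots> = (\<Sum>t\<in>range (zrep p). int (vsz (D t)))"
  proof (rule sum.cong[OF refl])
    fix t
    have "(\<Sum>x\<in>range (vrep p I). of_bool [dot I x z = t] (mod int p)) = (\<Sum>x\<in>D t \<inter> range (vrep p I). (1::int))"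
      using finite_range_vrep by (intro sum.mono_neutral_cong_right) (auto simp: D_def)
    then show "(\<Sum>x\<in>range (vrep p I). of_bool [dot I x z = t] (mod int p)) = int (vsz (D t))"
      by (simp add: vs.size_of_def)
  qed
  also have "\<dots> = (\<Sum>t\<in>range (zrep p). int (vsz (D r)))"
    by (intro sum.cong refl arg_cong[where f = int] eq)
  also have "\<dots> = int (vsz (D r) * p)" by (simp add: index_eq)
  finally show ?thesis unfolding D_def by (simp only: of_nat_eq_iff)
qed

definition slice_size :: "(nat \<Rightarrow> int) set \<Rightarrow> (nat \<Rightarrow> int) \<Rightarrow> int \<Rightarrow> int" where
  "slice_size A y i = int (vsz {x \<in> A. [dot I y x = i] (mod int p)})"

lemma slice_size_eq_sum:
  "slice_size A y i = (\<Sum>a\<in>A \<inter> range (vrep p I). of_bool [dot I y a = i] (mod int p))"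
proof -
  have "(\<Sum>a\<in>A \<inter> range (vrep p I). of_bool [dot I y a = i] (mod int p)) =
      (\<Sum>a\<in>{x \<in> A. [dot I y x = i] (mod int p)} \<inter> range (vrep p I). (1::int))"
    using finite_range_vrep by (intro sum.mono_neutral_cong_right) auto
  then show ?thesis by (simp add: slice_size_def vs.size_of_def)
qed

lemma per_fun_slice_size: "per_fun (slice_size A y)"
proof (rule per_funI)
  fix i j assume "[i = j] (mod int p)"
  then have "[dot I y x = i] (mod int p) \<longleftrightarrow> [dot I y x = j] (mod int p)" for x
    by (simp add: cong_def)
  then show "slice_size A y i = slice_size A y j" by (simp add: slice_size_def)
qed

lemma slice_size_nonneg: "slice_size A y i \<ge> 0"
  by (simp add: slice_size_def)

lemma Zsum_slice_size_mult:
  assumes "per_fun (X :: int \<Rightarrow> int)"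
  shows "Zsum (\<lambda>i. slice_size A y i * X i) = (\<Sum>a\<in>A \<inter> range (vrep p I). X (dot I y a))"
proof -
  have "Zsum (\<lambda>i. slice_size A y i * X i) =
      (\<Sum>i\<in>range (zrep p). \<Sum>a\<in>A \<inter> range (vrep p I). of_bool [dot I y a = i] (mod int p) * X i)"
    unfolding Zsum_def slice_size_eq_sum by (simp add: sum_distrib_right)
  also have "\<dots> = (\<Sum>a\<in>A \<inter> range (vrep p I). Zsum (\<lambda>i. of_bool [dot I y a = i] (mod int p) * X i))"
    unfolding Zsum_def by (rule sum.swap)
  finally show ?thesis by (simp only: Zsum_indicator[OF assms])
qed

lemma Zsum_slice_size: "Zsum (slice_size A y) = int (vsz A)"
  using Zsum_slice_size_mult[of "\<lambda>_. 1" A y] by (simp add: per_fun_def vs.size_of_def)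

lemma Zsum_slice_size_square:
  "Zsum (\<lambda>i. (slice_size A y i)\<^sup>2) =
     (\<Sum>a\<in>A \<inter> range (vrep p I). \<Sum>b\<in>A \<inter> range (vrep p I). of_bool [dot I y b = dot I y a] (mod int p))"
  unfolding power2_eq_square Zsum_slice_size_mult[OF per_fun_slice_size] by (simp only: slice_size_eq_sum)

lemma per_fun_translate: "per_fun g \<Longrightarrow> per_fun (\<lambda>x. g (x + c))"
  by (intro per_funI) (simp add: per_fun_cong cong_add_rcancel)

lemma Zsum_slice_size_triple:
  "Zsum (\<lambda>i. Zsum (\<lambda>j. slice_size A y i * slice_size A y j * slice_size A y (i + j))) =
     (\<Sum>a\<in>A \<inter> range (vrep p I). \<Sum>b\<in>A \<inter> range (vrep p I). \<Sum>c\<in>A \<inter> range (vrep p I).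
        of_bool [dot I y c = dot I y a + dot I y b] (mod int p))"
proof -
  let ?F = "A \<inter> range (vrep p I)" and ?s = "slice_size A y"
  have "Zsum (\<lambda>j. ?s i * ?s j * ?s (i + j)) = ?s i * (\<Sum>b\<in>?F. ?s (i + dot I y b))" for i
  proof -
    have "Zsum (\<lambda>j. ?s i * ?s j * ?s (i + j)) = ?s i * Zsum (\<lambda>j. ?s j * ?s (j + i))"
      by (subst Zsum_cmult[symmetric]) (simp add: ac_simps)
    then show ?thesis
      by (simp only: Zsum_slice_size_mult[OF per_fun_translate[OF per_fun_slice_size]] add.commute)
  qed
  then have "Zsum (\<lambda>i. Zsum (\<lambda>j. ?s i * ?s j * ?s (i + j))) = Zsum (\<lambda>i. ?s i * (\<Sum>b\<in>?F. ?s (i + dot I y b)))"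
    by simp
  also have "\<dots> = (\<Sum>a\<in>?F. \<Sum>b\<in>?F. ?s (dot I y a + dot I y b))"
  proof (rule Zsum_slice_size_mult)
    show "per_fun (\<lambda>i. \<Sum>b\<in>?F. ?s (i + dot I y b))"
      unfolding per_fun_def using per_fun_translate[OF per_fun_slice_size] unfolding per_fun_def by simp
  qed
  finally show ?thesis unfolding slice_size_eq_sum .
qed

lemma sum_of_bool_size: "(\<Sum>y\<in>range (vrep p I). of_bool (P y)) = int (vsz {y. P y})"
proof -
  have "(\<Sum>y\<in>range (vrep p I). of_bool (P y)) = (\<Sum>y\<in>{y. P y} \<inter> range (vrep p I). (1::int))"
    using finite_range_vrep by (intro sum.mono_neutral_cong_right) auto
  then show ?thesis by (simp add: vs.size_of_def)
qed

text \<open>Orthogonality in counting form: two distinct points have the same value under one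
  functional in p. The factor p on the left avoids a division.\<close>

lemma sum_over_functionals:
  "(\<Sum>y\<in>range (vrep p I). of_bool [dot I y a = dot I y b] (mod int p)) * int p =
     (if vrep p I a = vrep p I b then int p * int p ^ card I else int p ^ card I)"
proof (cases "vrep p I a = vrep p I b")
  case True
  then have "[dot I y a = dot I y b] (mod int p)" for y
    by (intro dot_cong) (auto simp: vrep_eq_iff)
  then show ?thesis using True by (simp add: card_range_vrep)
next
  case False
  then obtain j where j: "j \<in> I" "\<not> [a j = b j] (mod int p)" by (auto simp: vrep_eq_iff)
  then have "\<not> int p dvd (a - b) j" by (simp add: cong_iff_dvd_diff)
  from size_hyperplane[of j "a - b", OF j(1) this, of 0]
  have "int (vsz {y. [dot I y (a - b) = 0] (mod int p)}) * int p = int p ^ card I"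
    by (metis of_nat_mult of_nat_power)
  moreover have "[dot I y a = dot I y b] (mod int p) \<longleftrightarrow> [dot I y (a - b) = 0] (mod int p)" for y
    by (simp add: dot_diff_right cong_iff_dvd_diff)
  ultimately show ?thesis using False by (simp add: sum_of_bool_size)
qed

text \<open>The N diagonal pairs agree under every functional, the other N^2 - N pairs under one
  functional in p.\<close>

lemma sum_squares_over_functionals:
  fixes A
  defines "N \<equiv> int (vsz A)"
  shows "(\<Sum>y\<in>range (vrep p I). Zsum (\<lambda>i. (slice_size A y i)\<^sup>2)) * int p =
     int p ^ card I * (N * int p + (N\<^sup>2 - N))"
proof -
  let ?F = "A \<inter> range (vrep p I)"
  have N: "N = int (card ?F)" by (simp add: N_def vs.size_of_def)
  have finF: "finite ?F" using finite_range_vrep by blast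
  have "(\<Sum>y\<in>range (vrep p I). Zsum (\<lambda>i. (slice_size A y i)\<^sup>2)) =
      (\<Sum>a\<in>?F. \<Sum>b\<in>?F. \<Sum>y\<in>range (vrep p I). of_bool [dot I y b = dot I y a] (mod int p))"
    unfolding Zsum_slice_size_square by (rule sum_swap_2)
  then have "(\<Sum>y\<in>range (vrep p I). Zsum (\<lambda>i. (slice_size A y i)\<^sup>2)) * int p =
      (\<Sum>a\<in>?F. \<Sum>b\<in>?F. (\<Sum>y\<in>range (vrep p I). of_bool [dot I y b = dot I y a] (mod int p)) * int p)"
    by (simp only: sum_distrib_right)
  also have "\<dots> = (\<Sum>a\<in>?F. \<Sum>b\<in>?F. int p ^ card I + (if b = a then (int p - 1) * int p ^ card I else 0))"
  proof (intro sum.cong refl)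
    fix a b assume ab: "a \<in> ?F" "b \<in> ?F"
    then have "vrep p I b = vrep p I a \<longleftrightarrow> b = a" by auto
    then show "(\<Sum>y\<in>range (vrep p I). of_bool [dot I y b = dot I y a] (mod int p)) * int p =
        int p ^ card I + (if b = a then (int p - 1) * int p ^ card I else 0)"
      unfolding sum_over_functionals by (simp add: algebra_simps)
  qed
  also have "\<dots> = (\<Sum>a\<in>?F. N * int p ^ card I + (int p - 1) * int p ^ card I)"
    using finF by (intro sum.cong refl) (simp add: sum.distrib N)
  also have "\<dots> = int p ^ card I * (N * int p + (N\<^sup>2 - N))"
    by (simp add: N algebra_simps power2_eq_square)
  finally show ?thesis .
qed

text \<open>A solution of c = a + b in A would be counted by every functional. As there is none,
  each of the N^3 triples is counted by only one functional in p, which keeps the cubic sum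
  low.\<close>

lemma sum_triples_over_functionals:
  fixes A
  defines "N \<equiv> int (vsz A)"
  assumes A: "vper A" and sf: "\<And>a b. a \<in> A \<Longrightarrow> b \<in> A \<Longrightarrow> a + b \<notin> A"
  shows "(\<Sum>y\<in>range (vrep p I). Zsum (\<lambda>i. Zsum (\<lambda>j. slice_size A y i * slice_size A y j * slice_size A y (i + j)))) * int p =
     int p ^ card I * N ^ 3"
proof -
  let ?F = "A \<inter> range (vrep p I)"
  have N: "N = int (card ?F)" by (simp add: N_def vs.size_of_def)
  have "(\<Sum>y\<in>range (vrep p I). Zsum (\<lambda>i. Zsum (\<lambda>j. slice_size A y i * slice_size A y j * slice_size A y (i + j)))) =
      (\<Sum>a\<in>?F. \<Sum>b\<in>?F. \<Sum>c\<in>?F. \<Sum>y\<in>range (vrep p I). of_bool [dot I y c = dot I y (a + b)] (mod int p))"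
    unfolding Zsum_slice_size_triple dot_add_right
    by (rule sum_swap_3)
  then have "(\<Sum>y\<in>range (vrep p I). Zsum (\<lambda>i. Zsum (\<lambda>j. slice_size A y i * slice_size A y j * slice_size A y (i + j)))) * int p =
      (\<Sum>a\<in>?F. \<Sum>b\<in>?F. \<Sum>c\<in>?F. (\<Sum>y\<in>range (vrep p I). of_bool [dot I y c = dot I y (a + b)] (mod int p)) * int p)"
    by (simp only: sum_distrib_right)
  also have "\<dots> = (\<Sum>a\<in>?F. \<Sum>b\<in>?F. \<Sum>c\<in>?F. int p ^ card I)"
  proof (intro sum.cong refl)
    fix a b c assume abc: "a \<in> ?F" "b \<in> ?F" "c \<in> ?F"
    have "vrep p I c \<noteq> vrep p I (a + b)"
    proof
      assume "vrep p I c = vrep p I (a + b)"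
      then have "a + b \<in> A" using abc vs.periodic_cong[OF A] by blast
      then show False using sf abc by blast
    qed
    then show "(\<Sum>y\<in>range (vrep p I). of_bool [dot I y c = dot I y (a + b)] (mod int p)) * int p = int p ^ card I"
      unfolding sum_over_functionals by simp
  qed
  also have "\<dots> = int p ^ card I * N ^ 3" by (simp add: N power3_eq_cube)
  finally show ?thesis .
qed

end

context coordinate_space
begin

lemma Zsum_mult_right: "Zsum (\<lambda>x. f x * c :: 'b::comm_ring_1) = Zsum f * c"
  by (simp add: Zsum_def sum_distrib_right)

lemma Zsum_centered_square:
  fixes c :: "int \<Rightarrow> int"
  shows "Zsum (\<lambda>i. (int p * c i - Zsum c)\<^sup>2) = (int p)\<^sup>2 * Zsum (\<lambda>i. (c i)\<^sup>2) - int p * (Zsum c)\<^sup>2"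
proof -
  let ?N = "Zsum c"
  have "(int p * c i - ?N)\<^sup>2 = (int p)\<^sup>2 * (c i)\<^sup>2 - (2 * int p * ?N) * c i + ?N\<^sup>2" for i
    by (simp add: power2_eq_square algebra_simps)
  then have "Zsum (\<lambda>i. (int p * c i - ?N)\<^sup>2) =
      (int p)\<^sup>2 * Zsum (\<lambda>i. (c i)\<^sup>2) - (2 * int p * ?N) * ?N + int p * ?N\<^sup>2"
    by (simp only: Zsum_add Zsum_diff Zsum_cmult Zsum_const of_nat_id)
  then show ?thesis by (simp add: power2_eq_square)
qed

text \<open>In the expansion every product of at most two values of c sums to a power of N times a
  power of p, since the remaining index runs freely. The full triple product is the only correlation
  left.\<close>

lemma Zsum_centered_triple:
  fixes c :: "int \<Rightarrow> int"
  assumes c: "per_fun c"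
  defines "N \<equiv> Zsum c" and "k \<equiv> \<lambda>i. int p * c i - Zsum c"
  shows "Zsum (\<lambda>i. Zsum (\<lambda>j. k i * k j * k (i + j))) =
    int p ^ 3 * Zsum (\<lambda>i. Zsum (\<lambda>j. c i * c j * c (i + j))) - (int p)\<^sup>2 * N ^ 3"
proof -
  have tr: "Zsum (\<lambda>j. c (i + j)) = N" for i
    using Zsum_translate[OF c, of i] by (simp add: add.commute N_def)
  have swap: "Zsum (\<lambda>i. Zsum (\<lambda>j. c j * c (i + j))) = N\<^sup>2"
  proof -
    have "Zsum (\<lambda>i. Zsum (\<lambda>j. c j * c (i + j))) = Zsum (\<lambda>j. Zsum (\<lambda>i. c j * c (i + j)))"
      by (rule Zsum_swap)
    also have "\<dots> = Zsum (\<lambda>j. N * c j)"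
    proof -
      have "Zsum (\<lambda>i. c j * c (i + j)) = N * c j" for j
        by (simp only: Zsum_cmult Zsum_translate[OF c]) (simp add: N_def)
      then show ?thesis by simp
    qed
    also have "\<dots> = N * N" unfolding Zsum_cmult by (simp add: N_def)
    finally show ?thesis by (simp add: power2_eq_square)
  qed
  have expand: "k i * k j * k (i + j) = int p ^ 3 * (c i * c j * c (i + j))
      - ((int p)\<^sup>2 * N) * (c i * c j) - ((int p)\<^sup>2 * N) * (c i * c (i + j)) - ((int p)\<^sup>2 * N) * (c j * c (i + j))
      + (int p * N\<^sup>2) * c i + (int p * N\<^sup>2) * c j + (int p * N\<^sup>2) * c (i + j) - N ^ 3" for i j
    unfolding k_def N_def[symmetric]
    by (simp add: algebra_simps power2_eq_square power3_eq_cube)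
  have c1: "Zsum (\<lambda>i. Zsum (\<lambda>j. c i * c j)) = N\<^sup>2"
    by (simp only: Zsum_cmult Zsum_mult_right N_def[symmetric] power2_eq_square)
  have c2: "Zsum (\<lambda>i. Zsum (\<lambda>j. c i * c (i + j))) = N\<^sup>2"
    by (simp only: Zsum_cmult tr Zsum_mult_right N_def[symmetric] power2_eq_square)
  have c3: "Zsum (\<lambda>i. Zsum (\<lambda>j. c i)) = int p * N" "Zsum (\<lambda>i. Zsum (\<lambda>j. c j)) = int p * N"
    "Zsum (\<lambda>i. Zsum (\<lambda>j. c (i + j))) = int p * N"
    by (simp_all only: Zsum_const tr) (simp_all add: Zsum_cmult Zsum_const N_def)
  have c4: "Zsum (\<lambda>i. Zsum (\<lambda>j. N ^ 3)) = (int p)\<^sup>2 * N ^ 3"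
    by (simp add: Zsum_const power2_eq_square)
  have "Zsum (\<lambda>i. Zsum (\<lambda>j. k i * k j * k (i + j))) =
      int p ^ 3 * Zsum (\<lambda>i. Zsum (\<lambda>j. c i * c j * c (i + j)))
      - ((int p)\<^sup>2 * N) * N\<^sup>2 - ((int p)\<^sup>2 * N) * N\<^sup>2 - ((int p)\<^sup>2 * N) * N\<^sup>2
      + (int p * N\<^sup>2) * (int p * N) + (int p * N\<^sup>2) * (int p * N) + (int p * N\<^sup>2) * (int p * N) - (int p)\<^sup>2 * N ^ 3"
    unfolding expand by (simp only: Zsum_add Zsum_diff Zsum_cmult[of "int p ^ 3"]
        Zsum_cmult[of "(int p)\<^sup>2 * N"] Zsum_cmult[of "int p * N\<^sup>2"] swap c1 c2 c3 c4)
  then show ?thesis by (simp add: power2_eq_square power3_eq_cube)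
qed

lemma slice_size_0: "slice_size A 0 i = (if [0 = i] (mod int p) then int (vsz A) else 0)"
  by (simp add: slice_size_def dot_def)

text \<open>If all nonzero functionals were flat, \<open>flat_cubic_bound\<close> for the centred
  slice sizes could be added up over them. The quadratic and cubic sums over all functionals are
  known exactly, and the resulting quadratic inequality for N fails for N \<ge> (2m - 1) q.\<close>

lemma exists_nonflat_functional:
  fixes m q :: int and A :: "(nat \<Rightarrow> int) set"
  defines "N \<equiv> int (vsz A)"
  assumes p: "int p = 6 * m - 1" "m \<ge> 3" and q: "q > 0" "int p ^ card I = int p * q"
    and A: "vper A" and sf: "\<And>a b. a \<in> A \<Longrightarrow> b \<in> A \<Longrightarrow> a + b \<notin> A"
    and large: "(2 * m - 1) * q \<le> N"
  shows "\<exists>y. (\<exists>j\<in>I. \<not> int p dvd y j) \<and>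
    (\<exists>i j. int p * (slice_size A y i + slice_size A y j + slice_size A y (i + j)) > 6 * m * q)"
proof (rule ccontr)
  assume none: "\<not> ?thesis"
  have odd: "odd p"
  proof
    assume "even p"
    then have "even (int p)" by simp
    then show False using p by simp
  qed
  let ?R = "range (vrep p I)"
  define S where "S y = Zsum (\<lambda>i. (slice_size A y i)\<^sup>2)" for y
  define T where "T y = Zsum (\<lambda>i. Zsum (\<lambda>j. slice_size A y i * slice_size A y j * slice_size A y (i + j)))" for y
  have "0 \<in> ?R" by (simp add: range_vrep p_pos)
  have bound: "0 \<le> 4 * (int p ^ 3 * T y - (int p)\<^sup>2 * N ^ 3) + 7 * int p * q * ((int p)\<^sup>2 * S y - int p * N\<^sup>2)"
    if y: "y \<in> ?R - {0}" for y
  proof -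
    obtain j where "y j \<noteq> 0" using y by (metis DiffD2 ext singletonI zero_fun_apply)
    then have j: "j \<in> I" "0 \<le> y j" "y j < int p"
      using y unfolding range_vrep by (auto dest!: spec[of _ j] split: if_splits)
    then have "\<not> int p dvd y j" using \<open>y j \<noteq> 0\<close> zdvd_not_zless[of "y j" "int p"] by auto
    then have le: "int p * (slice_size A y a + slice_size A y b + slice_size A y (a + b)) \<le> 6 * m * q" for a b
      using none j by (meson not_less)
    define c where "c = slice_size A y"
    define k where "k = (\<lambda>i. int p * c i - Zsum c)"
    have pc: "per_fun c" and sc: "Zsum c = N"
      unfolding c_def N_def by (rule per_fun_slice_size, rule Zsum_slice_size)
    have "per_fun k" unfolding k_def per_fun_def using per_funD[OF pc] by simp
    moreover have "Zsum k = 0" unfolding k_def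
      by (simp only: Zsum_diff Zsum_cmult Zsum_const of_nat_id diff_self)
    moreover have "k a + k b + k (a + b) \<le> 3 * q" for a b
    proof -
      have "k a + k b + k (a + b) = int p * (c a + c b + c (a + b)) - 3 * N"
        by (simp add: k_def sc algebra_simps)
      also have "\<dots> \<le> 6 * m * q - 3 * ((2 * m - 1) * q)"
        using le[of a b] large by (simp add: c_def)
      finally show ?thesis by (simp add: algebra_simps)
    qed
    ultimately have "0 \<le> 4 * Zsum (\<lambda>i. Zsum (\<lambda>j. k i * k j * k (i + j))) + 7 * int p * q * Zsum (\<lambda>i. (k i)\<^sup>2)"
      using flat_cubic_bound odd by blast
    then show ?thesis
      unfolding k_def Zsum_centered_triple[OF pc] Zsum_centered_square unfolding sc
      by (simp only: S_def T_def c_def)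
  qed
  \<comment> \<open>The zero functional is not covered by \<open>bound\<close>, so its contribution
    is removed from the totals over all functionals.\<close>
  have "T 0 = N ^ 3"
  proof -
    have "slice_size A 0 i * slice_size A 0 j * slice_size A 0 (i + j) =
        of_bool [0 = i] (mod int p) * (of_bool [0 = j] (mod int p) * N ^ 3)" for i j
    proof (cases "[0 = i] (mod int p) \<and> [0 = j] (mod int p)")
      case True
      then have "[0 = i + j] (mod int p)" using cong_add[of 0 i "int p" 0 j] by simp
      then show ?thesis using True by (simp add: slice_size_0 N_def power3_eq_cube)
    qed (auto simp: slice_size_0)
    then show ?thesis
      by (simp add: T_def Zsum_cmult Zsum_indicator per_fun_def)
  qed
  have "S 0 = N\<^sup>2"
  proof -
    have "(slice_size A 0 i)\<^sup>2 = of_bool [0 = i] (mod int p) * N\<^sup>2" for i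
      by (simp add: slice_size_0 N_def)
    then show ?thesis by (simp add: S_def Zsum_indicator per_fun_def)
  qed
  have ST: "(\<Sum>y\<in>?R. T y) = q * N ^ 3"
    using sum_triples_over_functionals[OF A sf] q p_pos unfolding T_def N_def by simp
  have SS: "(\<Sum>y\<in>?R. S y) = q * (N * int p + (N\<^sup>2 - N))"
    using sum_squares_over_functionals[of A] q p_pos unfolding S_def N_def by simp
  have sumT: "(\<Sum>y\<in>?R - {0}. T y) = q * N ^ 3 - N ^ 3"
    using ST \<open>T 0 = N ^ 3\<close> \<open>0 \<in> ?R\<close> finite_range_vrep by (simp add: sum_diff1)
  have sumS: "(\<Sum>y\<in>?R - {0}. S y) = q * (N * int p + (N\<^sup>2 - N)) - N\<^sup>2"
    using SS \<open>S 0 = N\<^sup>2\<close> \<open>0 \<in> ?R\<close> finite_range_vrep by (simp add: sum_diff1)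
  have cardR: "int (card (?R - {0})) = int p * q - 1"
  proof -
    have "card ?R = Suc (card (?R - {0}))"
      using \<open>0 \<in> ?R\<close> finite_range_vrep by (metis card.remove)
    then have "int (card (?R - {0})) = int (card ?R) - 1" by linarith
    then show ?thesis using q card_range_vrep by simp
  qed
  have "0 \<le> (\<Sum>y\<in>?R - {0}. 4 * (int p ^ 3 * T y - (int p)\<^sup>2 * N ^ 3) + 7 * int p * q * ((int p)\<^sup>2 * S y - int p * N\<^sup>2))"
    using bound by (intro sum_nonneg)
  also have "\<dots> = 4 * (int p ^ 3 * (q * N ^ 3 - N ^ 3) - (int p * q - 1) * ((int p)\<^sup>2 * N ^ 3))
      + 7 * int p * q * ((int p)\<^sup>2 * (q * (N * int p + (N\<^sup>2 - N)) - N\<^sup>2) - (int p * q - 1) * (int p * N\<^sup>2))"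
    by (simp only: sum.distrib sum_subtractf sum_distrib_left[symmetric] sumT sumS sum_constant cardR)
      (simp only: ac_simps)
  also have "\<dots> = ((int p)\<^sup>2 * (int p - 1) * N) * (7 * q * (int p * q - N) - 4 * N\<^sup>2)"
    by (simp add: algebra_simps power2_eq_square power3_eq_cube)
  finally have pos: "0 \<le> ((int p)\<^sup>2 * (int p - 1) * N) * (7 * q * (int p * q - N) - 4 * N\<^sup>2)" .
  have "(2 * m - 1) * q > 0" using p q by simp
  then have "N > 0" using large by linarith
  then have "(int p)\<^sup>2 * (int p - 1) * N > 0" using p by simp
  then have "4 * N\<^sup>2 \<le> 7 * q * (int p * q - N)" using pos by (simp add: zero_le_mult_iff)
  moreover have "((2 * m - 1) * q)\<^sup>2 \<le> N\<^sup>2" using large \<open>(2 * m - 1) * q > 0\<close> by (intro power_mono) auto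
  moreover have "q * ((2 * m - 1) * q) \<le> q * N" using large q by (intro mult_left_mono) auto
  ultimately have "4 * ((2 * m - 1) * q)\<^sup>2 + 7 * (q * ((2 * m - 1) * q)) \<le> 7 * q * (int p * q)"
    by (simp add: algebra_simps)
  then have "q\<^sup>2 * (16 * m\<^sup>2 - 44 * m + 4) \<le> 0"
    unfolding p(1) by (simp add: algebra_simps power2_eq_square)
  moreover have "16 * m\<^sup>2 - 44 * m + 4 > 0"
  proof -
    have "m * 3 \<le> m * m" using p by (intro mult_left_mono) auto
    then show ?thesis using p(2) unfolding power2_eq_square by linarith
  qed
  ultimately show False using q by (simp add: mult_le_0_iff)
qed

end

subsection \<open>Automorphisms\<close>

context finite_quotient
begin

text \<open>Maps of the ambient group that induce mutually inverse automorphisms of the quotient;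
  additivity and invertibility hold only up to \<open>rep\<close>. Sets are moved by preimages
  \<open>{x. f x \<in> A}\<close>, which keeps them periodic.\<close>

definition automorphic :: "('a \<Rightarrow> 'a) \<Rightarrow> ('a \<Rightarrow> 'a) \<Rightarrow> bool" where
  "automorphic f g \<longleftrightarrow>
     (\<forall>x y. rep (f (x + y)) = rep (f x + f y)) \<and> (\<forall>x. rep (f (rep x)) = rep (f x)) \<and>
     (\<forall>x. rep (g (rep x)) = rep (g x)) \<and> (\<forall>x. rep (f (g x)) = rep x) \<and> (\<forall>x. rep (g (f x)) = rep x)"

lemma automorphicD:
  assumes "automorphic f g"
  shows "rep (f (x + y)) = rep (f x + f y)" "rep (f (rep x)) = rep (f x)"
    "rep (g (rep x)) = rep (g x)" "rep (f (g x)) = rep x" "rep (g (f x)) = rep x"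
  using assms by (auto simp: automorphic_def)

lemma automorphic_cong:
  assumes "automorphic f g" "rep x = rep y"
  shows "rep (f x) = rep (f y)" "rep (g x) = rep (g y)"
  using automorphicD(2,3)[OF assms(1)] assms(2) by metis+

lemma rep_add_cong: "rep x = rep x' \<Longrightarrow> rep y = rep y' \<Longrightarrow> rep (x + y) = rep (x' + y')"
  by (metis rep_add_left rep_add_right)

lemma automorphic_sym:
  assumes "automorphic f g"
  shows "automorphic g f"
proof -
  note D = automorphicD[OF assms] and C = automorphic_cong[OF assms]
  have "rep (g (x + y)) = rep (g x + g y)" for x y
  proof -
    have "rep (f (g x + g y)) = rep (x + y)"
      unfolding D(1) by (rule rep_add_cong) (rule D(4))+
    then have "rep (g (x + y)) = rep (g (f (g x + g y)))" by (intro C(2)) simp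
    then show ?thesis by (simp add: D(5))
  qed
  then show ?thesis using D by (simp add: automorphic_def)
qed

lemma automorphic_comp:
  assumes "automorphic f g" "automorphic f' g'"
  shows "automorphic (\<lambda>x. f (f' x)) (\<lambda>x. g' (g x))"
proof -
  note D = automorphicD[OF assms(1)] and C = automorphic_cong[OF assms(1)]
  note D' = automorphicD[OF assms(2)] and C' = automorphic_cong[OF assms(2)]
  have "rep (f (f' (x + y))) = rep (f (f' x) + f (f' y))" for x y
    using C(1)[OF D'(1)] D(1) by simp
  moreover have "rep (f (f' (rep x))) = rep (f (f' x))" for x using C(1)[OF D'(2)] .
  moreover have "rep (g' (g (rep x))) = rep (g' (g x))" for x using C'(2)[OF D(3)] .
  moreover have "rep (f (f' (g' (g x)))) = rep x" for x using C(1)[OF D'(4)] D(4) by simp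
  moreover have "rep (g' (g (f (f' x)))) = rep x" for x using C'(2)[OF D(5)] D'(5) by simp
  ultimately show ?thesis unfolding automorphic_def by blast
qed

lemma periodic_automorphic:
  assumes "automorphic f g" "periodic X"
  shows "periodic {x. f x \<in> X}"
  unfolding periodic_def using periodic_cong[OF assms(2) automorphicD(2)[OF assms(1)]] by simp

lemma mem_automorphic_iff:
  assumes "automorphic f g" "periodic X"
  shows "f (g x) \<in> X \<longleftrightarrow> x \<in> X"
  using periodic_cong[OF assms(2) automorphicD(4)[OF assms(1)]] .

lemma size_of_automorphic:
  assumes "automorphic f g" "periodic X"
  shows "size_of {x. f x \<in> X} = size_of X"
  unfolding size_of_def
proof (rule bij_betw_same_card[of "\<lambda>x. rep (f x)"], rule bij_betw_byWitness[where f' = "\<lambda>x. rep (g x)"])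
  note D = automorphicD[OF assms(1)]
  have fix_rep: "rep a = a" if "a \<in> range rep" for a using that by auto
  show "\<forall>a\<in>{x. f x \<in> X} \<inter> range rep. rep (g (rep (f a))) = a"
    unfolding D(3,5) using fix_rep by blast
  show "\<forall>a'\<in>X \<inter> range rep. rep (f (rep (g a'))) = a'"
    unfolding D(2,4) using fix_rep by blast
  show "(\<lambda>x. rep (f x)) ` ({x. f x \<in> X} \<inter> range rep) \<subseteq> X \<inter> range rep"
    using periodicD[OF assms(2)] by auto
  show "(\<lambda>x. rep (g x)) ` (X \<inter> range rep) \<subseteq> {x. f x \<in> X} \<inter> range rep"
  proof
    fix y assume "y \<in> (\<lambda>x. rep (g x)) ` (X \<inter> range rep)"
    then obtain x where x: "x \<in> X" "y = rep (g x)" by blast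
    have "f (rep (g x)) \<in> X"
      using periodic_cong[OF assms(2), of "f (rep (g x))" x] x(1) D(2,4) by simp
    then show "y \<in> {x. f x \<in> X} \<inter> range rep" using x by blast
  qed
qed

lemma sum_free_automorphic:
  assumes "automorphic f g" "periodic A" and "\<And>a b. a \<in> A \<Longrightarrow> b \<in> A \<Longrightarrow> a + b \<notin> A"
    and "f a \<in> A" "f b \<in> A"
  shows "f (a + b) \<notin> A"
  using assms(3)[OF assms(4,5)] periodic_cong[OF assms(2) automorphicD(1)[OF assms(1)]] by blast

end

context coordinate_space
begin

lemma cong_vrep: "i \<in> I \<Longrightarrow> [vrep p I x i = x i] (mod int p)"
  by (simp add: vrep_def cong_def)

lemma dot_vrep_right: "[dot I y (vrep p I x) = dot I y x] (mod int p)"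
  by (intro dot_cong cong_vrep) auto

lemma automorphic_swap:
  assumes "i \<in> I" "j \<in> I"
  shows "vs.automorphic (\<lambda>x. x \<circ> Transposition.transpose i j) (\<lambda>x. x \<circ> Transposition.transpose i j)"
proof -
  have "Transposition.transpose i j k \<in> I" if "k \<in> I" for k
    using that assms by (simp add: Transposition.transpose_def)
  then show ?thesis
    unfolding vs.automorphic_def vrep_eq_iff by (auto simp: cong_vrep)
qed

text \<open>The identity matrix with column k replaced by v, so that the k-th unit vector is mapped
  to v.\<close>

definition column_map :: "nat \<Rightarrow> (nat \<Rightarrow> int) \<Rightarrow> (nat \<Rightarrow> int) \<Rightarrow> nat \<Rightarrow> int" where
  "column_map k v x = (\<lambda>i. (if i = k then 0 else x i) + x k * v i)"

lemma automorphic_column: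
  assumes k: "k \<in> I" "\<not> int p dvd v k"
  obtains g where "vs.automorphic (column_map k v) g"
proof -
  obtain d where d: "[v k * d = 1] (mod int p)" using obtain_inverse[OF k(2)] by blast
  define g where "g z = (\<lambda>i. if i = k then d * z k else z i - (d * z k) * v i)" for z :: "nat \<Rightarrow> int"
  have d1: "[x * (v k * d) = x * 1] (mod int p)" for x using d by (rule cong_scalar_left)
  have "vs.automorphic (column_map k v) g"
    unfolding vs.automorphic_def vrep_eq_iff
  proof (intro conjI allI ballI)
    fix x z :: "nat \<Rightarrow> int" and i assume i: "i \<in> I"
    have v: "[vrep p I x i = x i] (mod int p)" "[vrep p I x k = x k] (mod int p)"
      using i k cong_vrep by auto
    show "[column_map k v (x + z) i = (column_map k v x + column_map k v z) i] (mod int p)"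
      by (simp add: column_map_def algebra_simps)
    show "[column_map k v (vrep p I x) i = column_map k v x i] (mod int p)"
      using v unfolding column_map_def by (auto intro!: cong_add cong_mult)
    show "[g (vrep p I x) i = g x i] (mod int p)"
      using v unfolding g_def by (auto intro!: cong_diff cong_mult)
    show "[column_map k v (g x) i = x i] (mod int p)"
      using d1[of "x k"] unfolding column_map_def g_def by (auto simp: ac_simps)
    show "[g (column_map k v x) i = x i] (mod int p)"
    proof (cases "i = k")
      case True
      then show ?thesis using d1[of "x k"] by (simp add: column_map_def g_def ac_simps)
    next
      case False
      have "[x i + x k * v i - (x k * (v k * d)) * v i = x i + x k * v i - (x k * 1) * v i] (mod int p)"
        by (intro cong_diff cong_refl cong_mult[OF d1])
      then show ?thesis using False by (simp add: column_map_def g_def ac_simps)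
    qed
  qed
  then show thesis by (rule that)
qed

text \<open>The identity matrix with row k replaced by y; the k-th entry of the argument is
  recovered by dividing by y k.\<close>

lemma automorphic_row:
  assumes k: "k \<in> I" "\<not> int p dvd y k"
  obtains g where "vs.automorphic (\<lambda>x. x(k := dot I y x)) g"
proof -
  obtain d where d: "[y k * d = 1] (mod int p)" using obtain_inverse[OF k(2)] by blast
  define D where "D x = dot (I - {k}) y x" for x
  have split: "dot I y x = y k * x k + D x" for x
    unfolding dot_def D_def using finite_I k by (simp add: sum.remove)
  have D_upd: "D (x(k := a)) = D x" for x a
    unfolding D_def dot_def by (intro sum.cong) auto
  have D_vrep: "[D (vrep p I x) = D x] (mod int p)" for x
    unfolding D_def dot_def by (intro cong_sum cong_mult cong_refl cong_vrep) simp
  define g where "g z = z(k := d * (z k - D z))" for z :: "nat \<Rightarrow> int"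
  have d1: "[(y k * d) * x = 1 * x] (mod int p)" for x using d by (rule cong_scalar_right)
  have "vs.automorphic (\<lambda>x. x(k := dot I y x)) g"
    unfolding vs.automorphic_def vrep_eq_iff
  proof (intro conjI allI ballI)
    fix x z :: "nat \<Rightarrow> int" and i assume i: "i \<in> I"
    have v: "[vrep p I x i = x i] (mod int p)" "[vrep p I x k = x k] (mod int p)"
      using i k cong_vrep by auto
    show "[((x + z)(k := dot I y (x + z))) i = (x(k := dot I y x) + z(k := dot I y z)) i] (mod int p)"
      by (simp add: dot_add_right)
    show "[((vrep p I x)(k := dot I y (vrep p I x))) i = (x(k := dot I y x)) i] (mod int p)"
      using v dot_vrep_right by simp
    show "[g (vrep p I x) i = g x i] (mod int p)"
      using v D_vrep unfolding g_def by (auto intro!: cong_diff cong_mult)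
    show "[((g x)(k := dot I y (g x))) i = x i] (mod int p)"
    proof (cases "i = k")
      case True
      have "y k * (d * (x k - D x)) + D x = (y k * d) * (x k - D x) + D x" by (simp add: ac_simps)
      moreover have "[(y k * d) * (x k - D x) + D x = 1 * (x k - D x) + D x] (mod int p)"
        by (intro cong_add d1 cong_refl)
      ultimately show ?thesis using True by (simp add: split g_def D_upd ac_simps)
    qed (simp add: g_def)
    show "[g (x(k := dot I y x)) i = x i] (mod int p)"
    proof (cases "i = k")
      case True
      have eq: "d * (dot I y x - D x) = (y k * d) * x k" by (simp add: split ac_simps)
      have "[d * (dot I y x - D x) = x k] (mod int p)"
        unfolding eq using d1[of "x k"] by simp
      then show ?thesis using True by (simp add: g_def D_upd)
    qed (simp add: g_def)
  qed
  then show thesis by (rule that)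
qed

text \<open>A coordinate swap brings the invertible entry of y to position k, then row k is
  replaced. In this way a nonzero functional becomes a coordinate.\<close>

lemma automorphic_functional:
  assumes "k \<in> I" "j \<in> I" "\<not> int p dvd y j"
  obtains f g where "vs.automorphic f g" "\<And>x. f x k = dot I y x"
proof -
  let ?t = "Transposition.transpose k j"
  have t_bij: "bij_betw ?t I I"
    using assms(1,2) by (intro bij_betw_byWitness[where f' = ?t]) (auto simp: Transposition.transpose_def)
  have "\<not> int p dvd (y \<circ> ?t) k" using assms by simp
  then obtain g where g: "vs.automorphic (\<lambda>x. x(k := dot I (y \<circ> ?t) x)) g"
    using automorphic_row[OF assms(1)] by blast
  have "dot I (y \<circ> ?t) (x \<circ> ?t) = dot I y x" for x
    unfolding dot_def using sum.reindex_bij_betw[OF t_bij, of "\<lambda>i. y i * x i"] by simp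
  then show thesis
    using that[OF vs.automorphic_comp[OF g automorphic_swap[OF assms(1,2)]]] by simp
qed

text \<open>Column k is replaced by the swapped v, and a coordinate swap afterwards restores the
  order. In this way a chosen direction becomes a coordinate axis.\<close>

lemma automorphic_vector:
  assumes "k \<in> I" "j \<in> I" "\<not> int p dvd v j"
  obtains f g where "vs.automorphic f g"
    "\<And>x t. f (x + (\<lambda>i. if i = k then t else 0)) = f x + (\<lambda>i. t * v i)"
proof -
  let ?t = "Transposition.transpose k j"
  have "\<not> int p dvd (v \<circ> ?t) k" using assms by simp
  then obtain g where g: "vs.automorphic (column_map k (v \<circ> ?t)) g"
    using automorphic_column[OF assms(1)] by blast
  show thesis
  proof (rule that[OF vs.automorphic_comp[OF automorphic_swap[OF assms(1,2)] g]])
    fix x t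
    show "column_map k (v \<circ> ?t) (x + (\<lambda>i. if i = k then t else 0)) \<circ> ?t =
        (column_map k (v \<circ> ?t) x \<circ> ?t) + (\<lambda>i. t * v i)"
      by (rule ext) (auto simp: column_map_def algebra_simps Transposition.transpose_def)
  qed
qed

end

section \<open>Sections over the first coordinate\<close>

locale split_space = prime_modulus +
  fixes n :: nat
  assumes n_pos: "n \<ge> 1"
begin

sublocale V: coordinate_space p "{..<n}" by unfold_locales simp

text \<open>The remaining coordinates keep their numbers 1, ..., n - 1, so a section consists of
  vectors indexed as in A itself. Renumbering is left to the transfer to \<open>Fp\<close>.\<close>

sublocale W: coordinate_space p "{0<..<n}" by unfold_locales simp

lemma W_index: "card (range (vrep p {0<..<n})) = p ^ (n - 1)"
  by (simp add: W.card_range_vrep)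

lemma V_index: "card (range (vrep p {..<n})) = p * p ^ (n - 1)"
  using n_pos V.card_range_vrep by (simp add: power_eq_if)

definition section_at :: "(nat \<Rightarrow> int) set \<Rightarrow> int \<Rightarrow> (nat \<Rightarrow> int) set" where
  "section_at A t = {w. w(0 := t) \<in> A}"

lemma per_section:
  assumes "V.vper A"
  shows "W.vper (section_at A t)"
proof (rule W.vperI)
  fix x y assume xy: "\<forall>i\<in>{0<..<n}. [x i = y i] (mod int p)" "x \<in> section_at A t"
  then have "x(0 := t) \<in> A \<longleftrightarrow> y(0 := t) \<in> A"
    by (intro V.vper_cong[OF assms]) auto
  then show "y \<in> section_at A t" using xy by (simp add: section_at_def)
qed

lemma section_cong:
  assumes "V.vper A" "[s = t] (mod int p)"
  shows "section_at A s = section_at A t"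
proof -
  have "w(0 := s) \<in> A \<longleftrightarrow> w(0 := t) \<in> A" for w
    using assms(2) by (intro V.vper_cong[OF assms(1)]) auto
  then show ?thesis by (simp add: section_at_def)
qed

lemma mem_section: "V.vper A \<Longrightarrow> [x 0 = t] (mod int p) \<Longrightarrow> x \<in> section_at A t \<longleftrightarrow> x \<in> A"
  unfolding section_at_def mem_Collect_eq by (rule V.vper_cong) (auto intro: cong_sym)

lemma section_sumset_disjoint:
  assumes "\<And>a b. a \<in> A \<Longrightarrow> b \<in> A \<Longrightarrow> a + b \<notin> A"
  shows "sumset (section_at A s) (section_at A t) \<inter> section_at A (s + t) = {}"
proof -
  have "(x + y)(0 := s + t) = x(0 := s) + y(0 := t)" for x y :: "nat \<Rightarrow> int"
    by (rule ext) simp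
  then show ?thesis using assms unfolding sumset_def section_at_def by auto
qed

lemma size_section:
  assumes A: "V.vper A"
  shows "V.vsz {x \<in> A. [x 0 = t] (mod int p)} = W.vsz (section_at A t)"
  unfolding V.vs.size_of_def W.vs.size_of_def
proof (rule bij_betw_same_card[of "\<lambda>x. x(0 := 0)"],
    rule bij_betw_byWitness[where f' = "\<lambda>w. w(0 := t mod int p)"])
  have rV: "x \<in> range (vrep p {..<n}) \<longleftrightarrow> (\<forall>i. if i < n then 0 \<le> x i \<and> x i < int p else x i = 0)" for x
    unfolding V.range_vrep by simp
  have rW: "x \<in> range (vrep p {0<..<n}) \<longleftrightarrow> (\<forall>i. if 0 < i \<and> i < n then 0 \<le> x i \<and> x i < int p else x i = 0)" for x
    unfolding W.range_vrep by simp
  show "\<forall>a\<in>{x \<in> A. [x 0 = t] (mod int p)} \<inter> range (vrep p {..<n}). (a(0 := 0))(0 := t mod int p) = a"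
  proof
    fix a assume a: "a \<in> {x \<in> A. [x 0 = t] (mod int p)} \<inter> range (vrep p {..<n})"
    then have "0 \<le> a 0 \<and> a 0 < int p" using rV[of a] n_pos by (auto dest: spec[of _ 0])
    then have "t mod int p = a 0" using a by (simp add: cong_def)
    then show "(a(0 := 0))(0 := t mod int p) = a" by auto
  qed
  show "\<forall>a\<in>section_at A t \<inter> range (vrep p {0<..<n}). (a(0 := t mod int p))(0 := 0) = a"
  proof
    fix a assume a: "a \<in> section_at A t \<inter> range (vrep p {0<..<n})"
    then have "a 0 = 0" using rW[of a] by (auto dest: spec[of _ 0])
    then show "(a(0 := t mod int p))(0 := 0) = a" by auto
  qed
  show "(\<lambda>x. x(0 := 0)) ` ({x \<in> A. [x 0 = t] (mod int p)} \<inter> range (vrep p {..<n})) \<subseteq>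
      section_at A t \<inter> range (vrep p {0<..<n})"
  proof (intro subsetI, elim imageE)
    fix w a assume w: "w = a(0 := 0)" and a: "a \<in> {x \<in> A. [x 0 = t] (mod int p)} \<inter> range (vrep p {..<n})"
    have "a(0 := 0) \<in> section_at A t \<longleftrightarrow> a \<in> A"
      unfolding section_at_def mem_Collect_eq by (rule V.vper_cong[OF A]) (use a in \<open>auto intro: cong_sym\<close>)
    moreover have "a(0 := 0) \<in> range (vrep p {0<..<n})" using a rV[of a] unfolding rW by auto
    ultimately show "w \<in> section_at A t \<inter> range (vrep p {0<..<n})" using w a by simp
  qed
  show "(\<lambda>w. w(0 := t mod int p)) ` (section_at A t \<inter> range (vrep p {0<..<n})) \<subseteq>
      {x \<in> A. [x 0 = t] (mod int p)} \<inter> range (vrep p {..<n})"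
  proof (intro subsetI, elim imageE)
    fix x w assume x: "x = w(0 := t mod int p)" and w: "w \<in> section_at A t \<inter> range (vrep p {0<..<n})"
    have "w(0 := t mod int p) \<in> A \<longleftrightarrow> w(0 := t) \<in> A"
      by (rule V.vper_cong[OF A]) auto
    then have "x \<in> A" using w x by (simp add: section_at_def)
    moreover have "x \<in> range (vrep p {..<n})"
      using w rW[of w] p_pos n_pos unfolding x rV by auto
    ultimately show "x \<in> {x \<in> A. [x 0 = t] (mod int p)} \<inter> range (vrep p {..<n})"
      using x by (simp add: cong_def)
  qed
qed

lemma size_eq_sum_sections:
  assumes A: "V.vper A"
  shows "int (V.vsz A) = Zsum (\<lambda>t. int (W.vsz (section_at A t)))"
proof -
  define y :: "nat \<Rightarrow> int" where "y = (\<lambda>i. if i = 0 then 1 else 0)"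
  have "dot {..<n} y x = x 0" for x
  proof -
    have "dot {..<n} y x = (\<Sum>i<n. if i = 0 then x 0 else 0)"
      unfolding dot_def y_def by (rule sum.cong) auto
    then show ?thesis using n_pos by simp
  qed
  then have "V.slice_size A y t = int (W.vsz (section_at A t))" for t
    using size_section[OF A] by (simp add: V.slice_size_def)
  then have "V.slice_size A y = (\<lambda>t. int (W.vsz (section_at A t)))" by blast
  then show ?thesis using V.Zsum_slice_size[of A y] by simp
qed

text \<open>The weak Kneser bound in the group of order p^(n-1). It requires all three sections to
  be nonempty, which is where flatness can fail.\<close>

lemma section_triple:
  assumes A: "V.vper A" and sf: "\<And>a b. a \<in> A \<Longrightarrow> b \<in> A \<Longrightarrow> a + b \<notin> A"
    and ne: "section_at A s \<noteq> {}" "section_at A t \<noteq> {}" "section_at A (s + t) \<noteq> {}"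
  shows "p * (W.vsz (section_at A s) + W.vsz (section_at A t) + W.vsz (section_at A (s + t))) \<le> (p + 1) * p ^ (n - 1)"
  using W.vs.size_of_sumset_disjoint[OF per_section[OF A] per_section[OF A] per_section[OF A] ne
      section_sumset_disjoint[OF sf]] by (simp add: W_index)

text \<open>The map f turns y into the first coordinate, so the slices of A along y become sections
  of the preimage under its inverse g.\<close>

lemma transfer_functional:
  assumes "j < n" "\<not> int p dvd y j" and A: "V.vper A"
  obtains f g where "V.vs.automorphic f g" "\<And>x. f x 0 = dot {..<n} y x"
    "V.vper {x. g x \<in> A}" "V.vsz {x. g x \<in> A} = V.vsz A"
    "\<And>t. int (W.vsz (section_at {x. g x \<in> A} t)) = V.slice_size A y t"
proof -
  obtain f g where fg: "V.vs.automorphic f g" "\<And>x. f x 0 = dot {..<n} y x"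
    using V.automorphic_functional[of 0 j y] assms n_pos by auto
  note gf = V.vs.automorphic_sym[OF fg(1)]
  have pA: "V.vper {x. g x \<in> A}" using V.vs.periodic_automorphic[OF gf A] .
  have "int (W.vsz (section_at {x. g x \<in> A} t)) = V.slice_size A y t" for t
  proof -
    let ?X = "{x \<in> A. [dot {..<n} y x = t] (mod int p)}"
    have "V.vper ?X"
    proof (rule V.vperI)
      fix x x' assume xx: "\<forall>i\<in>{..<n}. [x i = x' i] (mod int p)" "x \<in> ?X"
      then have "[dot {..<n} y x = dot {..<n} y x'] (mod int p)" by (intro V.dot_cong) auto
      moreover have "x' \<in> A" using V.vper_cong[OF A, of x x'] xx by auto
      ultimately show "x' \<in> ?X" using xx(2) by (auto simp: cong_def)
    qed
    then have "V.vsz ?X = V.vsz {x. g x \<in> ?X}" by (rule V.vs.size_of_automorphic[OF gf, symmetric])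
    also have "{x. g x \<in> ?X} = {x \<in> {x. g x \<in> A}. [x 0 = t] (mod int p)}"
    proof -
      have "[dot {..<n} y (g x) = x 0] (mod int p)" for x
      proof -
        have "vrep p {..<n} (f (g x)) = vrep p {..<n} x" by (rule V.vs.automorphicD(4)[OF fg(1)])
        then have "[f (g x) 0 = x 0] (mod int p)" using n_pos by (auto simp: V.vrep_eq_iff)
        then show ?thesis by (simp add: fg(2))
      qed
      then show ?thesis by (auto simp: cong_def)
    qed
    finally show ?thesis using size_section[OF pA] by (simp add: V.slice_size_def)
  qed
  then show thesis using that[OF fg pA V.vs.size_of_automorphic[OF gf A]] by blast
qed

text \<open>The slice sizes of y, multiplied by p to keep the bound 6m q integral, satisfy the
  hypotheses of \<open>support_in_middle_if_peak\<close>. The dilation found there is absorbed into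
  the functional.\<close>

lemma middle_functional_if_nonflat:
  fixes m :: int
  defines "q \<equiv> int (p ^ (n - 1))"
  assumes p: "int p = 6 * m - 1" "m \<ge> 2"
    and A: "V.vper A" and sf: "\<And>a b. a \<in> A \<Longrightarrow> b \<in> A \<Longrightarrow> a + b \<notin> A"
    and large: "(2 * m - 1) * q \<le> int (V.vsz A)"
    and j: "j < n" "\<not> int p dvd y j"
    and nonflat: "int p * (V.slice_size A y i + V.slice_size A y k + V.slice_size A y (i + k)) > 6 * m * q"
  shows "\<exists>y. (\<exists>j<n. \<not> int p dvd y j) \<and> (\<forall>x\<in>A. dot {..<n} y x mod int p \<in> {2 * m - 1..4 * m})"
proof -
  define f where "f t = int p * V.slice_size A y t" for t
  obtain F G where FG: "V.vs.automorphic F G"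
    "V.vper {x. G x \<in> A}" "\<And>t. int (W.vsz (section_at {x. G x \<in> A} t)) = V.slice_size A y t"
    using transfer_functional[of j y A, OF j A] by metis
  let ?A = "{x. G x \<in> A}"
  have sf': "a + b \<notin> ?A" if "a \<in> ?A" "b \<in> ?A" for a b
    using V.vs.sum_free_automorphic[OF V.vs.automorphic_sym[OF FG(1)] A sf] that by blast
  have qpos: "q > 0" using p_pos by (simp add: q_def)
  have triple: "f s + f t + f (s + t) \<le> 6 * m * q" if "f s > 0" "f t > 0" "f (s + t) > 0" for s t
  proof -
    have ne: "section_at ?A u \<noteq> {}" if "f u > 0" for u
    proof
      assume "section_at ?A u = {}"
      then have "V.slice_size A y u = 0" using FG(3)[of u] by simp
      then show False using that by (simp add: f_def)
    qed
    have "int (p * (W.vsz (section_at ?A s) + W.vsz (section_at ?A t) + W.vsz (section_at ?A (s + t)))) \<le> int ((p + 1) * p ^ (n - 1))"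
      using section_triple[OF FG(2) sf' ne[OF that(1)] ne[OF that(2)] ne[OF that(3)]] of_nat_mono by blast
    then have "int p * (V.slice_size A y s + V.slice_size A y t + V.slice_size A y (s + t)) \<le> (int p + 1) * q"
      by (simp add: FG(3)[symmetric] q_def algebra_simps)
    moreover have "(int p + 1) * q = 6 * m * q" using p by simp
    ultimately show ?thesis by (simp add: f_def algebra_simps)
  qed
  have f_nonneg: "f t \<ge> 0" for t using V.slice_size_nonneg by (simp add: f_def)
  have f_le: "f t \<le> int p * q" for t
  proof -
    have "W.vsz (section_at ?A t) \<le> p ^ (n - 1)" using W.vs.size_of_le_order by (simp add: W_index)
    then have "V.slice_size A y t \<le> q" using FG(3)[of t] unfolding q_def by linarith
    then show ?thesis unfolding f_def by (intro mult_left_mono) auto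
  qed
  have total: "(2 * m - 1) * int p * q \<le> (\<Sum>i\<in>range (zrep p). f i)"
  proof -
    have "(\<Sum>i\<in>range (zrep p). f i) = int p * Zsum (V.slice_size A y)"
      by (simp add: f_def Zsum_def sum_distrib_left)
    then have "(\<Sum>i\<in>range (zrep p). f i) = int p * int (V.vsz A)" by (simp add: V.Zsum_slice_size)
    moreover have "int p * ((2 * m - 1) * q) \<le> int p * int (V.vsz A)"
      using large by (intro mult_left_mono) auto
    ultimately show ?thesis by (simp add: ac_simps)
  qed
  \<comment> \<open>If no value exceeded 3m q, the violating triple would consist of three positive
    values, and the bound for nonempty sections would apply to it.\<close>
  have peak: "\<exists>t. f t > 3 * m * q"
  proof (rule ccontr)
    assume "\<not> ?thesis"
    then have le: "f t \<le> 3 * m * q" for t by (simp add: not_less)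
    have "f i + f k + f (i + k) > 6 * m * q" using nonflat by (simp add: f_def algebra_simps)
    then have "f i > 0" "f k > 0" "f (i + k) > 0"
      using le[of i] le[of k] le[of "i + k"] by linarith+
    then show False using triple[of i k] \<open>f i + f k + f (i + k) > 6 * m * q\<close> by linarith
  qed
  then obtain t where t: "f t > 3 * m * q" by blast
  have per_f: "f (zrep p x) = f x" for x
    unfolding f_def using per_funD[OF V.per_fun_slice_size] by simp
  obtain c where c: "\<not> int p dvd c" "\<And>i. f i > 0 \<Longrightarrow> (c * i) mod int p \<in> {2 * m - 1..4 * m}"
    using support_in_middle_if_peak[of m q f, OF p qpos per_f f_nonneg f_le triple total t] by blast
  let ?y = "\<lambda>i. c * y i"
  have "dot {..<n} ?y x = c * dot {..<n} y x" for x
    by (simp add: dot_def sum_distrib_left mult.assoc)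
  moreover have "f (dot {..<n} y x) > 0" if "x \<in> A" for x
  proof -
    let ?X = "{z \<in> A. [dot {..<n} y z = dot {..<n} y x] (mod int p)}"
    have "vrep p {..<n} x \<in> ?X \<inter> range (vrep p {..<n})"
      using that V.vs.periodicD[OF A] V.dot_vrep_right by auto
    then have "?X \<inter> range (vrep p {..<n}) \<noteq> {}" by blast
    then have "V.vsz ?X > 0" unfolding V.vs.size_of_def
      using V.finite_range_vrep by (subst card_gt_0_iff) blast
    then show ?thesis using p_pos by (simp add: f_def V.slice_size_def)
  qed
  ultimately have "\<forall>x\<in>A. dot {..<n} ?y x mod int p \<in> {2 * m - 1..4 * m}" using c(2) by simp
  moreover have "\<exists>j<n. \<not> int p dvd ?y j" using j c(1) by (auto simp: prime_dvd_mult)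
  ultimately show ?thesis by (intro exI[of _ ?y] conjI)
qed

end

subsection \<open>The prime 11\<close>

definition cos11 :: "int \<Rightarrow> real" where
  "cos11 k = cos (2 * pi / 11 * of_int k)"

lemma cos11_uminus: "cos11 (- k) = cos11 k"
  by (simp add: cos11_def)

lemma cos11_periodic: "cos11 (k + 11 * j) = cos11 k"
proof -
  have "2 * pi / 11 * of_int (k + 11 * j) = 2 * pi / 11 * of_int k + 2 * pi * of_int j"
    by (simp add: field_simps)
  then show ?thesis unfolding cos11_def by (simp only: cos_add cos_int_2pin sin_int_2pin mult_1_right mult_zero_right diff_zero)
qed

lemma cos11_mod: "cos11 (k mod 11) = cos11 k"
  using cos11_periodic[of "k mod 11" "k div 11"] by simp

lemma cos11_reflect: "cos11 (11 - k) = cos11 k"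
  using cos11_periodic[of "- k" 1] by (simp add: cos11_uminus)

text \<open>With t = 2 pi / 11 the identity cos(6t) = cos(5t) is a polynomial equation for c = cos
  t. Removing the root 1 leaves a quintic, whose root near 0.84 is located by monotonicity; the
  other cosines follow from multiple-angle formulas. The vanishing of the sum over all eleven
  residues is the same quintic.\<close>

lemma cos11_values:
  shows "cos11 0 = 1"
    and "0.84125 < cos11 1" "cos11 1 < 0.84126"
    and "0.4154 < cos11 2" "cos11 2 < 0.41544"
    and "- 0.1424 < cos11 3" "cos11 3 < - 0.1422"
    and "- 0.6549 < cos11 4" "cos11 4 < - 0.6548"
    and "- 0.9597 < cos11 5" "cos11 5 < - 0.9592"
    and "1 + 2 * (cos11 1 + cos11 2 + cos11 3 + cos11 4 + cos11 5) = 0"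
proof -
  show "cos11 0 = 1" by (simp add: cos11_def)
  define t c where "t = 2 * pi / 11" and "c = cos11 1"
  have c_eq: "c = cos t" by (simp add: c_def cos11_def t_def)
  have c2: "cos11 2 = 2 * c\<^sup>2 - 1"
    using cos_double_cos[of t] by (simp add: c_eq cos11_def t_def ac_simps)
  have c3: "cos11 3 = 4 * c ^ 3 - 3 * c"
    using cos_treble_cos[of t] by (simp add: c_eq cos11_def t_def ac_simps)
  have c4: "cos11 4 = 2 * (cos11 2)\<^sup>2 - 1"
    using cos_double_cos[of "2 * t"] by (simp add: cos11_def t_def ac_simps)
  have c6: "cos11 6 = 2 * (cos11 3)\<^sup>2 - 1"
    using cos_double_cos[of "3 * t"] by (simp add: cos11_def t_def ac_simps)
  have c5: "cos11 5 = 2 * cos11 2 * cos11 3 - c"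
  proof -
    have "cos (2 * t + 3 * t) + cos (3 * t - 2 * t) = 2 * cos (2 * t) * cos (3 * t)"
      by (simp only: cos_add cos_diff) simp
    moreover have "2 * t + 3 * t = 5 * t" "3 * t - 2 * t = t" by simp_all
    ultimately have "cos (5 * t) + cos t = 2 * cos (2 * t) * cos (3 * t)" by simp
    then show ?thesis by (simp add: c_eq cos11_def t_def ac_simps eq_diff_eq)
  qed
  have "cos11 6 = cos11 5" using cos11_reflect[of 5] by simp
  then have "(c - 1) * (32 * c ^ 5 + 16 * c ^ 4 - 32 * c ^ 3 - 12 * c\<^sup>2 + 6 * c + 1) = 0"
    unfolding c5 c6 c2 c3 by (simp add: algebra_simps power2_eq_square power3_eq_cube power4_eq_xxxx power_numeral_reduce)
  moreover have t: "0 < t" "t < pi / 4" using pi_gt_zero by (auto simp: t_def)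
  then have "c < 1" using cos_monotone_0_pi[of 0 t] by (simp add: c_eq)
  ultimately have W: "32 * c ^ 5 + 16 * c ^ 4 - 32 * c ^ 3 - 12 * c\<^sup>2 + 6 * c + 1 = 0" by simp
  \<comment> \<open>A first lower bound separates c from the other roots of the quintic, the cosines
    of 2t, ..., 5t.\<close>
  have "cos (pi / 4) < c" unfolding c_eq using t by (intro cos_monotone_0_pi) auto
  moreover have "0.7 < cos (pi / 4)"
  proof -
    have "1.4 < sqrt 2" by (rule real_less_rsqrt) (simp add: power2_eq_square)
    then show ?thesis by (simp add: cos_45)
  qed
  ultimately have "c > 0.7" by simp
  \<comment> \<open>Expanded at 0.7, the polynomial has positive coefficients except the constant one.\<close>
  define z where "z = c - 0.7"
  define g where "g z = 32*z^5 + 128*z^4 + 848/5*z^3 + 388/5*z^2 + 316/125*z - 7613/3125" for z :: real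
  have z: "z > 0" "g z = 0"
  proof -
    show "z > 0" using \<open>c > 0.7\<close> by (simp add: z_def)
    have c: "c = z + 7 / 10" by (simp add: z_def)
    have "g z = 32 * c ^ 5 + 16 * c ^ 4 - 32 * c ^ 3 - 12 * c\<^sup>2 + 6 * c + 1"
      unfolding g_def c by (simp add: field_simps power2_eq_square power3_eq_cube power4_eq_xxxx power_numeral_reduce)
    then show "g z = 0" using W by simp
  qed
  have mono: "g a \<le> g b" if "0 \<le> a" "a \<le> b" for a b
    unfolding g_def using that by (intro add_mono diff_mono mult_left_mono power_mono) auto
  have low: "0.84125 < c"
  proof (rule ccontr)
    assume "\<not> ?thesis"
    then have "g z \<le> g 0.14125" using z by (intro mono) (auto simp: z_def)
    moreover have "g 0.14125 < 0" by (simp add: g_def power_numeral_reduce)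
    ultimately show False using z by simp
  qed
  have high: "c < 0.84126"
  proof (rule ccontr)
    assume "\<not> ?thesis"
    then have "g 0.14126 \<le> g z" using z by (intro mono) (auto simp: z_def)
    moreover have "g 0.14126 > 0" by (simp add: g_def power_numeral_reduce)
    ultimately show False using z by simp
  qed
  show "0.84125 < cos11 1" "cos11 1 < 0.84126" using low high by (simp_all add: c_def)
  have sq: "0.84125 * 0.84125 \<le> c * c" "c * c \<le> 0.84126 * 0.84126"
    using low high by (intro mult_mono; simp)+
  have cu: "0.84125 * 0.84125 * 0.84125 \<le> c * c * c" "c * c * c \<le> 0.84126 * 0.84126 * 0.84126"
    using low high by (intro mult_mono; simp)+
  show b2: "0.4154 < cos11 2" "cos11 2 < 0.41544"
    unfolding c2 using sq by (simp_all add: power2_eq_square)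
  show b3: "- 0.1424 < cos11 3" "cos11 3 < - 0.1422"
    unfolding c3 using cu low high by (simp_all add: power3_eq_cube)
  have sq2: "0.41540 * 0.41540 \<le> cos11 2 * cos11 2" "cos11 2 * cos11 2 \<le> 0.41544 * 0.41544"
    using b2 by (intro mult_mono; simp)+
  show "- 0.6549 < cos11 4" "cos11 4 < - 0.6548"
    unfolding c4 using sq2 by (simp_all add: power2_eq_square)
  have "0.4154 * 0.1422 \<le> cos11 2 * (- cos11 3)" "cos11 2 * (- cos11 3) \<le> 0.41544 * 0.1424"
    using b2 b3 by (intro mult_mono; simp)+
  then show "- 0.9597 < cos11 5" "cos11 5 < - 0.9592"
    unfolding c5 using low high by simp_all
  show "1 + 2 * (cos11 1 + cos11 2 + cos11 3 + cos11 4 + cos11 5) = 0"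
  proof -
    have "1 + 2 * (c + cos11 2 + cos11 3 + cos11 4 + cos11 5) = 32 * c ^ 5 + 16 * c ^ 4 - 32 * c ^ 3 - 12 * c\<^sup>2 + 6 * c + 1"
      unfolding c5 c4 c3 c2 by (simp add: algebra_simps power2_eq_square power3_eq_cube power4_eq_xxxx power_numeral_reduce)
    then show ?thesis using W by (simp add: c_def)
  qed
qed

text \<open>The cosines multiplied by 1000 and rounded, so that the finite check runs in integer
  arithmetic; \<open>cos11_le_tab\<close> accounts for the rounding.\<close>

definition cos_tab :: "int \<Rightarrow> int" where
  "cos_tab k = (let r = k mod 11 in
     if r = 0 then 1000 else if r = 1 \<or> r = 10 then 841 else if r = 2 \<or> r = 9 then 415
     else if r = 3 \<or> r = 8 then -142 else if r = 4 \<or> r = 7 then -655 else -959)"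

lemma cos11_le_tab: "1000 * cos11 k \<le> of_int (cos_tab k) + 1 / 2"
proof -
  define r where "r = k mod 11"
  have "0 \<le> r" "r < 11" by (simp_all add: r_def)
  then have "r = 0 \<or> r = 1 \<or> r = 2 \<or> r = 3 \<or> r = 4 \<or> r = 5 \<or> r = 6 \<or> r = 7 \<or> r = 8 \<or> r = 9 \<or> r = 10"
    by presburger
  moreover have "cos11 k = cos11 r" by (simp add: r_def cos11_mod)
  moreover have "cos11 10 = cos11 1" "cos11 9 = cos11 2" "cos11 8 = cos11 3" "cos11 7 = cos11 4" "cos11 6 = cos11 5"
    using cos11_reflect[of 1] cos11_reflect[of 2] cos11_reflect[of 3] cos11_reflect[of 4] cos11_reflect[of 5] by simp_all
  ultimately show ?thesis
    unfolding cos_tab_def Let_def r_def[symmetric] using cos11_values by (auto simp: algebra_simps)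
qed

text \<open>The subsets of \<open>{0,1,2,3}\<close> that are empty or contain \<open>0\<close>: the possible shapes of a subset of
  an interval of length 4 in \<open>\<int>/11\<close>, read off from its first element.\<close>

definition shapes :: "nat list list" where
  "shapes = [[], [0], [0,1], [0,2], [0,3], [0,1,2], [0,1,3], [0,2,3], [0,1,2,3]]"

text \<open>For p = 11 the sets in question have on average at least 3 points per fibre, so the
  deficits of all fibres add up to at most 0.\<close>

definition deficit :: "nat list \<Rightarrow> int" where
  "deficit us = 3 - int (length us)"

text \<open>Up to rounding, 1000 times the squared modulus of the exponential sum over the
  shape.\<close>

definition autocorr :: "nat list \<Rightarrow> int" where
  "autocorr us = (\<Sum>u\<leftarrow>us. \<Sum>v\<leftarrow>us. cos_tab (int u - int v))"

text \<open>Indexed by i = u + v, at most 6 for elements u and v of two shapes, so that the inner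
  sum over \<open>cs\<close> is computed once for each offset e.\<close>

definition corr_row :: "int \<Rightarrow> nat list \<Rightarrow> int list" where
  "corr_row e cs = map (\<lambda>i. \<Sum>c\<leftarrow>cs. cos_tab (e + int i - int c)) [0..<7]"

definition hit_row :: "int \<Rightarrow> nat list \<Rightarrow> bool list" where
  "hit_row e cs = map (\<lambda>i. list_ex (\<lambda>c. (e + int i - int c) mod 11 = 0) cs) [0..<7]"

text \<open>The inequality of \<open>pointwise_bound\<close> multiplied by 12000, with a margin that covers the rounding in
  \<open>cos_tab\<close>. The multipliers \<open>5/12\<close>, \<open>19/4\<close> and \<open>7/5\<close> there were found by linear programming.\<close>

definition check_pair ::
    "int list \<Rightarrow> bool list \<Rightarrow> int \<Rightarrow> int \<Rightarrow> nat list \<times> int \<times> int \<Rightarrow> nat list \<times> int \<times> int \<Rightarrow> bool" where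
  "check_pair h f a c U V = (case U of (us, aU, dU) \<Rightarrow> case V of (vs, aV, dV) \<Rightarrow>
     list_ex (\<lambda>u. list_ex (\<lambda>v. f ! (u + v)) vs) us \<or>
     5000 \<le> 57000 * (dU + dV + c) - 16800 * (dU * dV + dU * c + dV * c)
       - 5 * (aU + aV + a) - 12 * (\<Sum>u\<leftarrow>us. \<Sum>v\<leftarrow>vs. h ! (u + v)))"

definition check_shift :: "int \<Rightarrow> bool" where
  "check_shift e = (let T = map (\<lambda>us. (us, autocorr us, deficit us)) shapes in
     list_all (\<lambda>(cs, a, c). let h = corr_row e cs; f = hit_row e cs in
       list_all (\<lambda>U. list_all (check_pair h f a c U) T) T) T)"

lemma check_shift_0_5: "list_all check_shift [0,1,2,3,4,5]"
  by code_simp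

lemma check_shift_6_10: "list_all check_shift [6,7,8,9,10]"
  by code_simp

lemma sum_list_le_error:
  fixes f g :: "'a \<Rightarrow> real"
  assumes "\<And>x. x \<in> set xs \<Longrightarrow> f x \<le> g x + d" "d \<ge> 0" "length xs \<le> 4"
  shows "sum_list (map f xs) \<le> sum_list (map g xs) + 4 * d"
proof -
  have "sum_list (map f xs) \<le> sum_list (map g xs) + real (length xs) * d"
    using assms(1) by (induction xs) (fastforce simp: algebra_simps)+
  also have "\<dots> \<le> sum_list (map g xs) + 4 * d"
    using assms(2,3) by (intro add_left_mono mult_right_mono) auto
  finally show ?thesis .
qed

lemma shapes_length: "us \<in> set shapes \<Longrightarrow> length us \<le> 4"
  and shapes_le: "us \<in> set shapes \<Longrightarrow> u \<in> set us \<Longrightarrow> u \<le> 3"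
  by (auto simp: shapes_def)

text \<open>The three shapes are those of the fibres over u, v and u + v, the number e is the offset
  between their starting points modulo 11, and \<open>free\<close> is sum-freeness. The right-hand
  side is made for summation over all u and v: its linear part becomes a positive multiple of the
  total deficit, which is at most 0, and the products become three times the square of the total
  deficit.\<close>

lemma pointwise_bound:
  assumes S: "us \<in> set shapes" "vs \<in> set shapes" "cs \<in> set shapes" and e: "0 \<le> e" "e \<le> 10"
    and free: "\<And>u v c. u \<in> set us \<Longrightarrow> v \<in> set vs \<Longrightarrow> c \<in> set cs \<Longrightarrow> (e + int u + int v - int c) mod 11 \<noteq> 0"
  defines "E \<equiv> \<lambda>us. \<Sum>u\<leftarrow>us. \<Sum>v\<leftarrow>us. cos11 (int u - int v)"
  shows "(\<Sum>u\<leftarrow>us. \<Sum>v\<leftarrow>vs. \<Sum>c\<leftarrow>cs. cos11 (e + int u + int v - int c)) + 5 / 12 * (E us + E vs + E cs)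
    < 19 / 4 * of_int (deficit us + deficit vs + deficit cs)
      - 7 / 5 * of_int (deficit us * deficit vs + deficit us * deficit cs + deficit vs * deficit cs)"
proof -
  have "check_shift e"
  proof -
    have "e = 0 \<or> e = 1 \<or> e = 2 \<or> e = 3 \<or> e = 4 \<or> e = 5 \<or> e = 6 \<or> e = 7 \<or> e = 8 \<or> e = 9 \<or> e = 10"
      using e by presburger
    then show ?thesis using check_shift_0_5 check_shift_6_10 by (auto simp: list_all_iff)
  qed
  then have "check_pair (corr_row e cs) (hit_row e cs) (autocorr cs) (deficit cs)
      (us, autocorr us, deficit us) (vs, autocorr vs, deficit vs)"
    using S by (auto simp: check_shift_def list_all_iff Let_def)
  moreover have idx: "u + v < 7" if "u \<in> set us" "v \<in> set vs" for u v
    using shapes_le[OF S(1) that(1)] shapes_le[OF S(2) that(2)] by simp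
  have "\<not> list_ex (\<lambda>u. list_ex (\<lambda>v. hit_row e cs ! (u + v)) vs) us"
    using free idx by (auto simp: list_ex_iff hit_row_def ac_simps)
  moreover have "(\<Sum>u\<leftarrow>us. \<Sum>v\<leftarrow>vs. corr_row e cs ! (u + v)) =
      (\<Sum>u\<leftarrow>us. \<Sum>v\<leftarrow>vs. \<Sum>c\<leftarrow>cs. cos_tab (e + int u + int v - int c))"
    using idx by (intro arg_cong[where f = sum_list] map_cong refl) (simp add: corr_row_def add.assoc)
  ultimately have main: "5000 \<le> 57000 * (deficit us + deficit vs + deficit cs)
      - 16800 * (deficit us * deficit vs + deficit us * deficit cs + deficit vs * deficit cs)
      - 5 * (autocorr us + autocorr vs + autocorr cs)
      - 12 * (\<Sum>u\<leftarrow>us. \<Sum>v\<leftarrow>vs. \<Sum>c\<leftarrow>cs. cos_tab (e + int u + int v - int c))" (is "_ \<le> ?lhs")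
    by (simp add: check_pair_def)
  have tab: "cos11 k \<le> of_int (cos_tab k) / 1000 + 1 / 2000" for k
    using cos11_le_tab[of k] by simp
  have of_int_sum_list: "of_int (sum_list (map f xs)) = (\<Sum>x\<leftarrow>xs. (of_int (f x) :: real))" for f and xs :: "nat list"
    by (induction xs) auto
  have div_sum_list: "(\<Sum>x\<leftarrow>xs. f x / 1000) = (\<Sum>x\<leftarrow>xs. f x) / (1000 :: real)" for f and xs :: "nat list"
    by (induction xs) (auto simp: add_divide_distrib)
  have E: "E us \<le> of_int (autocorr us) / 1000 + 4 * (4 * (1 / 2000))" if "us \<in> set shapes" for us
  proof -
    have "E us \<le> (\<Sum>u\<leftarrow>us. \<Sum>v\<leftarrow>us. of_int (cos_tab (int u - int v)) / 1000) + 4 * (4 * (1 / 2000))"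
      unfolding E_def by (intro sum_list_le_error tab shapes_length[OF that]) auto
    then show ?thesis by (simp add: autocorr_def of_int_sum_list div_sum_list)
  qed
  have G: "(\<Sum>u\<leftarrow>us. \<Sum>v\<leftarrow>vs. \<Sum>c\<leftarrow>cs. cos11 (e + int u + int v - int c)) \<le>
      of_int (\<Sum>u\<leftarrow>us. \<Sum>v\<leftarrow>vs. \<Sum>c\<leftarrow>cs. cos_tab (e + int u + int v - int c)) / 1000 + 4 * (4 * (4 * (1 / 2000)))"
  proof -
    have "(\<Sum>u\<leftarrow>us. \<Sum>v\<leftarrow>vs. \<Sum>c\<leftarrow>cs. cos11 (e + int u + int v - int c)) \<le>
      (\<Sum>u\<leftarrow>us. \<Sum>v\<leftarrow>vs. \<Sum>c\<leftarrow>cs. of_int (cos_tab (e + int u + int v - int c)) / 1000) + 4 * (4 * (4 * (1 / 2000)))"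
      by (intro sum_list_le_error tab shapes_length[OF S(1)] shapes_length[OF S(2)] shapes_length[OF S(3)]) auto
    then show ?thesis by (simp add: of_int_sum_list div_sum_list)
  qed
  \<comment> \<open>Rounding costs at most 64/2000 in the triple sum and 16/2000 in each
    \<open>E\<close>, together 504 in the scale of 12000, well below the margin of 5000.\<close>
  have "(5000 :: real) \<le> of_int ?lhs" using main by linarith
  then show ?thesis using E[OF S(1)] E[OF S(2)] E[OF S(3)] G by (simp add: field_simps)
qed

context prime_modulus
begin

lemma Zsum_11: "p = 11 \<Longrightarrow> Zsum g = g 0 + g 1 + g 2 + g 3 + g 4 + g 5 + g 6 + g 7 + g 8 + g 9 + g 10"
proof -
  assume "p = 11"
  moreover have "{0..<11::int} = {0,1,2,3,4,5,6,7,8,9,10}" unfolding Set.set_eq_iff insert_iff atLeastLessThan_iff empty_iff by presburger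
  ultimately have "range (zrep p) = {0,1,2,3,4,5,6,7,8,9,10}" by (simp add: range_zrep)
  then show ?thesis by (simp add: Zsum_def add.assoc)
qed

text \<open>Linear programming duality. Flatness at (i, j) and at (- i, - j) is added, which leaves
  the unknowns k i + k (- i) and constraints with right-hand side 6Q, five of which are used. Their
  dual weights have sum at most 9/2 and bound twice the objective, whence 27/2.\<close>

lemma flat_cosine_bound:
  fixes k :: "int \<Rightarrow> int"
  assumes p: "p = 11" and k: "per_fun k" "Zsum k = 0" and "Q > 0"
    and flat: "\<And>i j. k i + k j + k (i + j) \<le> 3 * Q"
  shows "- Zsum (\<lambda>i. of_int (k i) * cos11 i) \<le> 27 / 2 * of_int Q"
proof -
  define K where "K i = real_of_int (k i)" for i
  define q where "q = real_of_int Q"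
  have q: "q > 0" using assms(4) by (simp add: q_def)
  have fl: "K i + K j + K (i + j) \<le> 3 * q" for i j
    using flat[of i j] unfolding K_def q_def by linarith
  have per: "K (i + 11) = K i" for i
    unfolding K_def using per_fun_cong[OF k(1), of "i + 11" i] by (simp add: p cong_def)
  have K16: "K 16 = K 5" "K 12 = K 1" "K 14 = K 3" "K 11 = K 0"
    using per[of 5] per[of 1] per[of 3] per[of 0] by simp_all
  define X0 X1 X2 X3 X4 X5 where "X0 = 2 * K 0" and "X1 = K 1 + K 10" and "X2 = K 2 + K 9"
    and "X3 = K 3 + K 8" and "X4 = K 4 + K 7" and "X5 = K 5 + K 6"
  note Xdefs = X0_def X1_def X2_def X3_def X4_def X5_def
  have con: "X0 + 2 * X5 \<le> 6 * q" "X1 + 2 * X5 \<le> 6 * q" "X2 + X4 + X5 \<le> 6 * q" "2 * X3 + X5 \<le> 6 * q" "X3 + 2 * X4 \<le> 6 * q"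
    using fl[of 0 5] fl[of 0 6] fl[of 1 5] fl[of 10 6] fl[of 2 4] fl[of 9 7] fl[of 3 3] fl[of 8 8] fl[of 4 4] fl[of 7 7]
    by (simp_all add: Xdefs K16)
  have sum0: "X0 / 2 + X1 + X2 + X3 + X4 + X5 = 0"
  proof -
    have "real_of_int (Zsum k) = 0" using k by simp
    then show ?thesis unfolding Zsum_11[OF p] by (simp add: Xdefs K_def)
  qed
  define c1 c2 c3 c4 c5 where "c1 = cos11 1" and "c2 = cos11 2" and "c3 = cos11 3" and "c4 = cos11 4" and "c5 = cos11 5"
  note cdefs = c1_def c2_def c3_def c4_def c5_def
  have c: "0.84125 < c1" "c1 < 0.84126" "0.4154 < c2" "c2 < 0.41544" "- 0.1424 < c3" "c3 < - 0.1422"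
    "- 0.6549 < c4" "c4 < - 0.6548" "- 0.9597 < c5" "c5 < - 0.9592"
    unfolding cdefs by (rule cos11_values)+
  have cr: "cos11 10 = c1" "cos11 9 = c2" "cos11 8 = c3" "cos11 7 = c4" "cos11 6 = c5"
    using cos11_reflect[of 1] cos11_reflect[of 2] cos11_reflect[of 3] cos11_reflect[of 4] cos11_reflect[of 5]
    by (simp_all add: cdefs)
  have obj: "Zsum (\<lambda>i. of_int (k i) * cos11 i) = X0 / 2 + X1 * c1 + X2 * c2 + X3 * c3 + X4 * c4 + X5 * c5"
    unfolding Zsum_11[OF p] cr cdefs[symmetric] cos11_values(1) by (simp add: Xdefs K_def algebra_simps)
  \<comment> \<open>\<open>w1\<close>, ..., \<open>w5\<close> and \<open>\<nu>\<close> are an optimal dual solution of the linear program with constraints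
    \<open>con\<close> and \<open>sum0\<close>.\<close>
  define \<nu> where "\<nu> = (- 2 - 4 * c1 - 5 / 2 * c2 - c3 + c4 / 2 + 2 * c5) / 7"
  define w1 w2 w3 w5 w4 where "w1 = - 1 - \<nu>" and "w2 = - 2 * c1 - 2 * \<nu>" and "w3 = - 2 * c2 - 2 * \<nu>"
    and "w5 = c2 - c4" and "w4 = (- 2 * c3 - 2 * \<nu> - (c2 - c4)) / 2"
  have \<nu>: "- 1.217 < \<nu>" "\<nu> < - 1.214" using c unfolding \<nu>_def by simp_all
  have w: "w1 \<ge> 0" "w2 \<ge> 0" "w3 \<ge> 0" "w4 \<ge> 0" "w5 \<ge> 0" "w1 + w2 + w3 + w4 + w5 \<le> 9 / 2"
    using c \<nu> unfolding w1_def w2_def w3_def w4_def w5_def by (simp_all add: field_simps)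
  have "2 * - (X0 / 2 + X1 * c1 + X2 * c2 + X3 * c3 + X4 * c4 + X5 * c5) =
      w1 * (X0 + 2 * X5) + w2 * (X1 + 2 * X5) + w3 * (X2 + X4 + X5) + w4 * (2 * X3 + X5) + w5 * (X3 + 2 * X4)
      + 2 * \<nu> * (X0 / 2 + X1 + X2 + X3 + X4 + X5)"
    unfolding w1_def w2_def w3_def w4_def w5_def \<nu>_def by (simp add: field_simps)
  also have "\<dots> = w1 * (X0 + 2 * X5) + w2 * (X1 + 2 * X5) + w3 * (X2 + X4 + X5) + w4 * (2 * X3 + X5) + w5 * (X3 + 2 * X4)"
    using sum0 by simp
  also have "\<dots> \<le> w1 * (6 * q) + w2 * (6 * q) + w3 * (6 * q) + w4 * (6 * q) + w5 * (6 * q)"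
    using con w by (intro add_mono mult_left_mono) auto
  also have "\<dots> = (w1 + w2 + w3 + w4 + w5) * (6 * q)" by (simp add: algebra_simps)
  also have "\<dots> \<le> 9 / 2 * (6 * q)" using w q by (intro mult_right_mono) auto
  finally show ?thesis unfolding obj by (simp add: q_def)
qed

end

definition sin11 :: "int \<Rightarrow> real" where
  "sin11 k = sin (2 * pi / 11 * of_int k)"

lemma cos11_diff: "cos11 (x - y) = cos11 x * cos11 y + sin11 x * sin11 y"
  by (simp add: cos11_def sin11_def right_diff_distrib cos_diff)

lemma sin11_diff: "sin11 (x - y) = sin11 x * cos11 y - cos11 x * sin11 y"
  by (simp add: cos11_def sin11_def right_diff_distrib sin_diff)

lemma cos11_add: "cos11 (x + y) = cos11 x * cos11 y - sin11 x * sin11 y"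
  by (simp add: cos11_def sin11_def distrib_left cos_add)

lemma sum_cos11_diff:
  "(\<Sum>a\<in>F. \<Sum>b\<in>F. cos11 (\<alpha> a - \<alpha> b)) = (\<Sum>a\<in>F. cos11 (\<alpha> a))\<^sup>2 + (\<Sum>a\<in>F. sin11 (\<alpha> a))\<^sup>2"
  unfolding cos11_diff sum.distrib power2_eq_square sum_product ..

text \<open>With S the sum of exp(2 pi i \<alpha>(a) / 11) over F, the left-hand side is the real
  part of S S conj(S), that is, Re S times the squared modulus of S. The sine part of the last two
  factors cancels by antisymmetry.\<close>

lemma sum_cos11_triple:
  "(\<Sum>a\<in>F. \<Sum>b\<in>F. \<Sum>d\<in>F. cos11 (\<alpha> a + \<alpha> b - \<alpha> d)) =
     (\<Sum>a\<in>F. cos11 (\<alpha> a)) * (\<Sum>a\<in>F. \<Sum>b\<in>F. cos11 (\<alpha> a - \<alpha> b))"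
proof -
  define C S where "C = (\<Sum>a\<in>F. cos11 (\<alpha> a))" and "S = (\<Sum>a\<in>F. sin11 (\<alpha> a))"
  have 0: "(\<Sum>b\<in>F. \<Sum>d\<in>F. sin11 (\<alpha> b - \<alpha> d)) = 0"
  proof -
    have "(\<Sum>b\<in>F. \<Sum>d\<in>F. sin11 (\<alpha> b - \<alpha> d)) = S * C - C * S"
      unfolding sin11_diff sum_subtractf C_def S_def sum_product ..
    then show ?thesis by simp
  qed
  have eq: "cos11 (\<alpha> a + \<alpha> b - \<alpha> d) = cos11 (\<alpha> a) * cos11 (\<alpha> b - \<alpha> d) - sin11 (\<alpha> a) * sin11 (\<alpha> b - \<alpha> d)" for a b d
    using cos11_add[of "\<alpha> a" "\<alpha> b - \<alpha> d"] by (simp add: add_diff_eq)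
  have "(\<Sum>a\<in>F. \<Sum>b\<in>F. \<Sum>d\<in>F. cos11 (\<alpha> a + \<alpha> b - \<alpha> d)) =
      (\<Sum>a\<in>F. cos11 (\<alpha> a) * (\<Sum>b\<in>F. \<Sum>d\<in>F. cos11 (\<alpha> b - \<alpha> d)) - sin11 (\<alpha> a) * (\<Sum>b\<in>F. \<Sum>d\<in>F. sin11 (\<alpha> b - \<alpha> d)))"
    unfolding eq by (simp add: sum_subtractf sum_distrib_left)
  then show ?thesis unfolding 0 by (simp add: sum_distrib_right)
qed

text \<open>Both conditions ignore the sign of l, so the multipliers 1 to 5 represent all nonzero
  residues modulo 11.\<close>

definition neighbours :: "int list \<Rightarrow> bool" where
  "neighbours T \<longleftrightarrow> list_ex (\<lambda>l. list_ex (\<lambda>x. (x - 4 * l) mod 11 = 0 \<or> (x + 4 * l) mod 11 = 0) T \<and>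
     list_ex (\<lambda>x. (x - 5 * l) mod 11 = 0 \<or> (x + 5 * l) mod 11 = 0) T) [1, 2, 3, 4, 5]"

definition no_sums :: "int list \<Rightarrow> bool" where
  "no_sums T \<longleftrightarrow> list_all (\<lambda>x. list_all (\<lambda>y. list_all (\<lambda>z. (x + y - z) mod 11 \<noteq> 0) T) T) T"

lemma sum_free_triples_11:
  "list_all (\<lambda>a. list_all (\<lambda>b. list_all (\<lambda>c. a < b \<longrightarrow> b < c \<longrightarrow> no_sums [a, b, c] \<longrightarrow> neighbours [a, b, c])
     [1,2,3,4,5,6,7,8,9,10]) [1,2,3,4,5,6,7,8,9,10]) [1,2,3,4,5,6,7,8,9,10]"
  by code_simp

text \<open>Three elements are enough, so it suffices to check the triples from 1 to 10. After
  rescaling by l the residues 4 and 5 occur up to sign; with their negatives 7 and 6 they are the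
  steps that points of A will be shown to avoid.\<close>

lemma sum_free_11_neighbours:
  fixes X :: "int set"
  assumes X: "\<And>i. i mod 11 \<in> X \<longleftrightarrow> i \<in> X" "\<And>i j. i \<in> X \<Longrightarrow> j \<in> X \<Longrightarrow> i + j \<notin> X"
    and card: "card (X \<inter> {0..<11}) \<ge> 3"
  shows "\<exists>l. \<not> 11 dvd l \<and> (4 * l \<in> X \<or> - (4 * l) \<in> X) \<and> (5 * l \<in> X \<or> - (5 * l) \<in> X)"
proof -
  have cong: "i \<in> X \<longleftrightarrow> j \<in> X" if "i mod 11 = j mod 11" for i j
    using X(1)[of i] X(1)[of j] that by simp
  obtain T where T: "T \<subseteq> X \<inter> {0..<11}" "card T = 3"
    using obtain_subset_with_card_n[OF card] by blast
  then obtain a b c where abc: "T = {a, b, c}" "a < b" "b < c"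
  proof -
    have fin: "finite T" using T by (intro card_ge_0_finite) simp
    define xs where "xs = sorted_list_of_set T"
    have xs: "length xs = 3" "sorted xs" "distinct xs" "set xs = T"
      using T(2) fin by (simp_all add: xs_def)
    then obtain a b c where "xs = [a, b, c]"
      by (auto simp: numeral_3_eq_3 length_Suc_conv)
    then show thesis using xs that[of a b c] by auto
  qed
  have "0 \<notin> X" using X(2)[of 0 0] by auto
  have mem: "x \<in> {1,2,3,4,5,6,7,8,9,10}" "x \<in> X" if "x \<in> set [a, b, c]" for x
  proof -
    have x: "x \<in> X \<inter> {0..<11}" using that T abc by auto
    then show "x \<in> X" by simp
    have "x \<noteq> 0" using x \<open>0 \<notin> X\<close> by auto
    show "x \<in> {1,2,3,4,5,6,7,8,9,10}"
    proof -
      note \<open>x \<noteq> 0\<close>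
      moreover have "0 \<le> x" "x < 11" using x by auto
      ultimately show ?thesis unfolding insert_iff empty_iff by presburger
    qed
  qed
  have "no_sums [a, b, c]"
    unfolding no_sums_def list_all_iff
  proof (intro ballI)
    fix x y z assume xyz: "x \<in> set [a, b, c]" "y \<in> set [a, b, c]" "z \<in> set [a, b, c]"
    show "(x + y - z) mod 11 \<noteq> 0"
    proof
      assume "(x + y - z) mod 11 = 0"
      then have "(x + y) mod 11 = z mod 11" by (simp add: mod_eq_dvd_iff dvd_eq_mod_eq_0)
      then show False using X(2)[OF mem(2)[OF xyz(1)] mem(2)[OF xyz(2)]] mem(2)[OF xyz(3)] cong by blast
    qed
  qed
  then have "neighbours [a, b, c]"
  proof -
    let ?S = "set [1,2,3,4,5,6,7,8,9,10 :: int]"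
    have all: "\<forall>a\<in>?S. \<forall>b\<in>?S. \<forall>c\<in>?S. a < b \<longrightarrow> b < c \<longrightarrow> no_sums [a, b, c] \<longrightarrow> neighbours [a, b, c]"
      using sum_free_triples_11 unfolding list_all_iff .
    have S: "a \<in> ?S" "b \<in> ?S" "c \<in> ?S" using mem(1)[of a] mem(1)[of b] mem(1)[of c] by auto
    assume "no_sums [a, b, c]"
    then show ?thesis using all[rule_format, OF S abc(2,3)] by blast
  qed
  then have "\<exists>l\<in>set [1,2,3,4,5]. (\<exists>x\<in>set [a, b, c]. (x - 4 * l) mod 11 = 0 \<or> (x + 4 * l) mod 11 = 0) \<and>
      (\<exists>x\<in>set [a, b, c]. (x - 5 * l) mod 11 = 0 \<or> (x + 5 * l) mod 11 = 0)"
    unfolding neighbours_def list_ex_iff .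
  then obtain l x y where l: "l \<in> set [1,2,3,4,5]"
    and x': "x \<in> set [a, b, c]" "(x - 4 * l) mod 11 = 0 \<or> (x + 4 * l) mod 11 = 0"
    and y': "y \<in> set [a, b, c]" "(y - 5 * l) mod 11 = 0 \<or> (y + 5 * l) mod 11 = 0"
    by (elim bexE conjE) (rule that)
  note x = mem(2)[OF x'(1)] x'(2) and y = mem(2)[OF y'(1)] y'(2)
  have "x mod 11 = (4 * l) mod 11 \<or> x mod 11 = (- (4 * l)) mod 11" using x(2) by (auto simp: mod_eq_dvd_iff dvd_eq_mod_eq_0)
  then have "4 * l \<in> X \<or> - (4 * l) \<in> X" using x(1) cong by blast
  moreover have "y mod 11 = (5 * l) mod 11 \<or> y mod 11 = (- (5 * l)) mod 11" using y(2) by (auto simp: mod_eq_dvd_iff dvd_eq_mod_eq_0)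
  then have "5 * l \<in> X \<or> - (5 * l) \<in> X" using y(1) cong by blast
  moreover have "\<not> 11 dvd l" using l by auto
  ultimately show ?thesis by blast
qed

context prime_modulus
begin

text \<open>Differences from 4 to 7 are excluded modulo 11, so X lies within four consecutive
  residues starting at some s. The last clause evaluates sums over X as sums over the shape, for all
  weights at once.\<close>

lemma short_arc:
  assumes p: "p = 11" and X: "per X" and gap: "\<And>x t. x \<in> X \<Longrightarrow> 4 \<le> t \<Longrightarrow> t \<le> 7 \<Longrightarrow> x + t \<notin> X"
  shows "\<exists>s us. us \<in> set shapes \<and> (\<forall>u\<in>set us. s + int u \<in> X) \<and>
    (\<forall>\<phi> :: int \<Rightarrow> real. per_fun \<phi> \<longrightarrow> Zsum (\<lambda>t. of_bool (t \<in> X) * \<phi> t) = (\<Sum>u\<leftarrow>us. \<phi> (s + int u)))"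
proof (cases "X = {}")
  case True
  then show ?thesis by (intro exI[of _ 0] exI[of _ "[]"]) (simp add: shapes_def Zsum_def)
next
  case False
  then obtain x where x: "x \<in> X" by auto
  have behind: "x - t \<notin> X" if "4 \<le> t" "t \<le> 7" for t using gap[of "x - t" t] that x by auto
  \<comment> \<open>The earliest element among x - 3, ..., x has no element in the three places
    before it, since x - 4 to x - 7 are excluded.\<close>
  have "\<exists>s\<in>X. s - 1 \<notin> X \<and> s - 2 \<notin> X \<and> s - 3 \<notin> X"
  proof (cases "x - 3 \<in> X")
    case True
    then show ?thesis using behind[of 4] behind[of 5] behind[of 6] by (intro bexI[of _ "x - 3"]) auto
  next
    case n3: False
    show ?thesis
    proof (cases "x - 2 \<in> X")
      case True
      then show ?thesis using behind[of 4] behind[of 5] n3 by (intro bexI[of _ "x - 2"]) auto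
    next
      case n2: False
      show ?thesis
      proof (cases "x - 1 \<in> X")
        case True
        then show ?thesis using behind[of 4] n3 n2 by (intro bexI[of _ "x - 1"]) auto
      next
        case False
        then show ?thesis using x n2 n3 by blast
      qed
    qed
  qed
  then obtain s where s: "s \<in> X" "s - 1 \<notin> X" "s - 2 \<notin> X" "s - 3 \<notin> X" by blast
  have far: "s + 4 \<notin> X" "s + 5 \<notin> X" "s + 6 \<notin> X" "s + 7 \<notin> X" using gap[OF s(1)] by auto
  have "s + 8 \<in> X \<longleftrightarrow> s - 3 \<in> X" "s + 9 \<in> X \<longleftrightarrow> s - 2 \<in> X" "s + 10 \<in> X \<longleftrightarrow> s - 1 \<in> X"
    by (rule per_cong[OF X]; simp add: p cong_iff_dvd_diff)+
  then have far': "s + 8 \<notin> X" "s + 9 \<notin> X" "s + 10 \<notin> X" using s by auto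
  define us where "us = filter (\<lambda>i. s + int i \<in> X) [0, 1, 2, 3]"
  have "us \<in> set shapes" using s(1) by (simp add: us_def shapes_def)
  moreover have "\<forall>u\<in>set us. s + int u \<in> X" by (simp add: us_def)
  moreover have "Zsum (\<lambda>t. of_bool (t \<in> X) * \<phi> t) = (\<Sum>u\<leftarrow>us. \<phi> (s + int u))" if \<phi>: "per_fun \<phi>" for \<phi> :: "int \<Rightarrow> real"
  proof -
    have "per_fun (\<lambda>t. of_bool (t \<in> X) * \<phi> t)"
    proof (rule per_funI)
      fix a b :: int assume "[a = b] (mod int p)"
      then show "of_bool (a \<in> X) * \<phi> a = of_bool (b \<in> X) * \<phi> b"
        using per_cong[OF X \<open>[a = b] (mod int p)\<close>] per_fun_cong[OF \<phi> \<open>[a = b] (mod int p)\<close>] by simp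
    qed
    then have "Zsum (\<lambda>t. of_bool (t \<in> X) * \<phi> t) = Zsum (\<lambda>t. of_bool (t + s \<in> X) * \<phi> (t + s))"
      by (rule Zsum_translate[symmetric])
    then show ?thesis
      unfolding Zsum_11[OF p] using far far' s(1) by (simp add: us_def add.commute)
  qed
  ultimately show ?thesis by blast
qed

end

section \<open>A functional with a strongly negative cosine sum\<close>

context split_space
begin

lemma cos11_cong: "p = 11 \<Longrightarrow> [x = y] (mod int p) \<Longrightarrow> cos11 x = cos11 y"
  using cos11_mod[of x] cos11_mod[of y] by (simp add: cong_def)

lemma sum_range_split:
  assumes F: "\<And>x. F (vrep p {..<n} x) = F x"
  shows "(\<Sum>x\<in>range (vrep p {..<n}). F x) = (\<Sum>w\<in>range (vrep p {0<..<n}). Zsum (\<lambda>t. F (w(0 := t))))"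
proof -
  have rV: "x \<in> range (vrep p {..<n}) \<longleftrightarrow> (\<forall>i. if i < n then 0 \<le> x i \<and> x i < int p else x i = 0)" for x
    unfolding V.range_vrep by simp
  have rW: "x \<in> range (vrep p {0<..<n}) \<longleftrightarrow> (\<forall>i. if 0 < i \<and> i < n then 0 \<le> x i \<and> x i < int p else x i = 0)" for x
    unfolding W.range_vrep by simp
  have "(\<Sum>w\<in>range (vrep p {0<..<n}). Zsum (\<lambda>t. F (w(0 := t)))) =
      (\<Sum>(w, t)\<in>range (vrep p {0<..<n}) \<times> range (zrep p). F (w(0 := t)))"
    unfolding Zsum_def by (rule sum.cartesian_product)
  also have "\<dots> = (\<Sum>x\<in>range (vrep p {..<n}). F x)"
  proof (rule sum.reindex_bij_witness[where i = "\<lambda>x. (x(0 := 0), x 0)" and j = "\<lambda>(w, t). w(0 := t)"])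
    fix a assume a: "a \<in> range (vrep p {0<..<n}) \<times> range (zrep p)"
    obtain w t where wt: "a = (w, t)" by force
    have w: "w \<in> range (vrep p {0<..<n})" and t: "0 \<le> t" "t < int p"
      using a p_pos unfolding wt by (auto simp: range_zrep)
    have "w 0 = 0" using w rW[of w] by (auto dest: spec[of _ 0])
    then show "(((case a of (w, t) \<Rightarrow> w(0 := t)))(0 := 0), (case a of (w, t) \<Rightarrow> w(0 := t)) 0) = a"
      unfolding wt by auto
    show "(case a of (w, t) \<Rightarrow> w(0 := t)) \<in> range (vrep p {..<n})"
      using w t rW[of w] n_pos unfolding wt rV by auto
  next
    fix x assume x: "x \<in> range (vrep p {..<n})"
    show "(case (x(0 := 0), x 0) of (w, t) \<Rightarrow> w(0 := t)) = x" by simp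
    have "x(0 := 0) \<in> range (vrep p {0<..<n})" using x rV[of x] unfolding rW by auto
    moreover have "0 \<le> x 0 \<and> x 0 < int p" using x rV[of x] n_pos by (auto dest: spec[of _ 0])
    ultimately show "(x(0 := 0), x 0) \<in> range (vrep p {0<..<n}) \<times> range (zrep p)"
      using p_pos by (simp add: range_zrep)
  qed auto
  finally show ?thesis ..
qed

lemma dot_split: "dot {..<n} (y(0 := 1)) x = x 0 + dot {0<..<n} y x"
proof -
  have "{..<n} = insert 0 {0<..<n}" using n_pos by auto
  then have "dot {..<n} (y(0 := 1)) x = x 0 + (\<Sum>i\<in>{0<..<n}. (y(0 := 1)) i * x i)"
    by (simp add: dot_def)
  also have "(\<Sum>i\<in>{0<..<n}. (y(0 := 1)) i * x i) = dot {0<..<n} y x"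
    unfolding dot_def by (rule sum.cong) auto
  finally show ?thesis .
qed

text \<open>Orthogonality of characters over functionals with a fixed first coefficient: only the
  other coefficients vary, and their average vanishes unless all other entries of z vanish modulo
  p.\<close>

lemma sum_cos11_functionals:
  assumes p: "p = 11"
  shows "(\<Sum>y\<in>range (vrep p {0<..<n}). cos11 (s + dot {0<..<n} y z)) =
    (if vrep p {0<..<n} z = 0 then real (p ^ (n - 1)) * cos11 s else 0)"
proof (cases "vrep p {0<..<n} z = 0")
  case True
  have "cos11 (s + dot {0<..<n} y z) = cos11 s" for y
  proof -
    have "[dot {0<..<n} y z = dot {0<..<n} y 0] (mod int p)"
      by (rule W.dot_cong) (use True in \<open>auto simp: vrep_def fun_eq_iff cong_def split: if_splits\<close>)
    then have "(s + dot {0<..<n} y z) mod 11 = s mod 11"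
      using cong_add_lcancel[of s "dot {0<..<n} y z" 0 "int p"] by (simp add: dot_def p cong_def)
    then show ?thesis by (metis cos11_mod)
  qed
  then show ?thesis using True by (simp add: W_index)
next
  case False
  then obtain j where j: "j \<in> {0<..<n}" "\<not> int p dvd z j"
    by (auto simp: vrep_def fun_eq_iff dvd_eq_mod_eq_0 split: if_splits)
  define h where "h r = W.vsz {y. [dot {0<..<n} y z = r] (mod int p)}" for r
  have h: "h r = h 0" for r
  proof -
    have "h r * p = h 0 * p"
      using W.size_hyperplane[of j z, OF j, of r] W.size_hyperplane[of j z, OF j, of 0] unfolding h_def by simp
    then show ?thesis using p_pos by simp
  qed
  have per: "per_fun (\<lambda>r. cos11 (s + r))"
  proof (rule per_funI)
    fix x y assume "[x = y] (mod int p)"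
    then have "(s + x) mod 11 = (s + y) mod 11" by (metis p cong_add_lcancel cong_def of_nat_numeral)
    then show "cos11 (s + x) = cos11 (s + y)" by (metis cos11_mod)
  qed
  have per0: "per_fun cos11"
    by (rule per_funI) (metis cos11_mod cong_def p of_nat_numeral)
  have "(\<Sum>y\<in>range (vrep p {0<..<n}). cos11 (s + dot {0<..<n} y z)) =
      (\<Sum>y\<in>range (vrep p {0<..<n}). Zsum (\<lambda>r. of_bool [dot {0<..<n} y z = r] (mod int p) * cos11 (s + r)))"
    by (simp only: Zsum_indicator[OF per])
  also have "\<dots> = Zsum (\<lambda>r. (\<Sum>y\<in>range (vrep p {0<..<n}). of_bool [dot {0<..<n} y z = r] (mod int p)) * cos11 (s + r))"
    unfolding Zsum_def sum_distrib_right by (rule sum.swap)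
  also have "\<dots> = Zsum (\<lambda>r. real (h 0) * cos11 (s + r))"
  proof -
    have "(\<Sum>y\<in>range (vrep p {0<..<n}). of_bool [dot {0<..<n} y z = r] (mod int p)) = real (h 0)" for r
    proof -
      have "(\<Sum>y\<in>range (vrep p {0<..<n}). of_bool [dot {0<..<n} y z = r] (mod int p)) =
          real_of_int (\<Sum>y\<in>range (vrep p {0<..<n}). of_bool [dot {0<..<n} y z = r] (mod int p))"
        by simp
      then show ?thesis unfolding W.sum_of_bool_size h_def[symmetric] using h[of r] by simp
    qed
    then show ?thesis by simp
  qed
  also have "\<dots> = real (h 0) * Zsum cos11"
    unfolding Zsum_cmult using Zsum_translate[OF per0, of s] by (simp add: add.commute)
  also have "Zsum cos11 = 0"
    unfolding Zsum_11[OF p]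
    using cos11_values(1,12) cos11_reflect[of 1] cos11_reflect[of 2] cos11_reflect[of 3] cos11_reflect[of 4] cos11_reflect[of 5]
    by simp
  finally show ?thesis using False by simp
qed

lemma sum_over_set_split:
  fixes F :: "(nat \<Rightarrow> int) \<Rightarrow> real"
  assumes A: "V.vper A" and F: "\<And>x. F (vrep p {..<n} x) = F x"
  shows "(\<Sum>a\<in>A \<inter> range (vrep p {..<n}). F a) =
    (\<Sum>u\<in>range (vrep p {0<..<n}). Zsum (\<lambda>t. of_bool (u(0 := t) \<in> A) * F (u(0 := t))))"
proof -
  have "(\<Sum>a\<in>A \<inter> range (vrep p {..<n}). F a) = (\<Sum>a\<in>range (vrep p {..<n}). of_bool (a \<in> A) * F a)"
    using V.finite_range_vrep by (intro sum.mono_neutral_cong_left) auto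
  also have "\<dots> = (\<Sum>u\<in>range (vrep p {0<..<n}). Zsum (\<lambda>t. of_bool (u(0 := t) \<in> A) * F (u(0 := t))))"
    by (rule sum_range_split) (simp add: F V.vs.periodicD[OF A])
  finally show ?thesis .
qed

text \<open>The fibre over u is the part of A on the line through u parallel to the first
  axis.\<close>

definition fibre_sum :: "(nat \<Rightarrow> int) set \<Rightarrow> (nat \<Rightarrow> int) \<Rightarrow> (int \<Rightarrow> real) \<Rightarrow> real" where
  "fibre_sum A u \<phi> = Zsum (\<lambda>t. of_bool (u(0 := t) \<in> A) * \<phi> t)"

lemma fibre_sum_rep:
  assumes "V.vper A"
  shows "fibre_sum A (vrep p {0<..<n} u) \<phi> = fibre_sum A u \<phi>"
proof -
  have "(vrep p {0<..<n} u)(0 := t) \<in> A \<longleftrightarrow> u(0 := t) \<in> A" for t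
    by (rule V.vper_cong[OF assms]) (auto simp: vrep_def cong_def)
  then show ?thesis by (simp add: fibre_sum_def)
qed

text \<open>For the functionals with first coefficient 1 let C be the real part of the exponential
  sum over A and \<Psi> its squared modulus. Orthogonality expresses the sum of \<Psi> by the
  autocorrelations \<open>E\<close> of the fibres, and the sum of C \<Psi> by the correlations
  \<open>G\<close> of the fibres over u, v and u + v. The pointwise bound, summed over u and v,
  makes the sum of (C + 5/4 q) \<Psi> negative, and \<Psi> \<ge> 0, so some C is below - 5/4
  q.\<close>

lemma exists_cosine_functional:
  fixes A :: "(nat \<Rightarrow> int) set"
  defines "q \<equiv> real (p ^ (n - 1))"
  assumes p: "p = 11" and A: "V.vper A" and sf: "\<And>a b. a \<in> A \<Longrightarrow> b \<in> A \<Longrightarrow> a + b \<notin> A"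
    and large: "3 * q \<le> real (V.vsz A)"
    and gap: "\<And>x t. x \<in> A \<Longrightarrow> 4 \<le> t \<Longrightarrow> t \<le> 7 \<Longrightarrow> x(0 := x 0 + t) \<notin> A"
  shows "\<exists>y. (\<Sum>a\<in>A \<inter> range (vrep p {..<n}). cos11 (dot {..<n} (y(0 := 1)) a)) < - 5 / 4 * q"
proof -
  let ?R = "range (vrep p {0<..<n})" and ?F = "A \<inter> range (vrep p {..<n})"
  let ?d = "\<lambda>y a. dot {..<n} (y(0 := 1)) a"
  have q: "q > 0" using p by (simp add: q_def)
  have finR: "finite ?R" by (rule W.finite_range_vrep)
  have cardR: "real (card ?R) = q" by (simp add: W_index q_def)
  have cos_per: "per_fun (\<lambda>t. cos11 (a + t))" "per_fun (\<lambda>t. cos11 (a - t))" for a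
  proof -
    show "per_fun (\<lambda>t. cos11 (a + t))" "per_fun (\<lambda>t. cos11 (a - t))"
      by (rule per_funI, rule cos11_cong[OF p], erule cong_add[OF cong_refl] cong_diff[OF cong_refl])+
  qed
  have "\<exists>s us. us \<in> set shapes \<and> (\<forall>i\<in>set us. u(0 := s + int i) \<in> A) \<and>
      (\<forall>\<phi>. per_fun \<phi> \<longrightarrow> fibre_sum A u \<phi> = (\<Sum>i\<leftarrow>us. \<phi> (s + int i)))" for u
  proof -
    let ?X = "{t. u(0 := t) \<in> A}"
    have "per ?X"
    proof (rule perI)
      fix x y assume xy: "[x = y] (mod int p)" "x \<in> ?X"
      then have "u(0 := x) \<in> A \<longleftrightarrow> u(0 := y) \<in> A" by (intro V.vper_cong[OF A]) auto
      then show "y \<in> ?X" using xy by simp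
    qed
    moreover have "x + t \<notin> ?X" if "x \<in> ?X" "4 \<le> t" "t \<le> 7" for x t
      using gap[of "u(0 := x)" t] that by simp
    ultimately show ?thesis using short_arc[OF p, of ?X] unfolding fibre_sum_def by simp
  qed
  then obtain s us where us: "\<And>u. us u \<in> set shapes" "\<And>u i. i \<in> set (us u) \<Longrightarrow> u(0 := s u + int i) \<in> A"
    "\<And>u \<phi>. per_fun \<phi> \<Longrightarrow> fibre_sum A u \<phi> = (\<Sum>i\<leftarrow>us u. \<phi> (s u + int i))" by metis
  define D where "D u = 3 - fibre_sum A u (\<lambda>_. 1)" for u
  define E where "E u = fibre_sum A u (\<lambda>t. fibre_sum A u (\<lambda>r. cos11 (t - r)))" for u
  define G where "G u v = fibre_sum A u (\<lambda>t. fibre_sum A v (\<lambda>r. fibre_sum A (u + v) (\<lambda>z. cos11 (t + r - z))))" for u v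
  have per_sum: "per_fun (\<lambda>t. \<Sum>i\<leftarrow>xs. f i t)" if "\<And>i. per_fun (f i)" for xs :: "nat list" and f :: "nat \<Rightarrow> int \<Rightarrow> real"
    using that unfolding per_fun_def by simp
  have cos_per': "per_fun (\<lambda>t. cos11 (t + a))" for a
    using cos_per(1)[of a] by (simp add: add.commute)
  have D_eq: "D u = of_int (deficit (us u))" for u
  proof -
    have "fibre_sum A u (\<lambda>_. 1) = real (length (us u))"
      using us(3)[of "\<lambda>_. 1" u] by (simp add: per_fun_def sum_list_triv)
    then show ?thesis by (simp add: D_def deficit_def)
  qed
  have E_eq: "E u = (\<Sum>i\<leftarrow>us u. \<Sum>j\<leftarrow>us u. cos11 (int i - int j))" for u
  proof -
    have 1: "fibre_sum A u (\<lambda>r. cos11 (t - r)) = (\<Sum>j\<leftarrow>us u. cos11 (t - (s u + int j)))" for t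
      by (rule us(3)[OF cos_per(2)])
    have 2: "fibre_sum A u (\<lambda>t. \<Sum>j\<leftarrow>us u. cos11 (t - (s u + int j))) =
        (\<Sum>i\<leftarrow>us u. \<Sum>j\<leftarrow>us u. cos11 (s u + int i - (s u + int j)))"
    proof (rule us(3), rule per_sum)
      fix j
      show "per_fun (\<lambda>t. cos11 (t - (s u + int j)))" using cos_per'[of "- (s u + int j)"] by (simp only: add_uminus_conv_diff)
    qed
    show ?thesis unfolding E_def 1 2 by simp
  qed
  \<comment> \<open>Apart from the shapes, only the offset of the three starting points modulo 11
    enters, which leaves finitely many cases.\<close>
  have G_eq: "G u v = (\<Sum>i\<leftarrow>us u. \<Sum>j\<leftarrow>us v. \<Sum>k\<leftarrow>us (u + v). cos11 ((s u + s v - s (u + v)) mod 11 + int i + int j - int k))" for u v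
  proof -
    have 1: "fibre_sum A (u + v) (\<lambda>z. cos11 (t + r - z)) = (\<Sum>k\<leftarrow>us (u + v). cos11 (t + r - (s (u + v) + int k)))" for t r
      by (rule us(3)[OF cos_per(2)])
    have 2: "fibre_sum A v (\<lambda>r. \<Sum>k\<leftarrow>us (u + v). cos11 (t + r - (s (u + v) + int k))) =
        (\<Sum>j\<leftarrow>us v. \<Sum>k\<leftarrow>us (u + v). cos11 (t + (s v + int j) - (s (u + v) + int k)))" for t
    proof (rule us(3), rule per_sum)
      fix k
      show "per_fun (\<lambda>r. cos11 (t + r - (s (u + v) + int k)))"
        using cos_per'[of "t - (s (u + v) + int k)"] by (simp add: algebra_simps)
    qed
    have 3: "fibre_sum A u (\<lambda>t. \<Sum>j\<leftarrow>us v. \<Sum>k\<leftarrow>us (u + v). cos11 (t + (s v + int j) - (s (u + v) + int k))) =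
        (\<Sum>i\<leftarrow>us u. \<Sum>j\<leftarrow>us v. \<Sum>k\<leftarrow>us (u + v). cos11 (s u + int i + (s v + int j) - (s (u + v) + int k)))"
    proof (rule us(3), rule per_sum, rule per_sum)
      fix j k
      show "per_fun (\<lambda>t. cos11 (t + (s v + int j) - (s (u + v) + int k)))"
        using cos_per'[of "s v + int j - (s (u + v) + int k)"] by (simp add: algebra_simps)
    qed
    have 4: "cos11 (s u + int i + (s v + int j) - (s (u + v) + int k)) =
        cos11 ((s u + s v - s (u + v)) mod 11 + int i + int j - int k)" for i j k
    proof -
      have "s u + int i + (s v + int j) - (s (u + v) + int k) =
          ((s u + s v - s (u + v)) mod 11 + int i + int j - int k) + 11 * ((s u + s v - s (u + v)) div 11)"
        using div_mult_mod_eq[of "s u + s v - s (u + v)" 11] by linarith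
      then show ?thesis by (simp only: cos11_periodic)
    qed
    show ?thesis unfolding G_def 1 2 3 4 ..
  qed
  have point: "G u v + 5 / 12 * (E u + E v + E (u + v)) <
      19 / 4 * (D u + D v + D (u + v)) - 7 / 5 * (D u * D v + D u * D (u + v) + D v * D (u + v))" for u v
  proof -
    let ?e = "(s u + s v - s (u + v)) mod 11"
    have "(?e + int i + int j - int k) mod 11 \<noteq> 0"
      if ijk: "i \<in> set (us u)" "j \<in> set (us v)" "k \<in> set (us (u + v))" for i j k
    proof
      assume "(?e + int i + int j - int k) mod 11 = 0"
      moreover have "(s u + int i + (s v + int j)) - (s (u + v) + int k) =
          (?e + int i + int j - int k) + 11 * ((s u + s v - s (u + v)) div 11)"
        using div_mult_mod_eq[of "s u + s v - s (u + v)" 11] by linarith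
      ultimately have eq: "(s u + int i + (s v + int j)) mod 11 = (s (u + v) + int k) mod 11"
        unfolding mod_eq_dvd_iff by (metis dvd_add dvd_eq_mod_eq_0 dvd_triv_left)
      have "u(0 := s u + int i) + v(0 := s v + int j) \<notin> A" using sf us(2) ijk by blast
      moreover have "u(0 := s u + int i) + v(0 := s v + int j) \<in> A \<longleftrightarrow> (u + v)(0 := s (u + v) + int k) \<in> A"
        using eq by (intro V.vper_cong[OF A]) (auto simp: cong_def p)
      ultimately show False using us(2)[OF ijk(3)] by blast
    qed
    then show ?thesis
      unfolding G_eq E_eq D_eq using pointwise_bound[OF us(1) us(1) us(1), of ?e u v "u + v"] by simp
  qed
  define SD SE where "SD = (\<Sum>u\<in>?R. D u)" and "SE = (\<Sum>u\<in>?R. E u)"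
  have shift: "(\<Sum>v\<in>?R. f (u + v)) = (\<Sum>v\<in>?R. f v)" if "\<And>x. f (vrep p {0<..<n} x) = f x"
    for f :: "(nat \<Rightarrow> int) \<Rightarrow> real" and u
    using W.vs.sum_translate[of f u] that by (simp add: add.commute)
  have D_rep: "D (vrep p {0<..<n} u) = D u" and E_rep: "E (vrep p {0<..<n} u) = E u" for u
    unfolding D_def E_def fibre_sum_rep[OF A] by simp_all
  have "SD \<le> 0"
  proof -
    have "(\<Sum>a\<in>?F. 1) = (\<Sum>u\<in>?R. fibre_sum A u (\<lambda>_. 1))"
      unfolding fibre_sum_def by (rule sum_over_set_split[OF A]) simp
    then have "real (V.vsz A) = (\<Sum>u\<in>?R. fibre_sum A u (\<lambda>_. 1))" by (simp add: V.vs.size_of_def)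
    then have "SD = 3 * q - real (V.vsz A)" by (simp add: SD_def D_def sum_subtractf cardR[symmetric])
    then show ?thesis using large by simp
  qed
  \<comment> \<open>Each fibre occurs equally often in the roles of u, v and u + v, so the factor
    5/12 becomes 5/4.\<close>
  have total: "(\<Sum>u\<in>?R. \<Sum>v\<in>?R. G u v) + 5 / 4 * q * SE < 0"
  proof -
    have "(\<Sum>u\<in>?R. \<Sum>v\<in>?R. G u v + 5 / 12 * (E u + E v + E (u + v))) <
        (\<Sum>u\<in>?R. \<Sum>v\<in>?R. 19 / 4 * (D u + D v + D (u + v)) - 7 / 5 * (D u * D v + D u * D (u + v) + D v * D (u + v)))"
      using finR point by (intro sum_strict_mono) auto
    also have "\<dots> = 19 / 4 * (3 * q * SD) - 7 / 5 * (3 * SD\<^sup>2)"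
    proof -
      have row: "(\<Sum>v\<in>?R. 19 / 4 * (D u + D v + D (u + v)) - 7 / 5 * (D u * D v + D u * D (u + v) + D v * D (u + v))) =
          19 / 4 * (q * D u + 2 * SD) - 7 / 5 * (2 * D u * SD + (\<Sum>v\<in>?R. D v * D (u + v)))" for u
      proof -
        have "(\<Sum>v\<in>?R. 19 / 4 * (D u + D v + D (u + v)) - 7 / 5 * (D u * D v + D u * D (u + v) + D v * D (u + v))) =
            19 / 4 * (q * D u + SD + SD) - 7 / 5 * (D u * SD + D u * SD + (\<Sum>v\<in>?R. D v * D (u + v)))"
          by (simp only: sum_subtractf sum.distrib sum_distrib_left[symmetric] sum_constant shift[of D, OF D_rep]
              SD_def[symmetric] cardR)
        then show ?thesis by (simp add: algebra_simps)
      qed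
      have cross: "(\<Sum>u\<in>?R. \<Sum>v\<in>?R. D v * D (u + v)) = SD\<^sup>2"
      proof -
        have "(\<Sum>u\<in>?R. \<Sum>v\<in>?R. D v * D (u + v)) = (\<Sum>v\<in>?R. \<Sum>u\<in>?R. D v * D (v + u))"
          by (subst sum.swap) (simp add: add.commute)
        also have "\<dots> = (\<Sum>v\<in>?R. D v * SD)"
          by (simp only: sum_distrib_left[symmetric] shift[of D, OF D_rep] SD_def)
        finally show ?thesis by (simp add: sum_distrib_right[symmetric] SD_def power2_eq_square)
      qed
      have "(\<Sum>u\<in>?R. 19 / 4 * (q * D u + 2 * SD) - 7 / 5 * (2 * D u * SD + (\<Sum>v\<in>?R. D v * D (u + v)))) =
          19 / 4 * (q * SD + 2 * (real (card ?R) * SD)) - 7 / 5 * (2 * SD * SD + (\<Sum>u\<in>?R. \<Sum>v\<in>?R. D v * D (u + v)))"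
        by (simp only: sum_subtractf sum.distrib sum_distrib_left[symmetric] sum_distrib_right[symmetric]
            sum_constant SD_def[symmetric])
      then show ?thesis unfolding row cross cardR by (simp add: algebra_simps power2_eq_square)
    qed
    also have "\<dots> \<le> 0"
    proof -
      have "q * SD \<le> 0" "0 \<le> SD\<^sup>2" using \<open>SD \<le> 0\<close> q by (simp_all add: mult_nonneg_nonpos)
      then show ?thesis by linarith
    qed
    finally have "(\<Sum>u\<in>?R. \<Sum>v\<in>?R. G u v + 5 / 12 * (E u + E v + E (u + v))) < 0" .
    moreover have "(\<Sum>v\<in>?R. G u v + 5 / 12 * (E u + E v + E (u + v))) =
        (\<Sum>v\<in>?R. G u v) + 5 / 12 * (q * E u + SE + SE)" for u
      by (simp only: sum.distrib sum_distrib_left[symmetric] sum_constant shift[of E, OF E_rep] SE_def[symmetric] cardR)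
    ultimately have "(\<Sum>u\<in>?R. (\<Sum>v\<in>?R. G u v) + 5 / 12 * (q * E u + SE + SE)) < 0" by simp
    moreover have "(\<Sum>u\<in>?R. (\<Sum>v\<in>?R. G u v) + 5 / 12 * (q * E u + SE + SE)) =
        (\<Sum>u\<in>?R. \<Sum>v\<in>?R. G u v) + 5 / 12 * (q * SE + q * SE + q * SE)"
      by (simp only: sum.distrib sum_distrib_left[symmetric] sum_constant SE_def[symmetric] cardR)
    ultimately show ?thesis by (simp add: algebra_simps)
  qed
  define C \<Psi> where "C y = (\<Sum>a\<in>?F. cos11 (?d y a))" and "\<Psi> y = (\<Sum>a\<in>?F. \<Sum>b\<in>?F. cos11 (?d y a - ?d y b))" for y
  have \<Psi>_nonneg: "\<Psi> y \<ge> 0" for y unfolding \<Psi>_def sum_cos11_diff by simp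
  have tail0: "vrep p {0<..<n} (x - x') = 0 \<longleftrightarrow> vrep p {0<..<n} x = vrep p {0<..<n} x'" for x x'
  proof -
    have "vrep p {0<..<n} (x - x') = 0 \<longleftrightarrow> (\<forall>i\<in>{0<..<n}. (x i - x' i) mod int p = 0)"
      by (auto simp: vrep_def fun_eq_iff)
    then show ?thesis unfolding W.vrep_eq_iff by (simp add: cong_iff_dvd_diff dvd_eq_mod_eq_0)
  qed
  have cos_compat: "cos11 (vrep p {..<n} x 0 + a) = cos11 (x 0 + a)" for x a
  proof -
    have "(vrep p {..<n} x 0 + a) mod 11 = (x 0 + a) mod 11" using n_pos by (simp add: vrep_def p mod_add_left_eq)
    then show ?thesis by (metis cos11_mod)
  qed
  have cos_compat_diff: "cos11 (a - vrep p {..<n} x 0) = cos11 (a - x 0)" for a x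
    using cos_compat[of x "- a"] cos11_uminus[of "a - vrep p {..<n} x 0"] cos11_uminus[of "a - x 0"] by simp
  have tail_compat: "vrep p {0<..<n} (vrep p {..<n} x + a) = vrep p {0<..<n} (x + a)" for x a
    by (auto simp: vrep_def fun_eq_iff mod_add_left_eq)
  have tail_compat0: "vrep p {0<..<n} (vrep p {..<n} x) = vrep p {0<..<n} x" for x
    using tail_compat[of x 0] by simp
  have tail_upd: "vrep p {0<..<n} (u(0 := t)) = vrep p {0<..<n} u" for u t
    by (auto simp: vrep_def fun_eq_iff)
  have tail_upd_add: "vrep p {0<..<n} (u(0 := t) + v(0 := r)) = vrep p {0<..<n} (u + v)" for u v t r
    by (auto simp: vrep_def fun_eq_iff)
  have single: "(\<Sum>w\<in>?R. fibre_sum A w (\<lambda>r. of_bool (vrep p {0<..<n} z = vrep p {0<..<n} w) * \<phi> r)) = fibre_sum A z \<phi>" for z \<phi>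
  proof -
    have "(\<Sum>w\<in>?R. fibre_sum A w (\<lambda>r. of_bool (vrep p {0<..<n} z = vrep p {0<..<n} w) * \<phi> r)) =
        (\<Sum>w\<in>?R. if w = vrep p {0<..<n} z then fibre_sum A w \<phi> else 0)"
      by (rule sum.cong) (auto simp: fibre_sum_def Zsum_def)
    also have "\<dots> = fibre_sum A (vrep p {0<..<n} z) \<phi>" using finR by simp
    finally show ?thesis by (simp add: fibre_sum_rep[OF A])
  qed
  have sum\<Psi>: "(\<Sum>y\<in>?R. \<Psi> y) = q * SE"
  proof -
    have "(\<Sum>y\<in>?R. \<Psi> y) = (\<Sum>a\<in>?F. \<Sum>b\<in>?F. \<Sum>y\<in>?R. cos11 (?d y a - ?d y b))"
      unfolding \<Psi>_def by (rule sum_swap_2)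
    also have "\<dots> = (\<Sum>a\<in>?F. \<Sum>b\<in>?F. q * (of_bool (vrep p {0<..<n} a = vrep p {0<..<n} b) * cos11 (a 0 - b 0)))"
    proof (intro sum.cong refl)
      fix a b
      have "?d y a - ?d y b = (a 0 - b 0) + dot {0<..<n} y (a - b)" for y
        by (simp add: dot_split dot_diff_right)
      then show "(\<Sum>y\<in>?R. cos11 (?d y a - ?d y b)) = q * (of_bool (vrep p {0<..<n} a = vrep p {0<..<n} b) * cos11 (a 0 - b 0))"
        by (simp only: sum_cos11_functionals[OF p] tail0) (simp add: q_def)
    qed
    also have "\<dots> = q * (\<Sum>a\<in>?F. \<Sum>b\<in>?F. of_bool (vrep p {0<..<n} a = vrep p {0<..<n} b) * cos11 (a 0 - b 0))"
      by (simp only: sum_distrib_left)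
    also have "(\<Sum>a\<in>?F. \<Sum>b\<in>?F. of_bool (vrep p {0<..<n} a = vrep p {0<..<n} b) * cos11 (a 0 - b 0)) =
        (\<Sum>a\<in>?F. fibre_sum A a (\<lambda>r. cos11 (a 0 - r)))"
    proof (rule sum.cong[OF refl])
      fix a
      have "(\<Sum>b\<in>?F. of_bool (vrep p {0<..<n} a = vrep p {0<..<n} b) * cos11 (a 0 - b 0)) =
          (\<Sum>w\<in>?R. Zsum (\<lambda>t. of_bool (w(0 := t) \<in> A) * (of_bool (vrep p {0<..<n} a = vrep p {0<..<n} (w(0 := t))) * cos11 (a 0 - (w(0 := t)) 0))))"
      proof (rule sum_over_set_split[OF A])
        fix x
        note cos_compat_diff[of "a 0" x]
        then show "of_bool (vrep p {0<..<n} a = vrep p {0<..<n} (vrep p {..<n} x)) * cos11 (a 0 - vrep p {..<n} x 0) =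
            of_bool (vrep p {0<..<n} a = vrep p {0<..<n} x) * cos11 (a 0 - x 0)" by (simp add: tail_compat0)
      qed
      also have "\<dots> = (\<Sum>w\<in>?R. fibre_sum A w (\<lambda>t. of_bool (vrep p {0<..<n} a = vrep p {0<..<n} w) * cos11 (a 0 - t)))"
        by (simp add: fibre_sum_def tail_upd)
      finally show "(\<Sum>b\<in>?F. of_bool (vrep p {0<..<n} a = vrep p {0<..<n} b) * cos11 (a 0 - b 0)) =
          fibre_sum A a (\<lambda>r. cos11 (a 0 - r))" by (simp only: single)
    qed
    also have "\<dots> = (\<Sum>u\<in>?R. Zsum (\<lambda>t. of_bool (u(0 := t) \<in> A) * fibre_sum A (u(0 := t)) (\<lambda>r. cos11 ((u(0 := t)) 0 - r))))"
    proof (rule sum_over_set_split[OF A])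
      fix x
      have "fibre_sum A (vrep p {..<n} x) \<phi> = fibre_sum A x \<phi>" for \<phi>
        using fibre_sum_rep[OF A, of "vrep p {..<n} x" \<phi>] fibre_sum_rep[OF A, of x \<phi>] by (simp add: tail_compat0)
      moreover have "cos11 (vrep p {..<n} x 0 - r) = cos11 (x 0 - r)" for r using cos_compat[of x "- r"] by simp
      ultimately show "fibre_sum A (vrep p {..<n} x) (\<lambda>r. cos11 (vrep p {..<n} x 0 - r)) = fibre_sum A x (\<lambda>r. cos11 (x 0 - r))" by simp
    qed
    also have "\<dots> = SE"
      unfolding SE_def E_def fibre_sum_def by simp
    finally show ?thesis .
  qed
  have sum\<Phi>: "(\<Sum>y\<in>?R. C y * \<Psi> y) = q * (\<Sum>u\<in>?R. \<Sum>v\<in>?R. G u v)"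
  proof -
    have "(\<Sum>y\<in>?R. C y * \<Psi> y) = (\<Sum>a\<in>?F. \<Sum>b\<in>?F. \<Sum>c\<in>?F. \<Sum>y\<in>?R. cos11 (?d y a + ?d y b - ?d y c))"
      unfolding C_def \<Psi>_def sum_cos11_triple[symmetric] by (rule sum_swap_3)
    also have "\<dots> = (\<Sum>a\<in>?F. \<Sum>b\<in>?F. \<Sum>c\<in>?F. q * (of_bool (vrep p {0<..<n} (a + b) = vrep p {0<..<n} c) * cos11 (a 0 + b 0 - c 0)))"
    proof (intro sum.cong refl)
      fix a b c
      have "?d y a + ?d y b - ?d y c = (a 0 + b 0 - c 0) + dot {0<..<n} y ((a + b) - c)" for y
        by (simp add: dot_split dot_diff_right dot_add_right)
      then show "(\<Sum>y\<in>?R. cos11 (?d y a + ?d y b - ?d y c)) = q * (of_bool (vrep p {0<..<n} (a + b) = vrep p {0<..<n} c) * cos11 (a 0 + b 0 - c 0))"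
        by (simp only: sum_cos11_functionals[OF p] tail0) (simp add: q_def)
    qed
    also have "\<dots> = q * (\<Sum>a\<in>?F. \<Sum>b\<in>?F. \<Sum>c\<in>?F. of_bool (vrep p {0<..<n} (a + b) = vrep p {0<..<n} c) * cos11 (a 0 + b 0 - c 0))"
      by (simp only: sum_distrib_left)
    also have "(\<Sum>a\<in>?F. \<Sum>b\<in>?F. \<Sum>c\<in>?F. of_bool (vrep p {0<..<n} (a + b) = vrep p {0<..<n} c) * cos11 (a 0 + b 0 - c 0)) =
        (\<Sum>a\<in>?F. \<Sum>b\<in>?F. fibre_sum A (a + b) (\<lambda>r. cos11 (a 0 + b 0 - r)))"
    proof (intro sum.cong refl)
      fix a b
      have "(\<Sum>c\<in>?F. of_bool (vrep p {0<..<n} (a + b) = vrep p {0<..<n} c) * cos11 (a 0 + b 0 - c 0)) =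
          (\<Sum>w\<in>?R. Zsum (\<lambda>t. of_bool (w(0 := t) \<in> A) * (of_bool (vrep p {0<..<n} (a + b) = vrep p {0<..<n} (w(0 := t))) * cos11 (a 0 + b 0 - (w(0 := t)) 0))))"
      proof (rule sum_over_set_split[OF A])
        fix x
        note cos_compat_diff[of "a 0 + b 0" x]
        then show "of_bool (vrep p {0<..<n} (a + b) = vrep p {0<..<n} (vrep p {..<n} x)) * cos11 (a 0 + b 0 - vrep p {..<n} x 0) =
            of_bool (vrep p {0<..<n} (a + b) = vrep p {0<..<n} x) * cos11 (a 0 + b 0 - x 0)" by (simp add: tail_compat0)
      qed
      also have "\<dots> = (\<Sum>w\<in>?R. fibre_sum A w (\<lambda>t. of_bool (vrep p {0<..<n} (a + b) = vrep p {0<..<n} w) * cos11 (a 0 + b 0 - t)))"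
        by (simp add: fibre_sum_def tail_upd)
      finally show "(\<Sum>c\<in>?F. of_bool (vrep p {0<..<n} (a + b) = vrep p {0<..<n} c) * cos11 (a 0 + b 0 - c 0)) =
          fibre_sum A (a + b) (\<lambda>r. cos11 (a 0 + b 0 - r))" by (simp only: single)
    qed
    also have "\<dots> = (\<Sum>a\<in>?F. \<Sum>v\<in>?R. fibre_sum A v (\<lambda>r. fibre_sum A (a + v) (\<lambda>z. cos11 (a 0 + r - z))))"
    proof (rule sum.cong[OF refl])
      fix a
      have fib: "fibre_sum A (a + v(0 := r)) \<phi> = fibre_sum A (a + v) \<phi>" for v r \<phi>
        by (subst (1 2) fibre_sum_rep[OF A, symmetric], rule arg_cong[where f = "\<lambda>u. fibre_sum A u \<phi>"])
          (auto simp: vrep_def fun_eq_iff)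
      have "(\<Sum>b\<in>?F. fibre_sum A (a + b) (\<lambda>r. cos11 (a 0 + b 0 - r))) =
          (\<Sum>v\<in>?R. Zsum (\<lambda>r. of_bool (v(0 := r) \<in> A) * fibre_sum A (a + v(0 := r)) (\<lambda>z. cos11 (a 0 + (v(0 := r)) 0 - z))))"
      proof (rule sum_over_set_split[OF A])
        fix x
        have "fibre_sum A (a + vrep p {..<n} x) \<phi> = fibre_sum A (a + x) \<phi>" for \<phi>
          using fibre_sum_rep[OF A, of "a + vrep p {..<n} x" \<phi>] fibre_sum_rep[OF A, of "a + x" \<phi>]
            tail_compat[of x a] by (simp add: add.commute)
        moreover have "cos11 (a 0 + vrep p {..<n} x 0 - r) = cos11 (a 0 + x 0 - r)" for r
          using cos_compat[of x "a 0 - r"] by (simp add: algebra_simps)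
        ultimately show "fibre_sum A (a + vrep p {..<n} x) (\<lambda>r. cos11 (a 0 + vrep p {..<n} x 0 - r)) =
            fibre_sum A (a + x) (\<lambda>r. cos11 (a 0 + x 0 - r))" by simp
      qed
      then show "(\<Sum>b\<in>?F. fibre_sum A (a + b) (\<lambda>r. cos11 (a 0 + b 0 - r))) =
          (\<Sum>v\<in>?R. fibre_sum A v (\<lambda>r. fibre_sum A (a + v) (\<lambda>z. cos11 (a 0 + r - z))))"
        unfolding fib by (simp add: fibre_sum_def)
    qed
    also have "\<dots> = (\<Sum>u\<in>?R. Zsum (\<lambda>t. of_bool (u(0 := t) \<in> A) *
        (\<Sum>v\<in>?R. fibre_sum A v (\<lambda>r. fibre_sum A (u(0 := t) + v) (\<lambda>z. cos11 ((u(0 := t)) 0 + r - z))))))"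
    proof (rule sum_over_set_split[OF A])
      fix x
      have "fibre_sum A (vrep p {..<n} x + v) \<phi> = fibre_sum A (x + v) \<phi>" for v \<phi>
        using fibre_sum_rep[OF A, of "vrep p {..<n} x + v" \<phi>] fibre_sum_rep[OF A, of "x + v" \<phi>]
          tail_compat[of x v] by simp
      moreover have "cos11 (vrep p {..<n} x 0 + r - z) = cos11 (x 0 + r - z)" for r z
        using cos_compat[of x "r - z"] by (simp add: algebra_simps)
      ultimately show "(\<Sum>v\<in>?R. fibre_sum A v (\<lambda>r. fibre_sum A (vrep p {..<n} x + v) (\<lambda>z. cos11 (vrep p {..<n} x 0 + r - z)))) =
          (\<Sum>v\<in>?R. fibre_sum A v (\<lambda>r. fibre_sum A (x + v) (\<lambda>z. cos11 (x 0 + r - z))))" by simp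
    qed
    also have "\<dots> = (\<Sum>u\<in>?R. fibre_sum A u (\<lambda>t. \<Sum>v\<in>?R. fibre_sum A v (\<lambda>r. fibre_sum A (u + v) (\<lambda>z. cos11 (t + r - z)))))"
    proof -
      have "fibre_sum A (u(0 := t) + v) \<phi> = fibre_sum A (u + v) \<phi>" for u v t \<phi>
        by (subst (1 2) fibre_sum_rep[OF A, symmetric], rule arg_cong[where f = "\<lambda>u. fibre_sum A u \<phi>"])
          (auto simp: vrep_def fun_eq_iff)
      then show ?thesis by (simp add: fibre_sum_def)
    qed
    also have "\<dots> = (\<Sum>u\<in>?R. \<Sum>v\<in>?R. G u v)"
    proof (rule sum.cong[OF refl])
      fix u
      have "fibre_sum A u (\<lambda>t. \<Sum>v\<in>?R. H v t) = (\<Sum>v\<in>?R. fibre_sum A u (H v))" for H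
        unfolding fibre_sum_def Zsum_def sum_distrib_left by (rule sum.swap)
      then show "fibre_sum A u (\<lambda>t. \<Sum>v\<in>?R. fibre_sum A v (\<lambda>r. fibre_sum A (u + v) (\<lambda>z. cos11 (t + r - z)))) = (\<Sum>v\<in>?R. G u v)"
        by (simp only: G_def)
    qed
    finally show ?thesis .
  qed
  have "(\<Sum>y\<in>?R. (C y + 5 / 4 * q) * \<Psi> y) = q * ((\<Sum>u\<in>?R. \<Sum>v\<in>?R. G u v) + 5 / 4 * q * SE)"
    unfolding distrib_right sum.distrib sum\<Phi> sum_distrib_left[symmetric] sum\<Psi> by (simp add: algebra_simps)
  also have "\<dots> < 0" using total q by (simp add: mult_pos_neg)
  finally have neg: "(\<Sum>y\<in>?R. (C y + 5 / 4 * q) * \<Psi> y) < 0" .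
  have "\<exists>y\<in>?R. C y + 5 / 4 * q < 0"
  proof (rule ccontr)
    assume "\<not> ?thesis"
    then have "0 \<le> (\<Sum>y\<in>?R. (C y + 5 / 4 * q) * \<Psi> y)"
      using \<Psi>_nonneg by (intro sum_nonneg mult_nonneg_nonneg) (auto simp: not_less)
    then show False using neg by simp
  qed
  then obtain y where "C y + 5 / 4 * q < 0" by blast
  then have "C y < - 5 / 4 * q" by simp
  then show ?thesis unfolding C_def by blast
qed

end

context coordinate_space
begin

lemma automorphic_scale:
  assumes "\<not> int p dvd c"
  obtains g where "vs.automorphic (\<lambda>x i. c * x i) g"
proof -
  obtain d where d: "[c * d = 1] (mod int p)" using obtain_inverse[OF assms] by blast
  have "vs.automorphic (\<lambda>x i. c * x i) (\<lambda>x i. d * x i)"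
    unfolding vs.automorphic_def vrep_eq_iff
    using cong_cancel_inverse[OF d] by (auto simp: distrib_left intro!: cong_scalar_left cong_vrep)
  then show thesis by (rule that)
qed

lemma sum_real_slices:
  assumes "per_fun (\<phi> :: int \<Rightarrow> real)"
  shows "(\<Sum>a\<in>A \<inter> range (vrep p I). \<phi> (dot I y a)) = Zsum (\<lambda>i. of_int (slice_size A y i) * \<phi> i)"
proof -
  have "(\<Sum>a\<in>A \<inter> range (vrep p I). \<phi> (dot I y a)) =
      (\<Sum>a\<in>A \<inter> range (vrep p I). Zsum (\<lambda>i. of_bool [dot I y a = i] (mod int p) * \<phi> i))"
    by (simp only: Zsum_indicator[OF assms])
  also have "\<dots> = Zsum (\<lambda>i. \<Sum>a\<in>A \<inter> range (vrep p I). of_bool [dot I y a = i] (mod int p) * \<phi> i)"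
    unfolding Zsum_def by (rule sum.swap)
  also have "\<dots> = Zsum (\<lambda>i. of_int (slice_size A y i) * \<phi> i)"
    by (simp add: slice_size_eq_sum sum_distrib_right)
  finally show ?thesis .
qed

end

section \<open>Functionals that are not flat for p = 11, and the reduction to the middle
  interval\<close>

context split_space
begin

text \<open>Some line through 0 contains three points of A: over all 11 q vectors g, the multiples t
  g in A number 10 |A| \<ge> 30 q, more than two per vector. The points of A on it form a sum-free
  set modulo 11, and rescaling puts 4 and 5, up to sign, into that set. Hence no two points of A
  differ by 4 to 7 times the rescaled direction.\<close>

lemma exists_sparse_direction:
  assumes p: "p = 11" and A: "V.vper A" and sf: "\<And>a b. a \<in> A \<Longrightarrow> b \<in> A \<Longrightarrow> a + b \<notin> A"
    and large: "3 * p ^ (n - 1) \<le> V.vsz A"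
  shows "\<exists>g. (\<exists>j<n. \<not> int p dvd g j) \<and> (\<forall>a\<in>A. \<forall>t\<in>{4..7}. a + (\<lambda>i. t * g i) \<notin> A)"
proof -
  let ?R = "range (vrep p {..<n})" and ?N = "int (V.vsz A)"
  have "0 \<notin> A" using sf[of 0 0] by auto
  define X where "X g = {t :: int. (\<lambda>i. t * g i) \<in> A}" for g :: "nat \<Rightarrow> int"
  have "\<exists>g. Zsum (\<lambda>t. of_bool (t \<in> X g)) \<ge> (3 :: int)"
  proof (rule ccontr)
    assume "\<not> ?thesis"
    then have lt: "Zsum (\<lambda>t. of_bool (t \<in> X g)) < (3 :: int)" for g by (simp add: not_le)
    have le: "Zsum (\<lambda>t. of_bool (t \<in> X g)) \<le> (2 :: int)" for g using lt[of g] by linarith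
    have "(\<Sum>g\<in>?R. Zsum (\<lambda>t. of_bool (t \<in> X g))) \<le> (\<Sum>g\<in>?R. (2 :: int))"
      by (intro sum_mono le)
    also have "\<dots> = 22 * int (p ^ (n - 1))" by (simp only: sum_constant V_index) (simp add: p)
    finally have 1: "(\<Sum>g\<in>?R. Zsum (\<lambda>t. of_bool (t \<in> X g))) \<le> 22 * int (p ^ (n - 1))" .
    have "(\<Sum>g\<in>?R. Zsum (\<lambda>t. of_bool (t \<in> X g))) = Zsum (\<lambda>t. int (V.vsz {g. t \<in> X g}))"
      unfolding Zsum_def by (subst sum.swap) (simp only: V.sum_of_bool_size)
    moreover have "V.vsz {g. t \<in> X g} = V.vsz A" if "\<not> 11 dvd t" for t
    proof -
      have "\<not> int p dvd t" using that p by simp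
      then obtain h where "V.vs.automorphic (\<lambda>x i. t * x i) h" using V.automorphic_scale by blast
      from V.vs.size_of_automorphic[OF this A] show ?thesis by (simp add: X_def)
    qed
    moreover have "{g. 0 \<in> X g} = {}" using \<open>0 \<notin> A\<close> by (simp add: X_def zero_fun_def)
    ultimately have "(\<Sum>g\<in>?R. Zsum (\<lambda>t. of_bool (t \<in> X g))) = 10 * ?N"
      by (simp add: Zsum_11[OF p])
    moreover have "int (3 * p ^ (n - 1)) \<le> ?N" using large of_nat_mono by blast
    moreover have "int (p ^ (n - 1)) > 0" using p by simp
    ultimately show False using 1 by simp
  qed
  then obtain g where g: "Zsum (\<lambda>t. of_bool (t \<in> X g)) \<ge> (3 :: int)" by blast
  have range11: "range (zrep p) = {0..<11}" using p by (simp add: range_zrep)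
  have "Zsum (\<lambda>t. of_bool (t \<in> X g)) = int (card (X g \<inter> {0..<11}))"
  proof -
    have "Zsum (\<lambda>t. of_bool (t \<in> X g)) = (\<Sum>t\<in>X g \<inter> {0..<11}. (1::int))"
      unfolding Zsum_def range11 by (intro sum.mono_neutral_cong_right) auto
    then show ?thesis by simp
  qed
  then have card: "card (X g \<inter> {0..<11}) \<ge> 3" using g by simp
  have Xmod: "i mod 11 \<in> X g \<longleftrightarrow> i \<in> X g" for i
    unfolding X_def mem_Collect_eq
    by (rule V.vper_cong[OF A]) (auto simp: p cong_def mod_mult_left_eq)
  have Xsum: "i + j \<notin> X g" if "i \<in> X g" "j \<in> X g" for i j
  proof -
    have "(\<lambda>k. i * g k) + (\<lambda>k. j * g k) = (\<lambda>k. (i + j) * g k)" by (rule ext) (simp add: algebra_simps)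
    then show ?thesis using sf that by (metis X_def mem_Collect_eq)
  qed
  obtain l where l: "\<not> 11 dvd l" "4 * l \<in> X g \<or> - (4 * l) \<in> X g" "5 * l \<in> X g \<or> - (5 * l) \<in> X g"
    using sum_free_11_neighbours[OF Xmod Xsum card] by blast
  have "\<exists>j<n. \<not> int p dvd g j"
  proof (rule ccontr)
    assume none: "\<not> ?thesis"
    obtain t where "t \<in> X g" using l(2) by blast
    moreover have "(\<lambda>i. t * g i) \<in> A \<longleftrightarrow> 0 \<in> A"
      by (rule V.vper_cong[OF A]) (use none in \<open>auto simp: cong_0_iff\<close>)
    ultimately show False using \<open>0 \<notin> A\<close> by (simp add: X_def)
  qed
  then obtain j where j: "j < n" "\<not> int p dvd l * g j"
    using l(1) prime_dvd_mult by (metis p of_nat_numeral)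
  define g' where "g' = (\<lambda>i. l * g i)"
  \<comment> \<open>If t g' lies in A, then a + t g' is a sum of two elements of A; if - t g' does,
    then a is the sum of a + t g' and - t g'.\<close>
  have short: "a + (\<lambda>i. t * g' i) \<notin> A" if a: "a \<in> A" and t: "t = 4 \<or> t = 5" for a t
  proof
    assume b: "a + (\<lambda>i. t * g' i) \<in> A"
    have "t * l \<in> X g \<or> - (t * l) \<in> X g" using l t by auto
    then show False
    proof
      assume "t * l \<in> X g"
      then have "(\<lambda>i. t * g' i) \<in> A" by (simp add: X_def g'_def mult.assoc)
      then show False using sf[OF a] b by blast
    next
      assume "- (t * l) \<in> X g"
      then have "(\<lambda>i. - (t * g' i)) \<in> A" by (simp add: X_def g'_def mult.assoc)
      from sf[OF b this] have "a + (\<lambda>i. t * g' i) + (\<lambda>i. - (t * g' i)) \<notin> A" .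
      moreover have "a + (\<lambda>i. t * g' i) + (\<lambda>i. - (t * g' i)) = a" by (rule ext) simp
      ultimately show False using a by simp
    qed
  qed
  have "a + (\<lambda>i. t * g' i) \<notin> A" if a: "a \<in> A" and t: "t \<in> {4..7}" for a t
  proof (cases "t = 4 \<or> t = 5")
    case True
    then show ?thesis using short a by blast
  next
    case False
    \<comment> \<open>The steps 6 and 7 are the steps 5 and 4 taken backwards modulo 11.\<close>
    then have t': "11 - t = 4 \<or> 11 - t = 5" using t by auto
    show ?thesis
    proof
      assume b: "a + (\<lambda>i. t * g' i) \<in> A"
      from short[OF this t'] have "a + (\<lambda>i. t * g' i) + (\<lambda>i. (11 - t) * g' i) \<notin> A" .
      moreover have "a + (\<lambda>i. t * g' i) + (\<lambda>i. (11 - t) * g' i) \<in> A \<longleftrightarrow> a \<in> A"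
        by (rule V.vper_cong[OF A]) (simp add: p cong_iff_dvd_diff algebra_simps)
      ultimately show False using a by simp
    qed
  qed
  then have "\<forall>a\<in>A. \<forall>t\<in>{4..7}. a + (\<lambda>i. t * g' i) \<notin> A" by blast
  moreover have "\<exists>j<n. \<not> int p dvd g' j" using j unfolding g'_def by blast
  ultimately show ?thesis by (intro exI[of _ g'] conjI)
qed

text \<open>If the functional with cosine sum below - 5/4 q were flat,
  \<open>flat_cosine_bound\<close> for the slice sizes, scaled by 11 and centred, would keep its
  cosine sum at - 27/22 q or above, and - 27/22 > - 5/4. The slices are those of a preimage of A in
  which the sparse direction is the first axis.\<close>

lemma nonflat_after_automorphism_11:
  fixes A :: "(nat \<Rightarrow> int) set"
  assumes p: "p = 11" and A: "V.vper A" and sf: "\<And>a b. a \<in> A \<Longrightarrow> b \<in> A \<Longrightarrow> a + b \<notin> A"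
    and large: "3 * p ^ (n - 1) \<le> V.vsz A"
  obtains f g y i k where "V.vs.automorphic f g" "\<not> int p dvd y 0"
    "int p * (V.slice_size {x. f x \<in> A} y i + V.slice_size {x. f x \<in> A} y k + V.slice_size {x. f x \<in> A} y (i + k))
      > 12 * int (p ^ (n - 1))"
proof -
  define q where "q = int (p ^ (n - 1))"
  obtain v j where v: "j < n" "\<not> int p dvd v j" and dir: "\<And>a t. a \<in> A \<Longrightarrow> t \<in> {4..7} \<Longrightarrow> a + (\<lambda>i. t * v i) \<notin> A"
    using exists_sparse_direction[OF p A sf large] by blast
  obtain f g where fg: "V.vs.automorphic f g"
    and f: "\<And>x t. f (x + (\<lambda>i. if i = 0 then t else 0)) = f x + (\<lambda>i. t * v i)"
    using V.automorphic_vector[of 0 j v] v n_pos by auto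
  define A' where "A' = {x. f x \<in> A}"
  have A': "V.vper A'" "V.vsz A' = V.vsz A"
    unfolding A'_def using V.vs.periodic_automorphic[OF fg A] V.vs.size_of_automorphic[OF fg A] by auto
  have sf': "a + b \<notin> A'" if "a \<in> A'" "b \<in> A'" for a b
    using V.vs.sum_free_automorphic[OF fg A sf] that unfolding A'_def by blast
  have gap: "x(0 := x 0 + t) \<notin> A'" if "x \<in> A'" "4 \<le> t" "t \<le> 7" for x t
  proof -
    have "x(0 := x 0 + t) = x + (\<lambda>i. if i = 0 then t else 0)" by (rule ext) simp
    then show ?thesis using dir[of "f x" t] that f[of x t] by (simp add: A'_def)
  qed
  have large': "3 * real (p ^ (n - 1)) \<le> real (V.vsz A')"
    using large A'(2) by (metis of_nat_le_iff of_nat_mult of_nat_numeral)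
  obtain y where y: "(\<Sum>a\<in>A' \<inter> range (vrep p {..<n}). cos11 (dot {..<n} (y(0 := 1)) a)) < - 5 / 4 * real (p ^ (n - 1))"
    using exists_cosine_functional[OF p A'(1) sf' large' gap] by blast
  define Y where "Y = y(0 := 1)"
  define c where "c = V.slice_size A' Y"
  have per0: "per_fun cos11"
    by (rule per_funI) (metis cos11_mod cong_def p of_nat_numeral)
  have Zcos: "Zsum cos11 = 0"
    unfolding Zsum_11[OF p]
    using cos11_values(1,12) cos11_reflect[of 1] cos11_reflect[of 2] cos11_reflect[of 3] cos11_reflect[of 4] cos11_reflect[of 5]
    by simp
  have C: "Zsum (\<lambda>i. of_int (c i) * cos11 i) < - 5 / 4 * of_int q"
    using y unfolding Y_def[symmetric] V.sum_real_slices[OF per0] by (simp add: c_def q_def)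
  have "\<exists>i k. int p * (c i + c k + c (i + k)) > 12 * q"
  proof (rule ccontr)
    assume "\<not> ?thesis"
    then have le: "11 * (c i + c k + c (i + k)) \<le> 12 * q" for i k using p by (simp add: not_less)
    define N where "N = int (V.vsz A')"
    have N: "N \<ge> 3 * q" using large A'(2) unfolding N_def q_def by (metis of_nat_le_iff of_nat_mult of_nat_numeral)
    have Zc: "Zsum c = N" unfolding c_def N_def by (rule V.Zsum_slice_size)
    define \<kappa> where "\<kappa> i = 11 * c i - N" for i
    have "per_fun \<kappa>" unfolding \<kappa>_def c_def using V.per_fun_slice_size unfolding per_fun_def by simp
    moreover have "Zsum \<kappa> = 0" unfolding \<kappa>_def
      by (simp only: Zsum_diff Zsum_cmult Zsum_const Zc) (simp add: p)
    moreover have "\<kappa> i + \<kappa> k + \<kappa> (i + k) \<le> 3 * q" for i k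
      using le[of i k] N by (simp add: \<kappa>_def)
    moreover have "q > 0" using p by (simp add: q_def)
    ultimately have "- Zsum (\<lambda>i. of_int (\<kappa> i) * cos11 i) \<le> 27 / 2 * of_int q"
      using flat_cosine_bound[OF p] by blast
    moreover have "Zsum (\<lambda>i. of_int (\<kappa> i) * cos11 i) = 11 * Zsum (\<lambda>i. of_int (c i) * cos11 i)"
    proof -
      have "(\<lambda>i. of_int (\<kappa> i) * cos11 i) = (\<lambda>i. 11 * (of_int (c i) * cos11 i) - of_int N * cos11 i)"
        by (rule ext) (simp add: \<kappa>_def algebra_simps)
      then show ?thesis by (simp only: Zsum_diff Zsum_cmult Zcos mult_zero_right diff_zero)
    qed
    moreover have "real_of_int q > 0" using \<open>q > 0\<close> by simp
    ultimately show False using C by linarith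
  qed
  then obtain i k where "int p * (c i + c k + c (i + k)) > 12 * q" by blast
  moreover have "\<not> int p dvd Y 0" using p by (simp add: Y_def)
  ultimately show thesis using that[OF fg, of Y i k] unfolding c_def A'_def q_def by blast
qed

lemma middle_automorphism:
  fixes m :: int and A :: "(nat \<Rightarrow> int) set"
  assumes p: "int p = 6 * m - 1" "m \<ge> 2"
    and A: "V.vper A" and sf: "\<And>a b. a \<in> A \<Longrightarrow> b \<in> A \<Longrightarrow> a + b \<notin> A"
    and large: "(2 * m - 1) * int (p ^ (n - 1)) \<le> int (V.vsz A)"
  obtains f g where "V.vs.automorphic f g" "\<And>x. f x \<in> A \<Longrightarrow> x 0 mod int p \<in> {2 * m - 1..4 * m}"
proof -
  \<comment> \<open>Stated for an arbitrary set, because for p = 11 the functional is found for a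
    preimage of A.\<close>
  have from_functional: "\<exists>f g. V.vs.automorphic f g \<and> (\<forall>x. f x \<in> A \<longrightarrow> x 0 mod int p \<in> {2 * m - 1..4 * m})"
    if "\<exists>y. (\<exists>j<n. \<not> int p dvd y j) \<and> (\<forall>x\<in>A. dot {..<n} y x mod int p \<in> {2 * m - 1..4 * m})" for A
  proof -
    from that obtain y where y0: "(\<exists>j<n. \<not> int p dvd y j) \<and> (\<forall>x\<in>A. dot {..<n} y x mod int p \<in> {2 * m - 1..4 * m})"
      by (rule exE)
    note ex = y0[THEN conjunct1] and in_mid = y0[THEN conjunct2]
    from ex obtain j where y: "j < n" "\<not> int p dvd y j" by blast
    obtain f g where fg: "V.vs.automorphic f g" "\<And>x. f x 0 = dot {..<n} y x"
      using V.automorphic_functional[of 0 j y] y n_pos by auto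
    have "x 0 mod int p \<in> {2 * m - 1..4 * m}" if "g x \<in> A" for x
    proof -
      have "vrep p {..<n} (f (g x)) = vrep p {..<n} x" by (rule V.vs.automorphicD(4)[OF fg(1)])
      then have "[f (g x) 0 = x 0] (mod int p)" using n_pos by (auto simp: V.vrep_eq_iff)
      then have "x 0 mod int p = dot {..<n} y (g x) mod int p" by (simp add: fg(2) cong_def)
      then show ?thesis using in_mid that by simp
    qed
    then show ?thesis using V.vs.automorphic_sym[OF fg(1)] by blast
  qed
  show thesis
  proof (cases "m \<ge> 3")
    case True
    have "p ^ card {..<n} = p * p ^ (n - 1)" by (simp only: V_index[symmetric] V.card_range_vrep)
    then have "int p ^ card {..<n} = int p * int (p ^ (n - 1))" by (metis of_nat_mult of_nat_power)
    moreover have "int (p ^ (n - 1)) > 0" using p_pos by simp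
    ultimately obtain y j i k where "j < n" "\<not> int p dvd y j"
      "int p * (V.slice_size A y i + V.slice_size A y k + V.slice_size A y (i + k)) > 6 * m * int (p ^ (n - 1))"
      using V.exists_nonflat_functional[OF p(1) True _ _ A sf large] by auto
    from from_functional[OF middle_functional_if_nonflat[OF p A sf large this]] show thesis using that by blast
  next
    case False
    then have m: "m = 2" using p by simp
    then have p11: "p = 11" using p by simp
    have "int (3 * p ^ (n - 1)) \<le> int (V.vsz A)" using large m by simp
    then have "3 * p ^ (n - 1) \<le> V.vsz A" by (simp only: of_nat_le_iff)
    from nonflat_after_automorphism_11[OF p11 A sf this]
    obtain f g y i k where fg: "V.vs.automorphic f g" and y: "\<not> int p dvd y 0"
      "int p * (V.slice_size {x. f x \<in> A} y i + V.slice_size {x. f x \<in> A} y k + V.slice_size {x. f x \<in> A} y (i + k))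
        > 12 * int (p ^ (n - 1))" by metis
    have y2: "int p * (V.slice_size {x. f x \<in> A} y i + V.slice_size {x. f x \<in> A} y k + V.slice_size {x. f x \<in> A} y (i + k))
        > 6 * m * int (p ^ (n - 1))" using y(2) m by simp
    have large': "(2 * m - 1) * int (p ^ (n - 1)) \<le> int (V.vsz {x. f x \<in> A})"
      using large V.vs.size_of_automorphic[OF fg A] by simp
    have "a + b \<notin> {x. f x \<in> A}" if "a \<in> {x. f x \<in> A}" "b \<in> {x. f x \<in> A}" for a b
      using V.vs.sum_free_automorphic[OF fg A sf] that by blast
    moreover have "0 < n" using n_pos by simp
    ultimately obtain f' g' where fg': "V.vs.automorphic f' g'"
      "\<And>x. f (f' x) \<in> A \<Longrightarrow> x 0 mod int p \<in> {2 * m - 1..4 * m}"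
      using from_functional[OF middle_functional_if_nonflat[OF p V.vs.periodic_automorphic[OF fg A] _ large' _ y(1) y2]]
      by blast
    show thesis using that[OF V.vs.automorphic_comp[OF fg fg'(1)]] fg'(2) by blast
  qed
qed

end

subsection \<open>Sum-free sets over the middle interval\<close>

context split_space
begin

lemma mem_section_iff: "w \<in> section_at A i \<longleftrightarrow> w(0 := i) \<in> A"
  by (simp add: section_at_def)

lemma section_sum_free:
  assumes A: "V.vper A" and sf: "\<And>a b. a \<in> A \<Longrightarrow> b \<in> A \<Longrightarrow> a + b \<notin> A"
    and w: "w \<in> section_at A i" "w' \<in> section_at A j" and k: "[i + j = k] (mod int p)"
  shows "w + w' \<notin> section_at A k"
proof -
  have "(w + w')(0 := i + j) = w(0 := i) + w'(0 := j)" by (rule ext) simp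
  then have "w + w' \<notin> section_at A (i + j)" using sf w by (simp add: mem_section_iff)
  then show ?thesis using section_cong[OF A k] by simp
qed

text \<open>The translate of section j by x is disjoint from section k. If the sizes fill the whole
  group, the two sets are complementary.\<close>

lemma section_pair:
  assumes A: "V.vper A" and sf: "\<And>a b. a \<in> A \<Longrightarrow> b \<in> A \<Longrightarrow> a + b \<notin> A"
    and x: "x \<in> section_at A i" and k: "[i + j = k] (mod int p)"
  shows "W.vsz (section_at A j) + W.vsz (section_at A k) \<le> p ^ (n - 1)"
    and "p ^ (n - 1) \<le> W.vsz (section_at A j) + W.vsz (section_at A k) \<Longrightarrow>
      section_at A k = - {z. z - x \<in> section_at A j}"
proof -
  let ?T = "{z. z - x \<in> section_at A j}"
  have sub: "section_at A k \<subseteq> - ?T"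
    using section_sum_free[OF A sf x _ k] by fastforce
  have T: "W.vper ?T" "W.vsz ?T = W.vsz (section_at A j)"
    using W.vs.periodic_translate'[OF per_section[OF A]] W.vs.size_of_translate'[OF per_section[OF A]] by auto
  have c: "W.vsz (- ?T) + W.vsz ?T = p ^ (n - 1)"
    using W.vs.size_of_Compl[of ?T] by (simp only: W_index)
  show "W.vsz (section_at A j) + W.vsz (section_at A k) \<le> p ^ (n - 1)"
    using W.vs.size_of_mono[OF sub] c T by simp
  assume "p ^ (n - 1) \<le> W.vsz (section_at A j) + W.vsz (section_at A k)"
  then have "W.vsz (- ?T) \<le> W.vsz (section_at A k)" using c T by simp
  then show "section_at A k = - ?T"
    using W.vs.eq_if_subset_size[OF per_section[OF A] W.vs.periodic_Compl[OF T(1)] sub] by blast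
qed

lemma section_outside:
  assumes "\<And>x. x \<in> A \<Longrightarrow> x 0 mod int p \<in> S" "i mod int p \<notin> S"
  shows "section_at A i = {}"
  using assms(1)[of "_(0 := i)"] assms(2) by (auto simp: section_at_def)

lemma size_eq_sum_support:
  fixes a b :: int
  assumes A: "V.vper A" and supp: "\<forall>x\<in>A. x 0 mod int p \<in> {a..b}" and ab: "0 \<le> a" "b < int p"
  shows "int (V.vsz A) = (\<Sum>i\<in>{a..b}. int (W.vsz (section_at A i)))"
proof -
  have "int (V.vsz A) = (\<Sum>i\<in>{0..<int p}. int (W.vsz (section_at A i)))"
    using size_eq_sum_sections[OF A] p_pos by (simp add: Zsum_def range_zrep)
  also have "\<dots> = (\<Sum>i\<in>{a..b}. int (W.vsz (section_at A i)))"
  proof (rule sum.mono_neutral_right)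
    show "\<forall>i\<in>{0..<int p} - {a..b}. int (W.vsz (section_at A i)) = 0"
    proof
      fix i assume i: "i \<in> {0..<int p} - {a..b}"
      then have "i mod int p = i" by simp
      then have "section_at A i = {}" using section_outside[of A "{a..b}" i] supp i by auto
      then show "int (W.vsz (section_at A i)) = 0" by simp
    qed
  qed (use ab in auto)
  finally show ?thesis .
qed

lemma sum_interval_decompose:
  fixes m :: int and f :: "int \<Rightarrow> int"
  assumes "m \<ge> 2"
  shows "(\<Sum>i\<in>{2 * m - 1..4 * m}. f i) =
    f (2 * m - 1) + f (2 * m) + (\<Sum>i\<in>{2 * m + 1..4 * m - 3}. f i) + f (4 * m - 2) + f (4 * m - 1) + f (4 * m)"
    and "m \<ge> 2 \<Longrightarrow> (\<Sum>i\<in>{2 * m + 1..4 * m - 3}. f i) = f (2 * m + 1) + (\<Sum>i\<in>{2 * m + 2..4 * m - 3}. f i)"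
proof -
  have "{2 * m - 1..4 * m} = insert (2 * m - 1) (insert (2 * m) (insert (4 * m - 2) (insert (4 * m - 1)
      (insert (4 * m) {2 * m + 1..4 * m - 3}))))" using assms by auto
  then show "(\<Sum>i\<in>{2 * m - 1..4 * m}. f i) =
    f (2 * m - 1) + f (2 * m) + (\<Sum>i\<in>{2 * m + 1..4 * m - 3}. f i) + f (4 * m - 2) + f (4 * m - 1) + f (4 * m)"
    using assms by simp
  have "{2 * m + 1..4 * m - 3} = insert (2 * m + 1) {2 * m + 2..4 * m - 3}" using assms by auto
  then show "(\<Sum>i\<in>{2 * m + 1..4 * m - 3}. f i) = f (2 * m + 1) + (\<Sum>i\<in>{2 * m + 2..4 * m - 3}. f i)" by simp
qed

text \<open>The very structured set in terms of integer vectors. For P periodic in the coordinates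
  1, ..., n - 1, membership \<open>x \<in> P\<close> depends only on these coordinates.\<close>

definition model :: "int \<Rightarrow> (nat \<Rightarrow> int) set \<Rightarrow> (nat \<Rightarrow> int) set" where
  "model m P = {x. let t = x 0 mod int p; zero = (vrep p {0<..<n} x = 0) in
     t = 2 * m - 1 \<and> zero \<or> t = 2 * m \<and> x \<notin> P \<or> t \<in> {2 * m + 1..4 * m - 3} \<or>
     t = 4 * m - 2 \<and> \<not> zero \<or> t = 4 * m - 1 \<and> x \<in> P}"

text \<open>An element of section 2m - 1 translates section 2m off section 4m - 1, and section 2m -
  1 off section 4m - 2, so each of these pairs has total size at most q. With the 2m - 3 middle
  sections this gives at most (2m - 1) q, so every estimate is an equality once section 4m, which
  would add to the count, is known to be empty.\<close>

lemma one_sided_rigidity: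
  fixes m :: int and A :: "(nat \<Rightarrow> int) set"
  assumes p: "int p = 6 * m - 1" "m \<ge> 2"
    and A: "V.vper A" and sf0: "\<forall>a\<in>A. \<forall>b\<in>A. a + b \<notin> A"
    and large: "(2 * m - 1) * int (p ^ (n - 1)) \<le> int (V.vsz A)"
    and supp0: "\<forall>x\<in>A. x 0 mod int p \<in> {2 * m - 1..4 * m}"
    and R_ne: "section_at A (2 * m - 1) \<noteq> {}"
  shows "int (V.vsz A) = (2 * m - 1) * int (p ^ (n - 1))"
    and "section_at A (4 * m) = {}"
    and "\<And>i. i \<in> {2 * m + 1..4 * m - 3} \<Longrightarrow> section_at A i = UNIV"
    and "\<And>x. x \<in> section_at A (2 * m - 1) \<Longrightarrow> section_at A (4 * m - 1) = - {z. z - x \<in> section_at A (2 * m)}"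
    and "\<And>x. x \<in> section_at A (2 * m - 1) \<Longrightarrow> section_at A (4 * m - 2) = - {z. z - x \<in> section_at A (2 * m - 1)}"
proof -
  have sf: "a + b \<notin> A" if "a \<in> A" "b \<in> A" for a b using sf0 that by blast
  have supp: "x 0 mod int p \<in> {2 * m - 1..4 * m}" if "x \<in> A" for x using supp0 that by blast
  define H where "H i = section_at A i" for i
  define a where "a i = int (W.vsz (H i))" for i
  define q where "q = int (p ^ (n - 1))"
  have pair: "W.vsz (H j) + W.vsz (H k) \<le> p ^ (n - 1)" if "x \<in> H i" "[i + j = k] (mod int p)" for x i j k
    using section_pair(1)[of A x i j k] A sf that unfolding H_def by blast
  have pair': "H k = - {z. z - x \<in> H j}"
    if "x \<in> H i" "[i + j = k] (mod int p)" "p ^ (n - 1) \<le> W.vsz (H j) + W.vsz (H k)" for x i j k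
    using section_pair(2)[of A x i j k] A sf that unfolding H_def by blast
  have ssf: "w + w' \<notin> H k" if "w \<in> H i" "w' \<in> H j" "[i + j = k] (mod int p)" for w w' i j k
    using section_sum_free[of A w i w' j k] A sf that unfolding H_def by blast
  have perH: "W.vper (H i)" for i unfolding H_def by (rule per_section[OF A])
  have a_le: "a i \<le> q" for i
  proof -
    have "W.vsz (H i) \<le> p ^ (n - 1)" using W.vs.size_of_le_order[of "H i"] by (simp only: W_index)
    then show ?thesis unfolding a_def q_def by linarith
  qed
  have pair_le: "a j + a k \<le> q" if "x \<in> H i" "[i + j = k] (mod int p)" for x i j k
    using pair[OF that] unfolding a_def q_def by linarith
  have pair_eq: "H k = - {z. z - x \<in> H j}" if "x \<in> H i" "[i + j = k] (mod int p)" "q \<le> a j + a k" for x i j k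
  proof -
    have "p ^ (n - 1) \<le> W.vsz (H j) + W.vsz (H k)" using that(3) unfolding a_def q_def by linarith
    then show ?thesis using pair'[OF that(1,2)] by blast
  qed
  define mid where "mid = (\<Sum>i\<in>{2 * m + 1..4 * m - 3}. a i)"
  have N: "int (V.vsz A) = a (2 * m - 1) + a (2 * m) + mid + a (4 * m - 2) + a (4 * m - 1) + a (4 * m)"
    using size_eq_sum_support[OF A supp0] p sum_interval_decompose(1)[OF p(2), of a]
    unfolding a_def H_def mid_def by simp
  have c: "[(2 * m - 1) + 2 * m = 4 * m - 1] (mod int p)" "[(2 * m - 1) + (2 * m + 1) = 4 * m] (mod int p)"
    "[4 * m + (4 * m - 2) = 2 * m - 1] (mod int p)" "[(2 * m - 1) + (2 * m - 1) = 4 * m - 2] (mod int p)"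
    "[2 * m + 2 * m = 4 * m] (mod int p)" "[(4 * m - 1) + (4 * m - 1) = 2 * m - 1] (mod int p)"
    unfolding p(1) by (simp_all add: cong_iff_dvd_diff algebra_simps)
  obtain x0 where x0: "x0 \<in> H (2 * m - 1)" using R_ne by (auto simp: H_def)
  define R where "R = H (2 * m - 1)"
  define RR where "RR = sumset R R"
  have perRR: "W.vper RR" unfolding RR_def R_def by (rule W.vs.periodic_sumset[OF perH])
  have RR_disj: "H (4 * m - 2) \<subseteq> - RR"
    unfolding RR_def sumset_def R_def using ssf[OF _ _ c(4)] by blast
  have RR_a: "int (W.vsz RR) + a (4 * m - 2) \<le> q"
  proof -
    have "W.vsz (- RR) + W.vsz RR = p ^ (n - 1)" using W.vs.size_of_Compl[of RR] by (simp only: W_index)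
    then have "W.vsz RR + W.vsz (H (4 * m - 2)) \<le> p ^ (n - 1)" using W.vs.size_of_mono[OF RR_disj] by linarith
    then show ?thesis unfolding a_def q_def by linarith
  qed
  have translate: "W.vsz {z. z - x \<in> R} = W.vsz R" "W.vper {z. z - x \<in> R}" for x
    unfolding R_def using W.vs.size_of_translate'[OF perH] W.vs.periodic_translate'[OF perH] by auto
  have R_sub: "{z. z - x \<in> R} \<subseteq> RR" if "x \<in> R" for x
    unfolding RR_def using sumsetI[of x R _ R] that by force
  have R_RR: "a (2 * m - 1) \<le> int (W.vsz RR)"
    using W.vs.size_of_mono[OF R_sub[of x0]] translate(1)[of x0] x0 unfolding a_def R_def by simp
  have rigid: "H (4 * m - 2) = - {z. z - x \<in> R}" if "x \<in> R" "q \<le> a (2 * m - 1) + a (4 * m - 2)" for x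
    using pair_eq[of x "2 * m - 1" "2 * m - 1" "4 * m - 2"] that c(4) unfolding R_def by blast
  have large': "(2 * m - 1) * q \<le> a (2 * m - 1) + a (2 * m) + mid + a (4 * m - 2) + a (4 * m - 1) + a (4 * m)"
    using large N unfolding q_def by simp
  have p1: "a (2 * m) + a (4 * m - 1) \<le> q" by (rule pair_le[OF x0 c(1)])
  have mid_le: "mid \<le> (2 * m - 3) * q"
  proof -
    have "mid \<le> (\<Sum>i\<in>{2 * m + 1..4 * m - 3}. q)" unfolding mid_def by (intro sum_mono a_le)
    then show ?thesis using p(2) by simp
  qed
  \<comment> \<open>An element y of section 4m creates a third pair (2m + 1, 4m), so the count is
    tight again and - y lies in section 2m - 1. Half of y then contradicts sum-freeness: w with 2w =
    y is not in section 2m, so - w is in section 4m - 1, yet - w - w = - y is in section 2m -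
    1.\<close>
  have S: "H (4 * m) = {}"
  proof (rule ccontr)
    assume "H (4 * m) \<noteq> {}"
    then obtain y where y: "y \<in> H (4 * m)" by auto
    have p2: "a (2 * m + 1) + a (4 * m) \<le> q" by (rule pair_le[OF x0 c(2)])
    have p3: "a (4 * m - 2) + a (2 * m - 1) \<le> q" by (rule pair_le[OF y c(3)])
    have mid2: "mid \<le> a (2 * m + 1) + (2 * m - 4) * q"
    proof -
      have "(\<Sum>i\<in>{2 * m + 2..4 * m - 3}. a i) \<le> (\<Sum>i\<in>{2 * m + 2..4 * m - 3}. q)" by (intro sum_mono a_le)
      then show ?thesis using sum_interval_decompose(2)[OF p(2) p(2), of a] p(2) unfolding mid_def by simp
    qed
    have e1: "q \<le> a (2 * m) + a (4 * m - 1)" and e3: "q \<le> a (4 * m - 2) + a (2 * m - 1)"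
      using large' p1 p2 p3 mid2 by (simp_all add: algebra_simps)
    have R1: "H (4 * m - 1) = - {z. z - x \<in> H (2 * m)}" if "x \<in> R" for x
      using pair_eq[OF _ c(1) e1] that unfolding R_def by blast
    have R3: "R = - {z. z - y \<in> H (4 * m - 2)}"
      using pair_eq[OF y c(3) e3] unfolding R_def .
    have "q \<le> a (2 * m - 1) + a (4 * m - 2)" using e3 by simp
    then have R2: "H (4 * m - 2) = - {z. z - x0 \<in> R}" using rigid[of x0] x0 unfolding R_def by blast
    \<comment> \<open>The two complementations in \<open>R3\<close> and \<open>R2\<close> cancel and
      leave a translation.\<close>
    have "z \<in> R \<longleftrightarrow> z - y - x0 \<in> R" for z
      by (subst R3) (simp add: R2)
    from this[of x0] have "- y \<in> R" using x0 unfolding R_def by simp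
    have "\<not> int p dvd 2" using p zdvd_imp_le[of "int p" 2] by auto
    then obtain h where h: "[2 * h = 1] (mod int p)" using obtain_inverse by blast
    define w where "w = (\<lambda>i. h * y i)"
    have ww: "[(w + w) i = y i] (mod int p)" for i
      using cong_scalar_right[OF h, of "y i"] by (simp add: w_def algebra_simps)
    have "w \<notin> H (2 * m)"
    proof
      assume "w \<in> H (2 * m)"
      then have "w + w \<notin> H (4 * m)" using ssf[OF _ _ c(5)] by blast
      moreover have "w + w \<in> H (4 * m) \<longleftrightarrow> y \<in> H (4 * m)" by (rule W.vper_cong[OF perH ww])
      ultimately show False using y by blast
    qed
    moreover have "- w - (- y) \<in> H (2 * m) \<longleftrightarrow> w \<in> H (2 * m)"
    proof (rule W.vper_cong[OF perH])
      fix i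
      show "[(- w - - y) i = w i] (mod int p)"
        using ww[of i] cong_sym[OF ww[of i]] by (simp add: cong_iff_dvd_diff algebra_simps)
    qed
    ultimately have "- w \<in> H (4 * m - 1)" using R1[OF \<open>- y \<in> R\<close>] by blast
    then have "- w + - w \<notin> H (2 * m - 1)" using ssf[OF _ _ c(6)] by blast
    moreover have "- w + - w \<in> H (2 * m - 1) \<longleftrightarrow> - y \<in> H (2 * m - 1)"
    proof (rule W.vper_cong[OF perH])
      fix i
      show "[(- w + - w) i = (- y) i] (mod int p)"
        using ww[of i] cong_sym[OF ww[of i]] by (simp add: cong_iff_dvd_diff algebra_simps)
    qed
    ultimately show False using \<open>- y \<in> R\<close> unfolding R_def by blast
  qed
  then show "section_at A (4 * m) = {}" by (simp add: H_def)
  have a4m: "a (4 * m) = 0" using S by (simp add: a_def)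
  have e: "a (2 * m) + a (4 * m - 1) \<ge> q" "a (2 * m - 1) + a (4 * m - 2) \<ge> q" "mid \<ge> (2 * m - 3) * q"
    using large' p1 mid_le RR_a R_RR a4m by (simp_all add: algebra_simps)
  show "int (V.vsz A) = (2 * m - 1) * int (p ^ (n - 1))"
    using N large' p1 mid_le RR_a R_RR a4m unfolding q_def[symmetric] by (simp add: algebra_simps)
  show "section_at A (4 * m - 1) = - {z. z - x \<in> section_at A (2 * m)}" if "x \<in> section_at A (2 * m - 1)" for x
    using pair_eq[OF _ c(1) e(1)] that unfolding H_def by blast
  show "section_at A (4 * m - 2) = - {z. z - x \<in> section_at A (2 * m - 1)}" if "x \<in> section_at A (2 * m - 1)" for x
    using rigid[OF _ e(2)] that unfolding H_def R_def by blast
  show "section_at A i = UNIV" if i: "i \<in> {2 * m + 1..4 * m - 3}" for i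
  proof -
    have "a i = q"
    proof (rule ccontr)
      assume "a i \<noteq> q"
      then have "a i < q" using a_le[of i] by simp
      then have "mid < (\<Sum>i\<in>{2 * m + 1..4 * m - 3}. q)"
        unfolding mid_def using i a_le by (intro sum_strict_mono_ex1) auto
      then show False using e(3) p(2) by simp
    qed
    then have "W.vsz (H i) = p ^ (n - 1)" unfolding a_def q_def by linarith
    then have "W.vsz UNIV \<le> W.vsz (H i)" by (simp only: W.vs.size_of_UNIV W_index)
    then show ?thesis using W.vs.eq_if_subset_size[OF perH W.vs.periodic_UNIV] unfolding H_def by blast
  qed
qed

lemma one_sided_structure:
  fixes m :: int and A :: "(nat \<Rightarrow> int) set"
  assumes p: "int p = 6 * m - 1" "m \<ge> 2"
    and A: "V.vper A" and sf: "\<And>a b. a \<in> A \<Longrightarrow> b \<in> A \<Longrightarrow> a + b \<notin> A"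
    and large: "(2 * m - 1) * int (p ^ (n - 1)) \<le> int (V.vsz A)"
    and supp: "\<And>x. x \<in> A \<Longrightarrow> x 0 mod int p \<in> {2 * m - 1..4 * m}"
    and R_ne: "section_at A (2 * m - 1) \<noteq> {}"
  shows "(\<exists>v. vrep p {..<n} v \<noteq> 0 \<and> (\<forall>x. x + v \<in> A \<longleftrightarrow> x \<in> A)) \<or>
    (\<exists>f g P. V.vs.automorphic f g \<and> W.vper P \<and> (\<forall>w\<in>P. \<forall>w'\<in>P. vrep p {0<..<n} (w + w') \<noteq> 0) \<and>
      {x. f x \<in> A} = model m P)"
proof -
  have sf0: "\<forall>a\<in>A. \<forall>b\<in>A. a + b \<notin> A" and supp0: "\<forall>x\<in>A. x 0 mod int p \<in> {2 * m - 1..4 * m}"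
    using sf supp by blast+
  note rig = one_sided_rigidity[OF p A sf0 large supp0 R_ne]
  define R where "R = section_at A (2 * m - 1)"
  have sec: "x \<in> A \<longleftrightarrow> x \<in> section_at A (x 0 mod int p)" for x
    by (rule mem_section[OF A, symmetric]) (simp add: cong_def)
  have perS: "W.vper (section_at A i)" for i by (rule per_section[OF A])
  have cases: "section_at A t = {}" if "t \<notin> {2 * m - 1, 2 * m, 4 * m - 2, 4 * m - 1}" "t \<notin> {2 * m + 1..4 * m - 3}"
    "0 \<le> t" "t < int p" for t
  proof (cases "t = 4 * m")
    case True then show ?thesis using rig(2) by simp
  next
    case False
    then have "t mod int p \<notin> {2 * m - 1..4 * m}" using that by auto
    then show ?thesis using section_outside[of A "{2 * m - 1..4 * m}" t] supp by blast
  qed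
  show ?thesis
  proof (cases "W.vsz R \<ge> 2")
    case True
    obtain x where x: "x \<in> R" using R_ne by (auto simp: R_def)
    have "\<exists>x'\<in>R. vrep p {0<..<n} x' \<noteq> vrep p {0<..<n} x"
    proof (rule ccontr)
      assume "\<not> ?thesis"
      then have "R \<inter> range (vrep p {0<..<n}) \<subseteq> {vrep p {0<..<n} x}" by force
      then have "W.vsz R \<le> 1" unfolding W.vs.size_of_def using card_mono[of "{vrep p {0<..<n} x}"] by fastforce
      then show False using True by simp
    qed
    then obtain x' where x': "x' \<in> R" "vrep p {0<..<n} x' \<noteq> vrep p {0<..<n} x" by blast
    \<comment> \<open>Entry 0 of a vector in a section is arbitrary; it is cleared so that v moves
      points within their section.\<close>
    define v where "v = (x' - x)(0 := 0)"
    have "vrep p {..<n} v \<noteq> 0"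
    proof
      assume v0: "vrep p {..<n} v = 0"
      have "[x' i = x i] (mod int p)" if "i \<in> {0<..<n}" for i
      proof -
        have "vrep p {..<n} v i = 0" by (simp add: v0)
        then have "(x' i - x i) mod int p = 0" using that by (simp add: vrep_def v_def)
        then show ?thesis by (simp add: cong_iff_dvd_diff dvd_eq_mod_eq_0)
      qed
      then show False using x'(2) by (simp add: W.vrep_eq_iff)
    qed
    moreover have shift: "w + v \<in> section_at A t \<longleftrightarrow> w + (x' - x) \<in> section_at A t" for w t
      by (rule W.vper_cong[OF perS]) (simp add: v_def)
    have Q: "w \<in> section_at A (2 * m) \<longleftrightarrow> w + (x' - x) \<in> section_at A (2 * m)" for w
    proof -
      have "w + x' \<in> section_at A (4 * m - 1) \<longleftrightarrow> w \<notin> section_at A (2 * m)"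
        using rig(4)[of x'] x'(1) by (simp add: R_def)
      moreover have "w + x' \<in> section_at A (4 * m - 1) \<longleftrightarrow> w + x' - x \<notin> section_at A (2 * m)"
        using rig(4)[of x] x(1) by (simp add: R_def)
      ultimately show ?thesis by (simp add: add_diff_eq)
    qed
    have QR: "w \<in> R \<longleftrightarrow> w + (x' - x) \<in> R" for w
    proof -
      have "w + x' \<in> section_at A (4 * m - 2) \<longleftrightarrow> w \<notin> R"
        using rig(5)[of x'] x'(1) by (simp add: R_def)
      moreover have "w + x' \<in> section_at A (4 * m - 2) \<longleftrightarrow> w + x' - x \<notin> R"
        using rig(5)[of x] x(1) by (simp add: R_def)
      ultimately show ?thesis by (simp add: add_diff_eq)
    qed
    have period: "w + (x' - x) \<in> section_at A t \<longleftrightarrow> w \<in> section_at A t" if t: "0 \<le> t" "t < int p" for w t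
    proof -
      consider "t = 2 * m - 1" | "t = 2 * m" | "t \<in> {2 * m + 1..4 * m - 3}" | "t = 4 * m - 2" | "t = 4 * m - 1"
        | "section_at A t = {}" using cases[OF _ _ t] by blast
      then show ?thesis
      proof cases
        case 1 then show ?thesis using QR[of w] by (simp add: R_def)
      next
        case 2 then show ?thesis using Q[of w] by simp
      next
        case 3 then show ?thesis using rig(3) by simp
      next
        case 4
        have "w + (x' - x) \<in> section_at A t \<longleftrightarrow> w + (x' - x) - x \<notin> R"
          unfolding 4 using rig(5)[of x] x(1) by (simp add: R_def)
        moreover have "w \<in> section_at A t \<longleftrightarrow> w - x \<notin> R"
          unfolding 4 using rig(5)[of x] x(1) by (simp add: R_def)
        moreover have "w + (x' - x) - x = (w - x) + (x' - x)" by simp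
        ultimately show ?thesis using QR[of "w - x"] by simp
      next
        case 5
        have "w + (x' - x) \<in> section_at A t \<longleftrightarrow> w + (x' - x) - x \<notin> section_at A (2 * m)"
          unfolding 5 using rig(4)[of x] x(1) by (simp add: R_def)
        moreover have "w \<in> section_at A t \<longleftrightarrow> w - x \<notin> section_at A (2 * m)"
          unfolding 5 using rig(4)[of x] x(1) by (simp add: R_def)
        moreover have "w + (x' - x) - x = (w - x) + (x' - x)" by simp
        ultimately show ?thesis using Q[of "w - x"] by simp
      qed simp
    qed
    have "z + v \<in> A \<longleftrightarrow> z \<in> A" for z
    proof -
      have "(z + v) 0 = z 0" by (simp add: v_def)
      then show ?thesis using sec[of "z + v"] sec[of z] shift period[of "z 0 mod int p" z] p_pos by simp
    qed
    ultimately show ?thesis by blast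
  next
    case False
    obtain x0 where x0: "x0 \<in> R" using R_ne by (auto simp: R_def)
    have perR: "W.vper R" unfolding R_def by (rule perS)
    have R1: "z \<in> R \<longleftrightarrow> vrep p {0<..<n} z = vrep p {0<..<n} x0" for z
    proof
      assume z: "z \<in> R"
      show "vrep p {0<..<n} z = vrep p {0<..<n} x0"
      proof (rule ccontr)
        assume ne: "vrep p {0<..<n} z \<noteq> vrep p {0<..<n} x0"
        have "card {vrep p {0<..<n} z, vrep p {0<..<n} x0} \<le> W.vsz R"
          unfolding W.vs.size_of_def using z x0 W.vs.periodicD[OF perR] by (intro card_mono) auto
        then show False using False ne by simp
      qed
    next
      assume "vrep p {0<..<n} z = vrep p {0<..<n} x0"
      then show "z \<in> R" using x0 W.vs.periodic_cong[OF perR] by blast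
    qed
    have "\<not> int p dvd 2 * m - 1" using p zdvd_imp_le[of "int p" "2 * m - 1"] by auto
    then obtain d where d: "[(2 * m - 1) * d = 1] (mod int p)" using obtain_inverse by blast
    \<comment> \<open>The shear displaces points at height t by t d \<open>x0\<close>; since (2m -
      1) d = 1 modulo p, the displacement at height 2m - 1 is \<open>x0\<close> itself.\<close>
    define s where "s = (\<lambda>i. if i = 0 then 1 else d * x0 i)"
    define f where "f = V.column_map 0 s"
    have "\<not> int p dvd s 0" using p by (simp add: s_def)
    then obtain g where fg: "V.vs.automorphic f g"
      using V.automorphic_column[of 0 s] n_pos unfolding f_def by auto
    have f0: "f x 0 = x 0" and fi: "i \<noteq> 0 \<Longrightarrow> f x i = x i + x 0 * (d * x0 i)" for x i
      by (simp_all add: f_def V.column_map_def s_def)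
    define sh where "sh t w = (\<lambda>i. w i + t * (d * x0 i))" for t :: int and w :: "nat \<Rightarrow> int"
    have f_sec: "f x \<in> A \<longleftrightarrow> sh (x 0 mod int p) x \<in> section_at A (x 0 mod int p)" for x
    proof -
      have "f x \<in> section_at A (x 0 mod int p) \<longleftrightarrow> sh (x 0 mod int p) x \<in> section_at A (x 0 mod int p)"
      proof (rule W.vper_cong[OF perS])
        fix i assume "i \<in> {0<..<n}"
        then have "i \<noteq> 0" by simp
        then show "[f x i = sh (x 0 mod int p) x i] (mod int p)"
          by (auto simp: fi sh_def intro!: cong_add cong_mult)
      qed
      then show ?thesis using sec[of "f x"] f0 by simp
    qed
    define P where "P = {w. sh (4 * m - 1) w \<in> section_at A (4 * m - 1)}"
    have sh_cong: "[sh t w i = sh t w' i] (mod int p)" if "[w i = w' i] (mod int p)" for t w w' i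
      unfolding sh_def using that by (intro cong_add cong_refl)
    have perP: "W.vper P"
    proof (rule W.vperI)
      fix x y assume xy: "\<forall>i\<in>{0<..<n}. [x i = y i] (mod int p)" "x \<in> P"
      have "sh (4 * m - 1) x \<in> section_at A (4 * m - 1) \<longleftrightarrow> sh (4 * m - 1) y \<in> section_at A (4 * m - 1)"
        by (rule W.vper_cong[OF perS sh_cong]) (use xy in blast)
      then show "y \<in> P" using xy by (simp add: P_def)
    qed
    have dx: "[(2 * m - 1) * (d * x0 i) = x0 i] (mod int p)" for i
      using cong_scalar_right[OF d, of "x0 i"] by (simp add: mult.assoc)
    have zero_iff: "vrep p {0<..<n} w = 0 \<longleftrightarrow> (\<forall>i\<in>{0<..<n}. [w i = 0] (mod int p))" for w
      by (auto simp: vrep_def fun_eq_iff cong_def)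
    have c1: "sh (2 * m - 1) w \<in> R \<longleftrightarrow> vrep p {0<..<n} w = 0" for w
    proof -
      have "[w i + (2 * m - 1) * (d * x0 i) = x0 i] (mod int p) \<longleftrightarrow> [w i = 0] (mod int p)" for i
      proof -
        have "[w i + (2 * m - 1) * (d * x0 i) = w i + x0 i] (mod int p)"
          using dx by (simp add: cong_add_lcancel)
        then have "[w i + (2 * m - 1) * (d * x0 i) = x0 i] (mod int p) \<longleftrightarrow> [w i + x0 i = 0 + x0 i] (mod int p)"
          by (simp add: cong_def)
        then show ?thesis by (simp only: cong_add_rcancel)
      qed
      then show ?thesis unfolding R1 W.vrep_eq_iff zero_iff by (simp add: sh_def)
    qed
    \<comment> \<open>Subtracting \<open>x0\<close> lowers the shear parameter by 2m - 1, so the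
      complement relations between heights 4m - 1 and 2m and between 4m - 2 and 2m - 1 survive the
      shear.\<close>
    have minus_x0: "sh t w - x0 \<in> section_at A k \<longleftrightarrow> sh (t - (2 * m - 1)) w \<in> section_at A k" for t w k
    proof (rule W.vper_cong[OF perS])
      fix i
      have "(sh t w - x0) i - sh (t - (2 * m - 1)) w i = (2 * m - 1) * (d * x0 i) - x0 i"
        by (simp add: sh_def algebra_simps)
      then show "[(sh t w - x0) i = sh (t - (2 * m - 1)) w i] (mod int p)"
        using dx[of i] by (simp only: cong_iff_dvd_diff)
    qed
    have c2: "sh (2 * m) w \<in> section_at A (2 * m) \<longleftrightarrow> w \<notin> P" for w
    proof -
      have "w \<in> P \<longleftrightarrow> sh (4 * m - 1) w - x0 \<notin> section_at A (2 * m)"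
        using rig(4)[of x0] x0 by (simp add: P_def R_def)
      also have "\<dots> \<longleftrightarrow> sh (4 * m - 1 - (2 * m - 1)) w \<notin> section_at A (2 * m)"
        unfolding minus_x0 ..
      finally show ?thesis by simp
    qed
    have c4: "sh (4 * m - 2) w \<in> section_at A (4 * m - 2) \<longleftrightarrow> vrep p {0<..<n} w \<noteq> 0" for w
    proof -
      have "sh (4 * m - 2) w \<in> section_at A (4 * m - 2) \<longleftrightarrow> sh (4 * m - 2) w - x0 \<notin> section_at A (2 * m - 1)"
        using rig(5)[of x0] x0 by (simp add: R_def)
      also have "\<dots> \<longleftrightarrow> sh (4 * m - 2 - (2 * m - 1)) w \<notin> R"
        unfolding minus_x0 R_def ..
      also have "4 * m - 2 - (2 * m - 1) = 2 * m - 1" by simp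
      finally show ?thesis by (simp add: c1)
    qed
    have "f x \<in> A \<longleftrightarrow> x \<in> model m P" for x
    proof -
      define t where "t = x 0 mod int p"
      have t: "0 \<le> t" "t < int p" using p_pos by (simp_all add: t_def)
      have fx: "f x \<in> A \<longleftrightarrow> sh t x \<in> section_at A t" unfolding t_def by (rule f_sec)
      have mx: "x \<in> model m P \<longleftrightarrow> t = 2 * m - 1 \<and> vrep p {0<..<n} x = 0 \<or> t = 2 * m \<and> x \<notin> P \<or> t \<in> {2 * m + 1..4 * m - 3} \<or>
          t = 4 * m - 2 \<and> vrep p {0<..<n} x \<noteq> 0 \<or> t = 4 * m - 1 \<and> x \<in> P"
        unfolding model_def t_def Let_def by simp
      consider "t = 2 * m - 1" | "t = 2 * m" | "t \<in> {2 * m + 1..4 * m - 3}" | "t = 4 * m - 2" | "t = 4 * m - 1"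
        | "t \<notin> {2 * m - 1, 2 * m, 4 * m - 2, 4 * m - 1}" "t \<notin> {2 * m + 1..4 * m - 3}" by blast
      then show ?thesis
      proof cases
        case 1
        have "f x \<in> A \<longleftrightarrow> vrep p {0<..<n} x = 0" unfolding fx unfolding 1 using c1[of x] by (simp add: R_def)
        moreover have "x \<in> model m P \<longleftrightarrow> vrep p {0<..<n} x = 0" unfolding mx using 1 p(2) by simp
        ultimately show ?thesis by simp
      next
        case 2
        have "f x \<in> A \<longleftrightarrow> x \<notin> P" unfolding fx unfolding 2 by (rule c2)
        moreover have "x \<in> model m P \<longleftrightarrow> x \<notin> P" unfolding mx using 2 p(2) by simp
        ultimately show ?thesis by simp
      next
        case 3
        have "f x \<in> A" unfolding fx using rig(3)[OF 3] by simp
        moreover have "x \<in> model m P" unfolding mx using 3 by simp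
        ultimately show ?thesis by simp
      next
        case 4
        have "f x \<in> A \<longleftrightarrow> vrep p {0<..<n} x \<noteq> 0" unfolding fx unfolding 4 by (rule c4)
        moreover have "x \<in> model m P \<longleftrightarrow> vrep p {0<..<n} x \<noteq> 0" unfolding mx using 4 p(2) by simp
        ultimately show ?thesis by simp
      next
        case 5
        have "f x \<in> A \<longleftrightarrow> x \<in> P" unfolding fx unfolding 5 by (simp add: P_def)
        moreover have "x \<in> model m P \<longleftrightarrow> x \<in> P" unfolding mx using 5 p(2) by simp
        ultimately show ?thesis by simp
      next
        case 6
        have "f x \<notin> A" unfolding fx using cases[OF 6 t] by simp
        moreover have "x \<notin> model m P" unfolding mx using 6 by simp
        ultimately show ?thesis by simp
      qed
    qed
    \<comment> \<open>Twice the height 4m - 1 is p + (2m - 1), and the section at height 2m - 1 has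
      become the class of 0.\<close>
    moreover have "vrep p {0<..<n} (w + w') \<noteq> 0" if "w \<in> P" "w' \<in> P" for w w'
    proof
      assume z: "vrep p {0<..<n} (w + w') = 0"
      have cc: "[(4 * m - 1) + (4 * m - 1) = 2 * m - 1] (mod int p)"
        unfolding p(1) by (simp add: cong_iff_dvd_diff algebra_simps)
      have "sh (4 * m - 1) w + sh (4 * m - 1) w' \<notin> section_at A (2 * m - 1)"
        using section_sum_free[of A "sh (4 * m - 1) w" "4 * m - 1" "sh (4 * m - 1) w'" "4 * m - 1" "2 * m - 1"] A sf cc that
        unfolding P_def by blast
      moreover have "sh (4 * m - 1) w + sh (4 * m - 1) w' \<in> section_at A (2 * m - 1) \<longleftrightarrow>
          sh (2 * m - 1) (w + w') \<in> section_at A (2 * m - 1)"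
      proof (rule W.vper_cong[OF perS])
        fix i
        have "(sh (4 * m - 1) w + sh (4 * m - 1) w') i - sh (2 * m - 1) (w + w') i = int p * (d * x0 i)"
          unfolding p(1) by (simp add: sh_def algebra_simps)
        then show "[(sh (4 * m - 1) w + sh (4 * m - 1) w') i = sh (2 * m - 1) (w + w') i] (mod int p)"
          by (simp add: cong_iff_dvd_diff)
      qed
      ultimately show False using c1[of "w + w'"] z unfolding R_def by blast
    qed
    ultimately show ?thesis using fg perP by blast
  qed
qed

end

section \<open>Models and cuboids\<close>

lemma vrep_zero: "vrep p I 0 = 0"
  by (rule ext) (simp add: vrep_def)

context split_space
begin

lemma model_periodic:
  assumes P: "W.vper P"
  shows "V.vper (model m P)"
proof (rule V.vperI)
  fix x y assume xy: "\<forall>i\<in>{..<n}. [x i = y i] (mod int p)" "x \<in> model m P"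
  have "x 0 mod int p = y 0 mod int p" using xy(1) n_pos by (simp add: cong_def)
  moreover have "x \<in> P \<longleftrightarrow> y \<in> P" by (rule W.vper_cong[OF P]) (use xy in auto)
  moreover have "vrep p {0<..<n} x = vrep p {0<..<n} y" using xy(1) by (simp add: W.vrep_eq_iff)
  ultimately show "y \<in> model m P" using xy(2) by (simp add: model_def)
qed

text \<open>Heights lie in [2m - 1, 4m - 1], so a sum of heights returns to this range only as (2m -
  1) + (2m - 1), (2m - 1) + 2m or, after wrapping around, (4m - 1) + (4m - 1). The first two are
  excluded by the complementary sections of the model, the last by 0 \<notin> P + P.\<close>

lemma model_sum_free:
  fixes m :: int
  assumes p: "int p = 6 * m - 1" "m \<ge> 2"
    and P: "W.vper P" and P0: "\<And>w w'. w \<in> P \<Longrightarrow> w' \<in> P \<Longrightarrow> vrep p {0<..<n} (w + w') \<noteq> 0"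
    and x: "x \<in> model m P" and y: "y \<in> model m P"
  shows "x + y \<notin> model m P"
proof
  assume z: "x + y \<in> model m P"
  define s t u where "s = x 0 mod int p" and "t = y 0 mod int p" and "u = (x + y) 0 mod int p"
  define zero where "zero w \<longleftrightarrow> vrep p {0<..<n} w = 0" for w
  have X: "s = 2 * m - 1 \<and> zero x \<or> s = 2 * m \<and> x \<notin> P \<or> s \<in> {2 * m + 1..4 * m - 3} \<or> s = 4 * m - 2 \<and> \<not> zero x \<or> s = 4 * m - 1 \<and> x \<in> P"
    using x by (simp add: model_def s_def Let_def zero_def)
  have Y: "t = 2 * m - 1 \<and> zero y \<or> t = 2 * m \<and> y \<notin> P \<or> t \<in> {2 * m + 1..4 * m - 3} \<or> t = 4 * m - 2 \<and> \<not> zero y \<or> t = 4 * m - 1 \<and> y \<in> P"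
    using y by (simp add: model_def t_def Let_def zero_def)
  have Z: "u = 2 * m - 1 \<and> zero (x + y) \<or> u = 2 * m \<and> x + y \<notin> P \<or> u \<in> {2 * m + 1..4 * m - 3} \<or> u = 4 * m - 2 \<and> \<not> zero (x + y) \<or> u = 4 * m - 1 \<and> x + y \<in> P"
    using z by (simp add: model_def u_def Let_def zero_def)
  have bounds: "2 * m - 1 \<le> r \<and> r \<le> 4 * m - 1"
    if "r = 2 * m - 1 \<and> a \<or> r = 2 * m \<and> b \<or> r \<in> {2 * m + 1..4 * m - 3} \<or> r = 4 * m - 2 \<and> c \<or> r = 4 * m - 1 \<and> d"
    for r a b c d
    using that p(2) by (elim disjE) auto
  have rng: "2 * m - 1 \<le> s" "s \<le> 4 * m - 1" "2 * m - 1 \<le> t" "t \<le> 4 * m - 1" "2 * m - 1 \<le> u" "u \<le> 4 * m - 1"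
    using bounds[OF X] bounds[OF Y] bounds[OF Z] by blast+
  have u: "u = (s + t) mod int p" by (simp add: s_def t_def u_def mod_add_eq)
  have zero_add: "zero w \<Longrightarrow> vrep p {0<..<n} (w + w') = vrep p {0<..<n} w'" for w w'
    using W.vs.rep_add_left[of w w'] by (simp add: zero_def)
  show False
  proof (cases "s + t < int p")
    case True
    then have ust: "u = s + t" using u rng p(2) by simp
    then consider "s = 2 * m - 1" "t = 2 * m - 1" | "s = 2 * m - 1" "t = 2 * m" | "s = 2 * m" "t = 2 * m - 1"
      using rng by linarith
    then show False
    proof cases
      case 1
      then have "zero x" "zero y" "\<not> zero (x + y)" using X Y Z ust p(2) by auto
      then show False using zero_add[of x y] by (simp add: zero_def)
    next
      case 2
      then have "zero x" "y \<notin> P" "x + y \<in> P" using X Y Z ust p(2) by auto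
      then show False using zero_add[of x y] W.vs.periodic_cong[OF P] by blast
    next
      case 3
      then have "zero y" "x \<notin> P" "x + y \<in> P" using X Y Z ust p(2) by auto
      then show False using zero_add[of y x] W.vs.periodic_cong[OF P] by (metis add.commute)
    qed
  next
    case False
    have "u = (s + t - int p) mod int p" using u by simp
    moreover have "0 \<le> s + t - int p" "s + t - int p < int p" using False rng p by auto
    ultimately have "u = s + t - int p" by (metis mod_pos_pos_trivial)
    then have "s = 4 * m - 1" "t = 4 * m - 1" "u = 2 * m - 1" using rng p(1) by linarith+
    then have "x \<in> P" "y \<in> P" "zero (x + y)" using X Y Z p(2) by auto
    then show False using P0 by (simp add: zero_def)
  qed
qed

text \<open>P and its complement, and the class of 0 and its complement, contribute q each, in
  addition to the 2m - 3 full sections.\<close>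

lemma model_size:
  fixes m :: int
  assumes p: "int p = 6 * m - 1" "m \<ge> 2" and P: "W.vper P"
  shows "int (V.vsz (model m P)) = (2 * m - 1) * int (p ^ (n - 1))"
proof -
  let ?A = "model m P"
  note A = model_periodic[OF P, of m]
  define f where "f i = int (W.vsz (section_at ?A i))" for i
  define q where "q = int (p ^ (n - 1))"
  have supp: "\<forall>x\<in>?A. x 0 mod int p \<in> {2 * m - 1..4 * m}"
    using p(2) unfolding model_def Let_def by auto
  have upd: "vrep p {0<..<n} (w(0 := i)) = vrep p {0<..<n} w" for w i
    by (auto simp: vrep_def fun_eq_iff)
  have updP: "w(0 := i) \<in> P \<longleftrightarrow> w \<in> P" for w i
    using W.vs.periodic_cong[OF P upd] .
  have sec: "w \<in> section_at ?A i \<longleftrightarrow> i = 2 * m - 1 \<and> vrep p {0<..<n} w = 0 \<or> i = 2 * m \<and> w \<notin> P \<or>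
      i \<in> {2 * m + 1..4 * m - 3} \<or> i = 4 * m - 2 \<and> vrep p {0<..<n} w \<noteq> 0 \<or> i = 4 * m - 1 \<and> w \<in> P"
    if "0 \<le> i" "i < int p" for w i
    using that by (simp add: section_at_def model_def upd updP Let_def)
  have U: "int (W.vsz UNIV) = q" unfolding W.vs.size_of_UNIV W_index q_def ..
  have compl: "int (W.vsz (- X)) = q - int (W.vsz X)" for X
    using W.vs.size_of_Compl[of X] U W.vs.size_of_UNIV by linarith
  have zero_sz: "W.vsz {w. vrep p {0<..<n} w = 0} = 1"
  proof -
    have "(0 :: nat \<Rightarrow> int) \<in> range (vrep p {0<..<n})" using p_pos by (simp add: W.range_vrep)
    then have "{w. vrep p {0<..<n} w = 0} \<inter> range (vrep p {0<..<n}) = {0}"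
      using vrep_zero[of p "{0<..<n}"] by auto
    then show ?thesis by (simp add: W.vs.size_of_def)
  qed
  have s1: "section_at ?A (2 * m - 1) = {w. vrep p {0<..<n} w = 0}" using sec[of "2 * m - 1"] p by auto
  have s2: "section_at ?A (2 * m) = - P" using sec[of "2 * m"] p by auto
  have s3: "section_at ?A i = UNIV" if "i \<in> {2 * m + 1..4 * m - 3}" for i using sec[of i] that p by auto
  have s4: "section_at ?A (4 * m - 2) = - {w. vrep p {0<..<n} w = 0}" using sec[of "4 * m - 2"] p by auto
  have s5: "section_at ?A (4 * m - 1) = P" using sec[of "4 * m - 1"] p by auto
  have s6: "section_at ?A (4 * m) = {}" using sec[of "4 * m"] p by auto
  have f1: "f (2 * m - 1) = 1" "f (2 * m) = q - int (W.vsz P)" "f (4 * m - 2) = q - 1" "f (4 * m - 1) = int (W.vsz P)" "f (4 * m) = 0"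
    unfolding f_def s1 s2 s4 s5 s6 compl zero_sz by simp_all
  have "(\<Sum>i\<in>{2 * m + 1..4 * m - 3}. f i) = (\<Sum>i\<in>{2 * m + 1..4 * m - 3}. q)"
    by (rule sum.cong) (auto simp: f_def s3 U)
  also have "\<dots> = (2 * m - 3) * q" using p(2) by simp
  finally have mid: "(\<Sum>i\<in>{2 * m + 1..4 * m - 3}. f i) = (2 * m - 3) * q" .
  have "int (V.vsz ?A) = (\<Sum>i\<in>{2 * m - 1..4 * m}. f i)"
    using size_eq_sum_support[OF A supp] p unfolding f_def by simp
  then show ?thesis
    unfolding sum_interval_decompose(1)[OF p(2)] mid f1 q_def[symmetric] by (simp add: algebra_simps)
qed

text \<open>The preimage of the middle third of the residues, a sum-free set of the largest size.
  The sets removed at level 1 will be those contained in one of its automorphic images.\<close>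

definition cuboid :: "int \<Rightarrow> (nat \<Rightarrow> int) set" where
  "cuboid m = {x. x 0 mod int p \<in> {2 * m..4 * m - 1}}"

lemma cuboid_periodic: "V.vper (cuboid m)"
  by (rule V.vperI) (use n_pos in \<open>auto simp: cuboid_def cong_def\<close>)

text \<open>Sums of two heights from [2m, 4m - 1] range over 4m, ..., 8m - 2, which modulo 6m - 1 is
  the complement of that interval.\<close>

lemma cuboid_sum_free:
  fixes m :: int
  assumes p: "int p = 6 * m - 1" "m \<ge> 2" and x: "x \<in> cuboid m" "y \<in> cuboid m"
  shows "x + y \<notin> cuboid m"
proof
  assume z: "x + y \<in> cuboid m"
  define s t where "s = x 0 mod int p" and "t = y 0 mod int p"
  have st: "2 * m \<le> s" "s \<le> 4 * m - 1" "2 * m \<le> t" "t \<le> 4 * m - 1" using x by (simp_all add: cuboid_def s_def t_def)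
  have u: "(s + t) mod int p \<in> {2 * m..4 * m - 1}" using z by (simp add: cuboid_def s_def t_def mod_add_eq)
  show False
  proof (cases "s + t < int p")
    case True
    then show False using u st p(2) by simp
  next
    case False
    have "(s + t) mod int p = (s + t - int p) mod int p" by simp
    also have "\<dots> = s + t - int p" using False st p by (intro mod_pos_pos_trivial) auto
    finally show False using u st p by simp
  qed
qed

lemma cuboid_size:
  fixes m :: int
  assumes p: "int p = 6 * m - 1" "m \<ge> 2"
  shows "int (V.vsz (cuboid m)) = 2 * m * int (p ^ (n - 1))"
proof -
  have "int (V.vsz (cuboid m)) = (\<Sum>i\<in>{2 * m..4 * m - 1}. int (W.vsz (section_at (cuboid m) i)))"
    by (rule size_eq_sum_support[OF cuboid_periodic]) (use p in \<open>auto simp: cuboid_def\<close>)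
  also have "\<dots> = (\<Sum>i\<in>{2 * m..4 * m - 1}. int (p ^ (n - 1)))"
  proof (rule sum.cong[OF refl])
    fix i assume i: "i \<in> {2 * m..4 * m - 1}"
    then have "i mod int p = i" using p by simp
    then have "section_at (cuboid m) i = UNIV" using i by (auto simp: section_at_def cuboid_def)
    then show "int (W.vsz (section_at (cuboid m) i)) = int (p ^ (n - 1))"
      by (simp only: W.vs.size_of_UNIV W_index)
  qed
  also have "\<dots> = 2 * m * int (p ^ (n - 1))" using p(2) by simp
  finally show ?thesis .
qed

text \<open>A model contains a full coset of \<open>{x. x 0 = 0}\<close>, so a linear functional confining it to the
  middle interval is a multiple \<open>c\<close> of the first coordinate; \<open>c\<close> maps \<open>2m - 1\<close> consecutive residues
  into an interval of length \<open>2m\<close>, which forces \<open>c = \<plusminus>1\<close>, and both signs fail at the end point.\<close>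

lemma model_not_in_cuboid:
  fixes m :: int
  assumes p: "int p = 6 * m - 1" "m \<ge> 2"
    and P: "W.vper P" and P0: "\<And>w w'. w \<in> P \<Longrightarrow> w' \<in> P \<Longrightarrow> vrep p {0<..<n} (w + w') \<noteq> 0"
    and fg: "finite_quotient.automorphic (vrep p {..<N}) f g" "n \<le> N"
    and sub: "\<And>x. x \<in> model m P \<Longrightarrow> f x 0 mod int p \<in> {2 * m..4 * m - 1}"
  shows False
proof -
  interpret N: split_space p N using fg(2) n_pos by unfold_locales simp
  define lam where "lam x = f x 0 mod int p" for x
  have lam_add: "lam (x + y) = (lam x + lam y) mod int p" for x y
  proof -
    have "vrep p {..<N} (f (x + y)) = vrep p {..<N} (f x + f y)" by (rule N.V.vs.automorphicD(1)[OF fg(1)])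
    then have "[f (x + y) 0 = (f x + f y) 0] (mod int p)" using N.n_pos by (auto simp: N.V.vrep_eq_iff)
    then show ?thesis by (simp add: lam_def cong_def mod_add_eq)
  qed
  have lam_0: "lam 0 = 0"
  proof -
    have "lam 0 = (lam 0 + lam 0) mod int p" using lam_add[of 0 0] by simp
    then have "int p dvd lam 0"
      by (metis add_diff_cancel_right' lam_def mod_eq_dvd_iff mod_mod_trivial)
    moreover have "lam 0 mod int p = lam 0" by (simp add: lam_def)
    ultimately show ?thesis by (metis dvd_imp_mod_0)
  qed
  have lam_mult: "lam (\<lambda>i. int k * x i) = (int k * lam x) mod int p" for k x
  proof (induction k)
    case 0
    then show ?case using lam_0 by (simp add: zero_fun_def)
  next
    case (Suc k)
    have "(\<lambda>i. int (Suc k) * x i) = (\<lambda>i. int k * x i) + x" by (rule ext) (simp add: algebra_simps)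
    then have "lam (\<lambda>i. int (Suc k) * x i) = ((int k * lam x) mod int p + lam x) mod int p"
      using Suc lam_add by simp
    then show ?case by (simp add: mod_add_left_eq mod_add_right_eq algebra_simps)
  qed
  define e where "e = (\<lambda>i :: nat. if i = 0 then 1 else 0 :: int)"
  define c where "c = lam e"
  have c_rng: "0 \<le> c" "c < int p" using p_pos by (simp_all add: c_def lam_def)
  \<comment> \<open>The section at height 2m + 1 is full. If the functional did not vanish on
    vectors with first entry 0, it would take every value on that section, in particular 0.\<close>
  have tail: "lam w = 0" if w0: "w 0 = 0" for w
  proof (rule ccontr)
    assume "lam w \<noteq> 0"
    moreover have "0 \<le> lam w" "lam w < int p" using p_pos by (simp_all add: lam_def)
    ultimately have "\<not> int p dvd lam w" using zdvd_not_zless[of "lam w" "int p"] by auto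
    then obtain d where d: "[lam w * d = 1] (mod int p)" using obtain_inverse by blast
    define b where "b = lam (\<lambda>i. (2 * m + 1) * e i)"
    define k where "k = nat ((- b * d) mod int p)"
    have k: "[int k = - b * d] (mod int p)" using p_pos by (simp add: k_def cong_def)
    have "(\<lambda>i. (2 * m + 1) * e i) + (\<lambda>i. int k * w i) \<in> model m P"
      using p by (simp add: model_def e_def w0)
    then have "lam ((\<lambda>i. (2 * m + 1) * e i) + (\<lambda>i. int k * w i)) \<in> {2 * m..4 * m - 1}"
      using sub by (simp add: lam_def)
    then have "(b + int k * lam w) mod int p \<in> {2 * m..4 * m - 1}"
      by (simp add: lam_add lam_mult b_def mod_add_right_eq)
    moreover have "[b + int k * lam w = b + (- b * d) * lam w] (mod int p)"
      by (intro cong_add cong_refl cong_mult k)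
    moreover have "[b + (- b) * (lam w * d) = b + (- b) * 1] (mod int p)"
      by (intro cong_add cong_refl cong_mult d)
    ultimately show False using p(2) by (simp add: cong_def ac_simps)
  qed
  have lam_c: "lam x = (int k * c) mod int p" if "x 0 = int k" for x k
  proof -
    define w where "w = (\<lambda>i. if i = 0 then 0 else x i)"
    have "x = (\<lambda>i. int k * e i) + w" by (rule ext) (simp add: e_def w_def that)
    then have "lam x = (lam (\<lambda>i. int k * e i) + lam w) mod int p" using lam_add by simp
    then show ?thesis using tail[of w] by (simp add: w_def lam_mult c_def)
  qed
  have "0 \<notin> P"
  proof
    assume "0 \<in> P"
    from P0[OF this this] show False by (simp add: vrep_zero)
  qed
  \<comment> \<open>The points (i, 0) with 2m - 1 \<le> i \<le> 4m - 3 belong to the model; for i =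
    2m this uses 0 \<notin> P.\<close>
  have prog: "(i * c) mod int p \<in> {2 * m..4 * m - 1}" if i: "2 * m - 1 \<le> i" "i \<le> 4 * m - 3" for i
  proof -
    define x where "x = (\<lambda>j :: nat. if j = 0 then i else 0)"
    have "vrep p {0<..<n} x = 0" by (rule ext) (simp add: vrep_def x_def)
    moreover have "x \<notin> P"
    proof -
      have "x \<in> P \<longleftrightarrow> 0 \<in> P" by (rule W.vper_cong[OF P]) (simp add: x_def)
      then show ?thesis using \<open>0 \<notin> P\<close> by simp
    qed
    moreover have "x 0 mod int p = i" using i p by (simp add: x_def)
    ultimately have "x \<in> model m P" using i p(2) unfolding model_def Let_def by auto
    then have "lam x \<in> {2 * m..4 * m - 1}" using sub by (simp add: lam_def)
    moreover have "x 0 = int (nat i)" using i p(2) by (simp add: x_def)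
    ultimately show ?thesis using lam_c[of x "nat i"] i p(2) by simp
  qed
  \<comment> \<open>The target interval has 2m elements, so the differences of its elements are at
    most 2m - 1 in absolute value.\<close>
  have diff: "(k * c) mod int p \<in> {0..2 * m - 1} \<union> {4 * m..int p - 1}" if k: "0 \<le> k" "k \<le> 2 * m - 2" for k
  proof -
    define a b where "a = ((2 * m - 1) * c) mod int p" and "b = ((2 * m - 1 + k) * c) mod int p"
    have ab: "a \<in> {2 * m..4 * m - 1}" "b \<in> {2 * m..4 * m - 1}" unfolding a_def b_def using k p(2) by (intro prog; simp)+
    have eq: "(k * c) mod int p = (b - a) mod int p"
      by (simp add: a_def b_def mod_diff_eq algebra_simps)
    have "(b - a) mod int p = (if b \<ge> a then b - a else b - a + int p)"
    proof (cases "b \<ge> a")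
      case True
      then show ?thesis using ab p by simp
    next
      case False
      have "(b - a) mod int p = (b - a + int p) mod int p" by simp
      also have "\<dots> = b - a + int p" using False ab p by (intro mod_pos_pos_trivial) auto
      finally show ?thesis using False by simp
    qed
    then show ?thesis unfolding eq using ab p by auto
  qed
  define c' where "c' = (if c \<le> 2 * m - 1 then c else int p - c)"
  have c1: "c \<in> {0..2 * m - 1} \<union> {4 * m..int p - 1}" using diff[of 1] p c_rng by simp
  then have c': "0 \<le> c'" "c' \<le> 2 * m - 1" using p c_rng by (auto simp: c'_def)
  have diff': "(k * c') mod int p \<in> {0..2 * m - 1} \<union> {4 * m..int p - 1}" if k: "0 \<le> k" "k \<le> 2 * m - 2" for k
  proof (cases "c \<le> 2 * m - 1")
    case True then show ?thesis using diff[OF k] by (simp add: c'_def)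
  next
    case False
    define r where "r = (k * c) mod int p"
    have r: "r \<in> {0..2 * m - 1} \<union> {4 * m..int p - 1}" unfolding r_def by (rule diff[OF k])
    have eq: "(k * c') mod int p = (- r) mod int p"
    proof -
      have "k * c' = - (k * c) + k * int p" using False by (simp add: c'_def algebra_simps)
      then have "(k * c') mod int p = (- (k * c)) mod int p" by (simp only: mod_mult_self1)
      then show ?thesis by (simp add: r_def mod_minus_eq)
    qed
    show ?thesis
    proof (cases "r = 0")
      case True then show ?thesis using eq p(2) by simp
    next
      case False
      have "(- r) mod int p = (int p - r) mod int p" by simp
      also have "\<dots> = int p - r" using False r p by (intro mod_pos_pos_trivial) auto
      finally show ?thesis using eq r False p by auto
    qed
  qed
  have "c' \<noteq> 0"
  proof
    assume "c' = 0"
    then have "c = 0" using c_rng by (auto simp: c'_def split: if_splits)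
    then show False using prog[of "2 * m - 1"] p(2) by simp
  qed
  have "c' < 2"
  proof (rule ccontr)
    assume "\<not> c' < 2"
    then have c2: "c' \<ge> 2" by simp
    \<comment> \<open>Consecutive multiples of c' are at most 2m - 1 apart and cannot jump over the
      forbidden range from 2m to 4m - 1. For c' \<ge> 2, however, the multiple by 2m - 2 would have
      to be beyond it.\<close>
    have "k * c' \<le> 2 * m - 1" if "0 \<le> k" "k \<le> 2 * m - 2" for k
      using that
    proof (induction k rule: int_ge_induct)
      case base then show ?case using p(2) by simp
    next
      case (step k)
      then have IH: "k * c' \<le> 2 * m - 1" by simp
      have "0 \<le> k * c'" using step.hyps c' by simp
      have val: "(k + 1) * c' = k * c' + c'" by (simp add: algebra_simps)
      have "0 \<le> (k + 1) * c'" "(k + 1) * c' \<le> 4 * m - 2" using IH c' \<open>0 \<le> k * c'\<close> val by linarith+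
      then have "((k + 1) * c') mod int p = (k + 1) * c'" using p by (intro mod_pos_pos_trivial) auto
      then show ?case using diff'[of "k + 1"] step.prems step.hyps \<open>(k + 1) * c' \<le> 4 * m - 2\<close> by auto
    qed
    from this[of "2 * m - 2"] have "(2 * m - 2) * c' \<le> 2 * m - 1" using p(2) by simp
    moreover have "(2 * m - 2) * 2 \<le> (2 * m - 2) * c'" using c2 p(2) by (intro mult_left_mono) auto
    ultimately have "(2 * m - 2) * 2 \<le> 2 * m - 1" by (rule order_trans[rotated])
    then show False using p(2) by simp
  qed
  then have "c' = 1" using c'(1) \<open>c' \<noteq> 0\<close> by simp
  show False
  proof (cases "c \<le> 2 * m - 1")
    case True
    then have "c = 1" using \<open>c' = 1\<close> by (simp add: c'_def)
    then show False using prog[of "2 * m - 1"] p by simp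
  next
    case False
    then have c: "c = 6 * m - 2" using \<open>c' = 1\<close> p by (simp add: c'_def)
    have "(2 * m - 1) * c = (4 * m) + (2 * m - 2) * int p" unfolding c p(1) by (simp add: algebra_simps)
    then have "((2 * m - 1) * c) mod int p = (4 * m) mod int p" by simp
    moreover have "(4 * m) mod int p = 4 * m" using p by simp
    ultimately show False using prog[of "2 * m - 1"] p(2) by simp
  qed
qed

end

section \<open>Adding coordinates, and the induction on the dimension\<close>

context prime_modulus
begin

definition extend_map :: "nat \<Rightarrow> ((nat \<Rightarrow> int) \<Rightarrow> nat \<Rightarrow> int) \<Rightarrow> (nat \<Rightarrow> int) \<Rightarrow> nat \<Rightarrow> int" where
  "extend_map l f x = (\<lambda>i. if i < l then f x i else x i)"

lemma vrep_lessThan_eq_iff: "vrep p {..<k} x = vrep p {..<k} y \<longleftrightarrow> (\<forall>i<k. [x i = y i] (mod int p))"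
  by (auto simp: vrep_def fun_eq_iff cong_def)

lemma automorphic_extend:
  assumes "finite_quotient.automorphic (vrep p {..<l}) f g" and l: "l \<le> N"
  shows "finite_quotient.automorphic (vrep p {..<N}) (extend_map l f) (extend_map l g)"
proof -
  interpret L: coordinate_space p "{..<l}" by unfold_locales simp
  interpret N: coordinate_space p "{..<N}" by unfold_locales simp
  note fg = assms(1)
  note D = L.vs.automorphicD[OF fg, unfolded vrep_lessThan_eq_iff, rule_format]
  have cong: "[f x i = f y i] (mod int p)" "[g x i = g y i] (mod int p)"
    if "\<And>i. i < l \<Longrightarrow> [x i = y i] (mod int p)" "i < l" for x y i
  proof -
    have "vrep p {..<l} x = vrep p {..<l} y" using that(1) by (simp add: vrep_lessThan_eq_iff)
    from L.vs.automorphic_cong[OF fg this] show "[f x i = f y i] (mod int p)" "[g x i = g y i] (mod int p)"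
      using that(2) by (simp_all add: vrep_lessThan_eq_iff)
  qed
  have vr: "[vrep p {..<N} x i = x i] (mod int p)" if "i < N" for x i
    using that by (simp add: vrep_def)
  show ?thesis
    unfolding N.vs.automorphic_def vrep_lessThan_eq_iff
  proof (intro conjI allI impI)
    fix x y :: "nat \<Rightarrow> int" and i assume i: "i < N"
    show "[extend_map l f (x + y) i = (extend_map l f x + extend_map l f y) i] (mod int p)"
      using D(1)[of i x y] by (simp add: extend_map_def)
    show "[extend_map l f (vrep p {..<N} x) i = extend_map l f x i] (mod int p)"
    proof (cases "i < l")
      case True
      have "[f (vrep p {..<N} x) i = f x i] (mod int p)"
        by (rule cong(1)[OF _ True]) (use vr l in simp)
      then show ?thesis using True by (simp add: extend_map_def)
    next
      case False
      then show ?thesis using vr[OF i] by (simp add: extend_map_def)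
    qed
    show "[extend_map l g (vrep p {..<N} x) i = extend_map l g x i] (mod int p)"
    proof (cases "i < l")
      case True
      have "[g (vrep p {..<N} x) i = g x i] (mod int p)"
        by (rule cong(2)[OF _ True]) (use vr l in simp)
      then show ?thesis using True by (simp add: extend_map_def)
    next
      case False
      then show ?thesis using vr[OF i] by (simp add: extend_map_def)
    qed
    show "[extend_map l f (extend_map l g x) i = x i] (mod int p)"
    proof (cases "i < l")
      case True
      have "[f (extend_map l g x) i = f (g x) i] (mod int p)"
        by (rule cong(1)[OF _ True]) (simp add: extend_map_def)
      then have "[f (extend_map l g x) i = x i] (mod int p)" using D(4)[OF True, of x] by (rule cong_trans)
      then show ?thesis using True by (simp add: extend_map_def)
    next
      case False
      then show ?thesis by (simp add: extend_map_def)
    qed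
    show "[extend_map l g (extend_map l f x) i = x i] (mod int p)"
    proof (cases "i < l")
      case True
      have "[g (extend_map l f x) i = g (f x) i] (mod int p)"
        by (rule cong(2)[OF _ True]) (simp add: extend_map_def)
      then have "[g (extend_map l f x) i = x i] (mod int p)" using D(5)[OF True, of x] by (rule cong_trans)
      then show ?thesis using True by (simp add: extend_map_def)
    next
      case False
      then show ?thesis by (simp add: extend_map_def)
    qed
  qed
qed

lemma extend_map_mem:
  assumes "finite_quotient.periodic (vrep p {..<l}) X"
  shows "extend_map l f x \<in> X \<longleftrightarrow> f x \<in> X"
proof -
  interpret L: coordinate_space p "{..<l}" by unfold_locales simp
  show ?thesis by (rule L.vper_cong[OF assms]) (simp add: extend_map_def)
qed

lemma size_of_add_coordinate:
  assumes "finite_quotient.periodic (vrep p {..<l}) X"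
  shows "finite_quotient.size_of (vrep p {..<Suc l}) X = p * finite_quotient.size_of (vrep p {..<l}) X"
proof -
  interpret L: coordinate_space p "{..<l}" by unfold_locales simp
  interpret S: coordinate_space p "{..<Suc l}" by unfold_locales simp
  have rL: "x \<in> range (vrep p {..<l}) \<longleftrightarrow> (\<forall>i. if i < l then 0 \<le> x i \<and> x i < int p else x i = 0)" for x
    unfolding L.range_vrep by simp
  have rS: "x \<in> range (vrep p {..<Suc l}) \<longleftrightarrow> (\<forall>i. if i < Suc l then 0 \<le> x i \<and> x i < int p else x i = 0)" for x
    unfolding S.range_vrep by simp
  have mem: "x(l := t) \<in> X \<longleftrightarrow> x \<in> X" for x t
    by (rule L.vper_cong[OF assms]) simp
  have "bij_betw (\<lambda>x. (x(l := 0), x l)) (X \<inter> range (vrep p {..<Suc l})) ((X \<inter> range (vrep p {..<l})) \<times> {0..<int p})"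
  proof (rule bij_betw_byWitness[where f' = "\<lambda>(w, t). w(l := t)"])
    show "\<forall>a\<in>X \<inter> range (vrep p {..<Suc l}). (case (a(l := 0), a l) of (w, t) \<Rightarrow> w(l := t)) = a" by simp
    show "\<forall>a\<in>(X \<inter> range (vrep p {..<l})) \<times> {0..<int p}. ((case a of (w, t) \<Rightarrow> w(l := t))(l := 0), (case a of (w, t) \<Rightarrow> w(l := t)) l) = a"
    proof
      fix a assume a: "a \<in> (X \<inter> range (vrep p {..<l})) \<times> {0..<int p}"
      obtain w t where wt: "a = (w, t)" by force
      have "w l = 0" using a rL[of w] wt by (auto dest: spec[of _ l])
      then show "((case a of (w, t) \<Rightarrow> w(l := t))(l := 0), (case a of (w, t) \<Rightarrow> w(l := t)) l) = a"
        unfolding wt by auto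
    qed
    show "(\<lambda>x. (x(l := 0), x l)) ` (X \<inter> range (vrep p {..<Suc l})) \<subseteq> (X \<inter> range (vrep p {..<l})) \<times> {0..<int p}"
    proof
      fix a assume "a \<in> (\<lambda>x. (x(l := 0), x l)) ` (X \<inter> range (vrep p {..<Suc l}))"
      then obtain x where x: "a = (x(l := 0), x l)" "x \<in> X" and "x \<in> range (vrep p {..<Suc l})" by blast
      then have r: "\<forall>i. if i < Suc l then 0 \<le> x i \<and> x i < int p else x i = 0" using rS by blast
      have "x(l := 0) \<in> range (vrep p {..<l})" unfolding rL
      proof
        fix i show "if i < l then 0 \<le> (x(l := 0)) i \<and> (x(l := 0)) i < int p else (x(l := 0)) i = 0"
          using r[rule_format, of i] by (cases "i = l") (auto split: if_splits)
      qed
      moreover have "0 \<le> x l \<and> x l < int p" using r[rule_format, of l] by simp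
      ultimately show "a \<in> (X \<inter> range (vrep p {..<l})) \<times> {0..<int p}" using x mem by simp
    qed
    show "(\<lambda>(w, t). w(l := t)) ` ((X \<inter> range (vrep p {..<l})) \<times> {0..<int p}) \<subseteq> X \<inter> range (vrep p {..<Suc l})"
    proof
      fix a assume "a \<in> (\<lambda>(w, t). w(l := t)) ` ((X \<inter> range (vrep p {..<l})) \<times> {0..<int p})"
      then obtain w t where wt: "a = w(l := t)" "w \<in> X" "w \<in> range (vrep p {..<l})" "0 \<le> t" "t < int p" by auto
      then have r: "\<forall>i. if i < l then 0 \<le> w i \<and> w i < int p else w i = 0" using rL by blast
      have "w(l := t) \<in> range (vrep p {..<Suc l})" unfolding rS
      proof
        fix i show "if i < Suc l then 0 \<le> (w(l := t)) i \<and> (w(l := t)) i < int p else (w(l := t)) i = 0"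
          using r[rule_format, of i] wt(4,5) by (cases "i = l") (auto split: if_splits)
      qed
      then show "a \<in> X \<inter> range (vrep p {..<Suc l})" using wt mem by simp
    qed
  qed
  then have "card (X \<inter> range (vrep p {..<Suc l})) = card ((X \<inter> range (vrep p {..<l})) \<times> {0..<int p})"
    by (rule bij_betw_same_card)
  then show ?thesis unfolding S.vs.size_of_def L.vs.size_of_def by (simp add: card_cartesian_product)
qed

lemma periodic_mono_coordinates:
  assumes "finite_quotient.periodic (vrep p {..<l}) X" "l \<le> N"
  shows "finite_quotient.periodic (vrep p {..<N}) X"
proof -
  interpret L: coordinate_space p "{..<l}" by unfold_locales simp
  interpret N: coordinate_space p "{..<N}" by unfold_locales simp
  show ?thesis
  proof (rule N.vperI)
    fix x y assume xy: "\<forall>i\<in>{..<N}. [x i = y i] (mod int p)" "x \<in> X"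
    have "x \<in> X \<longleftrightarrow> y \<in> X" by (rule L.vper_cong[OF assms(1)]) (use xy(1) assms(2) in auto)
    then show "y \<in> X" using xy by simp
  qed
qed

text \<open>A set of integer vectors that is periodic in the first l coordinates is its own
  cylinder, and each further coordinate multiplies its size by p.\<close>

lemma size_of_extend:
  assumes X: "finite_quotient.periodic (vrep p {..<l}) X" and l: "l \<le> N"
  shows "finite_quotient.size_of (vrep p {..<N}) X = p ^ (N - l) * finite_quotient.size_of (vrep p {..<l}) X"
  using l
proof (induction N rule: dec_induct)
  case base
  then show ?case by simp
next
  case (step k)
  have "finite_quotient.size_of (vrep p {..<Suc k}) X = p * finite_quotient.size_of (vrep p {..<k}) X"
    by (rule size_of_add_coordinate[OF periodic_mono_coordinates[OF X step.hyps(1)]])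
  then show ?case using step by (simp add: Suc_diff_le)
qed

text \<open>The counterpart of \<open>structured\<close>. The model, read in N coordinates, is its
  own cylinder, so a single automorphism of the whole space takes the place of the two isomorphisms
  in the original definition.\<close>

definition lifted_structured :: "int \<Rightarrow> nat \<Rightarrow> (nat \<Rightarrow> int) set \<Rightarrow> bool" where
  "lifted_structured m N A \<longleftrightarrow> (\<exists>l f g P. 1 \<le> l \<and> l \<le> N \<and>
     finite_quotient.automorphic (vrep p {..<N}) f g \<and> finite_quotient.periodic (vrep p {0<..<l}) P \<and>
     (\<forall>w\<in>P. \<forall>w'\<in>P. vrep p {0<..<l} (w + w') \<noteq> 0) \<and> {x. f x \<in> A} = split_space.model p l m P)"

definition in_cuboid :: "int \<Rightarrow> nat \<Rightarrow> (nat \<Rightarrow> int) set \<Rightarrow> bool" where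
  "in_cuboid m N A \<longleftrightarrow> (\<exists>f g. finite_quotient.automorphic (vrep p {..<N}) f g \<and>
     (\<forall>x. f x \<in> A \<longrightarrow> x 0 mod int p \<in> {2 * m..4 * m - 1}))"

text \<open>If the set has a period, an automorphism moves the period to the last axis. The set is
  then periodic in n - 1 coordinates, and its size, already known to be exactly (2m - 1) p^(n-1),
  drops by the factor p, so it again meets the bound of the induction hypothesis.\<close>

lemma lifted_dichotomy:
  fixes m :: int
  assumes p: "int p = 6 * m - 1" "m \<ge> 2"
  shows "n \<ge> 1 \<Longrightarrow> finite_quotient.periodic (vrep p {..<n}) A \<Longrightarrow> \<forall>a\<in>A. \<forall>b\<in>A. a + b \<notin> A \<Longrightarrow>
    (2 * m - 1) * int (p ^ (n - 1)) \<le> int (finite_quotient.size_of (vrep p {..<n}) A) \<Longrightarrow>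
    in_cuboid m n A \<or>
    (int (finite_quotient.size_of (vrep p {..<n}) A) = (2 * m - 1) * int (p ^ (n - 1)) \<and> lifted_structured m n A)"
proof (induction n arbitrary: A rule: less_induct)
  case (less n)
  interpret S: split_space p n using less.prems(1) by unfold_locales
  note A = less.prems(2) and large = less.prems(4)
  have sf: "a + b \<notin> A" if "a \<in> A" "b \<in> A" for a b using less.prems(3) that by blast
  let ?goal = "in_cuboid m n A \<or> (int (S.V.vsz A) = (2 * m - 1) * int (p ^ (n - 1)) \<and> lifted_structured m n A)"
  have rigid: ?goal
    if fg: "S.V.vs.automorphic f g" and supp: "\<And>x. f x \<in> A \<Longrightarrow> x 0 mod int p \<in> {2 * m - 1..4 * m}"
      and R: "S.section_at {x. f x \<in> A} (2 * m - 1) \<noteq> {}" for f g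
  proof -
    define A1 where "A1 = {x. f x \<in> A}"
    have A1: "S.V.vper A1" "S.V.vsz A1 = S.V.vsz A"
      unfolding A1_def using S.V.vs.periodic_automorphic[OF fg A] S.V.vs.size_of_automorphic[OF fg A] by auto
    have sf1: "a + b \<notin> A1" if "a \<in> A1" "b \<in> A1" for a b
      using S.V.vs.sum_free_automorphic[OF fg A sf] that unfolding A1_def by blast
    have sf1': "\<forall>a\<in>A1. \<forall>b\<in>A1. a + b \<notin> A1" using sf1 by blast
    have supp1: "\<forall>x\<in>A1. x 0 mod int p \<in> {2 * m - 1..4 * m}" using supp by (simp add: A1_def)
    have supp1': "x 0 mod int p \<in> {2 * m - 1..4 * m}" if "x \<in> A1" for x using supp1 that by blast
    have large1: "(2 * m - 1) * int (p ^ (n - 1)) \<le> int (S.V.vsz A1)" using large A1 by simp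
    have R1: "S.section_at A1 (2 * m - 1) \<noteq> {}" using R by (simp add: A1_def)
    have size: "int (S.V.vsz A) = (2 * m - 1) * int (p ^ (n - 1))"
      using S.one_sided_rigidity(1)[OF p A1(1) sf1' large1 supp1 R1] A1(2) by simp
    have alt: "(\<exists>v. vrep p {..<n} v \<noteq> 0 \<and> (\<forall>x. x + v \<in> A1 \<longleftrightarrow> x \<in> A1)) \<or>
      (\<exists>f g P. S.V.vs.automorphic f g \<and> S.W.vper P \<and> (\<forall>w\<in>P. \<forall>w'\<in>P. vrep p {0<..<n} (w + w') \<noteq> 0) \<and>
        {x. f x \<in> A1} = S.model m P)"
      by (rule S.one_sided_structure[OF p A1(1) _ large1 _ R1]) (use sf1 supp1' in blast)+
    then show ?goal
    proof
      assume "\<exists>f g P. S.V.vs.automorphic f g \<and> S.W.vper P \<and> (\<forall>w\<in>P. \<forall>w'\<in>P. vrep p {0<..<n} (w + w') \<noteq> 0) \<and>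
        {x. f x \<in> A1} = S.model m P"
      then obtain f2 g2 P where m2: "S.V.vs.automorphic f2 g2" "S.W.vper P"
        "\<forall>w\<in>P. \<forall>w'\<in>P. vrep p {0<..<n} (w + w') \<noteq> 0" "{x. f2 x \<in> A1} = S.model m P" by blast
      have eq: "{x. f (f2 x) \<in> A} = S.model m P" using m2(4) by (simp add: A1_def)
      have "1 \<le> n" using less.prems(1) .
      then have "lifted_structured m n A"
        unfolding lifted_structured_def using S.V.vs.automorphic_comp[OF fg m2(1)] m2(2,3) eq by blast
      then show ?goal using size by blast
    next
      assume "\<exists>v. vrep p {..<n} v \<noteq> 0 \<and> (\<forall>x. x + v \<in> A1 \<longleftrightarrow> x \<in> A1)"
      then obtain v where v: "vrep p {..<n} v \<noteq> 0" and per_v: "\<And>x. x + v \<in> A1 \<longleftrightarrow> x \<in> A1" by blast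
      obtain j where j: "j < n" "\<not> int p dvd v j"
        using v by (auto simp: vrep_def fun_eq_iff dvd_eq_mod_eq_0 split: if_splits)
      obtain f3 g3 where fg3: "S.V.vs.automorphic f3 g3"
        and f3: "\<And>x t. f3 (x + (\<lambda>i. if i = n - 1 then t else 0)) = f3 x + (\<lambda>i. t * v i)"
        using S.V.automorphic_vector[of "n - 1" j v] j less.prems(1) by auto
      define A3 where "A3 = {x. f3 x \<in> A1}"
      have A3: "S.V.vper A3" "S.V.vsz A3 = S.V.vsz A1"
        unfolding A3_def using S.V.vs.periodic_automorphic[OF fg3 A1(1)] S.V.vs.size_of_automorphic[OF fg3 A1(1)] by auto
      have sf3: "a + b \<notin> A3" if "a \<in> A3" "b \<in> A3" for a b
        using S.V.vs.sum_free_automorphic[OF fg3 A1(1) sf1] that unfolding A3_def by blast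
      have mult_nat: "z + (\<lambda>i. int k * v i) \<in> A1 \<longleftrightarrow> z \<in> A1" for z k
      proof (induction k)
        case 0
        have "z + (\<lambda>i. int 0 * v i) = z" by (rule ext) simp
        then show ?case by simp
      next
        case (Suc k)
        have e: "z + (\<lambda>i. int (Suc k) * v i) = (z + (\<lambda>i. int k * v i)) + v" by (rule ext) (simp add: algebra_simps)
        show ?case unfolding e per_v by (rule Suc)
      qed
      have mult_int: "z + (\<lambda>i. t * v i) \<in> A1 \<longleftrightarrow> z \<in> A1" for z t
      proof -
        have "z + (\<lambda>i. t * v i) \<in> A1 \<longleftrightarrow> z + (\<lambda>i. int (nat (t mod int p)) * v i) \<in> A1"
        proof (rule S.V.vper_cong[OF A1(1)])
          fix i
          have c: "[t = int (nat (t mod int p))] (mod int p)" using p_pos by (simp add: cong_def)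
          show "[(z + (\<lambda>i. t * v i)) i = (z + (\<lambda>i. int (nat (t mod int p)) * v i)) i] (mod int p)"
            unfolding plus_fun_apply by (intro cong_add cong_refl cong_mult c)
        qed
        then show ?thesis by (simp only: mult_nat)
      qed
      have inv3: "x + (\<lambda>i. if i = n - 1 then t else 0) \<in> A3 \<longleftrightarrow> x \<in> A3" for x t
        unfolding A3_def mem_Collect_eq f3 by (rule mult_int)
      interpret L: coordinate_space p "{..<n - 1}" by unfold_locales simp
      have per3: "L.vper A3"
      proof (rule L.vperI)
        fix x y assume xy: "\<forall>i\<in>{..<n - 1}. [x i = y i] (mod int p)" "x \<in> A3"
        have "y \<in> A3 \<longleftrightarrow> x + (\<lambda>i. if i = n - 1 then y (n - 1) - x (n - 1) else 0) \<in> A3"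
        proof (rule S.V.vper_cong[OF A3(1)])
          fix i assume i: "i \<in> {..<n}"
          show "[y i = (x + (\<lambda>i. if i = n - 1 then y (n - 1) - x (n - 1) else 0)) i] (mod int p)"
          proof (cases "i = n - 1")
            case True then show ?thesis by simp
          next
            case False
            then have "[x i = y i] (mod int p)" using xy(1) i by auto
            then show ?thesis using False by (simp add: cong_sym)
          qed
        qed
        then show "y \<in> A3" using inv3 xy(2) by blast
      qed
      obtain z where z: "z \<in> A1" using R1 by (auto simp: S.section_at_def)
      have "g3 z \<in> A3" using z S.V.vs.mem_automorphic_iff[OF fg3 A1(1)] by (simp add: A3_def)
      \<comment> \<open>With no coordinate left the set would be empty or everything, and being
        nonempty it would contain 0.\<close>
      have n2: "n - 1 \<ge> 1"
      proof (rule ccontr)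
        assume "\<not> n - 1 \<ge> 1"
        then have "n - 1 = 0" by simp
        then have "g3 z \<in> A3 \<longleftrightarrow> 0 \<in> A3" by (intro L.vper_cong[OF per3]) simp
        then have "0 \<in> A3" using \<open>g3 z \<in> A3\<close> by simp
        then show False using sf3[of 0 0] by simp
      qed
      have sz3: "S.V.vsz A3 = p * L.vsz A3"
        using size_of_add_coordinate[OF per3] less.prems(1) by simp
      have "int p * int (L.vsz A3) = int p * ((2 * m - 1) * int (p ^ (n - 1 - 1)))"
      proof -
        have "int p * int (L.vsz A3) = (2 * m - 1) * int (p ^ (n - 1))"
          using sz3 A3(2) A1(2) size by (metis of_nat_mult)
        moreover have "p ^ (n - 1) = p * p ^ (n - 1 - 1)" using n2 by (metis Suc_diff_1 less_eq_Suc_le One_nat_def power_Suc)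
        then have "int (p ^ (n - 1)) = int p * int (p ^ (n - 1 - 1))" by (metis of_nat_mult)
        ultimately show ?thesis by (metis mult.left_commute)
      qed
      then have sz_L: "int (L.vsz A3) = (2 * m - 1) * int (p ^ (n - 1 - 1))" using p_pos by simp
      have "n - 1 < n" using less.prems(1) by simp
      have IH: "in_cuboid m (n - 1) A3 \<or> (int (L.vsz A3) = (2 * m - 1) * int (p ^ (n - 1 - 1)) \<and> lifted_structured m (n - 1) A3)"
      proof (rule less.IH[OF \<open>n - 1 < n\<close> n2 per3])
        show "\<forall>a\<in>A3. \<forall>b\<in>A3. a + b \<notin> A3" using sf3 by blast
        show "(2 * m - 1) * int (p ^ (n - 1 - 1)) \<le> int (L.vsz A3)" by (simp only: sz_L order_refl)
      qed
      have comp: "S.V.vs.automorphic (\<lambda>x. f (f3 (extend_map (n - 1) f4 x))) (\<lambda>x. extend_map (n - 1) g4 (g3 (g x)))"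
        if "L.vs.automorphic f4 g4" for f4 g4
        using S.V.vs.automorphic_comp[OF fg S.V.vs.automorphic_comp[OF fg3 automorphic_extend[OF that, of n]]] by simp
      have mem: "f (f3 (extend_map (n - 1) f4 x)) \<in> A \<longleftrightarrow> f4 x \<in> A3" for f4 x
        using extend_map_mem[OF per3, of f4 x] by (simp add: A3_def A1_def)
      from IH show ?goal
      proof
        assume "in_cuboid m (n - 1) A3"
        then obtain f4 g4 where f4: "L.vs.automorphic f4 g4" "\<And>x. f4 x \<in> A3 \<Longrightarrow> x 0 mod int p \<in> {2 * m..4 * m - 1}"
          unfolding in_cuboid_def by blast
        have "in_cuboid m n A" unfolding in_cuboid_def
          using comp[OF f4(1)] f4(2) mem by blast
        then show ?goal by blast
      next
        assume "int (L.vsz A3) = (2 * m - 1) * int (p ^ (n - 1 - 1)) \<and> lifted_structured m (n - 1) A3"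
        then obtain l f4 g4 P where l: "1 \<le> l" "l \<le> n - 1" and f4: "L.vs.automorphic f4 g4"
          and P: "finite_quotient.periodic (vrep p {0<..<l}) P" "\<forall>w\<in>P. \<forall>w'\<in>P. vrep p {0<..<l} (w + w') \<noteq> 0"
          and eq: "{x. f4 x \<in> A3} = split_space.model p l m P"
          unfolding lifted_structured_def by blast
        have "{x. f (f3 (extend_map (n - 1) f4 x)) \<in> A} = split_space.model p l m P"
          unfolding mem by (rule eq)
        moreover have "l \<le> n" using l by simp
        ultimately have "lifted_structured m n A"
          unfolding lifted_structured_def using l(1) comp[OF f4] P by blast
        then show ?goal using size by blast
      qed
    qed
  qed
  obtain f g where fg: "S.V.vs.automorphic f g" and supp: "\<And>x. f x \<in> A \<Longrightarrow> x 0 mod int p \<in> {2 * m - 1..4 * m}"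
    using S.middle_automorphism[OF p A _ large] sf by blast
  define A1 where "A1 = {x. f x \<in> A}"
  have A1: "S.V.vper A1" unfolding A1_def by (rule S.V.vs.periodic_automorphic[OF fg A])
  show ?case
  proof (cases "S.section_at A1 (2 * m - 1) = {}")
    case False
    then show ?thesis using rigid[of f g] fg supp unfolding A1_def by blast
  next
    case R: True
    show ?thesis
    proof (cases "S.section_at A1 (4 * m) = {}")
      case True
      have "x 0 mod int p \<in> {2 * m..4 * m - 1}" if "f x \<in> A" for x
      proof -
        have "x \<in> S.section_at A1 (x 0 mod int p)"
          using S.mem_section[OF A1, of x "x 0 mod int p"] that by (simp add: A1_def cong_def)
        then have "x 0 mod int p \<noteq> 2 * m - 1" "x 0 mod int p \<noteq> 4 * m" using R True by auto
        then show ?thesis using supp[OF that] by auto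
      qed
      then have "in_cuboid m n A" unfolding in_cuboid_def using fg by blast
      then show ?thesis by blast
    next
      case False
      then obtain w where w: "w(0 := 4 * m) \<in> A1" by (auto simp: S.section_at_def)
      \<comment> \<open>Negation exchanges the two ends of the middle interval, since (2m - 1) + 4m
        = p, and so leads back to a nonempty section 2m - 1.\<close>
      have um: "S.V.vs.automorphic uminus uminus"
        unfolding S.V.vs.automorphic_def by (simp add: S.V.vs.rep_uminus add.commute)
      have fm: "S.V.vs.automorphic (\<lambda>x. f (- x)) (\<lambda>x. - g x)"
        using S.V.vs.automorphic_comp[OF fg um] .
      have suppm: "x 0 mod int p \<in> {2 * m - 1..4 * m}" if "f (- x) \<in> A" for x
      proof -
        define r where "r = (- x 0) mod int p"
        have r: "r \<in> {2 * m - 1..4 * m}" using supp[OF that] by (simp add: r_def)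
        have "x 0 mod int p = (- r) mod int p" by (simp add: r_def mod_minus_eq)
        also have "\<dots> = (int p - r) mod int p" by simp
        also have "\<dots> = int p - r" using r p by (intro mod_pos_pos_trivial) auto
        finally show ?thesis using r p by auto
      qed
      have "- (w(0 := 4 * m)) \<in> {x. f (- x) \<in> A}" using w by (simp add: A1_def)
      moreover have "- (w(0 := 4 * m)) \<in> {x. f (- x) \<in> A} \<longleftrightarrow> (- w)(0 := 2 * m - 1) \<in> {x. f (- x) \<in> A}"
      proof (rule S.V.vper_cong[OF S.V.vs.periodic_automorphic[OF fm A]])
        fix i
        have "- (4 * m) - (2 * m - 1) = - int p" using p by simp
        then have "[- (4 * m) = 2 * m - 1] (mod int p)" by (simp add: cong_iff_dvd_diff)
        then show "[(- (w(0 := 4 * m))) i = ((- w)(0 := 2 * m - 1)) i] (mod int p)" by simp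
      qed
      ultimately have "- w \<in> S.section_at {x. f (- x) \<in> A} (2 * m - 1)" by (simp add: S.section_at_def)
      then have "S.section_at {x. f (- x) \<in> A} (2 * m - 1) \<noteq> {}" by blast
      then show ?thesis using rigid[of "\<lambda>x. f (- x)" "\<lambda>x. - g x"] fm suppm by blast
    qed
  qed
qed

lemma lifted_structured_properties:
  fixes m :: int
  assumes p: "int p = 6 * m - 1" "m \<ge> 2" and n: "n \<ge> 1"
    and A: "finite_quotient.periodic (vrep p {..<n}) A" and st: "lifted_structured m n A"
  shows "\<forall>a\<in>A. \<forall>b\<in>A. a + b \<notin> A"
    and "int (finite_quotient.size_of (vrep p {..<n}) A) = (2 * m - 1) * int (p ^ (n - 1))"
    and "\<not> in_cuboid m n A"
proof -
  obtain l f g P where l: "1 \<le> l" "l \<le> n" and fg: "finite_quotient.automorphic (vrep p {..<n}) f g"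
    and P: "finite_quotient.periodic (vrep p {0<..<l}) P" "\<forall>w\<in>P. \<forall>w'\<in>P. vrep p {0<..<l} (w + w') \<noteq> 0"
    and eq: "{x. f x \<in> A} = split_space.model p l m P"
    using st unfolding lifted_structured_def by blast
  interpret N: split_space p n using n by unfold_locales
  interpret L: split_space p l using l by unfold_locales
  have P2: "vrep p {0<..<l} (w + w') \<noteq> 0" if "w \<in> P" "w' \<in> P" for w w' using P(2) that by blast
  have perM: "N.V.vper (L.model m P)" unfolding eq[symmetric] by (rule N.V.vs.periodic_automorphic[OF fg A])
  have mem_A_iff: "x \<in> A \<longleftrightarrow> g x \<in> L.model m P" for x
    unfolding eq[symmetric] using N.V.vs.mem_automorphic_iff[OF fg A, of x] by simp
  show "\<forall>a\<in>A. \<forall>b\<in>A. a + b \<notin> A"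
  proof (intro ballI)
    fix a b assume ab: "a \<in> A" "b \<in> A"
    then have "g a + g b \<notin> L.model m P"
      using L.model_sum_free[OF p P(1)] P2 mem_A_iff by blast
    moreover have "vrep p {..<n} (g (a + b)) = vrep p {..<n} (g a + g b)"
      by (rule N.V.vs.automorphicD(1)[OF N.V.vs.automorphic_sym[OF fg]])
    ultimately show "a + b \<notin> A" using mem_A_iff[of "a + b"] N.V.vs.periodic_cong[OF perM] by blast
  qed
  have "N.V.vsz A = N.V.vsz (L.model m P)"
    unfolding eq[symmetric] by (rule N.V.vs.size_of_automorphic[OF fg A, symmetric])
  also have "\<dots> = p ^ (n - l) * L.V.vsz (L.model m P)"
    by (rule size_of_extend[OF L.model_periodic[OF P(1)] l(2)])
  finally have "int (N.V.vsz A) = int (p ^ (n - l)) * int (L.V.vsz (L.model m P))" by simp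
  also have "\<dots> = (2 * m - 1) * int (p ^ (n - l) * p ^ (l - 1))"
    unfolding L.model_size[OF p P(1)] by simp
  also have "p ^ (n - l) * p ^ (l - 1) = p ^ (n - 1)"
    using l by (simp add: power_add[symmetric])
  finally show "int (N.V.vsz A) = (2 * m - 1) * int (p ^ (n - 1))" .
  show "\<not> in_cuboid m n A"
  proof
    assume "in_cuboid m n A"
    then obtain f' g' where fg': "N.V.vs.automorphic f' g'" "\<And>x. f' x \<in> A \<Longrightarrow> x 0 mod int p \<in> {2 * m..4 * m - 1}"
      unfolding in_cuboid_def by blast
    have "g' (f x) 0 mod int p \<in> {2 * m..4 * m - 1}" if "x \<in> L.model m P" for x
    proof -
      have "f x \<in> A" using that eq by blast
      then have "f' (g' (f x)) \<in> A" using N.V.vs.mem_automorphic_iff[OF fg'(1) A] by blast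
      then show ?thesis by (rule fg'(2))
    qed
    then show False
      using L.model_not_in_cuboid[OF p P(1) _ N.V.vs.automorphic_comp[OF N.V.vs.automorphic_sym[OF fg'(1)] fg] l(2)] P2
      by blast
  qed
qed

end

subsection \<open>Transfer to the group \<open>\<bbbF>\<^sub>p\<^sup>n\<close>\<close>

definition proj :: "nat \<Rightarrow> nat \<Rightarrow> (nat \<Rightarrow> int) \<Rightarrow> nat \<Rightarrow> int" where
  "proj p n x = (\<lambda>i\<in>{..<n}. x i mod int p)"

text \<open>The preimage under reduction modulo p; it turns subsets of the carrier into periodic
  sets, with the image under \<open>proj\<close> as inverse.\<close>

definition lift :: "nat \<Rightarrow> nat \<Rightarrow> (nat \<Rightarrow> int) set \<Rightarrow> (nat \<Rightarrow> int) set" where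
  "lift p n B = {x. proj p n x \<in> B}"

context prime_modulus
begin

lemma carrier_Fp: "carrier (Fp p n) = (\<Pi>\<^sub>E i\<in>{..<n}. {0..<int p})"
  using p_pos by (simp add: Fp_def carrier_integer_mod_group)

lemma mult_Fp: "x \<otimes>\<^bsub>Fp p n\<^esub> y = (\<lambda>i\<in>{..<n}. (x i + y i) mod int p)"
  by (simp add: Fp_def mult_integer_mod_group)

lemma one_Fp: "\<one>\<^bsub>Fp p n\<^esub> = (\<lambda>i\<in>{..<n}. 0)"
  by (simp add: Fp_def)

lemma group_Fp: "group (Fp p n)"
  unfolding Fp_def by (simp add: group_integer_mod_group)

lemma finite_carrier_Fp: "finite (carrier (Fp p n))"
  unfolding carrier_Fp by (intro finite_PiE) auto

lemma proj_in: "proj p n x \<in> carrier (Fp p n)"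
  unfolding carrier_Fp proj_def using p_pos by auto

lemma proj_id:
  assumes "x \<in> carrier (Fp p n)"
  shows "proj p n x = x"
proof
  fix i
  show "proj p n x i = x i"
  proof (cases "i < n")
    case True
    then have "x i \<in> {0..<int p}" using PiE_mem[OF assms[unfolded carrier_Fp], of i] by simp
    then show ?thesis using True by (simp add: proj_def)
  next
    case False
    then show ?thesis using PiE_arb[OF assms[unfolded carrier_Fp], of i] by (simp add: proj_def)
  qed
qed

lemma proj_add: "proj p n (x + y) = proj p n x \<otimes>\<^bsub>Fp p n\<^esub> proj p n y"
  unfolding mult_Fp by (rule ext) (simp add: proj_def mod_add_eq)

lemma proj_eq_iff: "proj p n x = proj p n y \<longleftrightarrow> vrep p {..<n} x = vrep p {..<n} y"
  by (auto simp: proj_def vrep_def fun_eq_iff restrict_def)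

lemma lift_proj_image:
  assumes "finite_quotient.periodic (vrep p {..<n}) X"
  shows "lift p n (proj p n ` X) = X"
proof -
  interpret V: coordinate_space p "{..<n}" by unfold_locales simp
  show ?thesis unfolding lift_def using proj_eq_iff V.vs.periodic_cong[OF assms] by blast
qed

lemma periodic_lift: "finite_quotient.periodic (vrep p {..<n}) (lift p n B)"
proof -
  interpret V: coordinate_space p "{..<n}" by unfold_locales simp
  have "proj p n (vrep p {..<n} x) = proj p n x" for x by (simp add: proj_eq_iff)
  then show ?thesis unfolding V.vs.periodic_def lift_def by simp
qed

lemma size_lift:
  assumes "B \<subseteq> carrier (Fp p n)"
  shows "finite_quotient.size_of (vrep p {..<n}) (lift p n B) = card B"
proof -
  interpret V: coordinate_space p "{..<n}" by unfold_locales simp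
  have "bij_betw (proj p n) (lift p n B \<inter> range (vrep p {..<n})) B"
    unfolding bij_betw_def
  proof
    show "inj_on (proj p n) (lift p n B \<inter> range (vrep p {..<n}))"
    proof (rule inj_onI)
      fix x y assume "x \<in> lift p n B \<inter> range (vrep p {..<n})" "y \<in> lift p n B \<inter> range (vrep p {..<n})"
        and "proj p n x = proj p n y"
      then obtain x' y' where "x = vrep p {..<n} x'" "y = vrep p {..<n} y'" "vrep p {..<n} x = vrep p {..<n} y"
        by (auto simp: proj_eq_iff)
      then show "x = y" by simp
    qed
    show "proj p n ` (lift p n B \<inter> range (vrep p {..<n})) = B"
    proof
      show "proj p n ` (lift p n B \<inter> range (vrep p {..<n})) \<subseteq> B" by (auto simp: lift_def)
      show "B \<subseteq> proj p n ` (lift p n B \<inter> range (vrep p {..<n}))"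
      proof
        fix b assume b: "b \<in> B"
        have eq: "proj p n (vrep p {..<n} b) = b"
          using proj_id[of b n] assms b proj_eq_iff[of n "vrep p {..<n} b" b] by auto
        then have "vrep p {..<n} b \<in> lift p n B" using b by (simp add: lift_def)
        then show "b \<in> proj p n ` (lift p n B \<inter> range (vrep p {..<n}))" using eq by (metis IntI imageI rangeI)
      qed
    qed
  qed
  then show ?thesis unfolding V.vs.size_of_def by (rule bij_betw_same_card)
qed

lemma lift_subset_iff:
  assumes "B \<subseteq> carrier (Fp p n)"
  shows "lift p n B \<subseteq> lift p n C \<longleftrightarrow> B \<subseteq> C"
proof
  assume L: "lift p n B \<subseteq> lift p n C"
  show "B \<subseteq> C"
  proof
    fix x assume x: "x \<in> B"
    then have e: "proj p n x = x" using proj_id assms by blast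
    then have "x \<in> lift p n B" using x by (simp add: lift_def)
    then have "x \<in> lift p n C" using L by blast
    then show "x \<in> C" using e by (simp add: lift_def)
  qed
qed (auto simp: lift_def)

lemma sum_free_lift_iff:
  assumes "B \<subseteq> carrier (Fp p n)"
  shows "sum_free (Fp p n) B \<longleftrightarrow> (\<forall>a\<in>lift p n B. \<forall>b\<in>lift p n B. a + b \<notin> lift p n B)"
proof
  assume "sum_free (Fp p n) B"
  then show "\<forall>a\<in>lift p n B. \<forall>b\<in>lift p n B. a + b \<notin> lift p n B"
    unfolding sum_free_def lift_def by (auto simp: proj_add)
next
  assume L: "\<forall>a\<in>lift p n B. \<forall>b\<in>lift p n B. a + b \<notin> lift p n B"
  have "x \<otimes>\<^bsub>Fp p n\<^esub> y \<noteq> z" if xyz: "x \<in> B" "y \<in> B" "z \<in> B" for x y z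
  proof
    assume eq: "x \<otimes>\<^bsub>Fp p n\<^esub> y = z"
    have id: "proj p n x = x" "proj p n y = y" using proj_id assms xyz by auto
    then have "x \<in> lift p n B" "y \<in> lift p n B" using xyz by (auto simp: lift_def)
    then have "x + y \<notin> lift p n B" using L by blast
    moreover have "proj p n (x + y) = z" using eq id by (simp add: proj_add)
    ultimately show False using xyz by (simp add: lift_def)
  qed
  then show "sum_free (Fp p n) B" unfolding sum_free_def using assms by blast
qed

text \<open>An isomorphism \<phi> moves sets by images, whereas f moves them by preimages, so f
  represents the inverse of \<phi> and g represents \<phi>.\<close>

lemma isomorphic_subsets_iff:
  assumes B: "B \<subseteq> carrier (Fp p n)" and C: "C \<subseteq> carrier (Fp p n)"
  shows "isomorphic_subsets (Fp p n) B C \<longleftrightarrow>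
    (\<exists>f g. finite_quotient.automorphic (vrep p {..<n}) f g \<and> {x. f x \<in> lift p n B} = lift p n C)"
proof
  interpret V: coordinate_space p "{..<n}" by unfold_locales simp
  interpret G: group "Fp p n" by (rule group_Fp)
  assume "isomorphic_subsets (Fp p n) B C"
  then obtain \<phi> where \<phi>: "\<phi> \<in> iso (Fp p n) (Fp p n)" and img: "\<phi> ` B = C"
    unfolding isomorphic_subsets_def by blast
  define \<psi> where "\<psi> = inv_into (carrier (Fp p n)) \<phi>"
  have \<psi>: "\<psi> \<in> iso (Fp p n) (Fp p n)" unfolding \<psi>_def by (rule G.iso_set_sym[OF \<phi>])
  have bij: "bij_betw \<phi> (carrier (Fp p n)) (carrier (Fp p n))" using \<phi> by (simp add: iso_def)
  have inv: "\<psi> (\<phi> x) = x" "\<phi> (\<psi> x) = x" "\<phi> x \<in> carrier (Fp p n)" "\<psi> x \<in> carrier (Fp p n)"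
    if x: "x \<in> carrier (Fp p n)" for x
  proof -
    show "\<psi> (\<phi> x) = x" unfolding \<psi>_def by (rule bij_betw_inv_into_left[OF bij x])
    show "\<phi> (\<psi> x) = x" unfolding \<psi>_def by (rule bij_betw_inv_into_right[OF bij x])
    show "\<phi> x \<in> carrier (Fp p n)" using bij x by (rule bij_betwE[rule_format])
    show "\<psi> x \<in> carrier (Fp p n)" unfolding \<psi>_def using bij_betw_inv_into[OF bij] x by (rule bij_betwE[rule_format])
  qed
  define f g where "f x = \<psi> (proj p n x)" and "g x = \<phi> (proj p n x)" for x
  have pf: "proj p n (f x) = f x" "proj p n (g x) = g x" for x
    unfolding f_def g_def using inv(3,4)[OF proj_in] proj_id by auto
  have \<psi>_hom: "\<psi> (x \<otimes>\<^bsub>Fp p n\<^esub> y) = \<psi> x \<otimes>\<^bsub>Fp p n\<^esub> \<psi> y"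
    if "x \<in> carrier (Fp p n)" "y \<in> carrier (Fp p n)" for x y
    using \<psi> that by (simp add: iso_def hom_mult)
  have "V.vs.automorphic f g"
    unfolding V.vs.automorphic_def proj_eq_iff[symmetric]
  proof (intro conjI allI)
    fix x y
    show "proj p n (f (x + y)) = proj p n (f x + f y)"
      unfolding proj_add pf unfolding f_def proj_add by (rule \<psi>_hom[OF proj_in proj_in])
    have "proj p n (vrep p {..<n} x) = proj p n x" by (simp add: proj_eq_iff)
    then show "proj p n (f (vrep p {..<n} x)) = proj p n (f x)" "proj p n (g (vrep p {..<n} x)) = proj p n (g x)"
      by (simp_all add: f_def g_def)
    show "proj p n (f (g x)) = proj p n x"
      unfolding pf unfolding f_def pf unfolding g_def by (rule inv(1)[OF proj_in])
    show "proj p n (g (f x)) = proj p n x"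
      unfolding pf unfolding g_def pf unfolding f_def by (rule inv(2)[OF proj_in])
  qed
  moreover have "f x \<in> lift p n B \<longleftrightarrow> x \<in> lift p n C" for x
  proof -
    have "f x \<in> lift p n B \<longleftrightarrow> \<psi> (proj p n x) \<in> B" unfolding lift_def mem_Collect_eq pf unfolding f_def ..
    also have "\<dots> \<longleftrightarrow> proj p n x \<in> \<phi> ` B"
    proof
      assume "\<psi> (proj p n x) \<in> B"
      then have "\<phi> (\<psi> (proj p n x)) \<in> \<phi> ` B" by (rule imageI)
      then show "proj p n x \<in> \<phi> ` B" using inv(2)[OF proj_in] by simp
    next
      assume "proj p n x \<in> \<phi> ` B"
      then obtain b where "b \<in> B" "proj p n x = \<phi> b" by blast
      then show "\<psi> (proj p n x) \<in> B" using inv(1) B by auto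
    qed
    finally show ?thesis unfolding img lift_def by simp
  qed
  ultimately show "\<exists>f g. V.vs.automorphic f g \<and> {x. f x \<in> lift p n B} = lift p n C" by blast
next
  interpret V: coordinate_space p "{..<n}" by unfold_locales simp
  assume "\<exists>f g. V.vs.automorphic f g \<and> {x. f x \<in> lift p n B} = lift p n C"
  then obtain f g where fg: "V.vs.automorphic f g" and eq: "{x. f x \<in> lift p n B} = lift p n C" by blast
  note gf = V.vs.automorphic_sym[OF fg]
  define \<phi> where "\<phi> x = proj p n (g x)" for x
  define \<psi> where "\<psi> x = proj p n (f x)" for x
  have pg: "proj p n (g (proj p n x)) = proj p n (g x)" and pf: "proj p n (f (proj p n x)) = proj p n (f x)" for x
  proof -
    have "vrep p {..<n} (proj p n x) = vrep p {..<n} x" by (auto simp: vrep_def proj_def fun_eq_iff)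
    from V.vs.automorphic_cong[OF fg this]
    show "proj p n (g (proj p n x)) = proj p n (g x)" "proj p n (f (proj p n x)) = proj p n (f x)"
      by (simp_all add: proj_eq_iff)
  qed
  have fgp: "proj p n (f (g x)) = proj p n x" "proj p n (g (f x)) = proj p n x" for x
    using V.vs.automorphicD(4,5)[OF fg] by (simp_all add: proj_eq_iff)
  have "\<phi> \<in> hom (Fp p n) (Fp p n)"
  proof (rule homI)
    fix x y assume xy: "x \<in> carrier (Fp p n)" "y \<in> carrier (Fp p n)"
    show "\<phi> x \<in> carrier (Fp p n)" unfolding \<phi>_def by (rule proj_in)
    have "x \<otimes>\<^bsub>Fp p n\<^esub> y = proj p n (x + y)" using proj_id[OF xy(1)] proj_id[OF xy(2)] by (simp add: proj_add)
    then have "\<phi> (x \<otimes>\<^bsub>Fp p n\<^esub> y) = proj p n (g (x + y))" by (simp add: \<phi>_def pg)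
    also have "\<dots> = proj p n (g x + g y)" using V.vs.automorphicD(1)[OF gf] by (simp add: proj_eq_iff)
    finally show "\<phi> (x \<otimes>\<^bsub>Fp p n\<^esub> y) = \<phi> x \<otimes>\<^bsub>Fp p n\<^esub> \<phi> y" by (simp add: \<phi>_def proj_add)
  qed
  moreover have "bij_betw \<phi> (carrier (Fp p n)) (carrier (Fp p n))"
    by (rule bij_betw_byWitness[where f' = \<psi>]) (auto simp: \<phi>_def \<psi>_def pf pg fgp proj_id proj_in)
  ultimately have "\<phi> \<in> iso (Fp p n) (Fp p n)" by (simp add: iso_def)
  moreover have "\<phi> ` B = C"
  proof
    show "\<phi> ` B \<subseteq> C"
    proof
      fix y assume "y \<in> \<phi> ` B"
      then obtain b where b: "b \<in> B" "y = proj p n (g b)" by (auto simp: \<phi>_def)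
      have "proj p n (f (g b)) = b" using fgp(1)[of b] proj_id B b by auto
      then have "g b \<in> {x. f x \<in> lift p n B}" using b by (simp add: lift_def)
      then show "y \<in> C" unfolding eq using b by (simp add: lift_def)
    qed
    show "C \<subseteq> \<phi> ` B"
    proof
      fix y assume y: "y \<in> C"
      then have "proj p n y = y" using proj_id C by auto
      then have "y \<in> lift p n C" using y by (simp add: lift_def)
      then have "f y \<in> lift p n B" using eq by blast
      then have "\<psi> y \<in> B" by (simp add: lift_def \<psi>_def)
      moreover have "\<phi> (\<psi> y) = y" using \<open>proj p n y = y\<close> by (simp add: \<phi>_def \<psi>_def pg fgp)
      ultimately show "y \<in> \<phi> ` B" by (metis imageI)
    qed
  qed
  ultimately show "isomorphic_subsets (Fp p n) B C" unfolding isomorphic_subsets_def using B C by blast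
qed

lemma lift_cylinder:
  assumes "l \<le> n"
  shows "lift p n (cylinder p n l B) = lift p l B"
proof -
  have "restrict (proj p n x) {..<l} = proj p l x" for x
    using assms by (auto simp: proj_def fun_eq_iff restrict_def)
  then show ?thesis by (simp add: lift_def cylinder_def proj_in)
qed

lemma cylinder_carrier: "cylinder p n l B \<subseteq> carrier (Fp p n)"
  by (auto simp: cylinder_def)

lemma very_structured_model_carrier: "very_structured_model p m l P \<subseteq> carrier (Fp p l)"
  by (auto simp: very_structured_model_def Let_def slab_def)

text \<open>The entries of a vector in \<open>Fp p (l - 1)\<close> are numbered from 0, those of the
  split space without its first coordinate from 1; \<open>vtail\<close> performs the shift.\<close>

definition tail_pullback :: "nat \<Rightarrow> (nat \<Rightarrow> int) set \<Rightarrow> (nat \<Rightarrow> int) set" where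
  "tail_pullback l P = {w. vtail l (proj p l w) \<in> P}"

lemma vtail_proj: "vtail l (proj p l w) = proj p (l - 1) (\<lambda>i. w (Suc i))"
  by (rule ext) (auto simp: vtail_def proj_def restrict_def)

lemma vtail_proj_eq_iff: "vtail l (proj p l w) = vtail l (proj p l w') \<longleftrightarrow> vrep p {0<..<l} w = vrep p {0<..<l} w'"
proof -
  have "vtail l (proj p l w) = vtail l (proj p l w') \<longleftrightarrow> (\<forall>i<l - 1. [w (Suc i) = w' (Suc i)] (mod int p))"
    by (simp only: vtail_proj proj_eq_iff vrep_lessThan_eq_iff)
  also have "\<dots> \<longleftrightarrow> (\<forall>i\<in>{0<..<l}. [w i = w' i] (mod int p))"
  proof
    assume h: "\<forall>i<l - 1. [w (Suc i) = w' (Suc i)] (mod int p)"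
    show "\<forall>i\<in>{0<..<l}. [w i = w' i] (mod int p)"
    proof
      fix i assume i: "i \<in> {0<..<l}"
      then have "i - 1 < l - 1" "Suc (i - 1) = i" by auto
      then show "[w i = w' i] (mod int p)" using h by metis
    qed
  next
    assume h: "\<forall>i\<in>{0<..<l}. [w i = w' i] (mod int p)"
    show "\<forall>i<l - 1. [w (Suc i) = w' (Suc i)] (mod int p)"
    proof (intro allI impI)
      fix i assume "i < l - 1"
      then have "Suc i \<in> {0<..<l}" by auto
      then show "[w (Suc i) = w' (Suc i)] (mod int p)" using h by blast
    qed
  qed
  also have "\<dots> \<longleftrightarrow> vrep p {0<..<l} w = vrep p {0<..<l} w'"
    by (auto simp: vrep_def fun_eq_iff cong_def)
  finally show ?thesis .
qed

lemma periodic_tail_pullback: "finite_quotient.periodic (vrep p {0<..<l}) (tail_pullback l P)"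
proof -
  interpret W: coordinate_space p "{0<..<l}" by unfold_locales simp
  have "vtail l (proj p l (vrep p {0<..<l} x)) = vtail l (proj p l x)" for x by (simp add: vtail_proj_eq_iff)
  then show ?thesis unfolding W.vs.periodic_def tail_pullback_def by simp
qed

lemma vtail_one_iff: "vtail l (proj p l w) = \<one>\<^bsub>Fp p (l - 1)\<^esub> \<longleftrightarrow> vrep p {0<..<l} w = 0"
proof -
  have "vtail l (proj p l 0) = \<one>\<^bsub>Fp p (l - 1)\<^esub>"
    unfolding vtail_proj one_Fp by (rule ext) (simp add: proj_def)
  then show ?thesis using vtail_proj_eq_iff[of l w 0] by (simp add: vrep_zero)
qed

lemma lift_very_structured_model:
  assumes "l \<ge> 1"
  shows "lift p l (very_structured_model p m l P) = split_space.model p l m (tail_pullback l P)"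
proof -
  interpret L: split_space p l using assms by unfold_locales
  have 0: "proj p l x 0 = x 0 mod int p" for x using assms by (simp add: proj_def)
  have V: "vtail l (proj p l x) \<in> carrier (Fp p (l - 1))" for x unfolding vtail_proj by (rule proj_in)
  show ?thesis
    unfolding lift_def very_structured_model_def Let_def slab_def L.model_def tail_pullback_def
    by (rule Set.set_eqI)
      (simp only: mem_Collect_eq Un_iff Diff_iff singleton_iff 0 V proj_in vtail_one_iff simp_thms disj_assoc)
qed

lemma no_zero_sum_iff:
  assumes P: "P \<subseteq> carrier (Fp p (l - 1))" and l: "l \<ge> 1"
  shows "\<one>\<^bsub>Fp p (l - 1)\<^esub> \<notin> P <#>\<^bsub>Fp p (l - 1)\<^esub> P \<longleftrightarrow>
    (\<forall>w\<in>tail_pullback l P. \<forall>w'\<in>tail_pullback l P. vrep p {0<..<l} (w + w') \<noteq> 0)"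
proof -
  let ?H = "Fp p (l - 1)"
  have add: "vtail l (proj p l (w + w')) = vtail l (proj p l w) \<otimes>\<^bsub>?H\<^esub> vtail l (proj p l w')" for w w'
  proof -
    have "(\<lambda>i. (w + w') (Suc i)) = (\<lambda>i. w (Suc i)) + (\<lambda>i. w' (Suc i))" by (rule ext) simp
    then show ?thesis unfolding vtail_proj by (simp add: proj_add)
  qed
  have surj: "\<exists>w. vtail l (proj p l w) = x" if "x \<in> P" for x
  proof
    have "proj p (l - 1) x = x" using proj_id that P by auto
    then show "vtail l (proj p l (\<lambda>i. x (i - 1))) = x" unfolding vtail_proj by simp
  qed
  have "\<one>\<^bsub>?H\<^esub> \<in> P <#>\<^bsub>?H\<^esub> P \<longleftrightarrow> (\<exists>x\<in>P. \<exists>y\<in>P. \<one>\<^bsub>?H\<^esub> = x \<otimes>\<^bsub>?H\<^esub> y)"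
    by (auto simp: set_mult_def)
  also have "\<dots> \<longleftrightarrow> (\<exists>w\<in>tail_pullback l P. \<exists>w'\<in>tail_pullback l P. vrep p {0<..<l} (w + w') = 0)"
  proof
    assume "\<exists>x\<in>P. \<exists>y\<in>P. \<one>\<^bsub>?H\<^esub> = x \<otimes>\<^bsub>?H\<^esub> y"
    then obtain x y where xy: "x \<in> P" "y \<in> P" "\<one>\<^bsub>?H\<^esub> = x \<otimes>\<^bsub>?H\<^esub> y" by blast
    obtain w where w: "vtail l (proj p l w) = x" using surj[OF xy(1)] by blast
    obtain w' where w': "vtail l (proj p l w') = y" using surj[OF xy(2)] by blast
    have "vtail l (proj p l (w + w')) = \<one>\<^bsub>?H\<^esub>" using add w w' xy(3) by simp
    then show "\<exists>w\<in>tail_pullback l P. \<exists>w'\<in>tail_pullback l P. vrep p {0<..<l} (w + w') = 0"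
      using w w' xy unfolding vtail_one_iff tail_pullback_def by blast
  next
    assume "\<exists>w\<in>tail_pullback l P. \<exists>w'\<in>tail_pullback l P. vrep p {0<..<l} (w + w') = 0"
    then obtain w w' where "w \<in> tail_pullback l P" "w' \<in> tail_pullback l P" "vrep p {0<..<l} (w + w') = 0" by blast
    moreover from this(3) have "\<one>\<^bsub>?H\<^esub> = vtail l (proj p l w) \<otimes>\<^bsub>?H\<^esub> vtail l (proj p l w')"
      using vtail_one_iff[of l "w + w'"] add by simp
    ultimately show "\<exists>x\<in>P. \<exists>y\<in>P. \<one>\<^bsub>?H\<^esub> = x \<otimes>\<^bsub>?H\<^esub> y" unfolding tail_pullback_def by blast
  qed
  finally show ?thesis by blast
qed

lemma automorphic_id: "finite_quotient.automorphic (vrep p {..<n}) (\<lambda>x. x) (\<lambda>x. x)"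
proof -
  interpret V: coordinate_space p "{..<n}" by unfold_locales simp
  show ?thesis by (simp add: V.vs.automorphic_def)
qed

text \<open>In one direction the isomorphism with the cylinder is composed with the extension of the
  one with the model; in the other the model itself serves as the base of the cylinder. The m
  quantified in \<open>very_structured\<close> is determined by p = 6m - 1.\<close>

lemma structured_iff:
  assumes p: "int p = 6 * m - 1"
  shows "structured p n B \<longleftrightarrow> B \<subseteq> carrier (Fp p n) \<and> lifted_structured m n (lift p n B)"
proof
  assume "structured p n B"
  then obtain l B' where l: "l \<in> {1..n}" and vs: "very_structured p l B'"
    and iso: "isomorphic_subsets (Fp p n) B (cylinder p n l B')"
    unfolding structured_def by blast
  then obtain m' P where m': "int p = 6 * m' - 1" and P: "P \<subseteq> carrier (Fp p (l - 1))"
    "\<one>\<^bsub>Fp p (l - 1)\<^esub> \<notin> P <#>\<^bsub>Fp p (l - 1)\<^esub> P"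
    and iso': "isomorphic_subsets (Fp p l) B' (very_structured_model p m' l P)"
    unfolding very_structured_def by blast
  have m: "m' = m" using m' p by simp
  interpret N: coordinate_space p "{..<n}" by unfold_locales simp
  interpret L: coordinate_space p "{..<l}" by unfold_locales simp
  have B: "B \<subseteq> carrier (Fp p n)" and B': "B' \<subseteq> carrier (Fp p l)"
    using iso iso' unfolding isomorphic_subsets_def by auto
  obtain f g where fg: "N.vs.automorphic f g" "{x. f x \<in> lift p n B} = lift p n (cylinder p n l B')"
    using iso isomorphic_subsets_iff[OF B cylinder_carrier] by blast
  obtain f' g' where fg': "L.vs.automorphic f' g'" "{x. f' x \<in> lift p l B'} = lift p l (very_structured_model p m l P)"
    using iso' isomorphic_subsets_iff[OF B' very_structured_model_carrier] unfolding m by blast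
  have ln: "1 \<le> l" "l \<le> n" using l by auto
  have cyl: "lift p n (cylinder p n l B') = lift p l B'" by (rule lift_cylinder[OF ln(2)])
  have "{x. f (extend_map l f' x) \<in> lift p n B} = split_space.model p l m (tail_pullback l P)"
  proof -
    have "f (extend_map l f' x) \<in> lift p n B \<longleftrightarrow> f' x \<in> lift p l B'" for x
      using fg(2) extend_map_mem[OF periodic_lift, of l f' x B'] unfolding cyl by blast
    then show ?thesis using fg'(2) lift_very_structured_model[OF ln(1)] by simp
  qed
  moreover have "N.vs.automorphic (\<lambda>x. f (extend_map l f' x)) (\<lambda>x. extend_map l g' (g x))"
    by (rule N.vs.automorphic_comp[OF fg(1) automorphic_extend[OF fg'(1) ln(2)]])
  moreover have "\<forall>w\<in>tail_pullback l P. \<forall>w'\<in>tail_pullback l P. vrep p {0<..<l} (w + w') \<noteq> 0"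
    using no_zero_sum_iff[OF P(1) ln(1)] P(2) by blast
  ultimately have "lifted_structured m n (lift p n B)"
    unfolding lifted_structured_def using ln periodic_tail_pullback by blast
  then show "B \<subseteq> carrier (Fp p n) \<and> lifted_structured m n (lift p n B)" using B by blast
next
  assume h: "B \<subseteq> carrier (Fp p n) \<and> lifted_structured m n (lift p n B)"
  then obtain l f g Q where l: "1 \<le> l" "l \<le> n" and fg: "finite_quotient.automorphic (vrep p {..<n}) f g"
    and Q: "finite_quotient.periodic (vrep p {0<..<l}) Q" "\<forall>w\<in>Q. \<forall>w'\<in>Q. vrep p {0<..<l} (w + w') \<noteq> 0"
    and eq: "{x. f x \<in> lift p n B} = split_space.model p l m Q"
    unfolding lifted_structured_def by blast
  interpret W: coordinate_space p "{0<..<l}" by unfold_locales simp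
  define P where "P = (\<lambda>w. vtail l (proj p l w)) ` Q"
  have P: "P \<subseteq> carrier (Fp p (l - 1))" unfolding P_def vtail_proj using proj_in by blast
  have QP: "tail_pullback l P = Q"
  proof
    show "Q \<subseteq> tail_pullback l P" unfolding tail_pullback_def P_def by blast
    show "tail_pullback l P \<subseteq> Q"
    proof
      fix w assume "w \<in> tail_pullback l P"
      then obtain w' where w': "w' \<in> Q" "vtail l (proj p l w) = vtail l (proj p l w')"
        unfolding tail_pullback_def P_def by blast
      then have "vrep p {0<..<l} w = vrep p {0<..<l} w'" unfolding vtail_proj_eq_iff by blast
      then show "w \<in> Q" using W.vs.periodic_cong[OF Q(1)] w'(1) by blast
    qed
  qed
  define B' where "B' = very_structured_model p m l P"
  have B': "B' \<subseteq> carrier (Fp p l)" unfolding B'_def by (rule very_structured_model_carrier)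
  have liftB': "lift p l B' = split_space.model p l m Q"
    unfolding B'_def lift_very_structured_model[OF l(1)] QP ..
  have "isomorphic_subsets (Fp p l) B' B'"
    using isomorphic_subsets_iff[OF B' B'] automorphic_id[of l] by blast
  moreover have "\<one>\<^bsub>Fp p (l - 1)\<^esub> \<notin> P <#>\<^bsub>Fp p (l - 1)\<^esub> P"
    using no_zero_sum_iff[OF P l(1)] Q(2) unfolding QP by blast
  ultimately have "very_structured p l B'"
    unfolding very_structured_def using p P B'_def by blast
  moreover have "isomorphic_subsets (Fp p n) B (cylinder p n l B')"
  proof -
    have "{x. f x \<in> lift p n B} = lift p n (cylinder p n l B')"
      unfolding lift_cylinder[OF l(2)] liftB' by (rule eq)
    then show ?thesis using isomorphic_subsets_iff[of B n "cylinder p n l B'"] h cylinder_carrier fg by blast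
  qed
  ultimately show "structured p n B" unfolding structured_def using l by auto
qed

lemma sum_free_dichotomy:
  fixes m :: int
  assumes p: "int p = 6 * m - 1" "m \<ge> 2" and n: "n \<ge> 1"
    and B: "sum_free (Fp p n) B" "(2 * m - 1) * int (p ^ (n - 1)) \<le> int (card B)"
  shows "in_cuboid m n (lift p n B) \<or> (int (card B) = (2 * m - 1) * int (p ^ (n - 1)) \<and> structured p n B)"
proof -
  have car: "B \<subseteq> carrier (Fp p n)" using B(1) by (simp add: sum_free_def)
  have "\<forall>a\<in>lift p n B. \<forall>b\<in>lift p n B. a + b \<notin> lift p n B" using sum_free_lift_iff[OF car] B(1) by blast
  from lifted_dichotomy[OF p n periodic_lift this] show ?thesis
    using B(2) structured_iff[OF p(1)] car by (simp add: size_lift[OF car])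
qed

text \<open>A set confined to the middle third in suitable coordinates lies in a moved copy of the
  cuboid, which is sum-free and of known size.\<close>

lemma cuboid_superset:
  fixes m :: int
  assumes p: "int p = 6 * m - 1" "m \<ge> 2" and n: "n \<ge> 1"
    and B: "B \<subseteq> carrier (Fp p n)" "in_cuboid m n (lift p n B)"
  obtains C where "sum_free (Fp p n) C" "int (card C) = 2 * m * int (p ^ (n - 1))" "B \<subseteq> C"
proof -
  interpret S: split_space p n using n by unfold_locales
  obtain f g where fg: "S.V.vs.automorphic f g" and mid: "\<And>x. f x \<in> lift p n B \<Longrightarrow> x 0 mod int p \<in> {2 * m..4 * m - 1}"
    using B(2) unfolding in_cuboid_def by blast
  note gf = S.V.vs.automorphic_sym[OF fg]
  define K where "K = {x. g x \<in> S.cuboid m}"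
  have K: "S.V.vper K" "S.V.vsz K = S.V.vsz (S.cuboid m)"
    unfolding K_def using S.V.vs.periodic_automorphic[OF gf S.cuboid_periodic] S.V.vs.size_of_automorphic[OF gf S.cuboid_periodic] by auto
  have sfK: "a + b \<notin> K" if "a \<in> K" "b \<in> K" for a b
    using S.V.vs.sum_free_automorphic[OF gf S.cuboid_periodic[of m] S.cuboid_sum_free[OF p]] that unfolding K_def by blast
  define C where "C = proj p n ` K"
  have car: "C \<subseteq> carrier (Fp p n)" unfolding C_def using proj_in by blast
  have lC: "lift p n C = K" unfolding C_def by (rule lift_proj_image[OF K(1)])
  have "sum_free (Fp p n) C" unfolding sum_free_lift_iff[OF car] lC using sfK by blast
  moreover have "int (card C) = 2 * m * int (p ^ (n - 1))"
    using size_lift[OF car] K(2) S.cuboid_size[OF p] unfolding lC by simp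
  moreover have "B \<subseteq> C"
  proof -
    have "x \<in> K" if "x \<in> lift p n B" for x
    proof -
      have "f (g x) \<in> lift p n B" using S.V.vs.mem_automorphic_iff[OF fg periodic_lift] that by blast
      then show ?thesis using mid[of "g x"] by (simp add: K_def S.cuboid_def)
    qed
    then show ?thesis using lift_subset_iff[OF B(1), of C] lC by blast
  qed
  ultimately show thesis by (rule that)
qed

lemma structured_properties:
  fixes m :: int
  assumes p: "int p = 6 * m - 1" "m \<ge> 2" and n: "n \<ge> 1" and B: "structured p n B"
  shows "sum_free (Fp p n) B" "int (card B) = (2 * m - 1) * int (p ^ (n - 1))" "\<not> in_cuboid m n (lift p n B)"
proof -
  have car: "B \<subseteq> carrier (Fp p n)" and st: "lifted_structured m n (lift p n B)"
    using B structured_iff[OF p(1)] by blast+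
  note props = lifted_structured_properties[OF p n periodic_lift st]
  show "sum_free (Fp p n) B" using props(1) sum_free_lift_iff[OF car] by blast
  show "int (card B) = (2 * m - 1) * int (p ^ (n - 1))" using props(2) size_lift[OF car] by simp
  show "\<not> in_cuboid m n (lift p n B)" by (rule props(3))
qed

text \<open>The model with P = {} is an example in every dimension; it shows that the maximum at
  level 1 is attained.\<close>

lemma exists_structured:
  fixes m :: int
  assumes p: "int p = 6 * m - 1" and n: "n \<ge> 1"
  shows "\<exists>B. structured p n B"
proof -
  interpret S: split_space p n using n by unfold_locales
  let ?M = "S.model m {}"
  have per: "S.V.vper ?M" by (rule S.model_periodic) simp
  have "lifted_structured m n ?M"
    unfolding lifted_structured_def
  proof (intro exI conjI)
    show "1 \<le> n" "n \<le> n" using n by auto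
    show "S.V.vs.automorphic (\<lambda>x. x) (\<lambda>x. x)" by (rule automorphic_id)
    show "S.W.vper {}" by simp
    show "{x. x \<in> ?M} = ?M" by simp
  qed simp
  then have "structured p n (proj p n ` ?M)"
    unfolding structured_iff[OF p] lift_proj_image[OF per] using proj_in by blast
  then show ?thesis by blast
qed

lemma in_cuboid_empty: "in_cuboid m n {}"
  unfolding in_cuboid_def using automorphic_id[of n] by blast

lemma in_cuboid_subset: "in_cuboid m n A \<Longrightarrow> B \<subseteq> A \<Longrightarrow> in_cuboid m n B"
  unfolding in_cuboid_def by blast

end

section \<open>Levels 0 and 1 of the hierarchy of sum-free sets\<close>

theorem theorem1p4:
  fixes p n :: nat
  assumes "prime p" and "p \<ge> 11" and "p mod 3 = 2" and "n \<ge> 1"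
  shows "real (sf 1 (Fp p n)) = (real p - 2) / 3 * real p ^ (n - 1)
         \<and> SF_max 1 (Fp p n) = {A. structured p n A}"
proof -
  interpret prime_modulus p using assms(1) by unfold_locales
  define k where "k = (p + 1) div 6"
  have "odd p" using assms(1,2) prime_odd_nat by auto
  then have pk: "p + 1 = 6 * k" unfolding k_def using assms(3) by presburger
  define m where "m = int k"
  have p: "int p = 6 * m - 1" "m \<ge> 2" using pk assms(2) unfolding m_def by linarith+
  let ?G = "Fp p n"
  define q where "q = p ^ (n - 1)"
  have q: "q > 0" using p_pos by (simp add: q_def)
  have k2: "k \<ge> 2" using p(2) by (simp add: m_def)
  have m1: "2 * m - 1 = int (2 * k - 1)" "2 * m = int (2 * k)" using k2 by (simp_all add: m_def of_nat_diff)
  note dich = sum_free_dichotomy[OF p assms(4)] and sup = cuboid_superset[OF p assms(4)]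
    and props = structured_properties[OF p assms(4)]
  define SF0 where "SF0 = {B. sum_free ?G B}"
  have fin: "finite SF0"
    by (rule finite_subset[OF _ finite_Pow_iff[THEN iffD2, OF finite_carrier_Fp[of n]]]) (auto simp: SF0_def sum_free_def)
  have lt: "(2 * k - 1) * q < 2 * k * q" using q k2 by simp
  have big: "(\<exists>C\<in>SF0. card C = 2 * k * q \<and> B \<subseteq> C) \<or> (card B = (2 * k - 1) * q \<and> structured p n B)"
    if B: "B \<in> SF0" "(2 * k - 1) * q \<le> card B" for B
  proof -
    have sfB: "sum_free ?G B" using B(1) by (simp add: SF0_def)
    have "int ((2 * k - 1) * q) \<le> int (card B)" using B(2) by (simp only: of_nat_le_iff)
    then have "(2 * m - 1) * int (p ^ (n - 1)) \<le> int (card B)" unfolding m1(1) q_def by simp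
    from dich[OF sfB this] show ?thesis
    proof
      assume "in_cuboid m n (lift p n B)"
      moreover have "B \<subseteq> carrier ?G" using sfB by (simp add: sum_free_def)
      ultimately obtain C where C: "sum_free ?G C" "int (card C) = 2 * m * int (p ^ (n - 1))" "B \<subseteq> C"
        using sup by blast
      have "int (card C) = int (2 * k * q)" using C(2) unfolding m1(2) q_def by simp
      then have "card C = 2 * k * q" by (simp only: of_nat_eq_iff)
      then show ?thesis using C unfolding SF0_def by blast
    next
      assume st: "int (card B) = (2 * m - 1) * int (p ^ (n - 1)) \<and> structured p n B"
      then have "int (card B) = int ((2 * k - 1) * q)" unfolding m1(1) q_def by simp
      then have "card B = (2 * k - 1) * q" by (simp only: of_nat_eq_iff)
      then show ?thesis using st by blast
    qed
  qed
  \<comment> \<open>A sum-free set of size 2m q is too large to be structured, so it is confined to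
    a cuboid. A structured set contained in it would be confined as well, which is impossible; hence
    structured sets survive at level 1.\<close>
  have max_in: "in_cuboid m n (lift p n C)" if C: "C \<in> SF0" "card C = 2 * k * q" for C
  proof -
    have sfC: "sum_free ?G C" using C(1) by (simp add: SF0_def)
    have c: "int (card C) = 2 * m * int (p ^ (n - 1))" unfolding C(2) m1(2) q_def by simp
    have pos: "int (p ^ (n - 1)) > 0" using q unfolding q_def by simp
    have "(2 * m - 1) * int (p ^ (n - 1)) < int (card C)" unfolding c using pos by (simp add: algebra_simps)
    then show ?thesis using dich[OF sfC] by auto
  qed
  have st: "sum_free ?G B" "card B = (2 * k - 1) * q" "\<not> in_cuboid m n (lift p n B)" if "structured p n B" for B
  proof -
    show "sum_free ?G B" "\<not> in_cuboid m n (lift p n B)" using props[OF that] by blast+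
    have "int (card B) = int ((2 * k - 1) * q)" using props(2)[OF that] unfolding m1(1) q_def by simp
    then show "card B = (2 * k - 1) * q" by (simp only: of_nat_eq_iff)
  qed
  \<comment> \<open>The empty set is confined to a cuboid for trivial reasons, and the cuboid
    containing it is a sum-free set of size 2m q.\<close>
  obtain C0 where C0: "C0 \<in> SF0" "card C0 = 2 * k * q"
  proof -
    have "lift p n {} = {}" by (simp add: lift_def)
    then have "in_cuboid m n (lift p n {})" using in_cuboid_empty by simp
    then obtain C where C: "sum_free ?G C" "int (card C) = 2 * m * int (p ^ (n - 1))" using sup[of "{}"] by blast
    have "int (card C) = int (2 * k * q)" using C(2) unfolding m1(2) q_def by simp
    then have "card C = 2 * k * q" by (simp only: of_nat_eq_iff)
    then show thesis using that C unfolding SF0_def by blast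
  qed
  have le0: "card B \<le> 2 * k * q" if "B \<in> SF0" for B
  proof (cases "(2 * k - 1) * q \<le> card B")
    case True
    from big[OF that True] show ?thesis
    proof
      assume "\<exists>C\<in>SF0. card C = 2 * k * q \<and> B \<subseteq> C"
      then obtain C where C: "C \<in> SF0" "card C = 2 * k * q" "B \<subseteq> C" by blast
      then have "finite C" using finite_subset[OF _ finite_carrier_Fp[of n]] by (auto simp: SF0_def sum_free_def)
      then show ?thesis using card_mono[OF _ C(3)] C(2) by simp
    next
      assume "card B = (2 * k - 1) * q \<and> structured p n B"
      then show ?thesis using lt by linarith
    qed
  next
    case False
    then have "card B < (2 * k - 1) * q" by (rule not_le_imp_less)
    then show ?thesis using lt by linarith
  qed
  have max0: "max_card SF0 = 2 * k * q"
    unfolding max_card_def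
  proof (rule Max_eqI)
    show "finite (card ` SF0)" using fin by simp
    show "2 * k * q \<in> card ` SF0" using C0 by (metis imageI)
  qed (use le0 in auto)
  have SF1: "SF 1 ?G = {A \<in> SF0. \<not> (\<exists>C\<in>SF0. card C = 2 * k * q \<and> A \<subseteq> C)}"
    using max0 unfolding SF0_def by auto
  have structured_in: "B \<in> SF 1 ?G" if B: "structured p n B" for B
  proof -
    have B0: "B \<in> SF0" using st(1)[OF B] by (simp add: SF0_def)
    moreover have "\<not> B \<subseteq> C" if C: "C \<in> SF0" "card C = 2 * k * q" for C
    proof
      assume "B \<subseteq> C"
      then have "lift p n B \<subseteq> lift p n C" by (auto simp: lift_def)
      then show False using in_cuboid_subset[OF max_in[OF C]] st(3)[OF B] by blast
    qed
    ultimately show ?thesis unfolding SF1 by blast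
  qed
  have le1: "card B \<le> (2 * k - 1) * q" and max_structured: "card B = (2 * k - 1) * q \<Longrightarrow> structured p n B"
    if B: "B \<in> SF 1 ?G" for B
  proof -
    have *: "card B = (2 * k - 1) * q \<and> structured p n B" if "(2 * k - 1) * q \<le> card B"
      using big[OF _ that] B unfolding SF1 by blast
    show "card B \<le> (2 * k - 1) * q" using * by (cases "(2 * k - 1) * q \<le> card B") auto
    show "structured p n B" if "card B = (2 * k - 1) * q" using * that by simp
  qed
  obtain B0 where B0: "structured p n B0" using exists_structured[OF p(1) assms(4)] by blast
  have fin1: "finite (SF 1 ?G)" unfolding SF1 using fin by simp
  have sf1: "sf 1 ?G = (2 * k - 1) * q"
    unfolding sf_def max_card_def
  proof (rule Max_eqI)
    show "finite (card ` SF 1 ?G)" using fin1 by simp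
    show "(2 * k - 1) * q \<in> card ` SF 1 ?G" using structured_in[OF B0] st(2)[OF B0] by (metis imageI)
  qed (use le1 in auto)
  have "SF_max 1 ?G = {A. structured p n A}"
    unfolding SF_max_def sf1 using structured_in st(2) max_structured by blast
  moreover have "real (sf 1 ?G) = (real p - 2) / 3 * real p ^ (n - 1)"
  proof -
    have "real p = 6 * real k - 1" using arg_cong[OF pk, of real] by simp
    then have "(real p - 2) / 3 = real (2 * k - 1)" using k2 by (simp add: of_nat_diff field_simps)
    then show ?thesis unfolding sf1 q_def by simp
  qed
  ultimately show ?thesis by blast
qed

end
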